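(* Let $\mathcal{S}$ be a topos. The following concepts are equivalent: - (a) one-sorted uniform preorders internal to $\mathcal{S}$ with $\top,\wedge,\Rightarrow,\forall$; - (b) fibered triposes on $\mathcal{S}$; - (c) triposes with $\gamma$ on $\mathcal{S}$. That is, the assignments $(A,R)\mapsto\mathrm{ufam}(A,R)$ from (a) to (b) and $\mathcal{X}\mapsto(\mathcal{X}^{(1)},\gamma)$ from (b) to (c) are well defined and induce bijections between equivalence classes of the respective structures.
   Context: **(a)** A one-sorted uniform preorder internal to $\mathcal{S}$ is an object $A$ with a subobject $R\subseteq P(A\times A)$ such that in the internal logic: $r\in R$ and $s\subseteq r$ imply $s\in R$; $\mathrm{id}_A\in R$; $r,s\in R$ imply $sr\in R$ (composition of relations). A monotone map $(A,R)\to(B,S)$ is $f:A\to B$ such that internally $r\in R$ implies $\{(fa,fa')\mid(a,a')\in r\}\in S$; $f\le g$ iff $\{(fa,ga)\mid a\in A\}\in S$ holds; equivalences are taken in the resulting locally ordered category. Let $\mathcal{S}\downarrow\mathcal{S}$ be the arrow category, with objects $m:M\to L$ and commutative squares as morphisms; a morphism is vertical if its component on codomains is an identity. $\mathrm{ufam}(A,R)$ is the fibered preorder on $\mathcal{S}\downarrow\mathcal{S}$ whose predicates on $m:M\to L$ are morphisms $\varphi:M\to A$, with $\varphi\le\psi$ iff $\forall l:L.\ \{(\varphi x,\psi x)\mid x:M,\ mx=l\}\in R$ holds in the internal logic, and reindexing by precomposition. $(A,R)$ has $\top,\wedge,\Rightarrow,\forall$ if the fibers of $\mathrm{ufam}(A,R)$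 have finite meets and Heyting implication preserved by reindexing, and $\mathrm{ufam}(A,R)$ has universal quantification (right adjoints to reindexing) along vertical maps, satisfying Beck–Chevalley along arbitrary maps. **(b)** Let $\mathcal{X}$ be a fibered preorder on $\mathcal{S}\downarrow\mathcal{S}$. It is a fibered posetal pre-stack if $e^*\varphi\le e^*\psi$ implies $\varphi\le\psi$ for every vertical epimorphism $e$. $\le$ is horizontally definable if for $\varphi,\psi\in\mathcal{X}_{M\to L}$ there is a greatest subobject $U\rightarrowtail L$ such that $\varphi|_U\le\psi|_U$, where $(-)|_U$ is reindexing along the pullback square $(U\times_LM\to U)\to(M\to L)$. A fibered tripos on $\mathcal{S}$ is a fibered posetal pre-stack $\mathcal{X}$ on $\mathcal{S}\downarrow\mathcal{S}$ with horizontally definable $\le$, whose fibers are pre-Heyting algebras (structure preserved by reindexing), with universal quantification along vertical maps (satisfying Beck–Chevalley along arbitrary maps), and with a generic predicate $\mathsf{tr}\in\mathcal{X}_{\mathsf{Prop}\to1}$ (every predicate is isomorphic to a reindexing of it). Equivalence is fibered equivalence over $\mathcal{S}\downarrow\mathcal{S}$. **(c)** A tripos with $\gamma$ on $\mathcal{S}$ is a fibered preorder $\mathcal{P}$ on $\mathcal{S}$ that is a pre-stack ($e^*\varphi\le e^*\psi\Rightarrow\varphi\le\psi$ for epis $e$), models $\top,\wedge,\Rightarrow,\forall$ (reindexing-stable finite meets and implication, right adjoints to reindexing with Beck–Chevalley) and has a generic predicate $\mathsf{tr}\in\mathcal{P}_{\mathsf{Prop}}$, together with a finite meet preserving fibered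 monotone map $\gamma:\mathcal{P}\to\mathrm{sub}(\mathcal{S})$ to the subobject fibration such that $\top\le\gamma(p)$ implies $\top\le p$ for $p\in\mathcal{P}_1$. Equivalence is fibered equivalence over $\mathcal{S}$ commuting with $\gamma$ (up to isomorphism). **From (b) to (c).** $\mathcal{X}^{(1)}$ is the pullback of $\mathcal{X}$ along $M\mapsto(M\to1):\mathcal{S}\to\mathcal{S}\downarrow\mathcal{S}$. For $\varphi\in\mathcal{X}^{(1)}_M=\mathcal{X}_{M\to1}$, let $\overline\varphi\in\mathcal{X}_{\mathrm{id}_M}$ be its reindexing along $(\mathrm{id}_M,!):(\mathrm{id}_M:M\to M)\to(M\to1)$; $\gamma(\varphi)$ is the greatest subobject $U\rightarrowtail M$ such that $\top\le\overline\varphi|_U$.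
   Formalization: In (b), horizontal definability of ≤ additionally requires the greatest subobject U of L to be preserved by reindexing along every map K → L; with mere existence of U, γ need not be a fibered map and the claim fails (e.g. over Z/2-sets). *)

theory Defs
  imports Main
begin

section \<open>Categories and toposes\<close>

record ('o, 'a) cat =
  Obj :: "'o set"
  Arr :: "'a set"
  Dom :: "'a \<Rightarrow> 'o"
  Cod :: "'a \<Rightarrow> 'o"
  Idn :: "'o \<Rightarrow> 'a"
  Cmp :: "'a \<Rightarrow> 'a \<Rightarrow> 'a"  (infixr "\<cdot>\<index>" 75)

text \<open>\<open>g \<cdot>\<^bsub>C\<^esub> f\<close> is ``first f, then g''; its value is only relevant if
  \<open>Cod C f = Dom C g\<close>.\<close>

definition hom :: "('o, 'a) cat \<Rightarrow> 'o \<Rightarrow> 'o \<Rightarrow> 'a set" where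
  "hom C X Y = {f \<in> Arr C. Dom C f = X \<and> Cod C f = Y}"

definition category :: "('o, 'a) cat \<Rightarrow> bool" where
  "category C \<longleftrightarrow>
     (\<forall>f\<in>Arr C. Dom C f \<in> Obj C \<and> Cod C f \<in> Obj C) \<and>
     (\<forall>X\<in>Obj C. Idn C X \<in> hom C X X) \<and>
     (\<forall>f\<in>Arr C. \<forall>g\<in>Arr C. Cod C f = Dom C g \<longrightarrow> g \<cdot>\<^bsub>C\<^esub> f \<in> hom C (Dom C f) (Cod C g)) \<and>
     (\<forall>f\<in>Arr C. f \<cdot>\<^bsub>C\<^esub> Idn C (Dom C f) = f \<and> Idn C (Cod C f) \<cdot>\<^bsub>C\<^esub> f = f) \<and>
     (\<forall>f\<in>Arr C. \<forall>g\<in>Arr C. \<forall>h\<in>Arr C. Cod C f = Dom C g \<longrightarrow> Cod C g = Dom C h \<longrightarrow>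
        h \<cdot>\<^bsub>C\<^esub> (g \<cdot>\<^bsub>C\<^esub> f) = (h \<cdot>\<^bsub>C\<^esub> g) \<cdot>\<^bsub>C\<^esub> f)"

definition is_mono :: "('o, 'a) cat \<Rightarrow> 'a \<Rightarrow> bool" where
  "is_mono C u \<longleftrightarrow> u \<in> Arr C \<and>
     (\<forall>f\<in>Arr C. \<forall>g\<in>Arr C. Dom C f = Dom C g \<longrightarrow> Cod C f = Dom C u \<longrightarrow> Cod C g = Dom C u \<longrightarrow>
        u \<cdot>\<^bsub>C\<^esub> f = u \<cdot>\<^bsub>C\<^esub> g \<longrightarrow> f = g)"

definition is_epi :: "('o, 'a) cat \<Rightarrow> 'a \<Rightarrow> bool" where
  "is_epi C e \<longleftrightarrow> e \<in> Arr C \<and>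
     (\<forall>f\<in>Arr C. \<forall>g\<in>Arr C. Cod C f = Cod C g \<longrightarrow> Dom C f = Cod C e \<longrightarrow> Dom C g = Cod C e \<longrightarrow>
        f \<cdot>\<^bsub>C\<^esub> e = g \<cdot>\<^bsub>C\<^esub> e \<longrightarrow> f = g)"

definition is_terminal :: "('o, 'a) cat \<Rightarrow> 'o \<Rightarrow> bool" where
  "is_terminal C T \<longleftrightarrow> T \<in> Obj C \<and> (\<forall>X\<in>Obj C. \<exists>!f. f \<in> hom C X T)"

definition is_product :: "('o, 'a) cat \<Rightarrow> 'o \<Rightarrow> 'o \<Rightarrow> 'a \<Rightarrow> 'a \<Rightarrow> bool" where
  "is_product C X Y p q \<longleftrightarrow>
     p \<in> Arr C \<and> q \<in> Arr C \<and> Dom C p = Dom C q \<and> Cod C p = X \<and> Cod C q = Y \<and>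
     (\<forall>Z\<in>Obj C. \<forall>f\<in>hom C Z X. \<forall>g\<in>hom C Z Y.
        \<exists>!h. h \<in> hom C Z (Dom C p) \<and> p \<cdot>\<^bsub>C\<^esub> h = f \<and> q \<cdot>\<^bsub>C\<^esub> h = g)"

text \<open>\<open>is_pullback C f g p q\<close>: the square \<open>f \<cdot> p = g \<cdot> q\<close> is a pullback.\<close>

definition is_pullback :: "('o, 'a) cat \<Rightarrow> 'a \<Rightarrow> 'a \<Rightarrow> 'a \<Rightarrow> 'a \<Rightarrow> bool" where
  "is_pullback C f g p q \<longleftrightarrow>
     f \<in> Arr C \<and> g \<in> Arr C \<and> p \<in> Arr C \<and> q \<in> Arr C \<and> Cod C f = Cod C g \<and>
     Dom C p = Dom C q \<and> Cod C p = Dom C f \<and> Cod C q = Dom C g \<and> f \<cdot>\<^bsub>C\<^esub> p = g \<cdot>\<^bsub>C\<^esub> q \<and>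
     (\<forall>Z\<in>Obj C. \<forall>x\<in>hom C Z (Dom C f). \<forall>y\<in>hom C Z (Dom C g). f \<cdot>\<^bsub>C\<^esub> x = g \<cdot>\<^bsub>C\<^esub> y \<longrightarrow>
        (\<exists>!h. h \<in> hom C Z (Dom C p) \<and> p \<cdot>\<^bsub>C\<^esub> h = x \<and> q \<cdot>\<^bsub>C\<^esub> h = y))"

text \<open>Chosen limits; meaningful whenever the respective limit exists.\<close>

definition one :: "('o, 'a) cat \<Rightarrow> 'o" where
  "one C = (SOME T. is_terminal C T)"

definition bang :: "('o, 'a) cat \<Rightarrow> 'o \<Rightarrow> 'a" where
  "bang C X = (THE f. f \<in> hom C X (one C))"

definition prod_cone :: "('o, 'a) cat \<Rightarrow> 'o \<Rightarrow> 'o \<Rightarrow> 'a \<times> 'a" where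
  "prod_cone C X Y = (SOME (p, q). is_product C X Y p q)"

definition pr1 :: "('o, 'a) cat \<Rightarrow> 'o \<Rightarrow> 'o \<Rightarrow> 'a" where
  "pr1 C X Y = fst (prod_cone C X Y)"

definition pr2 :: "('o, 'a) cat \<Rightarrow> 'o \<Rightarrow> 'o \<Rightarrow> 'a" where
  "pr2 C X Y = snd (prod_cone C X Y)"

definition prd :: "('o, 'a) cat \<Rightarrow> 'o \<Rightarrow> 'o \<Rightarrow> 'o" where
  "prd C X Y = Dom C (pr1 C X Y)"

definition tup :: "('o, 'a) cat \<Rightarrow> 'a \<Rightarrow> 'a \<Rightarrow> 'a" where
  "tup C f g = (THE h. h \<in> hom C (Dom C f) (prd C (Cod C f) (Cod C g)) \<and>
     pr1 C (Cod C f) (Cod C g) \<cdot>\<^bsub>C\<^esub> h = f \<and> pr2 C (Cod C f) (Cod C g) \<cdot>\<^bsub>C\<^esub> h = g)"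

definition pb :: "('o, 'a) cat \<Rightarrow> 'a \<Rightarrow> 'a \<Rightarrow> 'a \<times> 'a" where
  "pb C f g = (SOME (p, q). is_pullback C f g p q)"

text \<open>\<open>is_power_object C X P e\<close>: every subobject \<open>r\<close> of \<open>X \<times> Y\<close> is the pullback of
  \<open>e\<close> (the membership relation on \<open>X \<times> P\<close>) along \<open>X \<times> c\<close> for a unique \<open>c : Y \<rightarrow> P\<close>.\<close>

definition is_power_object :: "('o, 'a) cat \<Rightarrow> 'o \<Rightarrow> 'o \<Rightarrow> 'a \<Rightarrow> bool" where
  "is_power_object C X P e \<longleftrightarrow>
     P \<in> Obj C \<and> is_mono C e \<and> Cod C e = prd C X P \<and>
     (\<forall>Y\<in>Obj C. \<forall>r. is_mono C r \<and> Cod C r = prd C X Y \<longrightarrow>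
        (\<exists>!c. c \<in> hom C Y P \<and>
           (\<exists>q. is_pullback C (tup C (pr1 C X Y) (c \<cdot>\<^bsub>C\<^esub> pr2 C X Y)) e r q)))"

definition topos :: "('o, 'a) cat \<Rightarrow> bool" where
  "topos C \<longleftrightarrow> category C \<and>
     (\<exists>T. is_terminal C T) \<and>
     (\<forall>f\<in>Arr C. \<forall>g\<in>Arr C. Cod C f = Cod C g \<longrightarrow> (\<exists>p q. is_pullback C f g p q)) \<and>
     (\<forall>X\<in>Obj C. \<exists>P e. is_power_object C X P e)"

definition power_data :: "('o, 'a) cat \<Rightarrow> 'o \<Rightarrow> 'o \<times> 'a" where
  "power_data C X = (SOME (P, e). is_power_object C X P e)"

definition pow :: "('o, 'a) cat \<Rightarrow> 'o \<Rightarrow> 'o" where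
  "pow C X = fst (power_data C X)"

definition mem :: "('o, 'a) cat \<Rightarrow> 'o \<Rightarrow> 'a" where
  "mem C X = snd (power_data C X)"

definition factors :: "('o, 'a) cat \<Rightarrow> 'a \<Rightarrow> 'a \<Rightarrow> bool" where
  "factors C f u \<longleftrightarrow> (\<exists>h\<in>hom C (Dom C f) (Dom C u). u \<cdot>\<^bsub>C\<^esub> h = f)"


section \<open>Internal logic\<close>

text \<open>Terms and formulas of the internal (Mitchell--Benabou) language, restricted to the
  connectives that are used below, with named variables. \<open>Fn f t\<close> applies an arrow,
  \<open>t \<^bold>\<in> u\<close> says that \<open>t\<close> lies in the subobject represented by the mono \<open>u\<close>, and
  \<open>\<lbrace>x \<^bold>: X | P\<rbrace>\<close> is a term of type \<open>pow C X\<close>. Sorts are the objects of the category;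
  ill-sorted expressions have no useful meaning.\<close>

type_synonym name = string

datatype ('o, 'a) tm =
    Var name
  | Fn 'a "('o, 'a) tm"
  | Tup "('o, 'a) tm" "('o, 'a) tm"
  | Compr name 'o "('o, 'a) fm"  ("\<lbrace>_ \<^bold>: _ | _\<rbrace>")
and ('o, 'a) fm =
    Equal "('o, 'a) tm" "('o, 'a) tm"  (infix "\<^bold>=" 50)
  | Elem "('o, 'a) tm" 'a  (infix "\<^bold>\<in>" 50)
  | Conj "('o, 'a) fm" "('o, 'a) fm"  (infixr "\<^bold>\<and>" 35)
  | Implies "('o, 'a) fm" "('o, 'a) fm"  (infixr "\<^bold>\<longrightarrow>" 25)
  | Forall name 'o "('o, 'a) fm"  ("(\<^bold>\<forall>_ \<^bold>: _ \<^bold>./ _)" [0, 0, 10] 10)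
  | Exists name 'o "('o, 'a) fm"  ("(\<^bold>\<exists>_ \<^bold>: _ \<^bold>./ _)" [0, 0, 10] 10)

text \<open>Kripke--Joyal semantics. At stage \<open>I\<close> a term denotes a generalized element with domain
  \<open>I\<close>; \<open>env\<close> assigns generalized elements at stage \<open>I\<close> to the variables. A comprehension term
  denotes the generalized element of the power object whose members at every later stage are
  those forced to satisfy the formula.\<close>

definition restrict_env :: "('o, 'a) cat \<Rightarrow> (name \<Rightarrow> 'a) \<Rightarrow> 'a \<Rightarrow> name \<Rightarrow> 'a" where
  "restrict_env C env p = (\<lambda>x. env x \<cdot>\<^bsub>C\<^esub> p)"

primrec eval_tm :: "('o, 'a) cat \<Rightarrow> ('o, 'a) tm \<Rightarrow> 'o \<Rightarrow> (name \<Rightarrow> 'a) \<Rightarrow> 'a"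
  and forces :: "('o, 'a) cat \<Rightarrow> ('o, 'a) fm \<Rightarrow> 'o \<Rightarrow> (name \<Rightarrow> 'a) \<Rightarrow> bool" where
  "eval_tm C (Var x) I env = env x"
| "eval_tm C (Fn f t) I env = f \<cdot>\<^bsub>C\<^esub> eval_tm C t I env"
| "eval_tm C (Tup s t) I env = tup C (eval_tm C s I env) (eval_tm C t I env)"
| "eval_tm C \<lbrace>x \<^bold>: X | P\<rbrace> I env =
     (THE r. r \<in> hom C I (pow C X) \<and>
        (\<forall>J\<in>Obj C. \<forall>p\<in>hom C J I. \<forall>a\<in>hom C J X.
           factors C (tup C a (r \<cdot>\<^bsub>C\<^esub> p)) (mem C X) \<longleftrightarrow> forces C P J ((restrict_env C env p)(x := a))))"
| "forces C (s \<^bold>= t) I env \<longleftrightarrow> eval_tm C s I env = eval_tm C t I env"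
| "forces C (t \<^bold>\<in> u) I env \<longleftrightarrow> factors C (eval_tm C t I env) u"
| "forces C (P \<^bold>\<and> Q) I env \<longleftrightarrow> forces C P I env \<and> forces C Q I env"
| "forces C (P \<^bold>\<longrightarrow> Q) I env \<longleftrightarrow>
     (\<forall>J\<in>Obj C. \<forall>p\<in>hom C J I.
        forces C P J (restrict_env C env p) \<longrightarrow> forces C Q J (restrict_env C env p))"
| "forces C (\<^bold>\<forall>x \<^bold>: X \<^bold>. P) I env \<longleftrightarrow>
     (\<forall>J\<in>Obj C. \<forall>p\<in>hom C J I. \<forall>a\<in>hom C J X. forces C P J ((restrict_env C env p)(x := a)))"
| "forces C (\<^bold>\<exists>x \<^bold>: X \<^bold>. P) I env \<longleftrightarrow>
     (\<exists>J\<in>Obj C. \<exists>p\<in>hom C J I. is_epi C p \<and>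
        (\<exists>a\<in>hom C J X. forces C P J ((restrict_env C env p)(x := a))))"

text \<open>Validity of a closed formula, for which the environment is irrelevant.\<close>

definition holds :: "('o, 'a) cat \<Rightarrow> ('o, 'a) fm \<Rightarrow> bool" where
  "holds C P \<longleftrightarrow> forces C P (one C) (\<lambda>_. undefined)"


section \<open>Internal uniform preorders\<close>

text \<open>A pair \<open>(A, R)\<close> of an object and a mono into \<open>pow C (prd C A A)\<close>.\<close>

type_synonym ('o, 'a) upo = "'o \<times> 'a"

definition In_rel :: "('o, 'a) cat \<Rightarrow> 'o \<Rightarrow> ('o, 'a) tm \<Rightarrow> ('o, 'a) tm \<Rightarrow> ('o, 'a) fm" where
  "In_rel C X t s = (Tup t s \<^bold>\<in> mem C X)"

definition Subset :: "('o, 'a) cat \<Rightarrow> 'o \<Rightarrow> ('o, 'a) tm \<Rightarrow> ('o, 'a) tm \<Rightarrow> ('o, 'a) fm" where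
  "Subset C X s r =
     (\<^bold>\<forall>''z'' \<^bold>: X \<^bold>. In_rel C X (Var ''z'') s \<^bold>\<longrightarrow> In_rel C X (Var ''z'') r)"

definition Id_rel :: "('o, 'a) cat \<Rightarrow> 'o \<Rightarrow> ('o, 'a) tm" where
  "Id_rel C A = \<lbrace>''z'' \<^bold>: prd C A A | \<^bold>\<exists>''a'' \<^bold>: A \<^bold>. Var ''z'' \<^bold>= Tup (Var ''a'') (Var ''a'')\<rbrace>"

text \<open>\<open>Comp_rel C A s r\<close> is the relational composite ``first \<open>r\<close>, then \<open>s\<close>''. In this definition
  and in those of \<open>Subset\<close> and \<open>Image_rel\<close>, the term arguments must not contain the
  variables \<open>z\<close>, \<open>a\<close>, \<open>b\<close>, \<open>c\<close> that get bound.\<close>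

definition Comp_rel :: "('o, 'a) cat \<Rightarrow> 'o \<Rightarrow> ('o, 'a) tm \<Rightarrow> ('o, 'a) tm \<Rightarrow> ('o, 'a) tm" where
  "Comp_rel C A s r =
     \<lbrace>''z'' \<^bold>: prd C A A | \<^bold>\<exists>''a'' \<^bold>: A \<^bold>. \<^bold>\<exists>''b'' \<^bold>: A \<^bold>. \<^bold>\<exists>''c'' \<^bold>: A \<^bold>.
        Var ''z'' \<^bold>= Tup (Var ''a'') (Var ''c'') \<^bold>\<and>
        In_rel C (prd C A A) (Tup (Var ''a'') (Var ''b'')) r \<^bold>\<and>
        In_rel C (prd C A A) (Tup (Var ''b'') (Var ''c'')) s\<rbrace>"

definition Image_rel :: "('o, 'a) cat \<Rightarrow> 'o \<Rightarrow> 'o \<Rightarrow> 'a \<Rightarrow> ('o, 'a) tm \<Rightarrow> ('o, 'a) tm" where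
  "Image_rel C A B f r =
     \<lbrace>''z'' \<^bold>: prd C B B | \<^bold>\<exists>''a'' \<^bold>: A \<^bold>. \<^bold>\<exists>''b'' \<^bold>: A \<^bold>.
        In_rel C (prd C A A) (Tup (Var ''a'') (Var ''b'')) r \<^bold>\<and>
        Var ''z'' \<^bold>= Tup (Fn f (Var ''a'')) (Fn f (Var ''b''))\<rbrace>"

definition uniform_preorder :: "('o, 'a) cat \<Rightarrow> ('o, 'a) upo \<Rightarrow> bool" where
  "uniform_preorder C U \<longleftrightarrow> (case U of (A, R) \<Rightarrow>
     A \<in> Obj C \<and> is_mono C R \<and> Cod C R = pow C (prd C A A) \<and>
     holds C (\<^bold>\<forall>''r'' \<^bold>: pow C (prd C A A) \<^bold>. \<^bold>\<forall>''s'' \<^bold>: pow C (prd C A A) \<^bold>.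
       Var ''r'' \<^bold>\<in> R \<^bold>\<and> Subset C (prd C A A) (Var ''s'') (Var ''r'') \<^bold>\<longrightarrow> Var ''s'' \<^bold>\<in> R) \<and>
     holds C (Id_rel C A \<^bold>\<in> R) \<and>
     holds C (\<^bold>\<forall>''r'' \<^bold>: pow C (prd C A A) \<^bold>. \<^bold>\<forall>''s'' \<^bold>: pow C (prd C A A) \<^bold>.
       Var ''r'' \<^bold>\<in> R \<^bold>\<and> Var ''s'' \<^bold>\<in> R \<^bold>\<longrightarrow> Comp_rel C A (Var ''s'') (Var ''r'') \<^bold>\<in> R))"

definition upo_map :: "('o, 'a) cat \<Rightarrow> ('o, 'a) upo \<Rightarrow> ('o, 'a) upo \<Rightarrow> 'a \<Rightarrow> bool" where
  "upo_map C U V f \<longleftrightarrow> (case (U, V) of ((A, R), (B, S)) \<Rightarrow>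
     f \<in> hom C A B \<and>
     holds C (\<^bold>\<forall>''r'' \<^bold>: pow C (prd C A A) \<^bold>.
       Var ''r'' \<^bold>\<in> R \<^bold>\<longrightarrow> Image_rel C A B f (Var ''r'') \<^bold>\<in> S))"

definition upo_map_le ::
    "('o, 'a) cat \<Rightarrow> ('o, 'a) upo \<Rightarrow> ('o, 'a) upo \<Rightarrow> 'a \<Rightarrow> 'a \<Rightarrow> bool" where
  "upo_map_le C U V f g \<longleftrightarrow> (case (U, V) of ((A, R), (B, S)) \<Rightarrow>
     holds C (\<lbrace>''z'' \<^bold>: prd C B B | \<^bold>\<exists>''a'' \<^bold>: A \<^bold>.
       Var ''z'' \<^bold>= Tup (Fn f (Var ''a'')) (Fn g (Var ''a''))\<rbrace> \<^bold>\<in> S))"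

definition upo_equiv :: "('o, 'a) cat \<Rightarrow> ('o, 'a) upo \<Rightarrow> ('o, 'a) upo \<Rightarrow> bool" where
  "upo_equiv C U V \<longleftrightarrow> (\<exists>f g. upo_map C U V f \<and> upo_map C V U g \<and>
     upo_map_le C U U (g \<cdot>\<^bsub>C\<^esub> f) (Idn C (fst U)) \<and> upo_map_le C U U (Idn C (fst U)) (g \<cdot>\<^bsub>C\<^esub> f) \<and>
     upo_map_le C V V (f \<cdot>\<^bsub>C\<^esub> g) (Idn C (fst V)) \<and> upo_map_le C V V (Idn C (fst V)) (f \<cdot>\<^bsub>C\<^esub> g))"


section \<open>Fibered preorders\<close>

text \<open>A (cloven) fibered preorder on a category: fibers \<open>Preds X I\<close>, ordered by \<open>Le X I\<close>, and a
  reindexing map \<open>Rdx X f\<close> from the fiber over \<open>Cod f\<close> to the fiber over \<open>Dom f\<close>, functorial up to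
  isomorphism.\<close>

record ('o, 'a, 'p) fpre =
  Preds :: "'o \<Rightarrow> 'p set"
  Le :: "'o \<Rightarrow> 'p \<Rightarrow> 'p \<Rightarrow> bool"
  Rdx :: "'a \<Rightarrow> 'p \<Rightarrow> 'p"

definition iso_pred :: "('o, 'a, 'p) fpre \<Rightarrow> 'o \<Rightarrow> 'p \<Rightarrow> 'p \<Rightarrow> bool" where
  "iso_pred X I \<phi> \<psi> \<longleftrightarrow> Le X I \<phi> \<psi> \<and> Le X I \<psi> \<phi>"

definition fibered_preorder :: "('o, 'a) cat \<Rightarrow> ('o, 'a, 'p) fpre \<Rightarrow> bool" where
  "fibered_preorder C X \<longleftrightarrow>
     (\<forall>I\<in>Obj C. \<forall>\<phi>\<in>Preds X I. Le X I \<phi> \<phi>) \<and>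
     (\<forall>I\<in>Obj C. \<forall>\<phi>\<in>Preds X I. \<forall>\<psi>\<in>Preds X I. \<forall>\<chi>\<in>Preds X I.
        Le X I \<phi> \<psi> \<longrightarrow> Le X I \<psi> \<chi> \<longrightarrow> Le X I \<phi> \<chi>) \<and>
     (\<forall>f\<in>Arr C. \<forall>\<phi>\<in>Preds X (Cod C f). Rdx X f \<phi> \<in> Preds X (Dom C f)) \<and>
     (\<forall>f\<in>Arr C. \<forall>\<phi>\<in>Preds X (Cod C f). \<forall>\<psi>\<in>Preds X (Cod C f).
        Le X (Cod C f) \<phi> \<psi> \<longrightarrow> Le X (Dom C f) (Rdx X f \<phi>) (Rdx X f \<psi>)) \<and>
     (\<forall>I\<in>Obj C. \<forall>\<phi>\<in>Preds X I. iso_pred X I (Rdx X (Idn C I) \<phi>) \<phi>) \<and>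
     (\<forall>f\<in>Arr C. \<forall>g\<in>Arr C. Cod C f = Dom C g \<longrightarrow> (\<forall>\<phi>\<in>Preds X (Cod C g).
        iso_pred X (Dom C f) (Rdx X (g \<cdot>\<^bsub>C\<^esub> f) \<phi>) (Rdx X f (Rdx X g \<phi>))))"

definition fib_map ::
    "('o, 'a) cat \<Rightarrow> ('o, 'a, 'p) fpre \<Rightarrow> ('o, 'a, 'q) fpre \<Rightarrow> ('o \<Rightarrow> 'p \<Rightarrow> 'q) \<Rightarrow> bool" where
  "fib_map C X Y F \<longleftrightarrow>
     (\<forall>I\<in>Obj C. \<forall>\<phi>\<in>Preds X I. F I \<phi> \<in> Preds Y I) \<and>
     (\<forall>I\<in>Obj C. \<forall>\<phi>\<in>Preds X I. \<forall>\<psi>\<in>Preds X I. Le X I \<phi> \<psi> \<longrightarrow> Le Y I (F I \<phi>) (F I \<psi>)) \<and>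
     (\<forall>f\<in>Arr C. \<forall>\<phi>\<in>Preds X (Cod C f).
        iso_pred Y (Dom C f) (F (Dom C f) (Rdx X f \<phi>)) (Rdx Y f (F (Cod C f) \<phi>)))"

definition fib_equivalence ::
    "('o, 'a) cat \<Rightarrow> ('o, 'a, 'p) fpre \<Rightarrow> ('o, 'a, 'q) fpre \<Rightarrow>
      ('o \<Rightarrow> 'p \<Rightarrow> 'q) \<Rightarrow> ('o \<Rightarrow> 'q \<Rightarrow> 'p) \<Rightarrow> bool" where
  "fib_equivalence C X Y F G \<longleftrightarrow> fib_map C X Y F \<and> fib_map C Y X G \<and>
     (\<forall>I\<in>Obj C. \<forall>\<phi>\<in>Preds X I. iso_pred X I (G I (F I \<phi>)) \<phi>) \<and>
     (\<forall>I\<in>Obj C. \<forall>\<psi>\<in>Preds Y I. iso_pred Y I (F I (G I \<psi>)) \<psi>)"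

definition fib_equiv :: "('o, 'a) cat \<Rightarrow> ('o, 'a, 'p) fpre \<Rightarrow> ('o, 'a, 'q) fpre \<Rightarrow> bool" where
  "fib_equiv C X Y \<longleftrightarrow> (\<exists>F G. fib_equivalence C X Y F G)"

definition is_top :: "('o, 'a, 'p) fpre \<Rightarrow> 'o \<Rightarrow> 'p \<Rightarrow> bool" where
  "is_top X I \<tau> \<longleftrightarrow> \<tau> \<in> Preds X I \<and> (\<forall>\<phi>\<in>Preds X I. Le X I \<phi> \<tau>)"

definition is_bot :: "('o, 'a, 'p) fpre \<Rightarrow> 'o \<Rightarrow> 'p \<Rightarrow> bool" where
  "is_bot X I \<beta> \<longleftrightarrow> \<beta> \<in> Preds X I \<and> (\<forall>\<phi>\<in>Preds X I. Le X I \<beta> \<phi>)"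

definition is_meet :: "('o, 'a, 'p) fpre \<Rightarrow> 'o \<Rightarrow> 'p \<Rightarrow> 'p \<Rightarrow> 'p \<Rightarrow> bool" where
  "is_meet X I \<phi> \<psi> \<mu> \<longleftrightarrow> \<mu> \<in> Preds X I \<and>
     (\<forall>\<chi>\<in>Preds X I. Le X I \<chi> \<mu> \<longleftrightarrow> Le X I \<chi> \<phi> \<and> Le X I \<chi> \<psi>)"

definition is_join :: "('o, 'a, 'p) fpre \<Rightarrow> 'o \<Rightarrow> 'p \<Rightarrow> 'p \<Rightarrow> 'p \<Rightarrow> bool" where
  "is_join X I \<phi> \<psi> \<sigma> \<longleftrightarrow> \<sigma> \<in> Preds X I \<and>
     (\<forall>\<chi>\<in>Preds X I. Le X I \<sigma> \<chi> \<longleftrightarrow> Le X I \<phi> \<chi> \<and> Le X I \<psi> \<chi>)"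

definition is_imp :: "('o, 'a, 'p) fpre \<Rightarrow> 'o \<Rightarrow> 'p \<Rightarrow> 'p \<Rightarrow> 'p \<Rightarrow> bool" where
  "is_imp X I \<phi> \<psi> \<iota> \<longleftrightarrow> \<iota> \<in> Preds X I \<and>
     (\<forall>\<chi>\<in>Preds X I. \<forall>\<mu>. is_meet X I \<chi> \<phi> \<mu> \<longrightarrow> (Le X I \<chi> \<iota> \<longleftrightarrow> Le X I \<mu> \<psi>))"

text \<open>\<open>is_forall C X f \<phi> \<chi>\<close>: \<open>\<chi>\<close> is the value at \<open>\<phi>\<close> of the right adjoint to reindexing
  along \<open>f\<close>.\<close>

definition is_forall :: "('o, 'a) cat \<Rightarrow> ('o, 'a, 'p) fpre \<Rightarrow> 'a \<Rightarrow> 'p \<Rightarrow> 'p \<Rightarrow> bool" where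
  "is_forall C X f \<phi> \<chi> \<longleftrightarrow> \<chi> \<in> Preds X (Cod C f) \<and>
     (\<forall>\<psi>\<in>Preds X (Cod C f). Le X (Cod C f) \<psi> \<chi> \<longleftrightarrow> Le X (Dom C f) (Rdx X f \<psi>) \<phi>)"

definition has_finite_meets :: "('o, 'a) cat \<Rightarrow> ('o, 'a, 'p) fpre \<Rightarrow> bool" where
  "has_finite_meets C X \<longleftrightarrow>
     (\<forall>I\<in>Obj C. \<exists>\<tau>. is_top X I \<tau>) \<and>
     (\<forall>I\<in>Obj C. \<forall>\<phi>\<in>Preds X I. \<forall>\<psi>\<in>Preds X I. \<exists>\<mu>. is_meet X I \<phi> \<psi> \<mu>) \<and>
     (\<forall>f\<in>Arr C. \<forall>\<tau>. is_top X (Cod C f) \<tau> \<longrightarrow> is_top X (Dom C f) (Rdx X f \<tau>)) \<and>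
     (\<forall>f\<in>Arr C. \<forall>\<phi>\<in>Preds X (Cod C f). \<forall>\<psi>\<in>Preds X (Cod C f). \<forall>\<mu>. is_meet X (Cod C f) \<phi> \<psi> \<mu> \<longrightarrow>
        is_meet X (Dom C f) (Rdx X f \<phi>) (Rdx X f \<psi>) (Rdx X f \<mu>))"

definition has_finite_joins :: "('o, 'a) cat \<Rightarrow> ('o, 'a, 'p) fpre \<Rightarrow> bool" where
  "has_finite_joins C X \<longleftrightarrow>
     (\<forall>I\<in>Obj C. \<exists>\<beta>. is_bot X I \<beta>) \<and>
     (\<forall>I\<in>Obj C. \<forall>\<phi>\<in>Preds X I. \<forall>\<psi>\<in>Preds X I. \<exists>\<sigma>. is_join X I \<phi> \<psi> \<sigma>) \<and>
     (\<forall>f\<in>Arr C. \<forall>\<beta>. is_bot X (Cod C f) \<beta> \<longrightarrow> is_bot X (Dom C f) (Rdx X f \<beta>)) \<and>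
     (\<forall>f\<in>Arr C. \<forall>\<phi>\<in>Preds X (Cod C f). \<forall>\<psi>\<in>Preds X (Cod C f). \<forall>\<sigma>. is_join X (Cod C f) \<phi> \<psi> \<sigma> \<longrightarrow>
        is_join X (Dom C f) (Rdx X f \<phi>) (Rdx X f \<psi>) (Rdx X f \<sigma>))"

definition has_implication :: "('o, 'a) cat \<Rightarrow> ('o, 'a, 'p) fpre \<Rightarrow> bool" where
  "has_implication C X \<longleftrightarrow>
     (\<forall>I\<in>Obj C. \<forall>\<phi>\<in>Preds X I. \<forall>\<psi>\<in>Preds X I. \<exists>\<iota>. is_imp X I \<phi> \<psi> \<iota>) \<and>
     (\<forall>f\<in>Arr C. \<forall>\<phi>\<in>Preds X (Cod C f). \<forall>\<psi>\<in>Preds X (Cod C f). \<forall>\<iota>. is_imp X (Cod C f) \<phi> \<psi> \<iota> \<longrightarrow>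
        is_imp X (Dom C f) (Rdx X f \<phi>) (Rdx X f \<psi>) (Rdx X f \<iota>))"

text \<open>Universal quantification along the maps in the class \<open>W\<close>, with the Beck--Chevalley
  condition for all pullback squares of maps in \<open>W\<close> along arbitrary maps.\<close>

definition has_forall :: "('o, 'a) cat \<Rightarrow> ('a \<Rightarrow> bool) \<Rightarrow> ('o, 'a, 'p) fpre \<Rightarrow> bool" where
  "has_forall C W X \<longleftrightarrow>
     (\<forall>f\<in>Arr C. W f \<longrightarrow> (\<forall>\<phi>\<in>Preds X (Dom C f). \<exists>\<chi>. is_forall C X f \<phi> \<chi>)) \<and>
     (\<forall>f g f' g'. W f \<longrightarrow> is_pullback C f g g' f' \<longrightarrow>
        (\<forall>\<phi>\<in>Preds X (Dom C f). \<forall>\<chi>. is_forall C X f \<phi> \<chi> \<longrightarrow>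
           is_forall C X f' (Rdx X g' \<phi>) (Rdx X g \<chi>)))"

definition reflects_le_along ::
    "('o, 'a) cat \<Rightarrow> ('a \<Rightarrow> bool) \<Rightarrow> ('o, 'a, 'p) fpre \<Rightarrow> bool" where
  "reflects_le_along C E X \<longleftrightarrow>
     (\<forall>e\<in>Arr C. E e \<longrightarrow> (\<forall>\<phi>\<in>Preds X (Cod C e). \<forall>\<psi>\<in>Preds X (Cod C e).
        Le X (Dom C e) (Rdx X e \<phi>) (Rdx X e \<psi>) \<longrightarrow> Le X (Cod C e) \<phi> \<psi>))"

definition is_generic :: "('o, 'a) cat \<Rightarrow> ('o, 'a, 'p) fpre \<Rightarrow> 'o \<Rightarrow> 'p \<Rightarrow> bool" where
  "is_generic C X G tr \<longleftrightarrow> G \<in> Obj C \<and> tr \<in> Preds X G \<and>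
     (\<forall>I\<in>Obj C. \<forall>\<phi>\<in>Preds X I. \<exists>f\<in>hom C I G. iso_pred X I \<phi> (Rdx X f tr))"

text \<open>The subobject fibration; subobjects are represented by monos.\<close>

definition sub_fib :: "('o, 'a) cat \<Rightarrow> ('o, 'a, 'a) fpre" where
  "sub_fib C = \<lparr>
     Preds = (\<lambda>L. {u. is_mono C u \<and> Cod C u = L}),
     Le = (\<lambda>L u w. factors C u w),
     Rdx = (\<lambda>f u. fst (pb C f u)) \<rparr>"


section \<open>The arrow category and the structures to be compared\<close>

text \<open>A morphism \<open>(m, m', u, v)\<close> of the arrow category is the commutative square
  \<open>m' \<cdot> u = v \<cdot> m\<close>.\<close>

type_synonym 'a sq = "'a \<times> 'a \<times> 'a \<times> 'a"

definition arrow_cat :: "('o, 'a) cat \<Rightarrow> ('a, 'a sq) cat" where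
  "arrow_cat C = \<lparr>
     Obj = Arr C,
     Arr = {(m, m', u, v). m \<in> Arr C \<and> m' \<in> Arr C \<and>
              u \<in> hom C (Dom C m) (Dom C m') \<and> v \<in> hom C (Cod C m) (Cod C m') \<and>
              m' \<cdot>\<^bsub>C\<^esub> u = v \<cdot>\<^bsub>C\<^esub> m},
     Dom = (\<lambda>(m, m', u, v). m),
     Cod = (\<lambda>(m, m', u, v). m'),
     Idn = (\<lambda>m. (m, m, Idn C (Dom C m), Idn C (Cod C m))),
     Cmp = (\<lambda>(m', m'', u', v') (m, _, u, v). (m, m'', u' \<cdot>\<^bsub>C\<^esub> u, v' \<cdot>\<^bsub>C\<^esub> v)) \<rparr>"

definition vertical :: "('o, 'a) cat \<Rightarrow> 'a sq \<Rightarrow> bool" where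
  "vertical C = (\<lambda>(m, m', u, v). Cod C m = Cod C m' \<and> v = Idn C (Cod C m))"

text \<open>\<open>base_change C m v\<close> is the pullback of \<open>m : M \<rightarrow> L\<close> along \<open>v : K \<rightarrow> L\<close>, regarded as an object
  over \<open>K\<close>, and \<open>Rdx X (base_change_sq C m v) \<phi>\<close> is \<open>\<phi>\<close> reindexed along the pullback square; for a
  mono \<open>v\<close> this is the restriction of \<open>\<phi>\<close> to the subobject \<open>v\<close>.\<close>

definition base_change :: "('o, 'a) cat \<Rightarrow> 'a \<Rightarrow> 'a \<Rightarrow> 'a" where
  "base_change C m v = fst (pb C v m)"

definition base_change_sq :: "('o, 'a) cat \<Rightarrow> 'a \<Rightarrow> 'a \<Rightarrow> 'a sq" where
  "base_change_sq C m v = (fst (pb C v m), m, snd (pb C v m), v)"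

definition greatest_sub :: "('o, 'a) cat \<Rightarrow> 'o \<Rightarrow> ('a \<Rightarrow> bool) \<Rightarrow> 'a \<Rightarrow> bool" where
  "greatest_sub C L Q U \<longleftrightarrow> is_mono C U \<and> Cod C U = L \<and> Q U \<and>
     (\<forall>V. is_mono C V \<and> Cod C V = L \<and> Q V \<longrightarrow> factors C V U)"

definition le_on ::
    "('o, 'a) cat \<Rightarrow> ('a, 'a sq, 'p) fpre \<Rightarrow> 'a \<Rightarrow> 'p \<Rightarrow> 'p \<Rightarrow> 'a \<Rightarrow> bool" where
  "le_on C X m \<phi> \<psi> U \<longleftrightarrow>
     Le X (base_change C m U) (Rdx X (base_change_sq C m U) \<phi>) (Rdx X (base_change_sq C m U) \<psi>)"

text \<open>As for all other structure on fibrations, the greatest subobject is required to be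
  preserved by reindexing. This does not follow from its mere existence: the fibers are only
  assumed to be separated for vertical epimorphisms, so that a greatest subobject need not be
  stable under pullback along an epimorphism \<open>K \<rightarrow> L\<close> of the base.\<close>

definition horizontally_definable :: "('o, 'a) cat \<Rightarrow> ('a, 'a sq, 'p) fpre \<Rightarrow> bool" where
  "horizontally_definable C X \<longleftrightarrow>
     (\<forall>m\<in>Arr C. \<forall>\<phi>\<in>Preds X m. \<forall>\<psi>\<in>Preds X m.
        \<exists>U. greatest_sub C (Cod C m) (le_on C X m \<phi> \<psi>) U \<and>
            (\<forall>v\<in>Arr C. Cod C v = Cod C m \<longrightarrow>
               greatest_sub C (Dom C v)
                 (le_on C X (base_change C m v)
                    (Rdx X (base_change_sq C m v) \<phi>) (Rdx X (base_change_sq C m v) \<psi>))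
                 (Rdx (sub_fib C) v U)))"

definition ufam :: "('o, 'a) cat \<Rightarrow> ('o, 'a) upo \<Rightarrow> ('a, 'a sq, 'a) fpre" where
  "ufam C U = (case U of (A, R) \<Rightarrow> \<lparr>
     Preds = (\<lambda>m. hom C (Dom C m) A),
     Le = (\<lambda>m \<phi> \<psi>. holds C (\<^bold>\<forall>''l'' \<^bold>: Cod C m \<^bold>.
            \<lbrace>''z'' \<^bold>: prd C A A | \<^bold>\<exists>''x'' \<^bold>: Dom C m \<^bold>.
               Fn m (Var ''x'') \<^bold>= Var ''l'' \<^bold>\<and>
               Var ''z'' \<^bold>= Tup (Fn \<phi> (Var ''x'')) (Fn \<psi> (Var ''x''))\<rbrace> \<^bold>\<in> R)),
     Rdx = (\<lambda>(m, m', u, v) \<phi>. \<phi> \<cdot>\<^bsub>C\<^esub> u) \<rparr>)"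

definition logical_uniform_preorder :: "('o, 'a) cat \<Rightarrow> ('o, 'a) upo \<Rightarrow> bool" where
  "logical_uniform_preorder C U \<longleftrightarrow> uniform_preorder C U \<and>
     has_finite_meets (arrow_cat C) (ufam C U) \<and>
     has_implication (arrow_cat C) (ufam C U) \<and>
     has_forall (arrow_cat C) (vertical C) (ufam C U)"

definition fibered_tripos :: "('o, 'a) cat \<Rightarrow> ('a, 'a sq, 'p) fpre \<Rightarrow> bool" where
  "fibered_tripos C X \<longleftrightarrow> fibered_preorder (arrow_cat C) X \<and>
     reflects_le_along (arrow_cat C) (\<lambda>e. vertical C e \<and> is_epi (arrow_cat C) e) X \<and>
     horizontally_definable C X \<and>
     has_finite_meets (arrow_cat C) X \<and>
     has_finite_joins (arrow_cat C) X \<and>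
     has_implication (arrow_cat C) X \<and>
     has_forall (arrow_cat C) (vertical C) X \<and>
     (\<exists>Prp\<in>Obj C. \<exists>tr. is_generic (arrow_cat C) X (bang C Prp) tr)"

text \<open>A fibered preorder \<open>P\<close> on \<open>C\<close> together with \<open>\<gamma>\<close>, where \<open>\<gamma> M \<phi>\<close> is a mono
  representing a subobject of \<open>M\<close>.\<close>

type_synonym ('o, 'a, 'p) gtripos = "('o, 'a, 'p) fpre \<times> ('o \<Rightarrow> 'p \<Rightarrow> 'a)"

definition tripos_with_gamma :: "('o, 'a) cat \<Rightarrow> ('o, 'a, 'p) gtripos \<Rightarrow> bool" where
  "tripos_with_gamma C T \<longleftrightarrow> (case T of (P, \<gamma>) \<Rightarrow>
     fibered_preorder C P \<and>
     reflects_le_along C (is_epi C) P \<and>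
     has_finite_meets C P \<and> has_implication C P \<and> has_forall C (\<lambda>_. True) P \<and>
     (\<exists>Prp tr. is_generic C P Prp tr) \<and>
     fib_map C P (sub_fib C) \<gamma> \<and>
     (\<forall>M\<in>Obj C. \<forall>\<tau>. is_top P M \<tau> \<longrightarrow> is_top (sub_fib C) M (\<gamma> M \<tau>)) \<and>
     (\<forall>M\<in>Obj C. \<forall>\<phi>\<in>Preds P M. \<forall>\<psi>\<in>Preds P M. \<forall>\<mu>. is_meet P M \<phi> \<psi> \<mu> \<longrightarrow>
        is_meet (sub_fib C) M (\<gamma> M \<phi>) (\<gamma> M \<psi>) (\<gamma> M \<mu>)) \<and>
     (\<forall>p\<in>Preds P (one C). is_top (sub_fib C) (one C) (\<gamma> (one C) p) \<longrightarrow> is_top P (one C) p))"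

definition gtripos_equiv ::
    "('o, 'a) cat \<Rightarrow> ('o, 'a, 'p) gtripos \<Rightarrow> ('o, 'a, 'q) gtripos \<Rightarrow> bool" where
  "gtripos_equiv C T T' \<longleftrightarrow> (case (T, T') of ((P, \<gamma>), (Q, \<delta>)) \<Rightarrow>
     \<exists>F G. fib_equivalence C P Q F G \<and>
       (\<forall>M\<in>Obj C. \<forall>\<phi>\<in>Preds P M. iso_pred (sub_fib C) M (\<delta> M (F M \<phi>)) (\<gamma> M \<phi>)))"

text \<open>The pullback of \<open>X\<close> along \<open>M \<mapsto> (M \<rightarrow> 1)\<close>.\<close>

definition first_level :: "('o, 'a) cat \<Rightarrow> ('a, 'a sq, 'p) fpre \<Rightarrow> ('o, 'a, 'p) fpre" where
  "first_level C X = \<lparr>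
     Preds = (\<lambda>M. Preds X (bang C M)),
     Le = (\<lambda>M. Le X (bang C M)),
     Rdx = (\<lambda>f. Rdx X (bang C (Dom C f), bang C (Cod C f), f, Idn C (one C))) \<rparr>"

definition bar :: "('o, 'a) cat \<Rightarrow> ('a, 'a sq, 'p) fpre \<Rightarrow> 'o \<Rightarrow> 'p \<Rightarrow> 'p" where
  "bar C X M \<phi> = Rdx X (Idn C M, bang C M, Idn C M, bang C M) \<phi>"

definition gamma_of :: "('o, 'a) cat \<Rightarrow> ('a, 'a sq, 'p) fpre \<Rightarrow> 'o \<Rightarrow> 'p \<Rightarrow> 'a" where
  "gamma_of C X M \<phi> = (SOME U. greatest_sub C M
     (\<lambda>V. is_top X (base_change C (Idn C M) V)
            (Rdx X (base_change_sq C (Idn C M) V) (bar C X M \<phi>))) U)"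

definition to_gtripos :: "('o, 'a) cat \<Rightarrow> ('a, 'a sq, 'p) fpre \<Rightarrow> ('o, 'a, 'p) gtripos" where
  "to_gtripos C X = (first_level C X, gamma_of C X)"

end

theory Submission
  imports Defs
begin

text \<open>
  Over \<open>m : M \<rightarrow> L\<close>, every predicate of a fibered tripos \<open>X\<close> is the reindexing of a predicate over
  \<open>M \<rightarrow> 1\<close>, and by Beck--Chevalley \<open>\<phi> \<le> \<psi>\<close> holds over \<open>m\<close> iff \<open>\<gamma>\<close> of \<open>\<forall>\<^sub>m (\<phi> \<Rightarrow> \<psi>)\<close> is the maximal subobject
  of \<open>L\<close>. So the fibered order can be recovered from the tripos with \<open>\<gamma>\<close>; by adjunction it can be
  written as ``\<open>m\<^sup>*\<chi> \<and> \<phi> \<le> \<psi>\<close> for some \<open>\<chi>\<close> over \<open>L\<close> with \<open>\<gamma> \<chi>\<close> maximal'', which makes it easy to see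
  that it inherits \<open>\<top>\<close>, \<open>\<and>\<close>, \<open>\<Rightarrow>\<close>, \<open>\<forall>\<close> from \<open>P\<close>. Given a tripos with \<open>\<gamma>\<close> and generic predicate \<open>tr\<close> over \<open>A\<close>,
  the same formula for the membership relation \<open>E \<rightarrow> pow (A \<times> A)\<close> and the two reindexings of \<open>tr\<close> to
  \<open>E\<close> yields a subobject \<open>R\<close> of \<open>pow (A \<times> A)\<close>, and the pre-stack condition shows that the order over
  \<open>m\<close> of two maps \<open>f, g : M \<rightarrow> A\<close> in \<open>ufam (A, R)\<close> is the above order of \<open>f\<^sup>*tr\<close> and \<open>g\<^sup>*tr\<close>.

  Uniform preorders are handled through the relation ``the family \<open>{(f x, g x) | m x = l}\<close>, as a map
  \<open>L \<rightarrow> pow (A \<times> A)\<close>, factors through \<open>R\<close>'' between maps \<open>f, g : M \<rightarrow> A\<close> over \<open>m\<close>: the three closure conditions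
  on \<open>R\<close> in the internal language say exactly that it is reflexive, transitive and stable under
  reindexing. Joins in \<open>ufam (A, R)\<close> are given by second-order encodings. On the side of the topos, only
  images and the stability of epimorphisms are needed; the image of a map is the intersection of all
  subobjects through which it factors.
\<close>

section \<open>Limits, power objects and epimorphisms in a topos\<close>

text \<open>The conditions on \<open>\<gamma>\<close> enter at separate places. Preservation of
  binary meets makes the recovered order transitive, preservation of top makes it contain the order
  of \<open>P\<close>, naturality makes it stable under reindexing, and the condition over the
  terminal object makes it agree with the order of \<open>P\<close> over
  \<open>M \<rightarrow> 1\<close>; the last point is why passing back to the first level returns
  \<open>P\<close>. The stability clause of horizontal definability does similar work on the other
  side: being a greatest subobject only speaks about monos into \<open>M\<close>, and stability
  turns this into a description of all generalized elements of \<open>\<gamma> \<phi>\<close>, the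
  form in which it can be reindexed and compared. That the passage from (b) to (c) is injective on
  equivalence classes is seen without a direct map between fibered triposes \<open>X\<close> and
  \<open>Y\<close>: the uniform preorder built from the first level of \<open>X\<close> is
  equivalent to \<open>X\<close> and to every \<open>Y\<close> with an equivalent tripos with
  \<open>\<gamma>\<close>.\<close>

locale cat_loc =
  fixes S :: "('o, 'a) cat" (structure)
  assumes cat: "category S"
begin

section \<open>Composites, monos, epis, factorizations and pullbacks in a category\<close>

lemmas cat_axioms = cat[unfolded category_def]

lemma dom_obj [simp]: "f \<in> Arr S \<Longrightarrow> Dom S f \<in> Obj S"
  and cod_obj [simp]: "f \<in> Arr S \<Longrightarrow> Cod S f \<in> Obj S"
  using cat_axioms by blast+

lemma idn_hom: "X \<in> Obj S \<Longrightarrow> Idn S X \<in> hom S X X"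
  using cat_axioms by blast

lemma idn_arr [simp]: "X \<in> Obj S \<Longrightarrow> Idn S X \<in> Arr S"
  and idn_dom [simp]: "X \<in> Obj S \<Longrightarrow> Dom S (Idn S X) = X"
  and idn_cod [simp]: "X \<in> Obj S \<Longrightarrow> Cod S (Idn S X) = X"
  using idn_hom[of X] by (simp_all add: hom_def)

lemma cmp_hom: "f \<in> Arr S \<Longrightarrow> g \<in> Arr S \<Longrightarrow> Cod S f = Dom S g \<Longrightarrow> g \<cdot> f \<in> hom S (Dom S f) (Cod S g)"
  using cat_axioms by blast

lemma cmp_arr [simp]: "f \<in> Arr S \<Longrightarrow> g \<in> Arr S \<Longrightarrow> Cod S f = Dom S g \<Longrightarrow> g \<cdot> f \<in> Arr S"
  and cmp_dom [simp]: "f \<in> Arr S \<Longrightarrow> g \<in> Arr S \<Longrightarrow> Cod S f = Dom S g \<Longrightarrow> Dom S (g \<cdot> f) = Dom S f"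
  and cmp_cod [simp]: "f \<in> Arr S \<Longrightarrow> g \<in> Arr S \<Longrightarrow> Cod S f = Dom S g \<Longrightarrow> Cod S (g \<cdot> f) = Cod S g"
  using cmp_hom[of f g] by (simp_all add: hom_def)

lemma idn_right [simp]: "f \<in> Arr S \<Longrightarrow> Dom S f = X \<Longrightarrow> f \<cdot> Idn S X = f"
  and idn_left [simp]: "f \<in> Arr S \<Longrightarrow> Cod S f = X \<Longrightarrow> Idn S X \<cdot> f = f"
  using cat_axioms by blast+

lemma assoc [simp]:
  "f \<in> Arr S \<Longrightarrow> g \<in> Arr S \<Longrightarrow> h \<in> Arr S \<Longrightarrow> Cod S f = Dom S g \<Longrightarrow> Cod S g = Dom S h \<Longrightarrow>
    (h \<cdot> g) \<cdot> f = h \<cdot> (g \<cdot> f)"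
  using cat_axioms by metis

text \<open>\<open>assoc\<close> brackets composites to the right, so an equation between two binary
  composites is no longer visible inside a longer one. This lemma and the next apply such an
  equation when a further arrow \<open>k\<close> is precomposed.\<close>

lemma cmp_extend:
  assumes "a \<cdot> b = c \<cdot> d" "a \<in> Arr S" "b \<in> Arr S" "c \<in> Arr S" "d \<in> Arr S" "k \<in> Arr S"
    "Cod S b = Dom S a" "Cod S d = Dom S c" "Cod S k = Dom S b" "Cod S k = Dom S d"
  shows "a \<cdot> (b \<cdot> k) = c \<cdot> (d \<cdot> k)"
proof -
  have "(a \<cdot> b) \<cdot> k = (c \<cdot> d) \<cdot> k" using assms(1) by simp
  thus ?thesis using assms(2-) by simp
qed

lemma cmp_extend1:
  assumes "a \<cdot> b = c" "a \<in> Arr S" "b \<in> Arr S" "k \<in> Arr S" "Cod S b = Dom S a" "Cod S k = Dom S b"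
  shows "a \<cdot> (b \<cdot> k) = c \<cdot> k"
proof -
  have "(a \<cdot> b) \<cdot> k = c \<cdot> k" using assms(1) by simp
  thus ?thesis using assms(2-) by simp
qed

lemma mono_arr [simp]: "is_mono S u \<Longrightarrow> u \<in> Arr S"
  unfolding is_mono_def by blast

lemma monoD:
  "is_mono S u \<Longrightarrow> u \<cdot> f = u \<cdot> g \<Longrightarrow> f \<in> Arr S \<Longrightarrow> g \<in> Arr S \<Longrightarrow> Dom S f = Dom S g \<Longrightarrow>
    Cod S f = Dom S u \<Longrightarrow> Cod S g = Dom S u \<Longrightarrow> f = g"
  unfolding is_mono_def by blast

lemma monoI:
  assumes "u \<in> Arr S"
    "\<And>f g. f \<in> Arr S \<Longrightarrow> g \<in> Arr S \<Longrightarrow> Dom S f = Dom S g \<Longrightarrow> Cod S f = Dom S u \<Longrightarrow> Cod S g = Dom S u \<Longrightarrow>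
      u \<cdot> f = u \<cdot> g \<Longrightarrow> f = g"
  shows "is_mono S u"
  using assms unfolding is_mono_def by blast

lemma epi_arr [simp]: "is_epi S u \<Longrightarrow> u \<in> Arr S"
  unfolding is_epi_def by blast

lemma epiD:
  "is_epi S e \<Longrightarrow> f \<cdot> e = g \<cdot> e \<Longrightarrow> f \<in> Arr S \<Longrightarrow> g \<in> Arr S \<Longrightarrow> Cod S f = Cod S g \<Longrightarrow>
    Dom S f = Cod S e \<Longrightarrow> Dom S g = Cod S e \<Longrightarrow> f = g"
  unfolding is_epi_def by blast

lemma epiI:
  assumes "e \<in> Arr S"
    "\<And>f g. f \<in> Arr S \<Longrightarrow> g \<in> Arr S \<Longrightarrow> Cod S f = Cod S g \<Longrightarrow> Dom S f = Cod S e \<Longrightarrow> Dom S g = Cod S e \<Longrightarrow>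
      f \<cdot> e = g \<cdot> e \<Longrightarrow> f = g"
  shows "is_epi S e"
  using assms unfolding is_epi_def by blast

lemma epi_idn [simp]: "X \<in> Obj S \<Longrightarrow> is_epi S (Idn S X)"
  by (rule epiI) (simp, metis idn_cod idn_right)

lemma mono_idn [simp]: "X \<in> Obj S \<Longrightarrow> is_mono S (Idn S X)"
  by (rule monoI) (simp, metis idn_dom idn_left)

lemma epi_cmp:
  assumes "is_epi S f" "is_epi S g" "Cod S f = Dom S g"
  shows "is_epi S (g \<cdot> f)"
proof (rule epiI)
  have a: "f \<in> Arr S" "g \<in> Arr S" using assms by auto
  thus "g \<cdot> f \<in> Arr S" using assms by simp
  fix x y assume x: "x \<in> Arr S" "y \<in> Arr S" "Cod S x = Cod S y" "Dom S x = Cod S (g \<cdot> f)"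
    "Dom S y = Cod S (g \<cdot> f)" "x \<cdot> (g \<cdot> f) = y \<cdot> (g \<cdot> f)"
  have "x \<cdot> g = y \<cdot> g" by (rule epiD[OF assms(1)]) (use x a assms(3) in simp_all)
  thus "x = y" by (rule epiD[OF assms(2)]) (use x a assms(3) in simp_all)
qed

lemma mono_cmp:
  assumes "is_mono S f" "is_mono S g" "Cod S f = Dom S g"
  shows "is_mono S (g \<cdot> f)"
proof (rule monoI)
  have a: "f \<in> Arr S" "g \<in> Arr S" using assms by auto
  thus "g \<cdot> f \<in> Arr S" using assms by simp
  fix x y assume x: "x \<in> Arr S" "y \<in> Arr S" "Dom S x = Dom S y" "Cod S x = Dom S (g \<cdot> f)"
    "Cod S y = Dom S (g \<cdot> f)" "(g \<cdot> f) \<cdot> x = (g \<cdot> f) \<cdot> y"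
  have "f \<cdot> x = f \<cdot> y" by (rule monoD[OF assms(2)]) (use x a assms(3) in simp_all)
  thus "x = y" by (rule monoD[OF assms(1)]) (use x a assms(3) in simp_all)
qed

lemma factorsI: "u \<cdot> h = f \<Longrightarrow> h \<in> Arr S \<Longrightarrow> u \<in> Arr S \<Longrightarrow> Cod S h = Dom S u \<Longrightarrow> factors S f u"
  unfolding factors_def hom_def by force

lemma factorsE:
  assumes "factors S f u" "u \<in> Arr S"
  obtains h where "h \<in> Arr S" "Dom S h = Dom S f" "Cod S h = Dom S u" "u \<cdot> h = f"
  using assms unfolding factors_def hom_def by blast

lemma factors_refl: "u \<in> Arr S \<Longrightarrow> factors S u u"
  by (rule factorsI[of _ "Idn S (Dom S u)"]) auto

lemma factors_cmp:
  assumes "factors S f u" "f \<in> Arr S" "k \<in> Arr S" "Cod S k = Dom S f" "u \<in> Arr S"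
  shows "factors S (f \<cdot> k) u"
proof -
  obtain h where "h \<in> Arr S" "Dom S h = Dom S f" "Cod S h = Dom S u" "u \<cdot> h = f"
    using assms by (elim factorsE)
  thus ?thesis using assms by (intro factorsI[of _ "h \<cdot> k"]) auto
qed

lemma factors_trans:
  assumes "factors S f u" "factors S u w" "u \<in> Arr S" "w \<in> Arr S"
  shows "factors S f w"
proof -
  obtain h where h: "h \<in> Arr S" "Dom S h = Dom S f" "Cod S h = Dom S u" "u \<cdot> h = f"
    using assms by (elim factorsE)
  obtain k where k: "k \<in> Arr S" "Dom S k = Dom S u" "Cod S k = Dom S w" "w \<cdot> k = u"
    using assms by (elim factorsE)
  have "w \<cdot> (k \<cdot> h) = u \<cdot> h" by (rule cmp_extend1) (use h k assms in simp_all)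
  thus ?thesis by (intro factorsI[of _ "k \<cdot> h"]) (use h k assms in simp_all)
qed

lemma idn_factors: "u \<in> Arr S \<Longrightarrow> factors S (Idn S (Cod S u)) u \<Longrightarrow> f \<in> Arr S \<Longrightarrow> Cod S f = Cod S u \<Longrightarrow> factors S f u"
  using factors_cmp[of "Idn S (Cod S u)" u f] by simp

lemma pullback_ex1:
  assumes "is_pullback S f g p q" "x \<in> hom S Z (Dom S f)" "y \<in> hom S Z (Dom S g)" "f \<cdot> x = g \<cdot> y" "Z \<in> Obj S"
  shows "\<exists>!h. h \<in> hom S Z (Dom S p) \<and> p \<cdot> h = x \<and> q \<cdot> h = y"
  using assms unfolding is_pullback_def by blast

lemma pullback_lift:
  assumes "is_pullback S f g p q" "x \<in> Arr S" "y \<in> Arr S" "Dom S x = Dom S y"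
    "Cod S x = Dom S f" "Cod S y = Dom S g" "f \<cdot> x = g \<cdot> y"
  obtains h where "h \<in> Arr S" "Dom S h = Dom S x" "Cod S h = Dom S p" "p \<cdot> h = x" "q \<cdot> h = y"
proof -
  have "\<exists>!h. h \<in> hom S (Dom S x) (Dom S p) \<and> p \<cdot> h = x \<and> q \<cdot> h = y"
    by (rule pullback_ex1[OF assms(1)]) (use assms in \<open>simp_all add: hom_def\<close>)
  thus ?thesis using that by (auto simp: hom_def)
qed

lemma pullback_unique:
  assumes "is_pullback S f g p q" "h \<in> Arr S" "k \<in> Arr S" "Dom S h = Dom S k"
    "Cod S h = Dom S p" "Cod S k = Dom S p" "p \<cdot> h = p \<cdot> k" "q \<cdot> h = q \<cdot> k"
  shows "h = k"
proof -
  have a: "f \<in> Arr S" "g \<in> Arr S" "p \<in> Arr S" "q \<in> Arr S" "Dom S p = Dom S q"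
    "Cod S p = Dom S f" "Cod S q = Dom S g" "f \<cdot> p = g \<cdot> q"
    using assms(1) unfolding is_pullback_def by auto
  have "f \<cdot> (p \<cdot> h) = g \<cdot> (q \<cdot> h)"
    by (rule cmp_extend) (use a assms in simp_all)
  then have "\<exists>!l. l \<in> hom S (Dom S h) (Dom S p) \<and> p \<cdot> l = p \<cdot> h \<and> q \<cdot> l = q \<cdot> h"
    by (intro pullback_ex1[OF assms(1)]) (use assms(2-6) a in \<open>simp_all add: hom_def\<close>)
  thus ?thesis using assms by (auto simp: hom_def)
qed

lemma pullbackD:
  assumes "is_pullback S f g p q"
  shows "f \<in> Arr S" "g \<in> Arr S" "p \<in> Arr S" "q \<in> Arr S" "Cod S f = Cod S g" "Dom S q = Dom S p"
    "Cod S p = Dom S f" "Cod S q = Dom S g" "f \<cdot> p = g \<cdot> q"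
  using assms unfolding is_pullback_def by auto

lemma pullbackI:
  assumes "f \<in> Arr S" "g \<in> Arr S" "p \<in> Arr S" "q \<in> Arr S" "Cod S f = Cod S g" "Dom S q = Dom S p"
    "Cod S p = Dom S f" "Cod S q = Dom S g" "f \<cdot> p = g \<cdot> q"
    and "\<And>x y. x \<in> Arr S \<Longrightarrow> y \<in> Arr S \<Longrightarrow> Dom S x = Dom S y \<Longrightarrow> Cod S x = Dom S f \<Longrightarrow>
      Cod S y = Dom S g \<Longrightarrow> f \<cdot> x = g \<cdot> y \<Longrightarrow>
      \<exists>h\<in>Arr S. Dom S h = Dom S x \<and> Cod S h = Dom S p \<and> p \<cdot> h = x \<and> q \<cdot> h = y"
    and "\<And>h k. h \<in> Arr S \<Longrightarrow> k \<in> Arr S \<Longrightarrow> Dom S h = Dom S k \<Longrightarrow> Cod S h = Dom S p \<Longrightarrow>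
      Cod S k = Dom S p \<Longrightarrow> p \<cdot> h = p \<cdot> k \<Longrightarrow> q \<cdot> h = q \<cdot> k \<Longrightarrow> h = k"
  shows "is_pullback S f g p q"
proof -
  have "\<exists>!h. h \<in> hom S Z (Dom S p) \<and> p \<cdot> h = x \<and> q \<cdot> h = y"
    if x: "x \<in> hom S Z (Dom S f)" "y \<in> hom S Z (Dom S g)" "f \<cdot> x = g \<cdot> y" for Z x y
  proof -
    obtain h where h: "h\<in>Arr S" "Dom S h = Dom S x" "Cod S h = Dom S p" "p \<cdot> h = x" "q \<cdot> h = y"
      using assms(10)[of x y] x by (auto simp: hom_def)
    show ?thesis
    proof (rule ex1I[of _ h])
      show "h \<in> hom S Z (Dom S p) \<and> p \<cdot> h = x \<and> q \<cdot> h = y" using h x by (simp add: hom_def)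
      fix k assume "k \<in> hom S Z (Dom S p) \<and> p \<cdot> k = x \<and> q \<cdot> k = y"
      thus "k = h" by - (rule assms(11), use h x in \<open>simp_all add: hom_def\<close>)
    qed
  qed
  thus ?thesis using assms(1-9) unfolding is_pullback_def by auto
qed

text \<open>A map into the pullback is determined by its first component, because the second one is
  then determined through the mono \<open>u\<close>.\<close>

lemma pullback_mono:
  assumes "is_pullback S f u p q" "is_mono S u"
  shows "is_mono S p"
proof (rule monoI)
    note a = pullbackD[OF assms(1)]
    show "p \<in> Arr S" by fact
    fix h k assume h: "h \<in> Arr S" "k \<in> Arr S" "Dom S h = Dom S k" "Cod S h = Dom S p"
      "Cod S k = Dom S p" "p \<cdot> h = p \<cdot> k"
    have "u \<cdot> (q \<cdot> h) = f \<cdot> (p \<cdot> h)" by (rule cmp_extend) (use a h in simp_all)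
    also have "\<dots> = u \<cdot> (q \<cdot> k)" unfolding h by (rule cmp_extend) (use a h in simp_all)
    finally have "q \<cdot> h = q \<cdot> k" by (rule monoD[OF assms(2)]) (use a h in simp_all)
    show "h = k" by (rule pullback_unique[OF assms(1)]) (fact | use h a \<open>q \<cdot> h = q \<cdot> k\<close> in simp)+
qed

text \<open>Subobjects are handled throughout by saying which generalized elements factor through
  them; for inverse images this formulation is independent of the pullback that was chosen.\<close>

lemma pullback_factors:
  assumes "is_pullback S f u p q" "h \<in> Arr S" "Cod S h = Dom S f"
  shows "factors S h p \<longleftrightarrow> factors S (f \<cdot> h) u"
proof
  note a = pullbackD[OF assms(1)]
  assume "factors S h p"
  then obtain k where k: "k \<in> Arr S" "Dom S k = Dom S h" "Cod S k = Dom S p" "p \<cdot> k = h"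
    using a by (elim factorsE) auto
  have "u \<cdot> (q \<cdot> k) = f \<cdot> (p \<cdot> k)" by (rule cmp_extend) (use a k in simp_all)
  hence "u \<cdot> (q \<cdot> k) = f \<cdot> h" using k(4) by simp
  thus "factors S (f \<cdot> h) u" by (rule factorsI) (use a k(1,3) in simp_all)
next
  note a = pullbackD[OF assms(1)]
  assume "factors S (f \<cdot> h) u"
  then obtain k where k: "k \<in> Arr S" "Dom S k = Dom S (f \<cdot> h)" "Cod S k = Dom S u" "u \<cdot> k = f \<cdot> h"
    using a by (elim factorsE) auto
  then obtain l where "l \<in> Arr S" "Dom S l = Dom S h" "Cod S l = Dom S p" "p \<cdot> l = h"
    using pullback_lift[OF assms(1), of h k] a assms by auto
  thus "factors S h p" using a by (intro factorsI) auto
qed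

lemma pullback_cong:
  assumes "is_pullback S f g p q" "is_pullback S f g p' q'"
  obtains k where "k \<in> Arr S" "Dom S k = Dom S p'" "Cod S k = Dom S p" "p \<cdot> k = p'" "q \<cdot> k = q'"
  using pullback_lift[OF assms(1), of p' q'] pullbackD[OF assms(1)] pullbackD[OF assms(2)] by metis

end

lemma some_pair:
  assumes "\<exists>x y. Q x y"
  shows "Q (fst (SOME (x, y). Q x y)) (snd (SOME (x, y). Q x y))"
proof -
  have "\<exists>z. case_prod Q z" using assms by auto
  hence "case_prod Q (SOME z. case_prod Q z)" by (rule someI_ex)
  thus ?thesis by (rule case_prod_beta[THEN iffD1])
qed

section \<open>Finite limits of a topos\<close>

locale topos_loc =
  fixes S :: "('o, 'a) cat" (structure)
  assumes topos: "topos S"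

sublocale topos_loc \<subseteq> cat_loc
  using topos by unfold_locales (simp add: topos_def)

context topos_loc
begin

lemma one_terminal: "is_terminal S (one S)"
  using topos unfolding topos_def one_def by (metis someI_ex)

lemma one_obj [simp]: "one S \<in> Obj S"
  using one_terminal by (simp add: is_terminal_def)

lemma bang_hom: "X \<in> Obj S \<Longrightarrow> bang S X \<in> hom S X (one S)"
  using one_terminal unfolding is_terminal_def bang_def by (metis (mono_tags, lifting) theI')

lemma bang_arr [simp]: "X \<in> Obj S \<Longrightarrow> bang S X \<in> Arr S"
  and bang_dom [simp]: "X \<in> Obj S \<Longrightarrow> Dom S (bang S X) = X"
  and bang_cod [simp]: "X \<in> Obj S \<Longrightarrow> Cod S (bang S X) = one S"
  using bang_hom by (auto simp: hom_def)

lemma to_one: "f \<in> Arr S \<Longrightarrow> g \<in> Arr S \<Longrightarrow> Cod S f = one S \<Longrightarrow> Cod S g = one S \<Longrightarrow> Dom S f = Dom S g \<Longrightarrow> f = g"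
  using one_terminal unfolding is_terminal_def hom_def
  by (metis (mono_tags, lifting) dom_obj mem_Collect_eq)

lemma bang_cmp [simp]: "f \<in> Arr S \<Longrightarrow> Cod S f = X \<Longrightarrow> bang S X \<cdot> f = bang S (Dom S f)"
  by (rule to_one) auto

lemma bang_one [simp]: "bang S (one S) = Idn S (one S)"
  by (rule to_one) auto

lemma pb_pullback:
  assumes "f \<in> Arr S" "g \<in> Arr S" "Cod S f = Cod S g"
  shows "is_pullback S f g (fst (pb S f g)) (snd (pb S f g))"
  using some_pair[of "is_pullback S f g"] topos assms unfolding topos_def pb_def by blast

text \<open>All squares over the terminal object commute, so a pullback over it is a product. Of
  finite limits, the definition of a topos only provides pullbacks and a terminal object.\<close>

lemma product_exists:
  assumes "X \<in> Obj S" "Y \<in> Obj S"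
  shows "\<exists>p q. is_product S X Y p q"
proof -
  obtain p q where p: "is_pullback S (bang S X) (bang S Y) p q"
    using pb_pullback[of "bang S X" "bang S Y"] assms by auto
  have "is_product S X Y p q"
    unfolding is_product_def
  proof (intro conjI ballI)
    fix Z f g assume "Z \<in> Obj S" "f \<in> hom S Z X" "g \<in> hom S Z Y"
    moreover from this have "bang S X \<cdot> f = bang S Y \<cdot> g" by (simp add: hom_def)
    ultimately show "\<exists>!h. h \<in> hom S Z (Dom S p) \<and> p \<cdot> h = f \<and> q \<cdot> h = g"
      using pullback_ex1[OF p, of f Z g] assms pullbackD[OF p] by simp
  qed (use pullbackD[OF p] assms in simp_all)
  thus ?thesis by blast
qed

lemma product: "X \<in> Obj S \<Longrightarrow> Y \<in> Obj S \<Longrightarrow> is_product S X Y (pr1 S X Y) (pr2 S X Y)"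
  unfolding pr1_def pr2_def prod_cone_def by (rule some_pair) (rule product_exists)

lemma pr_simps [simp]:
  assumes "X \<in> Obj S" "Y \<in> Obj S"
  shows "pr1 S X Y \<in> Arr S" "pr2 S X Y \<in> Arr S" "Dom S (pr1 S X Y) = prd S X Y"
    "Dom S (pr2 S X Y) = prd S X Y" "Cod S (pr1 S X Y) = X" "Cod S (pr2 S X Y) = Y"
  using product[OF assms] unfolding is_product_def prd_def by auto

lemma prd_obj [simp]: "X \<in> Obj S \<Longrightarrow> Y \<in> Obj S \<Longrightarrow> prd S X Y \<in> Obj S"
  using dom_obj[of "pr1 S X Y"] by simp

lemma tup_props:
  assumes "f \<in> Arr S" "g \<in> Arr S" "Dom S f = Dom S g"
  shows "tup S f g \<in> hom S (Dom S f) (prd S (Cod S f) (Cod S g)) \<and>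
     pr1 S (Cod S f) (Cod S g) \<cdot> tup S f g = f \<and> pr2 S (Cod S f) (Cod S g) \<cdot> tup S f g = g"
proof -
  have "\<exists>!h. h \<in> hom S (Dom S f) (prd S (Cod S f) (Cod S g)) \<and>
     pr1 S (Cod S f) (Cod S g) \<cdot> h = f \<and> pr2 S (Cod S f) (Cod S g) \<cdot> h = g"
    using product[of "Cod S f" "Cod S g"] assms unfolding is_product_def by (simp add: hom_def)
  from theI'[OF this] show ?thesis unfolding tup_def .
qed

lemma tup_simps [simp]:
  assumes "f \<in> Arr S" "g \<in> Arr S" "Dom S f = Dom S g"
  shows "tup S f g \<in> Arr S" "Dom S (tup S f g) = Dom S g" "Cod S (tup S f g) = prd S (Cod S f) (Cod S g)"
    "X = Cod S f \<Longrightarrow> Y = Cod S g \<Longrightarrow> pr1 S X Y \<cdot> tup S f g = f"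
    "X = Cod S f \<Longrightarrow> Y = Cod S g \<Longrightarrow> pr2 S X Y \<cdot> tup S f g = g"
  using tup_props[OF assms] assms by (auto simp: hom_def)

lemma prd_ext:
  assumes "h \<in> Arr S" "k \<in> Arr S" "Dom S h = Dom S k" "Cod S h = prd S X Y" "Cod S k = prd S X Y"
    "X \<in> Obj S" "Y \<in> Obj S" "pr1 S X Y \<cdot> h = pr1 S X Y \<cdot> k" "pr2 S X Y \<cdot> h = pr2 S X Y \<cdot> k"
  shows "h = k"
proof -
  have "\<exists>!l. l \<in> hom S (Dom S h) (prd S X Y) \<and> pr1 S X Y \<cdot> l = pr1 S X Y \<cdot> h \<and> pr2 S X Y \<cdot> l = pr2 S X Y \<cdot> h"
    using product[of X Y] assms unfolding is_product_def by (simp add: hom_def)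
  thus ?thesis using assms by (auto simp: hom_def)
qed

text \<open>As a simp rule this moves precomposition into the components, the normal form on which
  \<open>tup_inj\<close> is used later.\<close>

lemma tup_cmp [simp]:
  assumes "f \<in> Arr S" "g \<in> Arr S" "Dom S f = Dom S g" "k \<in> Arr S" "Cod S k = Dom S g"
  shows "tup S f g \<cdot> k = tup S (f \<cdot> k) (g \<cdot> k)"
proof (rule prd_ext[of _ _ "Cod S f" "Cod S g"])
  have "pr1 S (Cod S f) (Cod S g) \<cdot> (tup S f g \<cdot> k) = f \<cdot> k"
    by (rule cmp_extend1) (use assms in simp_all)
  thus "pr1 S (Cod S f) (Cod S g) \<cdot> (tup S f g \<cdot> k) = pr1 S (Cod S f) (Cod S g) \<cdot> tup S (f \<cdot> k) (g \<cdot> k)"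
    using assms by simp
  have "pr2 S (Cod S f) (Cod S g) \<cdot> (tup S f g \<cdot> k) = g \<cdot> k"
    by (rule cmp_extend1) (use assms in simp_all)
  thus "pr2 S (Cod S f) (Cod S g) \<cdot> (tup S f g \<cdot> k) = pr2 S (Cod S f) (Cod S g) \<cdot> tup S (f \<cdot> k) (g \<cdot> k)"
    using assms by simp
qed (use assms in simp_all)

lemma tup_eta: "h \<in> Arr S \<Longrightarrow> Cod S h = prd S X Y \<Longrightarrow> X \<in> Obj S \<Longrightarrow> Y \<in> Obj S \<Longrightarrow>
    tup S (pr1 S X Y \<cdot> h) (pr2 S X Y \<cdot> h) = h"
  by (rule prd_ext[of _ _ X Y]) auto

lemma tup_inj:
  assumes "tup S f g = tup S f' g'" "f \<in> Arr S" "g \<in> Arr S" "f' \<in> Arr S" "g' \<in> Arr S"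
    "Dom S f = Dom S g" "Dom S f' = Dom S g'" "Cod S f = Cod S f'" "Cod S g = Cod S g'"
  shows "f = f' \<and> g = g'"
proof
  have "f = pr1 S (Cod S f) (Cod S g) \<cdot> tup S f g" "g = pr2 S (Cod S f) (Cod S g) \<cdot> tup S f g"
    using assms(2,3,6) by simp_all
  moreover have "f' = pr1 S (Cod S f) (Cod S g) \<cdot> tup S f' g'" "g' = pr2 S (Cod S f) (Cod S g) \<cdot> tup S f' g'"
    using assms(4,5,7,8,9) by simp_all
  ultimately show "f = f'" "g = g'" using assms(1) by metis+
qed

lemma tup_mono1:
  assumes "is_mono S f" "g \<in> Arr S" "Dom S g = Dom S f"
  shows "is_mono S (tup S f g)"
proof (rule monoI)
  show "tup S f g \<in> Arr S" using assms by simp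
  fix h k assume h: "h \<in> Arr S" "k \<in> Arr S" "Dom S h = Dom S k" "Cod S h = Dom S (tup S f g)"
    "Cod S k = Dom S (tup S f g)" "tup S f g \<cdot> h = tup S f g \<cdot> k"
    have "f \<cdot> h = f \<cdot> k \<and> g \<cdot> h = g \<cdot> k"
      by (rule tup_inj) (use h assms in simp_all)
    with h assms show "h = k" by (auto intro: monoD[OF assms(1)])
qed

lemma tup_mono2:
  assumes "is_mono S g" "f \<in> Arr S" "Dom S g = Dom S f"
  shows "is_mono S (tup S f g)"
proof (rule monoI)
  show "tup S f g \<in> Arr S" using assms by simp
  fix h k assume h: "h \<in> Arr S" "k \<in> Arr S" "Dom S h = Dom S k" "Cod S h = Dom S (tup S f g)"
    "Cod S k = Dom S (tup S f g)" "tup S f g \<cdot> h = tup S f g \<cdot> k"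
    have "f \<cdot> h = f \<cdot> k \<and> g \<cdot> h = g \<cdot> k"
      by (rule tup_inj) (use h assms in simp_all)
    with h assms show "h = k" by (auto intro: monoD[OF assms(1)])
qed

text \<open>The equalizer of \<open>f\<close> and \<open>g\<close> is the inverse image of the
  diagonal of their common codomain under the pair \<open>(f, g)\<close>.\<close>

lemma equalizer:
  assumes "f \<in> Arr S" "g \<in> Arr S" "Dom S f = Dom S g" "Cod S f = Cod S g"
  obtains w where "is_mono S w" "Cod S w = Dom S f"
    "\<And>h. h \<in> Arr S \<Longrightarrow> Cod S h = Dom S f \<Longrightarrow> factors S h w \<longleftrightarrow> f \<cdot> h = g \<cdot> h"
proof -
  define Y where "Y = Cod S f"
  define d where "d = tup S (Idn S Y) (Idn S Y)"
  have Y: "Y \<in> Obj S" using assms by (simp add: Y_def)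
  have d: "d \<in> Arr S" "Dom S d = Y" "Cod S d = prd S Y Y" using Y by (auto simp: d_def)
  have dm: "is_mono S d" unfolding d_def by (rule tup_mono1) (use Y in simp_all)
  obtain p q where p: "is_pullback S (tup S f g) d p q"
    using pb_pullback[of "tup S f g" d] d assms unfolding Y_def by auto
  have "factors S h p \<longleftrightarrow> f \<cdot> h = g \<cdot> h" if h: "h \<in> Arr S" "Cod S h = Dom S f" for h
  proof -
    have "factors S h p \<longleftrightarrow> factors S (tup S (f \<cdot> h) (g \<cdot> h)) d"
      using pullback_factors[OF p, of h] h assms by simp
    also have "\<dots> \<longleftrightarrow> f \<cdot> h = g \<cdot> h"
    proof
      assume "factors S (tup S (f \<cdot> h) (g \<cdot> h)) d"
      then obtain k where k: "k \<in> Arr S" "Cod S k = Y" "d \<cdot> k = tup S (f \<cdot> h) (g \<cdot> h)"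
        using d by (auto elim: factorsE)
      hence t: "tup S (f \<cdot> h) (g \<cdot> h) = tup S k k" using Y by (simp add: d_def)
      have "f \<cdot> h = k \<and> g \<cdot> h = k"
        by (rule tup_inj[OF t]) (use k h assms Y_def in simp_all)
      thus "f \<cdot> h = g \<cdot> h" by simp
    next
      assume "f \<cdot> h = g \<cdot> h"
      thus "factors S (tup S (f \<cdot> h) (g \<cdot> h)) d"
        by (intro factorsI[of _ "f \<cdot> h"]) (use h assms Y_def d d_def in simp_all)
    qed
    finally show ?thesis .
  qed
  moreover have "is_mono S p" by (rule pullback_mono[OF p dm])
  moreover have "Cod S p = Dom S f" using pullbackD[OF p] assms by simp
  ultimately show ?thesis using that by blast
qed

section \<open>Power objects, generalized membership, and stability of epimorphisms\<close>

lemma power_object: "X \<in> Obj S \<Longrightarrow> is_power_object S X (pow S X) (mem S X)"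
  using some_pair[of "is_power_object S X"] topos
  unfolding topos_def pow_def mem_def power_data_def by blast

lemma pow_simps [simp]:
  assumes "X \<in> Obj S"
  shows "pow S X \<in> Obj S" "is_mono S (mem S X)" "mem S X \<in> Arr S" "Cod S (mem S X) = prd S X (pow S X)"
  using power_object[OF assms] by (auto simp: is_power_object_def)

abbreviation mb :: "'o \<Rightarrow> 'a \<Rightarrow> 'a \<Rightarrow> bool" where
  "mb X a r \<equiv> factors S (tup S a r) (mem S X)"

lemma mb_cmp:
  assumes "mb X a r" "X \<in> Obj S" "a \<in> Arr S" "r \<in> Arr S" "k \<in> Arr S"
    "Dom S a = Dom S r" "Cod S k = Dom S r" "Cod S a = X" "Cod S r = pow S X"
  shows "mb X (a \<cdot> k) (r \<cdot> k)"
  using factors_cmp[OF assms(1), of k] assms by simp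

text \<open>The right-hand side says that \<open>u\<close> and the membership relation pulled back
  along \<open>X \<times> c\<close> have the same generalized elements. As \<open>u\<close> is a
  mono, this agreement already makes the square a pullback; the arrow \<open>q\<close> is found by
  applying it to \<open>u\<close> itself.\<close>

lemma classify_iff:
  assumes "X \<in> Obj S" "Y \<in> Obj S" "is_mono S u" "Cod S u = prd S X Y" "c \<in> Arr S" "Dom S c = Y" "Cod S c = pow S X"
  shows "(\<exists>q. is_pullback S (tup S (pr1 S X Y) (c \<cdot> pr2 S X Y)) (mem S X) u q) \<longleftrightarrow>
    (\<forall>p a. p \<in> Arr S \<longrightarrow> a \<in> Arr S \<longrightarrow> Dom S a = Dom S p \<longrightarrow> Cod S p = Y \<longrightarrow> Cod S a = X \<longrightarrow>
      (mb X a (c \<cdot> p) \<longleftrightarrow> factors S (tup S a p) u))" (is "?L \<longleftrightarrow> ?R")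
proof
  have e: "tup S (pr1 S X Y) (c \<cdot> pr2 S X Y) \<cdot> tup S a p = tup S a (c \<cdot> p)"
    if "p \<in> Arr S" "a \<in> Arr S" "Dom S a = Dom S p" "Cod S p = Y" "Cod S a = X" for a p
    using that assms by simp
  {
    assume ?L
    then obtain q where "is_pullback S (tup S (pr1 S X Y) (c \<cdot> pr2 S X Y)) (mem S X) u q" by blast
    note pf = pullback_factors[OF this]
    show ?R
    proof (intro allI impI)
      fix p a assume pa: "p \<in> Arr S" "a \<in> Arr S" "Dom S a = Dom S p" "Cod S p = Y" "Cod S a = X"
      show "mb X a (c \<cdot> p) \<longleftrightarrow> factors S (tup S a p) u"
        using pf[of "tup S a p"] e[OF pa] pa assms by simp
    qed
  next
    assume R: ?R
    let ?t = "tup S (pr1 S X Y) (c \<cdot> pr2 S X Y)"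
    have t: "?t \<in> Arr S" "Dom S ?t = prd S X Y" "Cod S ?t = prd S X (pow S X)" using assms by auto
    have key: "factors S (?t \<cdot> h) (mem S X) \<longleftrightarrow> factors S h u"
      if h: "h \<in> Arr S" "Cod S h = prd S X Y" for h
    proof -
      have "?t \<cdot> h = tup S (pr1 S X Y \<cdot> h) (c \<cdot> (pr2 S X Y \<cdot> h))" using h assms by simp
      thus ?thesis
        using R[rule_format, of "pr2 S X Y \<cdot> h" "pr1 S X Y \<cdot> h"] h assms tup_eta[OF h] by simp
    qed
    have ua: "u \<in> Arr S" using assms by simp
    obtain q where q: "q \<in> Arr S" "Dom S q = Dom S u" "Cod S q = Dom S (mem S X)" "mem S X \<cdot> q = ?t \<cdot> u"
      using key[of u] factors_refl[of u] assms t ua by (metis cmp_dom factorsE pow_simps(3))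
    have "is_pullback S ?t (mem S X) u q"
    proof (rule pullbackI)
      fix x y assume h: "x \<in> Arr S" "y \<in> Arr S" "Dom S x = Dom S y" "Cod S x = Dom S ?t"
        "Cod S y = Dom S (mem S X)" "?t \<cdot> x = mem S X \<cdot> y"
      have "factors S x u" using key[of x] h assms t by (metis factorsI pow_simps(3))
      then obtain k where k: "k \<in> Arr S" "Dom S k = Dom S x" "Cod S k = Dom S u" "u \<cdot> k = x"
        using ua by (elim factorsE)
      have "mem S X \<cdot> (q \<cdot> k) = ?t \<cdot> (u \<cdot> k)"
        by (rule cmp_extend) (use q k t ua assms in simp_all)
      hence "mem S X \<cdot> (q \<cdot> k) = mem S X \<cdot> y" using h k by simp
      hence "q \<cdot> k = y" by (rule monoD[rotated]) (use q k h assms in simp_all)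
      thus "\<exists>h\<in>Arr S. Dom S h = Dom S x \<and> Cod S h = Dom S u \<and> u \<cdot> h = x \<and> q \<cdot> h = y"
        using k by blast
    next
      fix h k assume "h \<in> Arr S" "k \<in> Arr S" "Dom S h = Dom S k" "Cod S h = Dom S u" "Cod S k = Dom S u" "u \<cdot> h = u \<cdot> k"
      thus "h = k" using monoD[OF assms(3)] by blast
    qed (use q t ua assms in simp_all)
    thus ?L by blast
  }
qed

lemma classify:
  assumes "X \<in> Obj S" "Y \<in> Obj S" "is_mono S u" "Cod S u = prd S X Y"
  obtains c where "c \<in> Arr S" "Dom S c = Y" "Cod S c = pow S X"
    "\<And>p a. p \<in> Arr S \<Longrightarrow> a \<in> Arr S \<Longrightarrow> Dom S a = Dom S p \<Longrightarrow> Cod S p = Y \<Longrightarrow> Cod S a = X \<Longrightarrow>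
      mb X a (c \<cdot> p) \<longleftrightarrow> factors S (tup S a p) u"
proof -
  obtain c where "c \<in> hom S Y (pow S X)" "\<exists>q. is_pullback S (tup S (pr1 S X Y) (c \<cdot> pr2 S X Y)) (mem S X) u q"
    using power_object[OF assms(1)] assms unfolding is_power_object_def by (meson ex1E)
  thus ?thesis using that[of c] classify_iff[of X Y u c] assms by (auto simp: hom_def)
qed

text \<open>Both maps classify the subobject \<open>u\<close> of \<open>X \<times> Y\<close>
  obtained by pulling membership back along \<open>r\<close>; uniqueness of classifying maps then
  identifies them.\<close>

lemma pow_ext:
  assumes "X \<in> Obj S" "r \<in> Arr S" "r' \<in> Arr S" "Cod S r = pow S X" "Cod S r' = pow S X" "Dom S r = Dom S r'"
    and eq: "\<And>p a. p \<in> Arr S \<Longrightarrow> a \<in> Arr S \<Longrightarrow> Dom S a = Dom S p \<Longrightarrow> Cod S p = Dom S r \<Longrightarrow> Cod S a = X \<Longrightarrow>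
      mb X a (r \<cdot> p) \<longleftrightarrow> mb X a (r' \<cdot> p)"
  shows "r = r'"
proof -
  define Y where "Y = Dom S r"
  have Y: "Y \<in> Obj S" "Dom S r = Y" "Dom S r' = Y" using assms by (auto simp: Y_def)
  let ?t = "tup S (pr1 S X Y) (r \<cdot> pr2 S X Y)"
  obtain u q where u: "is_pullback S ?t (mem S X) u q"
    using pb_pullback[of ?t "mem S X"] assms Y by auto
  have m: "is_mono S u" using pullback_mono[OF u] assms by simp
  have c: "Cod S u = prd S X Y" using pullbackD[OF u] assms Y by simp
  have 1: "r \<in> hom S Y (pow S X)" "r' \<in> hom S Y (pow S X)" using assms Y by (auto simp: hom_def)
  have "\<exists>q. is_pullback S ?t (mem S X) u q" using u by blast
  moreover have "\<exists>q. is_pullback S (tup S (pr1 S X Y) (r' \<cdot> pr2 S X Y)) (mem S X) u q"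
    using calculation classify_iff[OF assms(1) Y(1) m c assms(2) Y(2) assms(4)]
      classify_iff[OF assms(1) Y(1) m c assms(3) Y(3) assms(5)] eq Y by metis
  ultimately show ?thesis
    using power_object[OF assms(1)] Y m c 1 unfolding is_power_object_def by blast
qed

text \<open>The two maps classify \<open>u\<close> and the maximal subobject, with values in the power object of the
  terminal object.\<close>

lemma mono_is_equalizer:
  assumes "is_mono S u"
  obtains c t where "c \<in> Arr S" "t \<in> Arr S" "Dom S c = Cod S u" "Dom S t = Cod S u" "Cod S t = Cod S c"
    "\<And>h. h \<in> Arr S \<Longrightarrow> Cod S h = Cod S u \<Longrightarrow> factors S h u \<longleftrightarrow> c \<cdot> h = t \<cdot> h"
proof -
  define X where "X = Cod S u"
  have u: "u \<in> Arr S" "Cod S u = X" "X \<in> Obj S" using assms by (auto simp: X_def)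
  \<comment> \<open>\<open>?b v\<close> is the subobject \<open>v\<close> moved to
    \<open>1 \<times> X\<close>, where it can be classified by a map into the power object of
    \<open>1\<close>.\<close>
  let ?b = "\<lambda>v. tup S (bang S (Dom S v)) v"
  have fb: "factors S (tup S a h) (?b v) \<longleftrightarrow> factors S h v"
    if h: "h \<in> Arr S" "Cod S h = X" "a \<in> Arr S" "Dom S a = Dom S h" "Cod S a = one S" "v \<in> Arr S" "Cod S v = X" for v h a
  proof
    assume "factors S (tup S a h) (?b v)"
    then obtain k where k: "k \<in> Arr S" "Dom S k = Dom S (tup S a h)" "Cod S k = Dom S (?b v)" "?b v \<cdot> k = tup S a h"
      by (rule factorsE) (use h in simp_all)
    hence e: "tup S a h = tup S (bang S (Dom S k)) (v \<cdot> k)" using h by simp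
    have "a = bang S (Dom S k) \<and> h = v \<cdot> k" by (rule tup_inj[OF e]) (use k h in simp_all)
    thus "factors S h v" using k h by (intro factorsI) auto
  next
    assume "factors S h v"
    then obtain k where k: "k \<in> Arr S" "Dom S k = Dom S h" "Cod S k = Dom S v" "v \<cdot> k = h"
      by (rule factorsE) (use h in simp_all)
    have "a = bang S (Dom S h)" by (rule to_one) (use h in simp_all)
    thus "factors S (tup S a h) (?b v)" using k h by (intro factorsI[of _ k]) auto
  qed
  have mb: "is_mono S (?b u)" "is_mono S (?b (Idn S X))" using assms u by (auto intro!: tup_mono2)
  have bc: "Cod S (?b u) = prd S (one S) X" "Cod S (?b (Idn S X)) = prd S (one S) X" using u by auto
  obtain c where c: "c \<in> Arr S" "Dom S c = X" "Cod S c = pow S (one S)"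
    "\<And>p a. p \<in> Arr S \<Longrightarrow> a \<in> Arr S \<Longrightarrow> Dom S a = Dom S p \<Longrightarrow> Cod S p = X \<Longrightarrow> Cod S a = one S \<Longrightarrow>
      mb (one S) a (c \<cdot> p) \<longleftrightarrow> factors S (tup S a p) (?b u)"
    using classify[OF one_obj u(3) mb(1) bc(1)] by blast
  obtain t where t: "t \<in> Arr S" "Dom S t = X" "Cod S t = pow S (one S)"
    "\<And>p a. p \<in> Arr S \<Longrightarrow> a \<in> Arr S \<Longrightarrow> Dom S a = Dom S p \<Longrightarrow> Cod S p = X \<Longrightarrow> Cod S a = one S \<Longrightarrow>
      mb (one S) a (t \<cdot> p) \<longleftrightarrow> factors S (tup S a p) (?b (Idn S X))"
    using classify[OF one_obj u(3) mb(2) bc(2)] by blast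
  have fi: "factors S h (Idn S X)" if "h \<in> Arr S" "Cod S h = X" for h
    using that u by (intro factorsI[of _ h]) auto
  have "factors S h u \<longleftrightarrow> c \<cdot> h = t \<cdot> h" if h: "h \<in> Arr S" "Cod S h = X" for h
  proof
    assume f: "factors S h u"
    show "c \<cdot> h = t \<cdot> h"
    proof (rule pow_ext[of "one S"])
      fix p a assume p: "p \<in> Arr S" "a \<in> Arr S" "Dom S a = Dom S p" "Cod S p = Dom S (c \<cdot> h)" "Cod S a = one S"
      have "factors S (h \<cdot> p) u" using factors_cmp[OF f, of p] p h c u by simp
      thus "mb (one S) a ((c \<cdot> h) \<cdot> p) \<longleftrightarrow> mb (one S) a ((t \<cdot> h) \<cdot> p)"
        using c(1-3) t(1-3) c(4)[of "h \<cdot> p" a] t(4)[of "h \<cdot> p" a] p h u fb[of "h \<cdot> p" a u]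
          fb[of "h \<cdot> p" a "Idn S X"] fi[of "h \<cdot> p"] by simp
    qed (use c t h in simp_all)
  next
    assume e: "c \<cdot> h = t \<cdot> h"
    let ?a = "bang S (Dom S h)"
    have "mb (one S) ?a (c \<cdot> h)"
      unfolding e using t(4)[of h ?a] fb[of h ?a "Idn S X"] fi[of h] h u by simp
    thus "factors S h u"
      using c(4)[of h ?a] fb[of h ?a u] h u by simp
  qed
  thus ?thesis using that[of c t] c t u by simp
qed

text \<open>A mono is the locus where two maps agree, and they agree on \<open>h\<close> as soon as
  they agree on \<open>h \<cdot> e\<close>. This is what makes membership in a subobject a local
  question.\<close>

lemma epi_factors_mono:
  assumes "is_epi S e" "is_mono S u" "factors S (h \<cdot> e) u" "h \<in> Arr S" "Cod S e = Dom S h" "Cod S h = Cod S u"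
  shows "factors S h u"
proof -
  obtain c t where c: "c \<in> Arr S" "t \<in> Arr S" "Dom S c = Cod S u" "Dom S t = Cod S u" "Cod S t = Cod S c"
    "\<And>h. h \<in> Arr S \<Longrightarrow> Cod S h = Cod S u \<Longrightarrow> factors S h u \<longleftrightarrow> c \<cdot> h = t \<cdot> h"
    using mono_is_equalizer[OF assms(2)] by blast
  have ea: "e \<in> Arr S" using assms by simp
  have "c \<cdot> (h \<cdot> e) = t \<cdot> (h \<cdot> e)" using c(6)[of "h \<cdot> e"] assms ea by simp
  hence "(c \<cdot> h) \<cdot> e = (t \<cdot> h) \<cdot> e" using assms c(1-5) ea by simp
  hence "c \<cdot> h = t \<cdot> h" by (rule epiD[OF assms(1)]) (use assms c(1-5) ea in simp_all)
  thus ?thesis using c(6)[of h] assms by simp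
qed

text \<open>The two classifying maps compare the fibres of \<open>g\<close> with their intersections with \<open>w\<close>; they
  agree on a generalized element \<open>h\<close> iff the fibre of \<open>g\<close> over \<open>h\<close> lies in \<open>w\<close>.\<close>

lemma fibrewise_inclusion:
  assumes "g \<in> Arr S" "is_mono S w" "Cod S w = Dom S g"
  obtains c t where "c \<in> Arr S" "t \<in> Arr S" "Dom S c = Cod S g" "Dom S t = Cod S g" "Cod S t = Cod S c"
    "\<And>h. h \<in> Arr S \<Longrightarrow> Cod S h = Cod S g \<Longrightarrow>
      c \<cdot> h = t \<cdot> h \<longleftrightarrow> (\<forall>k j. k \<in> Arr S \<longrightarrow> j \<in> Arr S \<longrightarrow> Dom S k = Dom S j \<longrightarrow> Cod S k = Dom S h \<longrightarrow>
         Cod S j = Dom S g \<longrightarrow> h \<cdot> k = g \<cdot> j \<longrightarrow> factors S j w)"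
proof -
  define J where "J = Dom S g"
  define I where "I = Cod S g"
  have g: "Dom S g = J" "Cod S g = I" "J \<in> Obj S" "I \<in> Obj S" "w \<in> Arr S" "Cod S w = J" "g \<in> Arr S"
    using assms by (auto simp: J_def I_def)
  \<comment> \<open>\<open>?G w\<close> is the graph of \<open>g\<close> restricted to
    \<open>w\<close>, a relation whose fibre over a point of \<open>I\<close> is the fibre of
    \<open>g\<close> cut down to \<open>w\<close>.\<close>
  let ?G = "\<lambda>w. tup S w (g \<cdot> w)"
  have fG: "factors S (tup S j h) (?G v) \<longleftrightarrow> factors S j v \<and> h = g \<cdot> j"
    if h: "h \<in> Arr S" "Cod S h = I" "j \<in> Arr S" "Dom S j = Dom S h" "Cod S j = J" "v \<in> Arr S" "Cod S v = J" for v h j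
  proof
    assume "factors S (tup S j h) (?G v)"
    then obtain k where k: "k \<in> Arr S" "Dom S k = Dom S (tup S j h)" "Cod S k = Dom S (?G v)" "?G v \<cdot> k = tup S j h"
      by (rule factorsE) (use h g in simp_all)
    hence e: "tup S j h = tup S (v \<cdot> k) (g \<cdot> (v \<cdot> k))" using h g by simp
    have "j = v \<cdot> k \<and> h = g \<cdot> (v \<cdot> k)" by (rule tup_inj[OF e]) (use k h g in simp_all)
    hence jv: "v \<cdot> k = j" "h = g \<cdot> (v \<cdot> k)" by blast+
    have "factors S j v" by (rule factorsI[OF jv(1)]) (use k(1,3) h(6,7) g in simp_all)
    thus "factors S j v \<and> h = g \<cdot> j" using jv by metis
  next
    assume f: "factors S j v \<and> h = g \<cdot> j"
    have "factors S j v" using f by blast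
    then obtain k where k: "k \<in> Arr S" "Dom S k = Dom S j" "Cod S k = Dom S v" "v \<cdot> k = j"
      by (rule factorsE) (rule h(6))
    have "?G v \<cdot> k = tup S (v \<cdot> k) (g \<cdot> (v \<cdot> k))" using k(1,3) h(6,7) g by simp
    hence "?G v \<cdot> k = tup S j h" using f by (simp add: k(4))
    thus "factors S (tup S j h) (?G v)" by (rule factorsI) (use k(1,3) h(6,7) g in simp_all)
  qed
  have mono: "is_mono S (?G w)" "is_mono S (?G (Idn S J))" using assms g by (auto intro!: tup_mono1)
  have cod: "Cod S (?G w) = prd S J I" "Cod S (?G (Idn S J)) = prd S J I" using g by auto
  obtain c where c: "c \<in> Arr S" "Dom S c = I" "Cod S c = pow S J"
    "\<And>p a. p \<in> Arr S \<Longrightarrow> a \<in> Arr S \<Longrightarrow> Dom S a = Dom S p \<Longrightarrow> Cod S p = I \<Longrightarrow> Cod S a = J \<Longrightarrow>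
      mb J a (c \<cdot> p) \<longleftrightarrow> factors S (tup S a p) (?G w)"
    using classify[OF g(3,4) mono(1) cod(1)] by blast
  obtain t where t: "t \<in> Arr S" "Dom S t = I" "Cod S t = pow S J"
    "\<And>p a. p \<in> Arr S \<Longrightarrow> a \<in> Arr S \<Longrightarrow> Dom S a = Dom S p \<Longrightarrow> Cod S p = I \<Longrightarrow> Cod S a = J \<Longrightarrow>
      mb J a (t \<cdot> p) \<longleftrightarrow> factors S (tup S a p) (?G (Idn S J))"
    using classify[OF g(3,4) mono(2) cod(2)] by blast
  have fi: "factors S h (Idn S J)" if "h \<in> Arr S" "Cod S h = J" for h
    using that g by (intro factorsI[of _ h]) auto
  have "c \<cdot> h = t \<cdot> h \<longleftrightarrow> (\<forall>k j. k \<in> Arr S \<longrightarrow> j \<in> Arr S \<longrightarrow> Dom S k = Dom S j \<longrightarrow> Cod S k = Dom S h \<longrightarrow>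
         Cod S j = J \<longrightarrow> h \<cdot> k = g \<cdot> j \<longrightarrow> factors S j w)" (is "_ \<longleftrightarrow> ?R")
    if h: "h \<in> Arr S" "Cod S h = I" for h
  proof
    assume e: "c \<cdot> h = t \<cdot> h"
    show ?R
    proof (intro allI impI)
      fix k j assume k: "k \<in> Arr S" "j \<in> Arr S" "Dom S k = Dom S j" "Cod S k = Dom S h" "Cod S j = J" "h \<cdot> k = g \<cdot> j"
      have "c \<cdot> (h \<cdot> k) = t \<cdot> (h \<cdot> k)" by (rule cmp_extend[OF e]) (use c t h k in simp_all)
      moreover have "mb J j (t \<cdot> (h \<cdot> k))"
        using t(4)[of "h \<cdot> k" j] fG[of "h \<cdot> k" j "Idn S J"] fi[of j] k h g by simp
      ultimately have "mb J j (c \<cdot> (h \<cdot> k))" by simp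
      thus "factors S j w"
        using c(4)[of "h \<cdot> k" j] fG[of "h \<cdot> k" j w] k h g by simp
    qed
  next
    assume R: ?R
    show "c \<cdot> h = t \<cdot> h"
    proof (rule pow_ext[of J])
      fix p a assume p: "p \<in> Arr S" "a \<in> Arr S" "Dom S a = Dom S p" "Cod S p = Dom S (c \<cdot> h)" "Cod S a = J"
      show "mb J a ((c \<cdot> h) \<cdot> p) \<longleftrightarrow> mb J a ((t \<cdot> h) \<cdot> p)"
        using R[rule_format, of p a] c(1-3) t(1-3) c(4)[of "h \<cdot> p" a] t(4)[of "h \<cdot> p" a] p h g
          fG[of "h \<cdot> p" a w] fG[of "h \<cdot> p" a "Idn S J"] fi[of a] by auto
    qed (use c t h g in simp_all)
  qed
  thus ?thesis using that[of c t] c t g by simp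
qed

text \<open>Universal quantification along \<open>g\<close> takes the place of a right adjoint to
  pullback. If \<open>x\<close> and \<open>y\<close> agree on \<open>p\<close>, let \<open>w\<close>
  be their equalizer. That the fibre of \<open>g\<close> over \<open>h\<close> lies in
  \<open>w\<close> is an equation \<open>c \<cdot> h = t \<cdot> h\<close>. It holds for
  \<open>h = e\<close>, because elements of that fibre come from the pullback; hence
  \<open>c = t\<close>, as \<open>e\<close> is epi. So it holds for \<open>h = g\<close> too, and
  the identity of \<open>Dom S g\<close> is an element of that fibre.\<close>

lemma epi_pullback:
  assumes "is_pullback S g e p q" "is_epi S e"
  shows "is_epi S p"
proof -
  note a = pullbackD[OF assms(1)]
  show ?thesis
  proof (rule epiI)
    show "p \<in> Arr S" by fact
    fix x y assume x: "x \<in> Arr S" "y \<in> Arr S" "Cod S x = Cod S y" "Dom S x = Cod S p" "Dom S y = Cod S p"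
      "x \<cdot> p = y \<cdot> p"
    obtain w where w: "is_mono S w" "Cod S w = Dom S x"
      "\<And>h. h \<in> Arr S \<Longrightarrow> Cod S h = Dom S x \<Longrightarrow> factors S h w \<longleftrightarrow> x \<cdot> h = y \<cdot> h"
      using equalizer[of x y] x by auto
    have wg: "Cod S w = Dom S g" using w x a by simp
    obtain c t where c: "c \<in> Arr S" "t \<in> Arr S" "Dom S c = Cod S g" "Dom S t = Cod S g" "Cod S t = Cod S c"
      "\<And>h. h \<in> Arr S \<Longrightarrow> Cod S h = Cod S g \<Longrightarrow>
        c \<cdot> h = t \<cdot> h \<longleftrightarrow> (\<forall>k j. k \<in> Arr S \<longrightarrow> j \<in> Arr S \<longrightarrow> Dom S k = Dom S j \<longrightarrow> Cod S k = Dom S h \<longrightarrow>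
         Cod S j = Dom S g \<longrightarrow> h \<cdot> k = g \<cdot> j \<longrightarrow> factors S j w)"
      using fibrewise_inclusion[OF a(1) w(1) wg] by blast
    have "factors S j w" if kj: "k \<in> Arr S" "j \<in> Arr S" "Dom S k = Dom S j" "Cod S k = Dom S e"
         "Cod S j = Dom S g" "e \<cdot> k = g \<cdot> j" for k j
    proof -
      obtain l where l: "l \<in> Arr S" "Cod S l = Dom S p" "p \<cdot> l = j"
        by (rule pullback_lift[OF assms(1), of j k]) (use kj in simp_all)
      have "factors S p w" using w(3)[of p] x a by simp
      thus ?thesis using factors_cmp[of p w l] l a w by simp
    qed
    hence "c \<cdot> e = t \<cdot> e" using c(6)[of e] a by simp
    hence "c = t" by (rule epiD[OF assms(2)]) (use c a in simp_all)
    hence "factors S (Idn S (Dom S g)) w" using c(6)[of g] a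
      by (metis cod_obj dom_obj idn_arr idn_cod idn_dom)
    thus "x = y" using w(3)[of "Idn S (Dom S g)"] x a by simp
  qed
qed

end

section \<open>Images\<close>

context topos_loc
begin

lemma preimage:
  assumes "f \<in> Arr S" "is_mono S u" "Cod S f = Cod S u"
  obtains v where "is_mono S v" "Cod S v = Dom S f"
    "\<And>h. h \<in> Arr S \<Longrightarrow> Cod S h = Dom S f \<Longrightarrow> factors S h v \<longleftrightarrow> factors S (f \<cdot> h) u"
proof -
  obtain p q where p: "is_pullback S f u p q"
    using pb_pullback[of f u] assms by auto
  show ?thesis
    by (rule that[of p]) (use pullback_mono[OF p] pullback_factors[OF p] pullbackD[OF p] assms in simp_all)
qed

text \<open>Universal quantification along the second projection: \<open>w\<close> is the locus
  where the classifying map of \<open>u\<close> agrees with that of the maximal relation.\<close>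

lemma forall_sub:
  assumes "X \<in> Obj S" "Y \<in> Obj S" "is_mono S u" "Cod S u = prd S X Y"
  obtains w where "is_mono S w" "Cod S w = Y"
    "\<And>y. y \<in> Arr S \<Longrightarrow> Cod S y = Y \<Longrightarrow> factors S y w \<longleftrightarrow>
      (\<forall>p a. p \<in> Arr S \<longrightarrow> a \<in> Arr S \<longrightarrow> Dom S a = Dom S p \<longrightarrow> Cod S p = Dom S y \<longrightarrow> Cod S a = X \<longrightarrow>
        factors S (tup S a (y \<cdot> p)) u)"
proof -
  let ?i = "Idn S (prd S X Y)"
  have i: "is_mono S ?i" "Cod S ?i = prd S X Y" using assms by simp_all
  obtain c where c: "c \<in> Arr S" "Dom S c = Y" "Cod S c = pow S X"
    "\<And>p a. p \<in> Arr S \<Longrightarrow> a \<in> Arr S \<Longrightarrow> Dom S a = Dom S p \<Longrightarrow> Cod S p = Y \<Longrightarrow> Cod S a = X \<Longrightarrow>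
      mb X a (c \<cdot> p) \<longleftrightarrow> factors S (tup S a p) u"
    using classify[OF assms] by blast
  obtain t where t: "t \<in> Arr S" "Dom S t = Y" "Cod S t = pow S X"
    "\<And>p a. p \<in> Arr S \<Longrightarrow> a \<in> Arr S \<Longrightarrow> Dom S a = Dom S p \<Longrightarrow> Cod S p = Y \<Longrightarrow> Cod S a = X \<Longrightarrow>
      mb X a (t \<cdot> p) \<longleftrightarrow> factors S (tup S a p) ?i"
    using classify[OF assms(1,2) i] by blast
  obtain w where w: "is_mono S w" "Cod S w = Y"
    "\<And>h. h \<in> Arr S \<Longrightarrow> Cod S h = Y \<Longrightarrow> factors S h w \<longleftrightarrow> c \<cdot> h = t \<cdot> h"
    using equalizer[of c t] c(1-3) t(1-3) by metis
  have fi: "factors S h ?i" if "h \<in> Arr S" "Cod S h = prd S X Y" for h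
    by (rule factorsI[of _ h]) (use that assms in simp_all)
  have "factors S y w \<longleftrightarrow>
      (\<forall>p a. p \<in> Arr S \<longrightarrow> a \<in> Arr S \<longrightarrow> Dom S a = Dom S p \<longrightarrow> Cod S p = Dom S y \<longrightarrow> Cod S a = X \<longrightarrow>
        factors S (tup S a (y \<cdot> p)) u)" (is "_ \<longleftrightarrow> ?R") if y: "y \<in> Arr S" "Cod S y = Y" for y
  proof
    assume "factors S y w"
    hence e: "c \<cdot> y = t \<cdot> y" using w(3)[OF y] by simp
    show ?R
    proof (intro allI impI)
      fix p a assume p: "p \<in> Arr S" "a \<in> Arr S" "Dom S a = Dom S p" "Cod S p = Dom S y" "Cod S a = X"
      have "c \<cdot> (y \<cdot> p) = t \<cdot> (y \<cdot> p)" by (rule cmp_extend[OF e]) (use c(1-3) t(1-3) p y in simp_all)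
      moreover have "mb X a (t \<cdot> (y \<cdot> p))" using t(4)[of "y \<cdot> p" a] fi[of "tup S a (y \<cdot> p)"] p y by simp
      ultimately show "factors S (tup S a (y \<cdot> p)) u" using c(4)[of "y \<cdot> p" a] p y by simp
    qed
  next
    assume R: ?R
    have "c \<cdot> y = t \<cdot> y"
    proof (rule pow_ext[of X])
      fix p a assume p: "p \<in> Arr S" "a \<in> Arr S" "Dom S a = Dom S p" "Cod S p = Dom S (c \<cdot> y)" "Cod S a = X"
      show "mb X a ((c \<cdot> y) \<cdot> p) \<longleftrightarrow> mb X a ((t \<cdot> y) \<cdot> p)"
        using R[rule_format, of p a] c(1-3) t(1-3) c(4)[of "y \<cdot> p" a] t(4)[of "y \<cdot> p" a] p y
          fi[of "tup S a (y \<cdot> p)"] by simp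
    qed (use c(1-3) t(1-3) y assms in simp_all)
    thus "factors S y w" using w(3)[OF y] by simp
  qed
  thus ?thesis using that[of w] w by blast
qed

text \<open>The intersection is formed internally: \<open>w\<close> consists of the elements of
  \<open>pow S B\<close> that contain every value of \<open>f\<close>, and \<open>i\<close> of the
  elements of \<open>B\<close> lying in every member of \<open>w\<close>. An external subobject
  \<open>z\<close> is compared with \<open>i\<close> by viewing it inside
  \<open>B \<times> 1\<close>, where its classifying map is a global element \<open>s\<close> of the
  power object.\<close>

lemma least_subobject_through:
  assumes f: "f \<in> Arr S" "Dom S f = A" "Cod S f = B"
  obtains i where "is_mono S i" "Cod S i = B" "factors S f i"
    "\<And>w. is_mono S w \<Longrightarrow> Cod S w = B \<Longrightarrow> factors S f w \<Longrightarrow> factors S i w"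
proof -
  have AB: "A \<in> Obj S" "B \<in> Obj S" using f by auto
  let ?P = "pow S B"
  let ?g = "tup S (f \<cdot> pr1 S A ?P) (pr2 S A ?P)"
  have g: "?g \<in> Arr S" "Dom S ?g = prd S A ?P" "Cod S ?g = prd S B ?P" using f AB by simp_all
  obtain u where u: "is_mono S u" "Cod S u = prd S A ?P"
    "\<And>h. h \<in> Arr S \<Longrightarrow> Cod S h = prd S A ?P \<Longrightarrow> factors S h u \<longleftrightarrow> factors S (?g \<cdot> h) (mem S B)"
    using preimage[of ?g "mem S B"] g AB by auto
  have um: "factors S (tup S a s) u \<longleftrightarrow> mb B (f \<cdot> a) s"
    if "a \<in> Arr S" "s \<in> Arr S" "Dom S a = Dom S s" "Cod S a = A" "Cod S s = ?P" for a s
    using u(3)[of "tup S a s"] that f AB by simp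
  obtain w where w: "is_mono S w" "Cod S w = ?P"
    "\<And>y. y \<in> Arr S \<Longrightarrow> Cod S y = ?P \<Longrightarrow> factors S y w \<longleftrightarrow>
      (\<forall>p a. p \<in> Arr S \<longrightarrow> a \<in> Arr S \<longrightarrow> Dom S a = Dom S p \<longrightarrow> Cod S p = Dom S y \<longrightarrow> Cod S a = A \<longrightarrow>
        factors S (tup S a (y \<cdot> p)) u)"
    using forall_sub[OF AB(1) _ u(1,2)] AB by auto
  define D where "D = Dom S w"
  have wD: "w \<in> Arr S" "Dom S w = D" "D \<in> Obj S" using w by (simp_all add: D_def)
  let ?k = "tup S (pr2 S D B) (w \<cdot> pr1 S D B)"
  have k: "?k \<in> Arr S" "Dom S ?k = prd S D B" "Cod S ?k = prd S B ?P" using wD AB w(2) by simp_all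
  obtain v where v: "is_mono S v" "Cod S v = prd S D B"
    "\<And>h. h \<in> Arr S \<Longrightarrow> Cod S h = prd S D B \<Longrightarrow> factors S h v \<longleftrightarrow> factors S (?k \<cdot> h) (mem S B)"
    using preimage[of ?k "mem S B"] k AB by auto
  have vm: "factors S (tup S d b) v \<longleftrightarrow> mb B b (w \<cdot> d)"
    if "d \<in> Arr S" "b \<in> Arr S" "Dom S d = Dom S b" "Cod S d = D" "Cod S b = B" for d b
    using v(3)[of "tup S d b"] that wD AB w(2) by simp
  obtain i where i: "is_mono S i" "Cod S i = B"
    "\<And>y. y \<in> Arr S \<Longrightarrow> Cod S y = B \<Longrightarrow> factors S y i \<longleftrightarrow>
      (\<forall>p a. p \<in> Arr S \<longrightarrow> a \<in> Arr S \<longrightarrow> Dom S a = Dom S p \<longrightarrow> Cod S p = Dom S y \<longrightarrow> Cod S a = D \<longrightarrow>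
        factors S (tup S a (y \<cdot> p)) v)"
    using forall_sub[OF wD(3) AB(2) v(1,2)] by auto
  have "factors S f i"
  proof (rule i(3)[THEN iffD2], intro f, intro f, intro allI impI)
    fix p d assume p: "p \<in> Arr S" "d \<in> Arr S" "Dom S d = Dom S p" "Cod S p = Dom S f" "Cod S d = D"
    have "factors S (w \<cdot> d) w" by (rule factorsI[of _ d]) (use p wD in simp_all)
    hence "factors S (tup S p ((w \<cdot> d) \<cdot> Idn S (Dom S p))) u"
      using w(3)[of "w \<cdot> d", THEN iffD1, rule_format, of "Idn S (Dom S p)" p] p wD w(2) f AB by simp
    hence "mb B (f \<cdot> p) (w \<cdot> d)" using um[of p "w \<cdot> d"] p wD w(2) f AB by simp
    thus "factors S (tup S d (f \<cdot> p)) v" using vm[of d "f \<cdot> p"] p f by simp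
  qed
  moreover have "factors S i z" if z: "is_mono S z" "Cod S z = B" "factors S f z" for z
  proof -
    have za: "z \<in> Arr S" using z by simp
    let ?z = "tup S z (bang S (Dom S z))"
    have zm: "is_mono S ?z" "Cod S ?z = prd S B (one S)"
      using z za by (auto intro!: tup_mono1)
    obtain s where s: "s \<in> Arr S" "Dom S s = one S" "Cod S s = pow S B"
      "\<And>p a. p \<in> Arr S \<Longrightarrow> a \<in> Arr S \<Longrightarrow> Dom S a = Dom S p \<Longrightarrow> Cod S p = one S \<Longrightarrow> Cod S a = B \<Longrightarrow>
        mb B a (s \<cdot> p) \<longleftrightarrow> factors S (tup S a p) ?z"
      using classify[OF AB(2) one_obj zm] by blast
    have sz: "mb B a (s \<cdot> p) \<longleftrightarrow> factors S a z"
      if p: "p \<in> Arr S" "a \<in> Arr S" "Dom S a = Dom S p" "Cod S p = one S" "Cod S a = B" for a p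
    proof
      assume "mb B a (s \<cdot> p)"
      hence "factors S (tup S a p) ?z" using s(4)[of p a] p by simp
      then obtain k where k: "k \<in> Arr S" "Dom S k = Dom S (tup S a p)" "Cod S k = Dom S ?z" "?z \<cdot> k = tup S a p"
        by (rule factorsE) (use za in simp)
      hence e: "tup S (z \<cdot> k) (bang S (Dom S k)) = tup S a p" using za by simp
      have "z \<cdot> k = a" using tup_inj[OF e] k(1-3) za p z(2) by simp
      thus "factors S a z" by (rule factorsI) (use k(1,3) za in simp_all)
    next
      assume "factors S a z"
      then obtain k where k: "k \<in> Arr S" "Dom S k = Dom S a" "Cod S k = Dom S z" "z \<cdot> k = a"
        by (rule factorsE) (use za in simp)
      have "bang S (Dom S k) = p" by (rule to_one) (use p k in simp_all)
      hence "?z \<cdot> k = tup S a p" using k(1,3,4) za by simp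
      hence "factors S (tup S a p) ?z" by (rule factorsI) (use k(1,3) za in simp_all)
      thus "mb B a (s \<cdot> p)" using s(4)[of p a] p by simp
    qed
    have "factors S s w"
    proof (rule w(3)[THEN iffD2], fact, fact, intro allI impI)
      fix p a assume p: "p \<in> Arr S" "a \<in> Arr S" "Dom S a = Dom S p" "Cod S p = Dom S s" "Cod S a = A"
      have "factors S (f \<cdot> a) z" using factors_cmp[OF z(3), of a] p f za by simp
      hence "mb B (f \<cdot> a) (s \<cdot> p)" using sz[of p "f \<cdot> a"] p f s(1-3) by simp
      thus "factors S (tup S a (s \<cdot> p)) u" using um[of a "s \<cdot> p"] p s(1-3) by simp
    qed
    then obtain d where d: "d \<in> Arr S" "Dom S d = Dom S s" "Cod S d = Dom S w" "w \<cdot> d = s"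
      by (rule factorsE) (rule wD)
    have ia: "i \<in> Arr S" using i by simp
    \<comment> \<open>The global element \<open>d\<close> of \<open>w\<close>, moved to the stage of
      \<open>i\<close>; the condition that defines \<open>i\<close> is instantiated at it.\<close>
    let ?d = "d \<cdot> bang S (Dom S i)"
    have "factors S i i" using ia by (rule factors_refl)
    hence "factors S (tup S ?d (i \<cdot> Idn S (Dom S i))) v"
      using i(3)[of i] ia i(2) d(1-3) s(2) wD(2)
      by (metis bang_arr bang_cod bang_dom cmp_arr cmp_cod cmp_dom dom_obj idn_arr idn_cod idn_dom)
    hence "mb B i (w \<cdot> ?d)"
      using vm[of ?d i] ia i(2) d(1-3) s(2) wD by simp
    moreover have "w \<cdot> ?d = s \<cdot> bang S (Dom S i)"
      by (rule cmp_extend1[OF d(4)]) (use d s ia wD in simp_all)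
    ultimately show "factors S i z" using sz[of "bang S (Dom S i)" i] ia i(2) by simp
  qed
  ultimately show ?thesis using that i by blast
qed

text \<open>If \<open>x\<close> and \<open>y\<close> agree on \<open>e\<close>, then
  \<open>e\<close> factors through their equalizer \<open>v\<close>, so \<open>f\<close> factors
  through \<open>i \<cdot> v\<close>. Since \<open>i\<close> is least, it factors through
  \<open>i \<cdot> v\<close> as well; thus the identity factors through \<open>v\<close>, which
  means \<open>x = y\<close>.\<close>

lemma image_factorization:
  assumes "f \<in> Arr S"
  obtains e i where "is_epi S e" "is_mono S i" "Cod S e = Dom S i" "Dom S e = Dom S f" "Cod S i = Cod S f" "i \<cdot> e = f"
proof -
  obtain i where i: "is_mono S i" "Cod S i = Cod S f" "factors S f i"
    "\<And>w. is_mono S w \<Longrightarrow> Cod S w = Cod S f \<Longrightarrow> factors S f w \<Longrightarrow> factors S i w"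
    using least_subobject_through[OF assms refl refl] by blast
  have ia: "i \<in> Arr S" using i by simp
  obtain e where e: "e \<in> Arr S" "Dom S e = Dom S f" "Cod S e = Dom S i" "i \<cdot> e = f"
    using i(3) ia by (rule factorsE)
  have "is_epi S e"
  proof (rule epiI)
    fix x y assume x: "x \<in> Arr S" "y \<in> Arr S" "Cod S x = Cod S y" "Dom S x = Cod S e" "Dom S y = Cod S e" "x \<cdot> e = y \<cdot> e"
    obtain v where v: "is_mono S v" "Cod S v = Dom S x"
      "\<And>h. h \<in> Arr S \<Longrightarrow> Cod S h = Dom S x \<Longrightarrow> factors S h v \<longleftrightarrow> x \<cdot> h = y \<cdot> h"
      using equalizer[of x y] x by auto
    have va: "v \<in> Arr S" "Cod S v = Dom S i" using v x e by simp_all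
    have "factors S e v" using v(3)[of e] e x by simp
    then obtain l where l: "l \<in> Arr S" "Dom S l = Dom S e" "Cod S l = Dom S v" "v \<cdot> l = e"
      using va(1) by (rule factorsE)
    have "(i \<cdot> v) \<cdot> l = f" using l(1,3,4) va ia e(4) by simp
    hence "factors S f (i \<cdot> v)" by (rule factorsI) (use l(1,3) va ia in simp_all)
    hence "factors S i (i \<cdot> v)"
      by (intro i(4) mono_cmp) (use v(1) i(1,2) va ia in simp_all)
    then obtain k where k: "k \<in> Arr S" "Dom S k = Dom S i" "Cod S k = Dom S (i \<cdot> v)" "(i \<cdot> v) \<cdot> k = i"
      by (rule factorsE) (use ia va in simp)
    have "v \<cdot> k = Idn S (Dom S i)"
      by (rule monoD[OF i(1)]) (use k va ia in simp_all)
    hence "factors S (Idn S (Dom S i)) v" by (rule factorsI) (use k(1,3) va ia in simp_all)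
    thus "x = y" using v(3)[of "Idn S (Dom S i)"] x e ia by simp
  qed (rule e)
  thus ?thesis using that i e by blast
qed

text \<open>\<open>imem m t p a\<close> says that locally \<open>a = t x\<close> for some \<open>x\<close> in the fibre of \<open>m\<close> over \<open>p\<close>;
  \<open>img m t\<close> is the corresponding family of subobjects of the codomain of \<open>t\<close>.\<close>

definition imem :: "'a \<Rightarrow> 'a \<Rightarrow> 'a \<Rightarrow> 'a \<Rightarrow> bool" where
  "imem m t p a \<longleftrightarrow> (\<exists>q x. is_epi S q \<and> x \<in> Arr S \<and> Cod S q = Dom S p \<and> Dom S x = Dom S q \<and>
     Cod S x = Dom S m \<and> m \<cdot> x = p \<cdot> q \<and> t \<cdot> x = a \<cdot> q)"

definition img :: "'a \<Rightarrow> 'a \<Rightarrow> 'a" where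
  "img m t = (SOME r. r \<in> Arr S \<and> Dom S r = Cod S m \<and> Cod S r = pow S (Cod S t) \<and>
     (\<forall>p a. p \<in> Arr S \<longrightarrow> a \<in> Arr S \<longrightarrow> Dom S a = Dom S p \<longrightarrow> Cod S p = Cod S m \<longrightarrow> Cod S a = Cod S t \<longrightarrow>
       (mb (Cod S t) a (r \<cdot> p) \<longleftrightarrow> imem m t p a)))"

lemma imemI:
  "is_epi S q \<Longrightarrow> x \<in> Arr S \<Longrightarrow> Cod S q = Dom S p \<Longrightarrow> Dom S x = Dom S q \<Longrightarrow>
     Cod S x = Dom S m \<Longrightarrow> m \<cdot> x = p \<cdot> q \<Longrightarrow> t \<cdot> x = a \<cdot> q \<Longrightarrow> imem m t p a"
  unfolding imem_def by blast

lemma imemE: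
  assumes "imem m t p a"
  obtains q x where "is_epi S q" "q \<in> Arr S" "x \<in> Arr S" "Cod S q = Dom S p" "Dom S x = Dom S q"
     "Cod S x = Dom S m" "m \<cdot> x = p \<cdot> q" "t \<cdot> x = a \<cdot> q"
  using assms epi_arr unfolding imem_def by blast

text \<open>The pair \<open>(t, m)\<close> is factored as an epi followed by a mono
  \<open>i\<close>, and the classifying map of \<open>i\<close> is the family. An element of
  \<open>i\<close> comes from the index object after pulling the epi back, which is again an epi;
  conversely factoring through \<open>i\<close> may be checked on a cover.\<close>

lemma img_exists:
  assumes "m \<in> Arr S" "t \<in> Arr S" "Dom S m = Dom S t"
  shows "\<exists>r. r \<in> Arr S \<and> Dom S r = Cod S m \<and> Cod S r = pow S (Cod S t) \<and>
     (\<forall>p a. p \<in> Arr S \<longrightarrow> a \<in> Arr S \<longrightarrow> Dom S a = Dom S p \<longrightarrow> Cod S p = Cod S m \<longrightarrow> Cod S a = Cod S t \<longrightarrow>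
       (mb (Cod S t) a (r \<cdot> p) \<longleftrightarrow> imem m t p a))"
proof -
  let ?f = "tup S t m"
  have f: "?f \<in> Arr S" "Dom S ?f = Dom S t" "Cod S ?f = prd S (Cod S t) (Cod S m)" using assms by simp_all
  obtain e i where ei: "is_epi S e" "is_mono S i" "Cod S e = Dom S i" "Dom S e = Dom S ?f" "Cod S i = Cod S ?f" "i \<cdot> e = ?f"
    using image_factorization[OF f(1)] by blast
  have a: "e \<in> Arr S" "i \<in> Arr S" using ei by simp_all
  have ic: "Cod S i = prd S (Cod S t) (Cod S m)" using ei f by simp
  obtain r where r: "r \<in> Arr S" "Dom S r = Cod S m" "Cod S r = pow S (Cod S t)"
    "\<And>p a. p \<in> Arr S \<Longrightarrow> a \<in> Arr S \<Longrightarrow> Dom S a = Dom S p \<Longrightarrow> Cod S p = Cod S m \<Longrightarrow> Cod S a = Cod S t \<Longrightarrow>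
      mb (Cod S t) a (r \<cdot> p) \<longleftrightarrow> factors S (tup S a p) i"
    using classify[OF _ _ ei(2) ic] assms by auto
  have "factors S (tup S a p) i \<longleftrightarrow> imem m t p a"
    if p: "p \<in> Arr S" "a \<in> Arr S" "Dom S a = Dom S p" "Cod S p = Cod S m" "Cod S a = Cod S t" for p a
  proof
    assume "factors S (tup S a p) i"
    then obtain k where k: "k \<in> Arr S" "Dom S k = Dom S (tup S a p)" "Cod S k = Dom S i" "i \<cdot> k = tup S a p"
      using a(2) by (rule factorsE)
    have kd: "Dom S k = Dom S p" using k(2) p by simp
    obtain q x where q: "is_pullback S k e q x" using pb_pullback[of k e] k(1,3) a ei(3) by auto
    note qD = pullbackD[OF q]
    have "?f \<cdot> x = tup S a p \<cdot> q"
    proof -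
      have "i \<cdot> (e \<cdot> x) = i \<cdot> (k \<cdot> q)" using qD(9) by simp
      moreover have "i \<cdot> (e \<cdot> x) = ?f \<cdot> x" by (rule cmp_extend1[OF ei(6)]) (use qD a ei(3) in simp_all)
      moreover have "i \<cdot> (k \<cdot> q) = tup S a p \<cdot> q" by (rule cmp_extend1[OF k(4)]) (use qD a k(1,3) in simp_all)
      ultimately show ?thesis by metis
    qed
    hence e: "tup S (t \<cdot> x) (m \<cdot> x) = tup S (a \<cdot> q) (p \<cdot> q)"
      using qD assms p kd ei(4) by simp
    have "t \<cdot> x = a \<cdot> q \<and> m \<cdot> x = p \<cdot> q"
      by (rule tup_inj[OF e]) (use qD assms p kd ei(4) in simp_all)
    thus "imem m t p a"
      by (intro imemI[of q x]) (use qD assms kd ei(4) epi_pullback[OF q ei(1)] in simp_all)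
  next
    assume "imem m t p a"
    then obtain q x where q: "is_epi S q" "q \<in> Arr S" "x \<in> Arr S" "Cod S q = Dom S p" "Dom S x = Dom S q"
     "Cod S x = Dom S m" "m \<cdot> x = p \<cdot> q" "t \<cdot> x = a \<cdot> q" by (rule imemE)
    have "i \<cdot> (e \<cdot> x) = ?f \<cdot> x"
      by (rule cmp_extend1[OF ei(6)]) (use q(2-6) a ei(3,4) assms in simp_all)
    also have "\<dots> = tup S a p \<cdot> q" using q(2-8) assms p by simp
    finally have "factors S (tup S a p \<cdot> q) i"
      by (rule factorsI) (use q(2-6) a ei(3,4) assms in simp_all)
    thus "factors S (tup S a p) i"
      by (rule epi_factors_mono[OF q(1) ei(2)]) (use q(4) p ic in simp_all)
  qed
  thus ?thesis using r by blast
qed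

lemma img_simps [simp]:
  assumes "m \<in> Arr S" "t \<in> Arr S" "Dom S m = Dom S t"
  shows "img m t \<in> Arr S" "Dom S (img m t) = Cod S m" "Cod S (img m t) = pow S (Cod S t)"
  using someI_ex[OF img_exists[OF assms]] unfolding img_def[symmetric] by blast+

lemma mb_img:
  assumes "m \<in> Arr S" "t \<in> Arr S" "Dom S m = Dom S t"
    "p \<in> Arr S" "a \<in> Arr S" "Dom S a = Dom S p" "Cod S p = Cod S m" "Cod S a = Cod S t" "X = Cod S t"
  shows "mb X a (img m t \<cdot> p) \<longleftrightarrow> imem m t p a"
  using someI_ex[OF img_exists[OF assms(1-3)]] assms(4-) unfolding img_def[symmetric] by blast

lemma img_eqI:
  assumes "m \<in> Arr S" "t \<in> Arr S" "Dom S m = Dom S t" "r \<in> Arr S" "Dom S r = Cod S m" "Cod S r = pow S (Cod S t)"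
    and "\<And>p a. p \<in> Arr S \<Longrightarrow> a \<in> Arr S \<Longrightarrow> Dom S a = Dom S p \<Longrightarrow> Cod S p = Cod S m \<Longrightarrow> Cod S a = Cod S t \<Longrightarrow>
      mb (Cod S t) a (r \<cdot> p) \<longleftrightarrow> imem m t p a"
  shows "r = img m t"
proof (rule pow_ext[of "Cod S t"])
  fix p a assume "p \<in> Arr S" "a \<in> Arr S" "Dom S a = Dom S p" "Cod S p = Dom S r" "Cod S a = Cod S t"
  thus "mb (Cod S t) a (r \<cdot> p) \<longleftrightarrow> mb (Cod S t) a (img m t \<cdot> p)"
    using assms(7)[of p a] mb_img[OF assms(1-3), of p a] assms(5) by simp
qed (use assms(1-6) in simp_all)

lemma imem_self:
  assumes "m \<in> Arr S" "t \<in> Arr S" "Dom S m = Dom S t"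
  shows "imem m t m t"
  by (rule imemI[of "Idn S (Dom S m)" "Idn S (Dom S m)"]) (use assms in simp_all)

text \<open>Deduced from stability of membership under composition, which avoids pulling back the
  cover by hand.\<close>

lemma imem_cmp:
  assumes "imem m t p a" "m \<in> Arr S" "t \<in> Arr S" "Dom S m = Dom S t" "p \<in> Arr S" "a \<in> Arr S"
    "Dom S a = Dom S p" "Cod S p = Cod S m" "Cod S a = Cod S t" "k \<in> Arr S" "Cod S k = Dom S p"
  shows "imem m t (p \<cdot> k) (a \<cdot> k)"
proof -
  have "mb (Cod S t) (a \<cdot> k) ((img m t \<cdot> p) \<cdot> k)"
    by (rule mb_cmp) (use mb_img[OF assms(2-9) refl] assms in simp_all)
  thus ?thesis using mb_img[OF assms(2-4), of "p \<cdot> k" "a \<cdot> k"] assms(2-) by simp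
qed

text \<open>The index object is the extension of \<open>r\<close>, that is, membership pulled back
  along \<open>X \<times> r\<close>, and its two projections serve as \<open>t\<close> and
  \<open>m\<close>. This allows every generalized element of a power object to be treated as a
  family of the form \<open>img m t\<close>.\<close>

lemma pow_is_img:
  assumes "X \<in> Obj S" "r \<in> Arr S" "Cod S r = pow S X"
  obtains m t where "m \<in> Arr S" "t \<in> Arr S" "Dom S m = Dom S t" "Cod S t = X" "Cod S m = Dom S r" "r = img m t"
proof -
  define I where "I = Dom S r"
  have I: "I \<in> Obj S" "Dom S r = I" using assms by (simp_all add: I_def)
  let ?g = "tup S (pr1 S X I) (r \<cdot> pr2 S X I)"
  obtain u where u: "is_mono S u" "Cod S u = prd S X I"
    "\<And>h. h \<in> Arr S \<Longrightarrow> Cod S h = prd S X I \<Longrightarrow> factors S h u \<longleftrightarrow> factors S (?g \<cdot> h) (mem S X)"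
    using preimage[of ?g "mem S X"] assms I by auto
  have ua: "u \<in> Arr S" using u by simp
  let ?m = "pr2 S X I \<cdot> u" and ?t = "pr1 S X I \<cdot> u"
  have mt: "?m \<in> Arr S" "?t \<in> Arr S" "Dom S ?m = Dom S ?t" "Cod S ?t = X" "Cod S ?m = Dom S r"
    using ua u(2) assms I by simp_all
  have ut: "tup S ?t ?m = u" by (rule tup_eta) (use u ua assms I in simp_all)
  have "r = img ?m ?t"
  proof (rule img_eqI)
    fix p a assume p: "p \<in> Arr S" "a \<in> Arr S" "Dom S a = Dom S p" "Cod S p = Cod S ?m" "Cod S a = Cod S ?t"
    have pI: "Cod S p = I" "Cod S a = X" using p mt I by simp_all
    have fu: "factors S (tup S a p) u \<longleftrightarrow> mb X a (r \<cdot> p)"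
      using u(3)[of "tup S a p"] p(1-3) pI assms I by simp
    have "factors S (tup S a p) u \<longleftrightarrow> imem ?m ?t p a"
    proof
      assume "factors S (tup S a p) u"
      then obtain k where k: "k \<in> Arr S" "Dom S k = Dom S (tup S a p)" "Cod S k = Dom S u" "u \<cdot> k = tup S a p"
        using ua by (rule factorsE)
      have "?t \<cdot> k = a" "?m \<cdot> k = p"
        using k ua u(2) p(1-3) pI assms I by simp_all
      thus "imem ?m ?t p a"
        by (intro imemI[of "Idn S (Dom S p)" k]) (use k(1-3) p mt ua u(2) assms I in simp_all)
    next
      assume "imem ?m ?t p a"
      then obtain q x where q: "is_epi S q" "q \<in> Arr S" "x \<in> Arr S" "Cod S q = Dom S p" "Dom S x = Dom S q"
       "Cod S x = Dom S ?m" "?m \<cdot> x = p \<cdot> q" "?t \<cdot> x = a \<cdot> q" by (rule imemE)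
      have xu: "Cod S x = Dom S u" using q(6) ua u(2) assms I by simp
      have "u \<cdot> x = tup S ?t ?m \<cdot> x" using ut by simp
      also have "\<dots> = tup S (?t \<cdot> x) (?m \<cdot> x)" by (rule tup_cmp) (use q(3,6) mt in simp_all)
      also have "\<dots> = tup S a p \<cdot> q" unfolding q(7,8) using q(2,4) p by simp
      finally have "factors S (tup S a p \<cdot> q) u" by (rule factorsI) (use q(3) xu ua in simp_all)
      thus "factors S (tup S a p) u"
        by (rule epi_factors_mono[OF q(1) u(1)]) (use q(4) p(1-3) pI u(2) in simp_all)
    qed
    thus "mb (Cod S ?t) a (r \<cdot> p) \<longleftrightarrow> imem ?m ?t p a" using fu mt(4) by simp
  qed (use mt assms in simp_all)
  thus ?thesis using that mt by blast
qed

text \<open>Beck-Chevalley for images: by the pullback property, the fibre of \<open>m\<close> over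
  \<open>v \<cdot> p\<close> is the fibre of \<open>n\<close> over \<open>p\<close>.\<close>

lemma img_cmp:
  assumes "m \<in> Arr S" "t \<in> Arr S" "Dom S m = Dom S t" "is_pullback S v m n k"
  shows "img m t \<cdot> v = img n (t \<cdot> k)"
proof -
  note a = pullbackD[OF assms(4)]
  show ?thesis
  proof (rule img_eqI)
    fix p b assume p: "p \<in> Arr S" "b \<in> Arr S" "Dom S b = Dom S p" "Cod S p = Cod S n" "Cod S b = Cod S (t \<cdot> k)"
    have "mb (Cod S t) b (img m t \<cdot> (v \<cdot> p)) \<longleftrightarrow> imem m t (v \<cdot> p) b"
      by (rule mb_img) (use assms(1-3) a p in simp_all)
    also have "\<dots> \<longleftrightarrow> imem n (t \<cdot> k) p b"
    proof
      assume "imem m t (v \<cdot> p) b"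
      then obtain q x where q: "is_epi S q" "q \<in> Arr S" "x \<in> Arr S" "Cod S q = Dom S (v \<cdot> p)" "Dom S x = Dom S q"
       "Cod S x = Dom S m" "m \<cdot> x = (v \<cdot> p) \<cdot> q" "t \<cdot> x = b \<cdot> q" by (rule imemE)
      have qp: "Cod S q = Dom S p" using q(4) p a by simp
      obtain y where y: "y \<in> Arr S" "Dom S y = Dom S (p \<cdot> q)" "Cod S y = Dom S n" "n \<cdot> y = p \<cdot> q" "k \<cdot> y = x"
        by (rule pullback_lift[OF assms(4), of "p \<cdot> q" x]) (use q(2,3,5,6,7) qp p a in simp_all)
      have "t \<cdot> (k \<cdot> y) = b \<cdot> q" using y(5) q(8) by simp
      thus "imem n (t \<cdot> k) p b"
        by (intro imemI[of q y]) (use q(1,2) qp y(1-4) p a assms(1-3) in simp_all)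
    next
      assume "imem n (t \<cdot> k) p b"
      then obtain q x where q: "is_epi S q" "q \<in> Arr S" "x \<in> Arr S" "Cod S q = Dom S p" "Dom S x = Dom S q"
       "Cod S x = Dom S n" "n \<cdot> x = p \<cdot> q" "(t \<cdot> k) \<cdot> x = b \<cdot> q" by (rule imemE)
      have "m \<cdot> (k \<cdot> x) = v \<cdot> (n \<cdot> x)"
        by (rule cmp_extend) (use q(3,6) a assms in simp_all)
      also have "\<dots> = (v \<cdot> p) \<cdot> q" unfolding q(7) using q(2,4) p a by simp
      finally show "imem m t (v \<cdot> p) b"
        by (intro imemI[of q "k \<cdot> x"]) (use q(1-6,8) a p assms(1-3) in simp_all)
    qed
    finally show "mb (Cod S (t \<cdot> k)) b ((img m t \<cdot> v) \<cdot> p) \<longleftrightarrow> imem n (t \<cdot> k) p b"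
      using assms(1-3) a p by simp
  qed (use assms(1-3) a in simp_all)
qed

text \<open>Membership in an image means local existence of an index, so replacing the index object
  by a cover changes nothing.\<close>

lemma img_epi:
  assumes "m \<in> Arr S" "t \<in> Arr S" "Dom S m = Dom S t" "is_epi S e" "Cod S e = Dom S m"
  shows "img (m \<cdot> e) (t \<cdot> e) = img m t"
proof -
  have e: "e \<in> Arr S" using assms by simp
  have "img m t = img (m \<cdot> e) (t \<cdot> e)"
  proof (rule img_eqI)
    fix p b assume p: "p \<in> Arr S" "b \<in> Arr S" "Dom S b = Dom S p" "Cod S p = Cod S (m \<cdot> e)" "Cod S b = Cod S (t \<cdot> e)"
    have pc: "Cod S p = Cod S m" "Cod S b = Cod S t" using p assms e by simp_all
    have "mb (Cod S t) b (img m t \<cdot> p) \<longleftrightarrow> imem m t p b"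
      by (rule mb_img) (use assms p(1-3) pc in simp_all)
    also have "\<dots> \<longleftrightarrow> imem (m \<cdot> e) (t \<cdot> e) p b"
    proof
      assume "imem m t p b"
      then obtain q x where q: "is_epi S q" "q \<in> Arr S" "x \<in> Arr S" "Cod S q = Dom S p" "Dom S x = Dom S q"
       "Cod S x = Dom S m" "m \<cdot> x = p \<cdot> q" "t \<cdot> x = b \<cdot> q" by (rule imemE)
      obtain q' y where y: "is_pullback S x e q' y" using pb_pullback[of x e] q(3,6) e assms by auto
      note yD = pullbackD[OF y]
      have "m \<cdot> (e \<cdot> y) = m \<cdot> (x \<cdot> q')" using yD(9) by simp
      also have "\<dots> = (p \<cdot> q) \<cdot> q'" by (rule cmp_extend1[OF q(7)]) (use q(3,6) yD assms in simp_all)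
      finally have 1: "(m \<cdot> e) \<cdot> y = p \<cdot> (q \<cdot> q')" using yD assms e q(2-6) p by simp
      have "t \<cdot> (e \<cdot> y) = t \<cdot> (x \<cdot> q')" using yD(9) by simp
      also have "\<dots> = (b \<cdot> q) \<cdot> q'" by (rule cmp_extend1[OF q(8)]) (use q(3,6) yD assms in simp_all)
      finally have 2: "(t \<cdot> e) \<cdot> y = b \<cdot> (q \<cdot> q')" using yD assms e q(2-6) p by simp
      have 3: "is_epi S (q \<cdot> q')" by (rule epi_cmp[OF epi_pullback[OF y assms(4)] q(1)]) (use yD q(5) in simp)
      show "imem (m \<cdot> e) (t \<cdot> e) p b"
        by (rule imemI[OF 3 _ _ _ _ 1 2]) (use yD q(2-6) assms(1-3,5) e in simp_all)
    next
      assume "imem (m \<cdot> e) (t \<cdot> e) p b"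
      then obtain q x where q: "is_epi S q" "q \<in> Arr S" "x \<in> Arr S" "Cod S q = Dom S p" "Dom S x = Dom S q"
       "Cod S x = Dom S (m \<cdot> e)" "(m \<cdot> e) \<cdot> x = p \<cdot> q" "(t \<cdot> e) \<cdot> x = b \<cdot> q" by (rule imemE)
      show "imem m t p b"
        by (rule imemI[of q "e \<cdot> x"]) (use q e assms in simp_all)
    qed
    finally show "mb (Cod S (t \<cdot> e)) b (img m t \<cdot> p) \<longleftrightarrow> imem (m \<cdot> e) (t \<cdot> e) p b"
      using assms e by simp
  qed (use assms e in simp_all)
  thus ?thesis by simp
qed

end

section \<open>The internal language\<close>

declare eval_tm.simps(4) [simp del]

lemma restrict_env_apply [simp]: "restrict_env S env p x = Cmp S (env x) p"
  by (simp add: restrict_env_def)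

lemma homD:
  assumes "f \<in> hom S X Y"
  shows "f \<in> Arr S" "Dom S f = X" "Cod S f = Y"
  using assms by (simp_all add: hom_def)

context topos_loc
begin

text \<open>The \<open>THE\<close> in the semantics of a comprehension is resolved by extensionality
  of power objects: it is enough to guess the family and to check that the formula is forced exactly
  where an index exists locally. The change of stage \<open>c\<close> is for formulas with a free
  variable, such as \<open>l\<close> in the order of \<open>ufam\<close>.\<close>

lemma eval_img:
  assumes mt: "m \<in> Arr S" "t \<in> Arr S" "Dom S m = Dom S t" and c: "c \<in> Arr S" "Cod S c = Cod S m"
    and I: "Dom S c = I" and X: "X = Cod S t"
    and P: "\<And>p a. p \<in> Arr S \<Longrightarrow> a \<in> Arr S \<Longrightarrow> Dom S a = Dom S p \<Longrightarrow> Cod S p = I \<Longrightarrow> Cod S a = X \<Longrightarrow>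
      forces S P (Dom S p) ((restrict_env S env p)(x := a)) \<longleftrightarrow> imem m t (c \<cdot> p) a"
  shows "eval_tm S \<lbrace>x \<^bold>: X | P\<rbrace> I env = img m t \<cdot> c"
  unfolding eval_tm.simps(4)
proof (rule the_equality)
  have XO: "X \<in> Obj S" using mt X by simp
  have e: "mb X a ((img m t \<cdot> c) \<cdot> p) \<longleftrightarrow> forces S P (Dom S p) ((restrict_env S env p)(x := a))"
    if p: "p \<in> Arr S" "a \<in> Arr S" "Dom S a = Dom S p" "Cod S p = I" "Cod S a = X" for p a
    using P[OF p] mb_img[OF mt, of "c \<cdot> p" a X] mt c I X p by simp
  show 1: "img m t \<cdot> c \<in> hom S I (pow S X) \<and>
        (\<forall>J\<in>Obj S. \<forall>p\<in>hom S J I. \<forall>a\<in>hom S J X.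
           mb X a ((img m t \<cdot> c) \<cdot> p) \<longleftrightarrow> forces S P J ((restrict_env S env p)(x := a)))"
    using e mt c I X by (simp add: hom_def)
  fix r assume r: "r \<in> hom S I (pow S X) \<and>
        (\<forall>J\<in>Obj S. \<forall>p\<in>hom S J I. \<forall>a\<in>hom S J X.
           mb X a (r \<cdot> p) \<longleftrightarrow> forces S P J ((restrict_env S env p)(x := a)))"
  show "r = img m t \<cdot> c"
  proof (rule pow_ext[OF XO])
    fix p a assume p: "p \<in> Arr S" "a \<in> Arr S" "Dom S a = Dom S p" "Cod S p = Dom S r" "Cod S a = X"
    have pI: "Cod S p = I" using r p by (simp add: hom_def)
    have "mb X a (r \<cdot> p) \<longleftrightarrow> forces S P (Dom S p) ((restrict_env S env p)(x := a))"
      using r p(1-3,5) pI by (simp add: hom_def)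
    thus "mb X a (r \<cdot> p) \<longleftrightarrow> mb X a ((img m t \<cdot> c) \<cdot> p)" using e[OF p(1-3) pI p(5)] by simp
  qed (use r mt c I X in \<open>simp_all add: hom_def\<close>)
qed

lemma eval_img_idn:
  assumes mt: "m \<in> Arr S" "t \<in> Arr S" "Dom S m = Dom S t" and I: "Cod S m = I" and X: "X = Cod S t"
    and P: "\<And>p a. p \<in> Arr S \<Longrightarrow> a \<in> Arr S \<Longrightarrow> Dom S a = Dom S p \<Longrightarrow> Cod S p = I \<Longrightarrow> Cod S a = X \<Longrightarrow>
      forces S P (Dom S p) ((restrict_env S env p)(x := a)) \<longleftrightarrow> imem m t p a"
  shows "eval_tm S \<lbrace>x \<^bold>: X | P\<rbrace> I env = img m t"
proof -
  have "eval_tm S \<lbrace>x \<^bold>: X | P\<rbrace> I env = img m t \<cdot> Idn S I"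
    by (rule eval_img) (use assms in auto)
  thus ?thesis using mt I by simp
qed

text \<open>\<open>holds\<close> starts from an unspecified environment, and restriction composes
  its values with arrows, so apart from the bound variable nothing is known about the environment
  reached. The rules below therefore produce some environment when eliminating and treat all of them
  when introducing.\<close>

lemma holds_forall1D:
  assumes "holds S (\<^bold>\<forall>x \<^bold>: X \<^bold>. P)" "r \<in> Arr S" "Cod S r = X"
  shows "\<exists>env. env x = r \<and> forces S P (Dom S r) env"
proof -
  have "bang S (Dom S r) \<in> hom S (Dom S r) (one S)" "r \<in> hom S (Dom S r) X"
    using assms by (simp_all add: hom_def)
  hence "forces S P (Dom S r) ((restrict_env S (\<lambda>_. undefined) (bang S (Dom S r)))(x := r))"
    using assms unfolding holds_def forces.simps by (meson dom_obj)
  thus ?thesis by (metis fun_upd_same)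
qed

lemma holds_forall1I:
  assumes "\<And>I env. env x \<in> hom S I X \<Longrightarrow> forces S P I env"
  shows "holds S (\<^bold>\<forall>x \<^bold>: X \<^bold>. P)"
  unfolding holds_def forces.simps
  by (intro ballI assms) simp

text \<open>Of the later stages over which an implication quantifies, the identity is the one
  needed. Composition with it is not known to fix the unspecified values of \<open>env\<close>,
  hence the restricted environment stays in the statement.\<close>

lemma forces_implies_idn:
  assumes "forces S (P \<^bold>\<longrightarrow> Q) I env" "I \<in> Obj S"
    "forces S P I (restrict_env S env (Idn S I))"
  shows "forces S Q I (restrict_env S env (Idn S I))"
proof -
  have "Idn S I \<in> hom S I I" using assms(2) by (simp add: hom_def)
  thus ?thesis using assms unfolding forces.simps by blast
qed

lemma holds_forall2D:
  assumes "holds S (\<^bold>\<forall>x \<^bold>: X \<^bold>. \<^bold>\<forall>y \<^bold>: Y \<^bold>. P \<^bold>\<longrightarrow> Q)" "x \<noteq> y" "r \<in> Arr S" "Cod S r = X" "s \<in> Arr S" "Cod S s = Y" "Dom S s = Dom S r"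
  shows "\<exists>env. env x = r \<and> env y = s \<and> (forces S P (Dom S r) env \<longrightarrow> forces S Q (Dom S r) env)"
proof -
  obtain env where e: "env x = r" "forces S (\<^bold>\<forall>y \<^bold>: Y \<^bold>. P \<^bold>\<longrightarrow> Q) (Dom S r) env"
    using holds_forall1D[OF assms(1,3,4)] by blast
  have "Idn S (Dom S r) \<in> hom S (Dom S r) (Dom S r)" "s \<in> hom S (Dom S r) Y"
    using assms by (simp_all add: hom_def)
  hence f: "forces S (P \<^bold>\<longrightarrow> Q) (Dom S r) ((restrict_env S env (Idn S (Dom S r)))(y := s))"
    using e(2) assms(3) unfolding forces.simps(5) by (meson dom_obj forces.simps(5))
  let ?e = "restrict_env S ((restrict_env S env (Idn S (Dom S r)))(y := s)) (Idn S (Dom S r))"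
  have "?e x = r" "?e y = s" using assms e by simp_all
  thus ?thesis using forces_implies_idn[OF f] assms(3) by (intro exI[of _ ?e]) auto
qed

lemma holds_forall2I:
  assumes "\<And>I env. env x \<in> hom S I X \<Longrightarrow> env y \<in> hom S I Y \<Longrightarrow> forces S P I env \<Longrightarrow> forces S Q I env" "x \<noteq> y"
  shows "holds S (\<^bold>\<forall>x \<^bold>: X \<^bold>. \<^bold>\<forall>y \<^bold>: Y \<^bold>. P \<^bold>\<longrightarrow> Q)"
proof (rule holds_forall1I)
  fix I env assume e: "env x \<in> hom S I X"
  show "forces S (\<^bold>\<forall>y \<^bold>: Y \<^bold>. P \<^bold>\<longrightarrow> Q) I env"
    unfolding forces.simps
  proof (intro ballI impI)
    fix J p s K q
    assume h: "J \<in> Obj S" "p \<in> hom S J I" "s \<in> hom S J Y" "K \<in> Obj S" "q \<in> hom S K J"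
      "forces S P K (restrict_env S ((restrict_env S env p)(y := s)) q)"
    show "forces S Q K (restrict_env S ((restrict_env S env p)(y := s)) q)"
      by (rule assms(1)) (use h e assms(2) in \<open>simp_all add: hom_def\<close>)
  qed
qed

lemma holds_forall1_impD:
  assumes "holds S (\<^bold>\<forall>x \<^bold>: X \<^bold>. P \<^bold>\<longrightarrow> Q)" "r \<in> Arr S" "Cod S r = X"
  shows "\<exists>env. env x = r \<and> (forces S P (Dom S r) env \<longrightarrow> forces S Q (Dom S r) env)"
proof -
  obtain env where e: "env x = r" "forces S (P \<^bold>\<longrightarrow> Q) (Dom S r) env"
    using holds_forall1D[OF assms] by blast
  let ?e = "restrict_env S env (Idn S (Dom S r))"
  have "?e x = r" using assms e by simp
  thus ?thesis using forces_implies_idn[OF e(2)] assms(2) by (intro exI[of _ ?e]) auto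
qed

lemma holds_forall1_impI:
  assumes "\<And>I env. env x \<in> hom S I X \<Longrightarrow> forces S P I env \<Longrightarrow> forces S Q I env"
  shows "holds S (\<^bold>\<forall>x \<^bold>: X \<^bold>. P \<^bold>\<longrightarrow> Q)"
proof (rule holds_forall1I)
  fix I env assume e: "env x \<in> hom S I X"
  show "forces S (P \<^bold>\<longrightarrow> Q) I env"
    unfolding forces.simps
  proof (intro ballI impI)
    fix K q
    assume h: "K \<in> Obj S" "q \<in> hom S K I" "forces S P K (restrict_env S env q)"
    show "forces S Q K (restrict_env S env q)"
      by (rule assms(1)) (use h e in \<open>simp_all add: hom_def\<close>)
  qed
qed

text \<open>The stages introduced by the quantifier and by the implication collapse into one. The
  conditions on names prevent capture by the bound variable of \<open>Subset\<close>.\<close>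

lemma forces_Subset:
  assumes "env y \<in> hom S I (pow S X)" "env x \<in> hom S I (pow S X)" "X \<in> Obj S" "x \<noteq> ''z''" "y \<noteq> ''z''"
  shows "forces S (Subset S X (Var y) (Var x)) I env \<longleftrightarrow>
    (\<forall>p a. p \<in> Arr S \<longrightarrow> a \<in> Arr S \<longrightarrow> Dom S a = Dom S p \<longrightarrow> Cod S p = I \<longrightarrow> Cod S a = X \<longrightarrow>
       mb X a (env y \<cdot> p) \<longrightarrow> mb X a (env x \<cdot> p))" (is "?L \<longleftrightarrow> ?R")
proof
  assume L: ?L
  show ?R
  proof (intro allI impI)
    fix p a assume p: "p \<in> Arr S" "a \<in> Arr S" "Dom S a = Dom S p" "Cod S p = I" "Cod S a = X" "mb X a (env y \<cdot> p)"
    let ?J = "Dom S p"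
    have "?J \<in> Obj S" "p \<in> hom S ?J I" "a \<in> hom S ?J X" "Idn S ?J \<in> hom S ?J ?J" using p by (simp_all add: hom_def)
    moreover from L have "\<forall>J\<in>Obj S. \<forall>p\<in>hom S J I. \<forall>a\<in>hom S J X. \<forall>K\<in>Obj S. \<forall>q\<in>hom S K J.
       mb X (a \<cdot> q) ((env y \<cdot> p) \<cdot> q) \<longrightarrow> mb X (a \<cdot> q) ((env x \<cdot> p) \<cdot> q)"
      using assms unfolding Subset_def In_rel_def by simp
    ultimately have "mb X (a \<cdot> Idn S ?J) ((env y \<cdot> p) \<cdot> Idn S ?J) \<longrightarrow> mb X (a \<cdot> Idn S ?J) ((env x \<cdot> p) \<cdot> Idn S ?J)"
      by blast
    thus "mb X a (env x \<cdot> p)" using p homD[OF assms(1)] homD[OF assms(2)] by simp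
  qed
next
  assume R: ?R
  have "\<forall>J\<in>Obj S. \<forall>p\<in>hom S J I. \<forall>a\<in>hom S J X. \<forall>K\<in>Obj S. \<forall>q\<in>hom S K J.
       mb X (a \<cdot> q) ((env y \<cdot> p) \<cdot> q) \<longrightarrow> mb X (a \<cdot> q) ((env x \<cdot> p) \<cdot> q)"
  proof (intro ballI impI)
    fix J p a K q assume h: "p \<in> hom S J I" "a \<in> hom S J X" "q \<in> hom S K J" "mb X (a \<cdot> q) ((env y \<cdot> p) \<cdot> q)"
    note p = homD[OF h(1)] homD[OF h(2)] homD[OF h(3)] homD[OF assms(1)] homD[OF assms(2)]
    show "mb X (a \<cdot> q) ((env x \<cdot> p) \<cdot> q)"
      using R[rule_format, of "p \<cdot> q" "a \<cdot> q"] h(4) p by simp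
  qed
  thus ?L using assms unfolding Subset_def In_rel_def by simp
qed

section \<open>The notions of a uniform preorder evaluated on families of pairs\<close>

definition rel :: "'a \<Rightarrow> 'a \<Rightarrow> 'a \<Rightarrow> 'a \<Rightarrow> bool" where
  "rel R m f g \<longleftrightarrow> factors S (img m (tup S f g)) R"

lemma ufam_simps [simp]:
  "Preds (ufam S (A, R)) m = hom S (Dom S m) A"
  "Rdx (ufam S (A, R)) (m, m', u, v) f = f \<cdot> u"
  by (simp_all add: ufam_def)

text \<open>Truth for all \<open>l\<close> amounts to truth for the generic element, the identity of
  \<open>Cod S m\<close>, where the comprehension denotes \<open>img m (tup S f g)\<close>
  itself.\<close>

lemma ufam_Le:
  assumes m: "m \<in> Arr S" and f: "f \<in> hom S (Dom S m) A" and g: "g \<in> hom S (Dom S m) A"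
    and R: "is_mono S R" "Cod S R = pow S (prd S A A)"
  shows "Le (ufam S (A, R)) m f g \<longleftrightarrow> rel R m f g"
proof -
  let ?t = "tup S f g"
  note fg = homD[OF f] homD[OF g]
  have Ra: "R \<in> Arr S" using R by simp
  have t: "?t \<in> Arr S" "Dom S ?t = Dom S m" "Cod S ?t = prd S A A" using fg by simp_all
  let ?P = "\<^bold>\<exists>''x'' \<^bold>: Dom S m \<^bold>. Fn m (Var ''x'') \<^bold>= Var ''l'' \<^bold>\<and>
               Var ''z'' \<^bold>= Tup (Fn f (Var ''x'')) (Fn g (Var ''x''))"
  have ev: "eval_tm S \<lbrace>''z'' \<^bold>: prd S A A | ?P\<rbrace> I env = img m ?t \<cdot> env ''l''"
    if env: "env ''l'' \<in> hom S I (Cod S m)" for I env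
  proof (rule eval_img)
    note l = homD[OF env]
    fix p a assume p: "p \<in> Arr S" "a \<in> Arr S" "Dom S a = Dom S p" "Cod S p = I" "Cod S a = prd S A A"
    have "forces S ?P (Dom S p) ((restrict_env S env p)(''z'' := a)) \<longleftrightarrow>
      (\<exists>J\<in>Obj S. \<exists>q\<in>hom S J (Dom S p). is_epi S q \<and> (\<exists>x\<in>hom S J (Dom S m).
         m \<cdot> x = (env ''l'' \<cdot> p) \<cdot> q \<and> a \<cdot> q = tup S (f \<cdot> x) (g \<cdot> x)))" (is "_ \<longleftrightarrow> ?R")
      by simp
    also have "?R \<longleftrightarrow> imem m ?t (env ''l'' \<cdot> p) a"
    proof
      assume ?R
      then obtain J q x where h: "q\<in>hom S J (Dom S p)" "is_epi S q" "x\<in>hom S J (Dom S m)"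
         "m \<cdot> x = (env ''l'' \<cdot> p) \<cdot> q" "a \<cdot> q = tup S (f \<cdot> x) (g \<cdot> x)" by blast
      note q = homD[OF h(1)] homD[OF h(3)]
      have "?t \<cdot> x = a \<cdot> q" using h(5) q fg by simp
      thus "imem m ?t (env ''l'' \<cdot> p) a" using q h(2,4) p l by (intro imemI[of q x]) simp_all
    next
      assume "imem m ?t (env ''l'' \<cdot> p) a"
      then obtain q x where q: "is_epi S q" "q \<in> Arr S" "x \<in> Arr S" "Cod S q = Dom S (env ''l'' \<cdot> p)" "Dom S x = Dom S q"
       "Cod S x = Dom S m" "m \<cdot> x = (env ''l'' \<cdot> p) \<cdot> q" "?t \<cdot> x = a \<cdot> q" by (rule imemE)
      have "Dom S q \<in> Obj S" "q \<in> hom S (Dom S q) (Dom S p)" "x \<in> hom S (Dom S q) (Dom S m)"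
        using q(2-6) p l by (simp_all add: hom_def)
      moreover have "a \<cdot> q = tup S (f \<cdot> x) (g \<cdot> x)" using q(8)[symmetric] q(3,6) fg by simp
      ultimately show ?R using q(1,7) by blast
    qed
    finally show "forces S ?P (Dom S p) ((restrict_env S env p)(''z'' := a)) \<longleftrightarrow> imem m ?t (env ''l'' \<cdot> p) a" .
  qed (use m t homD[OF env] in simp_all)
  have "Le (ufam S (A, R)) m f g \<longleftrightarrow> holds S (\<^bold>\<forall>''l'' \<^bold>: Cod S m \<^bold>. \<lbrace>''z'' \<^bold>: prd S A A | ?P\<rbrace> \<^bold>\<in> R)"
    by (simp add: ufam_def)
  also have "\<dots> \<longleftrightarrow> rel R m f g"
  proof
    assume "holds S (\<^bold>\<forall>''l'' \<^bold>: Cod S m \<^bold>. \<lbrace>''z'' \<^bold>: prd S A A | ?P\<rbrace> \<^bold>\<in> R)"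
    from holds_forall1D[OF this, of "Idn S (Cod S m)"] m
    obtain env where e: "env ''l'' = Idn S (Cod S m)" "forces S (\<lbrace>''z'' \<^bold>: prd S A A | ?P\<rbrace> \<^bold>\<in> R) (Cod S m) env"
      by auto
    have "eval_tm S \<lbrace>''z'' \<^bold>: prd S A A | ?P\<rbrace> (Cod S m) env = img m ?t \<cdot> env ''l''"
      by (rule ev) (use e m in \<open>simp add: hom_def\<close>)
    thus "rel R m f g" using e m t by (simp add: rel_def)
  next
    assume r: "rel R m f g"
    show "holds S (\<^bold>\<forall>''l'' \<^bold>: Cod S m \<^bold>. \<lbrace>''z'' \<^bold>: prd S A A | ?P\<rbrace> \<^bold>\<in> R)"
    proof (rule holds_forall1I)
      fix I env assume env: "env ''l'' \<in> hom S I (Cod S m)"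
      have "factors S (img m ?t \<cdot> env ''l'') R"
        by (rule factors_cmp) (use r m t Ra homD[OF env] in \<open>simp_all add: rel_def\<close>)
      thus "forces S (\<lbrace>''z'' \<^bold>: prd S A A | ?P\<rbrace> \<^bold>\<in> R) I env" using ev[of env I, OF env] by simp
    qed
  qed
  finally show ?thesis .
qed

text \<open>Makes an inequality of maps an inequality of predicates over
  \<open>A \<rightarrow> 1\<close>, so that it can be reindexed to any other object.\<close>

lemma upo_map_le_iff:
  assumes f: "f \<in> hom S A B" and g: "g \<in> hom S A B"
  shows "upo_map_le S (A, R) (B, R') f g \<longleftrightarrow> rel R' (bang S A) f g"
proof -
  note fg = homD[OF f] homD[OF g]
  have A: "A \<in> Obj S" using dom_obj[OF fg(1)] fg(2) by simp
  let ?t = "tup S f g"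
  have t: "?t \<in> Arr S" "Dom S ?t = A" "Cod S ?t = prd S B B" using fg by simp_all
  let ?P = "\<^bold>\<exists>''a'' \<^bold>: A \<^bold>. Var ''z'' \<^bold>= Tup (Fn f (Var ''a'')) (Fn g (Var ''a''))"
  have "eval_tm S \<lbrace>''z'' \<^bold>: prd S B B | ?P\<rbrace> (one S) env = img (bang S A) ?t" for env
  proof (rule eval_img_idn)
    fix p a assume p: "p \<in> Arr S" "a \<in> Arr S" "Dom S a = Dom S p" "Cod S p = one S" "Cod S a = prd S B B"
    have "forces S ?P (Dom S p) ((restrict_env S env p)(''z'' := a)) \<longleftrightarrow>
      (\<exists>J\<in>Obj S. \<exists>q\<in>hom S J (Dom S p). is_epi S q \<and> (\<exists>x\<in>hom S J A. a \<cdot> q = tup S (f \<cdot> x) (g \<cdot> x)))" (is "_ \<longleftrightarrow> ?R")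
      by simp
    also have "?R \<longleftrightarrow> imem (bang S A) ?t p a"
    proof
      assume ?R
      then obtain J q x where h: "q\<in>hom S J (Dom S p)" "is_epi S q" "x\<in>hom S J A"
         "a \<cdot> q = tup S (f \<cdot> x) (g \<cdot> x)" by blast
      note q = homD[OF h(1)] homD[OF h(3)]
      have "?t \<cdot> x = a \<cdot> q" using h(4) q fg by simp
      moreover have "bang S A \<cdot> x = p \<cdot> q" by (rule to_one) (use q p A dom_obj[OF q(1)] in simp_all)
      ultimately show "imem (bang S A) ?t p a" using q h(2) p A by (intro imemI[of q x]) simp_all
    next
      assume "imem (bang S A) ?t p a"
      then obtain q x where q: "is_epi S q" "q \<in> Arr S" "x \<in> Arr S" "Cod S q = Dom S p" "Dom S x = Dom S q"
       "Cod S x = Dom S (bang S A)" "bang S A \<cdot> x = p \<cdot> q" "?t \<cdot> x = a \<cdot> q" by (rule imemE)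
      have "Dom S q \<in> Obj S" "q \<in> hom S (Dom S q) (Dom S p)" "x \<in> hom S (Dom S q) A"
        using q(2-6) p A by (simp_all add: hom_def)
      moreover have "a \<cdot> q = tup S (f \<cdot> x) (g \<cdot> x)" using q(8)[symmetric] q(3,6) fg A by simp
      ultimately show ?R using q(1) by blast
    qed
    finally show "forces S ?P (Dom S p) ((restrict_env S env p)(''z'' := a)) \<longleftrightarrow> imem (bang S A) ?t p a" .
  qed (use A t in simp_all)
  thus ?thesis by (simp add: upo_map_le_def rel_def holds_def)
qed

text \<open>Image relations can be computed once \<open>r\<close> is presented as a family of pairs.
  The covers of the two existential quantifiers and of the membership statement compose to a single
  cover.\<close>

lemma eval_Image_rel:
  assumes m: "m \<in> Arr S" and f: "f \<in> hom S (Dom S m) A" and g: "g \<in> hom S (Dom S m) A"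
    and h: "h \<in> hom S A B" and env: "env ''r'' = img m (tup S f g)"
  shows "eval_tm S (Image_rel S A B h (Var ''r'')) (Cod S m) env = img m (tup S (h \<cdot> f) (h \<cdot> g))"
proof -
  note fg = homD[OF f] homD[OF g] homD[OF h]
  have A: "A \<in> Obj S" using dom_obj[OF fg(7)] fg(8) by simp
  let ?t = "tup S f g" and ?t' = "tup S (h \<cdot> f) (h \<cdot> g)"
  have t: "?t \<in> Arr S" "Dom S ?t = Dom S m" "Cod S ?t = prd S A A" using fg by simp_all
  have t': "?t' \<in> Arr S" "Dom S ?t' = Dom S m" "Cod S ?t' = prd S B B" using fg by simp_all
  let ?P = "\<^bold>\<exists>''a'' \<^bold>: A \<^bold>. \<^bold>\<exists>''b'' \<^bold>: A \<^bold>.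
        In_rel S (prd S A A) (Tup (Var ''a'') (Var ''b'')) (Var ''r'') \<^bold>\<and>
        Var ''z'' \<^bold>= Tup (Fn h (Var ''a'')) (Fn h (Var ''b''))"
  have "eval_tm S \<lbrace>''z'' \<^bold>: prd S B B | ?P\<rbrace> (Cod S m) env = img m ?t'"
  proof (rule eval_img_idn)
    fix p z assume p: "p \<in> Arr S" "z \<in> Arr S" "Dom S z = Dom S p" "Cod S p = Cod S m" "Cod S z = prd S B B"
    have "forces S ?P (Dom S p) ((restrict_env S env p)(''z'' := z)) \<longleftrightarrow>
      (\<exists>J\<in>Obj S. \<exists>q\<in>hom S J (Dom S p). is_epi S q \<and> (\<exists>a\<in>hom S J A.
      (\<exists>K\<in>Obj S. \<exists>r\<in>hom S K J. is_epi S r \<and> (\<exists>b\<in>hom S K A.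
         mb (prd S A A) (tup S (a \<cdot> r) b) (((img m ?t \<cdot> p) \<cdot> q) \<cdot> r) \<and>
         (z \<cdot> q) \<cdot> r = tup S (h \<cdot> (a \<cdot> r)) (h \<cdot> b)))))" (is "_ \<longleftrightarrow> ?R")
      by (simp add: In_rel_def env)
    also have "?R \<longleftrightarrow> imem m ?t' p z"
    proof
      assume ?R
      then obtain J q a K r b where *: "q\<in>hom S J (Dom S p)" "is_epi S q" "a\<in>hom S J A"
        "r\<in>hom S K J" "is_epi S r" "b\<in>hom S K A"
         "mb (prd S A A) (tup S (a \<cdot> r) b) (((img m ?t \<cdot> p) \<cdot> q) \<cdot> r)"
         "(z \<cdot> q) \<cdot> r = tup S (h \<cdot> (a \<cdot> r)) (h \<cdot> b)" by blast
      note q = homD[OF *(1)] homD[OF *(3)] homD[OF *(4)] homD[OF *(6)]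
      have "imem m ?t (p \<cdot> (q \<cdot> r)) (tup S (a \<cdot> r) b)"
        using *(7) mb_img[of m ?t "p \<cdot> (q \<cdot> r)" "tup S (a \<cdot> r) b"] m t p q by simp
      then obtain s x where s: "is_epi S s" "s \<in> Arr S" "x \<in> Arr S" "Cod S s = Dom S (p \<cdot> (q \<cdot> r))" "Dom S x = Dom S s"
       "Cod S x = Dom S m" "m \<cdot> x = (p \<cdot> (q \<cdot> r)) \<cdot> s" "?t \<cdot> x = tup S (a \<cdot> r) b \<cdot> s" by (rule imemE)
      have sc: "Cod S s = K" using s(4) p q by simp
      have te: "tup S (f \<cdot> x) (g \<cdot> x) = tup S (a \<cdot> (r \<cdot> s)) (b \<cdot> s)" using s(8) s(3,5,6) sc s(2) q fg by simp
      have e: "f \<cdot> x = a \<cdot> (r \<cdot> s) \<and> g \<cdot> x = b \<cdot> s"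
        by (rule tup_inj[OF te]) (use s(2-6) sc q fg in simp_all)
      have "?t' \<cdot> x = tup S (h \<cdot> (f \<cdot> x)) (h \<cdot> (g \<cdot> x))" using s(3,5,6) fg by simp
      also have "\<dots> = tup S (h \<cdot> (a \<cdot> r)) (h \<cdot> b) \<cdot> s" using e s(2) sc q fg by simp
      also have "\<dots> = ((z \<cdot> q) \<cdot> r) \<cdot> s" using *(8) by simp
      also have "\<dots> = z \<cdot> (q \<cdot> (r \<cdot> s))" using s(2) sc q p by simp
      finally have 1: "?t' \<cdot> x = z \<cdot> (q \<cdot> (r \<cdot> s))" .
      have 2: "m \<cdot> x = p \<cdot> (q \<cdot> (r \<cdot> s))" using s(7) s(2) sc q p by simp
      have 3: "is_epi S (q \<cdot> (r \<cdot> s))"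
        by (intro epi_cmp *(2,5) s(1)) (use sc q s(2) in simp_all)
      show "imem m ?t' p z" by (rule imemI[OF 3 s(3) _ _ _ 2 1]) (use sc q s(2-6) p in simp_all)
    next
      assume "imem m ?t' p z"
      then obtain q x where q: "is_epi S q" "q \<in> Arr S" "x \<in> Arr S" "Cod S q = Dom S p" "Dom S x = Dom S q"
       "Cod S x = Dom S m" "m \<cdot> x = p \<cdot> q" "?t' \<cdot> x = z \<cdot> q" by (rule imemE)
      let ?J = "Dom S q"
      have J: "?J \<in> Obj S" "q \<in> hom S ?J (Dom S p)" "f \<cdot> x \<in> hom S ?J A" "Idn S ?J \<in> hom S ?J ?J"
        "g \<cdot> x \<in> hom S ?J A" "is_epi S (Idn S ?J)"
        using q(2-6) p fg by (simp_all add: hom_def)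
      have "imem m ?t (m \<cdot> x) (?t \<cdot> x)"
        by (rule imem_cmp[OF imem_self]) (use m t q(3-6) in simp_all)
      hence "imem m ?t (p \<cdot> q) (?t \<cdot> x)" using q(7) by simp
      hence "mb (prd S A A) (?t \<cdot> x) (img m ?t \<cdot> (p \<cdot> q))"
        using mb_img[of m ?t "p \<cdot> q" "?t \<cdot> x"] m t p q(2-6) by simp
      hence 1: "mb (prd S A A) (tup S ((f \<cdot> x) \<cdot> Idn S ?J) (g \<cdot> x)) (((img m ?t \<cdot> p) \<cdot> q) \<cdot> Idn S ?J)"
        using m t p q(2-6) fg by simp
      have 2: "(z \<cdot> q) \<cdot> Idn S ?J = tup S (h \<cdot> ((f \<cdot> x) \<cdot> Idn S ?J)) (h \<cdot> (g \<cdot> x))"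
        using q(8)[symmetric] q(2-6) p fg by simp
      from J q(1) 1 2 show ?R by blast
    qed
    finally show "forces S ?P (Dom S p) ((restrict_env S env p)(''z'' := z)) \<longleftrightarrow> imem m ?t' p z" .
  qed (use m t' in simp_all)
  thus ?thesis by (simp add: Image_rel_def)
qed

lemma eval_Id_rel:
  assumes A: "A \<in> Obj S"
  shows "eval_tm S (Id_rel S A) (one S) env = img (bang S A) (tup S (Idn S A) (Idn S A))"
proof -
  let ?i = "Idn S A"
  let ?t = "tup S ?i ?i"
  have t: "?t \<in> Arr S" "Dom S ?t = A" "Cod S ?t = prd S A A" using A by simp_all
  let ?P = "\<^bold>\<exists>''a'' \<^bold>: A \<^bold>. Var ''z'' \<^bold>= Tup (Var ''a'') (Var ''a'')"
  have "eval_tm S \<lbrace>''z'' \<^bold>: prd S A A | ?P\<rbrace> (one S) env = img (bang S A) ?t" for env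
  proof (rule eval_img_idn)
    fix p a assume p: "p \<in> Arr S" "a \<in> Arr S" "Dom S a = Dom S p" "Cod S p = one S" "Cod S a = prd S A A"
    have "forces S ?P (Dom S p) ((restrict_env S env p)(''z'' := a)) \<longleftrightarrow>
      (\<exists>J\<in>Obj S. \<exists>q\<in>hom S J (Dom S p). is_epi S q \<and> (\<exists>x\<in>hom S J A. a \<cdot> q = tup S x x))" (is "_ \<longleftrightarrow> ?R")
      by simp
    also have "?R \<longleftrightarrow> imem (bang S A) ?t p a"
    proof
      assume ?R
      then obtain J q x where h: "q\<in>hom S J (Dom S p)" "is_epi S q" "x\<in>hom S J A"
         "a \<cdot> q = tup S x x" by blast
      note q = homD[OF h(1)] homD[OF h(3)]
      have "?t \<cdot> x = a \<cdot> q" using h(4) q A by simp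
      moreover have "bang S A \<cdot> x = p \<cdot> q" by (rule to_one) (use q p A dom_obj[OF q(1)] in simp_all)
      ultimately show "imem (bang S A) ?t p a" using q h(2) p A by (intro imemI[of q x]) simp_all
    next
      assume "imem (bang S A) ?t p a"
      then obtain q x where q: "is_epi S q" "q \<in> Arr S" "x \<in> Arr S" "Cod S q = Dom S p" "Dom S x = Dom S q"
       "Cod S x = Dom S (bang S A)" "bang S A \<cdot> x = p \<cdot> q" "?t \<cdot> x = a \<cdot> q" by (rule imemE)
      have "Dom S q \<in> Obj S" "q \<in> hom S (Dom S q) (Dom S p)" "x \<in> hom S (Dom S q) A"
        using q(2-6) p A by (simp_all add: hom_def)
      moreover have "a \<cdot> q = tup S x x" using q(8)[symmetric] q(3,6) A by simp
      ultimately show ?R using q(1) by blast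
    qed
    finally show "forces S ?P (Dom S p) ((restrict_env S env p)(''z'' := a)) \<longleftrightarrow> imem (bang S A) ?t p a" .
  qed (use A t in simp_all)
  thus ?thesis by (simp add: Id_rel_def)
qed

text \<open>Two families of pairs are composed over the pullback of \<open>(g, m)\<close> and
  \<open>(f', m')\<close>, whose elements are pairs of indices over the same base point with
  matching middle entries.\<close>

lemma eval_Comp_rel:
  assumes m: "m \<in> Arr S" and f: "f \<in> hom S (Dom S m) A" and g: "g \<in> hom S (Dom S m) A"
    and m': "m' \<in> Arr S" "Cod S m' = Cod S m" and f': "f' \<in> hom S (Dom S m') A" and g': "g' \<in> hom S (Dom S m') A"
    and env: "env ''r'' = img m (tup S f g)" "env ''s'' = img m' (tup S f' g')"
    and pb: "is_pullback S (tup S g m) (tup S f' m') u u'"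
  shows "eval_tm S (Comp_rel S A (Var ''s'') (Var ''r'')) (Cod S m) env = img (m \<cdot> u) (tup S (f \<cdot> u) (g' \<cdot> u'))"
proof -
  note fg = homD[OF f] homD[OF g] homD[OF f'] homD[OF g']
  have A: "A \<in> Obj S" using cod_obj[OF fg(1)] fg(3) by simp
  let ?t = "tup S f g" and ?t' = "tup S f' g'"
  have t: "?t \<in> Arr S" "Dom S ?t = Dom S m" "Cod S ?t = prd S A A" using fg by simp_all
  have t': "?t' \<in> Arr S" "Dom S ?t' = Dom S m'" "Cod S ?t' = prd S A A" using fg by simp_all
  have u: "u \<in> Arr S" "u' \<in> Arr S" "Dom S u' = Dom S u" "Cod S u = Dom S m" "Cod S u' = Dom S m'"
    using pullbackD[OF pb] m m' fg by simp_all
  have ue: "tup S (g \<cdot> u) (m \<cdot> u) = tup S (f' \<cdot> u') (m' \<cdot> u')"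
    using pullbackD(9)[OF pb] u m m' fg by simp
  have ue: "g \<cdot> u = f' \<cdot> u' \<and> m \<cdot> u = m' \<cdot> u'"
    by (rule tup_inj[OF ue]) (use u m m' fg in simp_all)
  let ?n = "m \<cdot> u" and ?w = "tup S (f \<cdot> u) (g' \<cdot> u')"
  have n: "?n \<in> Arr S" "Dom S ?n = Dom S u" "Cod S ?n = Cod S m" using u m by simp_all
  have w: "?w \<in> Arr S" "Dom S ?w = Dom S u" "Cod S ?w = prd S A A" using u fg by simp_all
  let ?P = "\<^bold>\<exists>''a'' \<^bold>: A \<^bold>. \<^bold>\<exists>''b'' \<^bold>: A \<^bold>. \<^bold>\<exists>''c'' \<^bold>: A \<^bold>.
        Var ''z'' \<^bold>= Tup (Var ''a'') (Var ''c'') \<^bold>\<and>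
        In_rel S (prd S A A) (Tup (Var ''a'') (Var ''b'')) (Var ''r'') \<^bold>\<and>
        In_rel S (prd S A A) (Tup (Var ''b'') (Var ''c'')) (Var ''s'')"
  have "eval_tm S \<lbrace>''z'' \<^bold>: prd S A A | ?P\<rbrace> (Cod S m) env = img ?n ?w"
  proof (rule eval_img_idn)
    fix p z assume p: "p \<in> Arr S" "z \<in> Arr S" "Dom S z = Dom S p" "Cod S p = Cod S m" "Cod S z = prd S A A"
    have "forces S ?P (Dom S p) ((restrict_env S env p)(''z'' := z)) \<longleftrightarrow>
      (\<exists>J\<in>Obj S. \<exists>q\<in>hom S J (Dom S p). is_epi S q \<and> (\<exists>a\<in>hom S J A.
      (\<exists>K\<in>Obj S. \<exists>r\<in>hom S K J. is_epi S r \<and> (\<exists>b\<in>hom S K A.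
      (\<exists>L\<in>Obj S. \<exists>s\<in>hom S L K. is_epi S s \<and> (\<exists>c\<in>hom S L A.
         ((z \<cdot> q) \<cdot> r) \<cdot> s = tup S ((a \<cdot> r) \<cdot> s) c \<and>
         mb (prd S A A) (tup S ((a \<cdot> r) \<cdot> s) (b \<cdot> s)) ((((img m ?t \<cdot> p) \<cdot> q) \<cdot> r) \<cdot> s) \<and>
         mb (prd S A A) (tup S (b \<cdot> s) c) ((((img m' ?t' \<cdot> p) \<cdot> q) \<cdot> r) \<cdot> s)))))))" (is "_ \<longleftrightarrow> ?R")
      by (simp add: In_rel_def env)
    also have "?R \<longleftrightarrow> imem ?n ?w p z"
    proof
      assume ?R
      then obtain J q a K r b L s c where *: "q\<in>hom S J (Dom S p)" "is_epi S q" "a\<in>hom S J A"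
        "r\<in>hom S K J" "is_epi S r" "b\<in>hom S K A" "s\<in>hom S L K" "is_epi S s" "c\<in>hom S L A"
         "((z \<cdot> q) \<cdot> r) \<cdot> s = tup S ((a \<cdot> r) \<cdot> s) c"
         "mb (prd S A A) (tup S ((a \<cdot> r) \<cdot> s) (b \<cdot> s)) ((((img m ?t \<cdot> p) \<cdot> q) \<cdot> r) \<cdot> s)"
         "mb (prd S A A) (tup S (b \<cdot> s) c) ((((img m' ?t' \<cdot> p) \<cdot> q) \<cdot> r) \<cdot> s)" by blast
      note q = homD[OF *(1)] homD[OF *(3)] homD[OF *(4)] homD[OF *(6)] homD[OF *(7)] homD[OF *(9)]
      \<comment> \<open>The covers of the three existential quantifiers are composed to one cover
        \<open>k\<close>, at whose stage \<open>a'\<close>, \<open>b'\<close> and \<open>c\<close>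
        live.\<close>
      define k where "k = q \<cdot> (r \<cdot> s)"
      define a' where "a' = a \<cdot> (r \<cdot> s)"
      define b' where "b' = b \<cdot> s"
      have k: "k \<in> Arr S" "Dom S k = L" "Cod S k = Dom S p" "a' \<in> Arr S" "Dom S a' = L" "Cod S a' = A"
        "b' \<in> Arr S" "Dom S b' = L" "Cod S b' = A" "c \<in> Arr S" "Dom S c = L" "Cod S c = A"
        unfolding k_def a'_def b'_def using q by simp_all
      have ke: "is_epi S k" unfolding k_def by (intro epi_cmp *(2,5,8)) (use q in simp_all)
      have zk: "z \<cdot> k = tup S a' c" using *(10) p q by (simp add: k_def a'_def)
      have "mb (prd S A A) (tup S a' b') (img m ?t \<cdot> (p \<cdot> k))"
        using *(11) p q m t by (simp add: k_def a'_def b'_def)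
      hence "imem m ?t (p \<cdot> k) (tup S a' b')"
        using mb_img[of m ?t "p \<cdot> k" "tup S a' b'"] m t p k by simp
      then obtain d x where d: "is_epi S d" "d \<in> Arr S" "x \<in> Arr S" "Cod S d = Dom S (p \<cdot> k)" "Dom S x = Dom S d"
       "Cod S x = Dom S m" "m \<cdot> x = (p \<cdot> k) \<cdot> d" "?t \<cdot> x = tup S a' b' \<cdot> d" by (rule imemE)
      have dc: "Cod S d = L" using d(4) p k by simp
      have te: "tup S (f \<cdot> x) (g \<cdot> x) = tup S (a' \<cdot> d) (b' \<cdot> d)" using d(2,3,5,6,8) dc k fg by simp
      have e: "f \<cdot> x = a' \<cdot> d \<and> g \<cdot> x = b' \<cdot> d"
        by (rule tup_inj[OF te]) (use d(2-6) dc k fg in simp_all)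
      have "mb (prd S A A) (tup S b' c) (img m' ?t' \<cdot> (p \<cdot> k))"
        using *(12) p q m' t' by (simp add: k_def b'_def)
      hence "imem m' ?t' (p \<cdot> k) (tup S b' c)"
        using mb_img[of m' ?t' "p \<cdot> k" "tup S b' c"] m' t' p k by simp
      hence "imem m' ?t' ((p \<cdot> k) \<cdot> d) (tup S b' c \<cdot> d)"
        by (rule imem_cmp) (use m' t' p k d(2) dc in simp_all)
      then obtain d' x' where d': "is_epi S d'" "d' \<in> Arr S" "x' \<in> Arr S" "Cod S d' = Dom S ((p \<cdot> k) \<cdot> d)" "Dom S x' = Dom S d'"
       "Cod S x' = Dom S m'" "m' \<cdot> x' = ((p \<cdot> k) \<cdot> d) \<cdot> d'" "?t' \<cdot> x' = (tup S b' c \<cdot> d) \<cdot> d'" by (rule imemE)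
      have dc': "Cod S d' = Dom S d" using d'(4) p k d(2) dc by simp
      have te': "tup S (f' \<cdot> x') (g' \<cdot> x') = tup S (b' \<cdot> (d \<cdot> d')) (c \<cdot> (d \<cdot> d'))"
        using d'(2,3,5,6,8) dc' d(2) dc k fg by simp
      have e': "f' \<cdot> x' = b' \<cdot> (d \<cdot> d') \<and> g' \<cdot> x' = c \<cdot> (d \<cdot> d')"
        by (rule tup_inj[OF te']) (use d'(2-6) dc' d(2) dc k fg in simp_all)
      have x: "tup S g m \<cdot> (x \<cdot> d') = tup S (g \<cdot> (x \<cdot> d')) (m \<cdot> (x \<cdot> d'))"
        by (rule tup_cmp) (use d(2,3,5,6) d'(2,5,6) dc' m fg in simp_all)
      have gx: "g \<cdot> (x \<cdot> d') = b' \<cdot> (d \<cdot> d')"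
        by (rule cmp_extend) (use e d(2,3,5,6) d'(2,5,6) dc dc' k m fg in simp_all)
      have mx: "m \<cdot> (x \<cdot> d') = (p \<cdot> k) \<cdot> (d \<cdot> d')"
        by (rule cmp_extend[OF d(7)]) (use d(2,3,5,6) d'(2,5,6) dc dc' k m p in simp_all)
      have x': "tup S f' m' \<cdot> x' = tup S (f' \<cdot> x') (m' \<cdot> x')"
        by (rule tup_cmp) (use d'(2,3,5,6) m' fg in simp_all)
      have mx': "m' \<cdot> x' = (p \<cdot> k) \<cdot> (d \<cdot> d')" using d'(7) d(2) d'(2) dc dc' k p by simp
      \<comment> \<open>Moved to a common cover, the two indices \<open>x\<close> and
        \<open>x'\<close> agree in the middle entry and over the base; hence they define an element
        \<open>y\<close> of the pullback.\<close>
      have "tup S g m \<cdot> (x \<cdot> d') = tup S f' m' \<cdot> x'"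
        unfolding x x' gx mx mx' using e' by simp
      then obtain y where y: "y \<in> Arr S" "Dom S y = Dom S (x \<cdot> d')" "Cod S y = Dom S u" "u \<cdot> y = x \<cdot> d'" "u' \<cdot> y = x'"
        by (rule pullback_lift[OF pb, rotated -2]) (use d(2,3,5,6) d'(2,3,5,6) dc' m m' fg in simp_all)
      have yd: "Dom S y = Dom S d'" using y(2) d(3,5) d'(2) dc' by simp
      have "?n \<cdot> y = m \<cdot> (u \<cdot> y)" using y(1,3) u m by simp
      also have "\<dots> = p \<cdot> (k \<cdot> (d \<cdot> d'))" unfolding y(4) mx using p k d(2) d'(2) dc dc' by simp
      finally have 1: "?n \<cdot> y = p \<cdot> (k \<cdot> (d \<cdot> d'))" .
      have fx: "f \<cdot> (x \<cdot> d') = a' \<cdot> (d \<cdot> d')"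
        by (rule cmp_extend) (use e d(2,3,5,6) d'(2,5,6) dc dc' k m fg in simp_all)
      have "?w \<cdot> y = tup S (f \<cdot> (u \<cdot> y)) (g' \<cdot> (u' \<cdot> y))" using y(1,3) u fg by simp
      also have "\<dots> = tup S (a' \<cdot> (d \<cdot> d')) (c \<cdot> (d \<cdot> d'))" unfolding y(4,5) fx using e' by simp
      also have "\<dots> = tup S a' c \<cdot> (d \<cdot> d')" using k d(2) d'(2) dc dc' by simp
      also have "\<dots> = z \<cdot> (k \<cdot> (d \<cdot> d'))" unfolding zk[symmetric] using p k(1-3) d(2) d'(2) dc dc' by simp
      finally have 2: "?w \<cdot> y = z \<cdot> (k \<cdot> (d \<cdot> d'))" .
      have 3: "is_epi S (k \<cdot> (d \<cdot> d'))" by (intro epi_cmp ke d(1) d'(1)) (use k d(2) d'(2) dc dc' in simp_all)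
      show "imem ?n ?w p z"
        by (rule imemI[OF 3 y(1) _ _ _ 1 2]) (use k(1-3) d(2) d'(2) dc dc' yd y(3) n in simp_all)
    next
      assume "imem ?n ?w p z"
      then obtain q x where q: "is_epi S q" "q \<in> Arr S" "x \<in> Arr S" "Cod S q = Dom S p" "Dom S x = Dom S q"
       "Cod S x = Dom S ?n" "?n \<cdot> x = p \<cdot> q" "?w \<cdot> x = z \<cdot> q" by (rule imemE)
      have xc: "Cod S x = Dom S u" using q(6) n by simp
      let ?J = "Dom S q"
      let ?i = "Idn S ?J"
      let ?a = "f \<cdot> (u \<cdot> x)" and ?b = "g \<cdot> (u \<cdot> x)" and ?c = "g' \<cdot> (u' \<cdot> x)"
      have J: "?J \<in> Obj S" "q \<in> hom S ?J (Dom S p)" "?a \<in> hom S ?J A" "?i \<in> hom S ?J ?J"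
        "?b \<in> hom S ?J A" "?c \<in> hom S ?J A" "is_epi S ?i"
        using q(2-5) xc p fg u by (simp_all add: hom_def)
      note Jd = homD[OF J(3)] homD[OF J(5)] homD[OF J(6)]
      have bf: "f' \<cdot> (u' \<cdot> x) = ?b"
        using cmp_extend[of g u f' u' x] ue q(3) xc u fg by simp
      have mm: "m' \<cdot> (u' \<cdot> x) = p \<cdot> q" "m \<cdot> (u \<cdot> x) = p \<cdot> q"
        using cmp_extend[of m u m' u' x] ue q(3,7) xc u m m' by simp_all
      have "imem m ?t (m \<cdot> (u \<cdot> x)) (?t \<cdot> (u \<cdot> x))"
        by (rule imem_cmp[OF imem_self]) (use m t q(3-5) xc u in simp_all)
      moreover have "?t \<cdot> (u \<cdot> x) = tup S ?a ?b" using fg u xc q(3) by simp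
      ultimately have "imem m ?t (p \<cdot> q) (tup S ?a ?b)" using mm by simp
      hence "mb (prd S A A) (tup S ?a ?b) (img m ?t \<cdot> (p \<cdot> q))"
        using mb_img[of m ?t "p \<cdot> q" "tup S ?a ?b"] m t p q(2-4) Jd by simp
      hence 1: "mb (prd S A A) (tup S ((?a \<cdot> ?i) \<cdot> ?i) (?b \<cdot> ?i)) ((((img m ?t \<cdot> p) \<cdot> q) \<cdot> ?i) \<cdot> ?i)"
        using m t p q(2-4) Jd by simp
      have "imem m' ?t' (m' \<cdot> (u' \<cdot> x)) (?t' \<cdot> (u' \<cdot> x))"
        by (rule imem_cmp[OF imem_self]) (use m' t' q(3-5) xc u in simp_all)
      moreover have "?t' \<cdot> (u' \<cdot> x) = tup S ?b ?c" unfolding bf[symmetric] using fg u xc q(3) by simp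
      ultimately have "imem m' ?t' (p \<cdot> q) (tup S ?b ?c)" using mm by simp
      hence "mb (prd S A A) (tup S ?b ?c) (img m' ?t' \<cdot> (p \<cdot> q))"
        using mb_img[of m' ?t' "p \<cdot> q" "tup S ?b ?c"] m' t' p q(2-4) Jd by simp
      hence 2: "mb (prd S A A) (tup S (?b \<cdot> ?i) ?c) ((((img m' ?t' \<cdot> p) \<cdot> q) \<cdot> ?i) \<cdot> ?i)"
        using m' t' p q(2-4) Jd by simp
      have "z \<cdot> q = tup S ?a ?c" unfolding q(8)[symmetric] using fg u xc q(3) by simp
      hence 3: "((z \<cdot> q) \<cdot> ?i) \<cdot> ?i = tup S ((?a \<cdot> ?i) \<cdot> ?i) ?c" using p q(2,4) Jd by simp
      from J q(1) 1 2 3 show ?R by blast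
    qed
    finally show "forces S ?P (Dom S p) ((restrict_env S env p)(''z'' := z)) \<longleftrightarrow> imem ?n ?w p z" .
  qed (use n w in simp_all)
  thus ?thesis by (simp add: Comp_rel_def)
qed

end

section \<open>Uniform preorders as families of preorders\<close>

context topos_loc
begin

lemma holds_forall2E:
  assumes "holds S (\<^bold>\<forall>x \<^bold>: X \<^bold>. \<^bold>\<forall>y \<^bold>: Y \<^bold>. P \<^bold>\<longrightarrow> Q)" "x \<noteq> y" "r \<in> hom S I X" "s \<in> hom S I Y"
  obtains env where "env x = r" "env y = s" "forces S P I env \<Longrightarrow> forces S Q I env"
proof -
  note rs = homD[OF assms(3)] homD[OF assms(4)]
  obtain env where e: "env x = r \<and> env y = s \<and> (forces S P (Dom S r) env \<longrightarrow> forces S Q (Dom S r) env)"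
    using holds_forall2D[OF assms(1,2) rs(1,3,4,6)] rs(2,5) by auto
  show ?thesis by (rule that[of env]) (use e rs(2) in simp_all)
qed

lemma pow_prd_is_img:
  assumes "A \<in> Obj S" "r \<in> Arr S" "Cod S r = pow S (prd S A A)"
  obtains m f g where "m \<in> Arr S" "f \<in> hom S (Dom S m) A" "g \<in> hom S (Dom S m) A" "Cod S m = Dom S r"
    "r = img m (tup S f g)"
proof -
  obtain m t where mt: "m \<in> Arr S" "t \<in> Arr S" "Dom S m = Dom S t" "Cod S t = prd S A A" "Cod S m = Dom S r" "r = img m t"
    using pow_is_img[of "prd S A A" r] assms by auto
  have t: "tup S (pr1 S A A \<cdot> t) (pr2 S A A \<cdot> t) = t"
    by (rule tup_eta) (use mt(2,4) assms(1) in simp_all)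
  show ?thesis
    by (rule that[of m "pr1 S A A \<cdot> t" "pr2 S A A \<cdot> t"])
      (use mt(1-4) assms(1) in \<open>simp_all add: hom_def mt(5) mt(6)[symmetric] t\<close>)
qed

lemma rel_epi:
  assumes "m \<in> Arr S" "f \<in> hom S (Dom S m) A" "g \<in> hom S (Dom S m) A" "is_epi S e" "Cod S e = Dom S m"
  shows "rel R (m \<cdot> e) (f \<cdot> e) (g \<cdot> e) \<longleftrightarrow> rel R m f g"
proof -
  note fg = homD[OF assms(2)] homD[OF assms(3)]
  have "img (m \<cdot> e) (tup S f g \<cdot> e) = img m (tup S f g)"
    by (rule img_epi) (use fg assms(1,4,5) in simp_all)
  moreover have "tup S f g \<cdot> e = tup S (f \<cdot> e) (g \<cdot> e)"
    by (rule tup_cmp) (use fg assms(4,5) in simp_all)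
  ultimately show ?thesis by (simp only: rel_def)
qed

lemma rel_pullback:
  assumes "m \<in> Arr S" "f \<in> hom S (Dom S m) A" "g \<in> hom S (Dom S m) A" "is_pullback S v m n k"
  shows "rel R n (f \<cdot> k) (g \<cdot> k) \<longleftrightarrow> factors S (img m (tup S f g) \<cdot> v) R"
proof -
  note fg = homD[OF assms(2)] homD[OF assms(3)]
  have "img m (tup S f g) \<cdot> v = img n (tup S f g \<cdot> k)"
    by (rule img_cmp) (use fg assms(1,4) in simp_all)
  moreover have "tup S f g \<cdot> k = tup S (f \<cdot> k) (g \<cdot> k)"
    by (rule tup_cmp) (use fg pullbackD[OF assms(4)] in simp_all)
  ultimately show ?thesis by (simp only: rel_def)
qed

text \<open>The last clause has two special cases: with \<open>v\<close> an identity it expresses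
  downward closure of \<open>R\<close>, and for pullback squares it is substitution in the
  base.\<close>

definition preorder_family :: "'o \<Rightarrow> 'a \<Rightarrow> bool" where
  "preorder_family A R \<longleftrightarrow> A \<in> Obj S \<and> is_mono S R \<and> Cod S R = pow S (prd S A A) \<and>
     (\<forall>m f. m \<in> Arr S \<longrightarrow> f \<in> hom S (Dom S m) A \<longrightarrow> rel R m f f) \<and>
     (\<forall>m f g h. m \<in> Arr S \<longrightarrow> f \<in> hom S (Dom S m) A \<longrightarrow> g \<in> hom S (Dom S m) A \<longrightarrow> h \<in> hom S (Dom S m) A \<longrightarrow>
        rel R m f g \<longrightarrow> rel R m g h \<longrightarrow> rel R m f h) \<and>
     (\<forall>m f g m' u v. m \<in> Arr S \<longrightarrow> f \<in> hom S (Dom S m) A \<longrightarrow> g \<in> hom S (Dom S m) A \<longrightarrow>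
        m' \<in> Arr S \<longrightarrow> u \<in> hom S (Dom S m') (Dom S m) \<longrightarrow> v \<in> hom S (Cod S m') (Cod S m) \<longrightarrow>
        m \<cdot> u = v \<cdot> m' \<longrightarrow> rel R m f g \<longrightarrow> rel R m' (f \<cdot> u) (g \<cdot> u))"

text \<open>Generalized elements of the power object are presented as families of pairs, which makes
  each closure condition a statement about \<open>rel R\<close>. An inclusion of relations is an
  inclusion of families only after passing to a cover, and \<open>rel_epi\<close> removes that
  cover.\<close>

lemma uniform_preorderI:
  assumes "preorder_family A R"
  shows "uniform_preorder S (A, R)"
proof -
  have A: "A \<in> Obj S" and R: "is_mono S R" "R \<in> Arr S" "Cod S R = pow S (prd S A A)"
    and refl: "\<And>m f. m \<in> Arr S \<Longrightarrow> f \<in> hom S (Dom S m) A \<Longrightarrow> rel R m f f"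
    and trans: "\<And>m f g h. m \<in> Arr S \<Longrightarrow> f \<in> hom S (Dom S m) A \<Longrightarrow> g \<in> hom S (Dom S m) A \<Longrightarrow> h \<in> hom S (Dom S m) A \<Longrightarrow>
        rel R m f g \<Longrightarrow> rel R m g h \<Longrightarrow> rel R m f h"
    and stab: "\<And>m f g m' u v. m \<in> Arr S \<Longrightarrow> f \<in> hom S (Dom S m) A \<Longrightarrow> g \<in> hom S (Dom S m) A \<Longrightarrow>
        m' \<in> Arr S \<Longrightarrow> u \<in> hom S (Dom S m') (Dom S m) \<Longrightarrow> v \<in> hom S (Cod S m') (Cod S m) \<Longrightarrow>
        m \<cdot> u = v \<cdot> m' \<Longrightarrow> rel R m f g \<Longrightarrow> rel R m' (f \<cdot> u) (g \<cdot> u)"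
    using assms mono_arr unfolding preorder_family_def by metis+
  let ?X = "prd S A A"
  let ?P = "pow S ?X"
  have X: "?X \<in> Obj S" using A by simp
  have down: "factors S s R"
    if r: "r \<in> hom S I ?P" and s: "s \<in> hom S I ?P" and rR: "factors S r R"
      and sub: "\<And>p a. p \<in> Arr S \<Longrightarrow> a \<in> Arr S \<Longrightarrow> Dom S a = Dom S p \<Longrightarrow> Cod S p = I \<Longrightarrow> Cod S a = ?X \<Longrightarrow>
        mb ?X a (s \<cdot> p) \<Longrightarrow> mb ?X a (r \<cdot> p)" for r s I
  proof -
    note rs = homD[OF r] homD[OF s]
    obtain m f g where m: "m \<in> Arr S" and f: "f \<in> hom S (Dom S m) A" and g: "g \<in> hom S (Dom S m) A"
      and mr: "Cod S m = Dom S r" and re: "r = img m (tup S f g)"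
      using pow_prd_is_img[OF A rs(1,3)] by metis
    obtain m' f' g' where m': "m' \<in> Arr S" and f': "f' \<in> hom S (Dom S m') A" and g': "g' \<in> hom S (Dom S m') A"
      and mr': "Cod S m' = Dom S s" and se: "s = img m' (tup S f' g')"
      using pow_prd_is_img[OF A rs(4,6)] by metis
    note fg = homD[OF f] homD[OF g] homD[OF f'] homD[OF g']
    have mI: "Cod S m = I" "Cod S m' = I" using mr mr' rs by simp_all
    let ?t = "tup S f g" and ?t' = "tup S f' g'"
    have t: "?t \<in> Arr S" "Dom S ?t = Dom S m" "Cod S ?t = prd S A A" using fg by simp_all
    have t': "?t' \<in> Arr S" "Dom S ?t' = Dom S m'" "Cod S ?t' = prd S A A" using fg by simp_all
    \<comment> \<open>The inclusion is tested on the generic pair of \<open>s\<close>, which yields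
      an index \<open>x\<close> for \<open>r\<close> over a cover \<open>q\<close> of the index
      object of \<open>s\<close>.\<close>
    have "mb ?X ?t' (s \<cdot> m')"
      unfolding se by (subst mb_img) (use m' t' imem_self[OF m' t'(1) t'(2)[symmetric]] in simp_all)
    hence "mb ?X ?t' (r \<cdot> m')" by (intro sub) (use m' t' mI in simp_all)
    hence "imem m ?t m' ?t'"
      unfolding re by (rule mb_img[THEN iffD1, rotated -1]) (use m t m' t' mI in simp_all)
    then obtain q x where q: "is_epi S q" "q \<in> Arr S" "x \<in> Arr S" "Cod S q = Dom S m'" "Dom S x = Dom S q"
       "Cod S x = Dom S m" "m \<cdot> x = m' \<cdot> q" "?t \<cdot> x = ?t' \<cdot> q" by (rule imemE)
    have te: "tup S (f \<cdot> x) (g \<cdot> x) = tup S (f' \<cdot> q) (g' \<cdot> q)" using q(2-6,8) fg by simp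
    have e: "f \<cdot> x = f' \<cdot> q \<and> g \<cdot> x = g' \<cdot> q" by (rule tup_inj[OF te]) (use q(2-6) fg in simp_all)
    have "rel R m f g" using rR re by (simp add: rel_def)
    hence "rel R (m' \<cdot> q) (f \<cdot> x) (g \<cdot> x)"
      by (rule stab[OF m f g, where v = "Idn S I", rotated -1]) (use q(2-7) m' mI cod_obj[OF m] in \<open>simp_all add: hom_def\<close>)
    hence "rel R m' f' g'" using rel_epi[OF m' f' g' q(1,4)] e by simp
    thus ?thesis using se by (simp add: rel_def)
  qed
  have "holds S (\<^bold>\<forall>''r'' \<^bold>: ?P \<^bold>. \<^bold>\<forall>''s'' \<^bold>: ?P \<^bold>.
       Var ''r'' \<^bold>\<in> R \<^bold>\<and> Subset S ?X (Var ''s'') (Var ''r'') \<^bold>\<longrightarrow> Var ''s'' \<^bold>\<in> R)"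
  proof (rule holds_forall2I)
    fix I env assume e: "env ''r'' \<in> hom S I ?P" "env ''s'' \<in> hom S I ?P"
      "forces S (Var ''r'' \<^bold>\<in> R \<^bold>\<and> Subset S ?X (Var ''s'') (Var ''r'')) I env"
    have "forces S (Subset S ?X (Var ''s'') (Var ''r'')) I env" "factors S (env ''r'') R"
      using e(3) by simp_all
    with forces_Subset[where env = env, OF e(2,1) X]
    have "factors S (env ''s'') R" by (intro down[OF e(1,2)]) simp_all
    thus "forces S (Var ''s'' \<^bold>\<in> R) I env" by simp
  qed simp
  moreover have "holds S (Id_rel S A \<^bold>\<in> R)"
    using refl[of "bang S A" "Idn S A"] A by (simp add: holds_def eval_Id_rel rel_def hom_def)
  moreover have "holds S (\<^bold>\<forall>''r'' \<^bold>: ?P \<^bold>. \<^bold>\<forall>''s'' \<^bold>: ?P \<^bold>.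
       Var ''r'' \<^bold>\<in> R \<^bold>\<and> Var ''s'' \<^bold>\<in> R \<^bold>\<longrightarrow> Comp_rel S A (Var ''s'') (Var ''r'') \<^bold>\<in> R)"
  proof (rule holds_forall2I)
    fix I env assume e: "env ''r'' \<in> hom S I ?P" "env ''s'' \<in> hom S I ?P"
      "forces S (Var ''r'' \<^bold>\<in> R \<^bold>\<and> Var ''s'' \<^bold>\<in> R) I env"
    note rs = homD[OF e(1)] homD[OF e(2)]
    obtain m f g where m: "m \<in> Arr S" and f: "f \<in> hom S (Dom S m) A" and g: "g \<in> hom S (Dom S m) A"
      and mr: "Cod S m = Dom S (env ''r'')" and re: "env ''r'' = img m (tup S f g)"
      using pow_prd_is_img[OF A rs(1,3)] by metis
    obtain m' f' g' where m': "m' \<in> Arr S" and f': "f' \<in> hom S (Dom S m') A" and g': "g' \<in> hom S (Dom S m') A"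
      and mr': "Cod S m' = Dom S (env ''s'')" and se: "env ''s'' = img m' (tup S f' g')"
      using pow_prd_is_img[OF A rs(4,6)] by metis
    note fg = homD[OF f] homD[OF g] homD[OF f'] homD[OF g']
    have mI: "Cod S m = I" "Cod S m' = I" using mr mr' rs by simp_all
    let ?a = "tup S g m" and ?b = "tup S f' m'"
    have ab: "?a \<in> Arr S" "Dom S ?a = Dom S m" "Cod S ?a = prd S A I" "?b \<in> Arr S" "Dom S ?b = Dom S m'" "Cod S ?b = prd S A I"
      using fg m m' mI by simp_all
    obtain u u' where pb: "is_pullback S ?a ?b u u'" using pb_pullback[of ?a ?b] ab by auto
    have u: "u \<in> Arr S" "u' \<in> Arr S" "Dom S u' = Dom S u" "Cod S u = Dom S m" "Cod S u' = Dom S m'"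
      using pullbackD[OF pb] ab by simp_all
    have ue: "tup S (g \<cdot> u) (m \<cdot> u) = tup S (f' \<cdot> u') (m' \<cdot> u')"
      using pullbackD(9)[OF pb] u m m' fg by simp
    have ue: "g \<cdot> u = f' \<cdot> u' \<and> m \<cdot> u = m' \<cdot> u'"
      by (rule tup_inj[OF ue]) (use u m m' fg mI in simp_all)
    have idI: "Idn S I \<in> hom S I I" using mI cod_obj[OF m] by (simp add: hom_def)
    have mu: "m \<cdot> u \<in> Arr S" "Dom S (m \<cdot> u) = Dom S u" "Cod S (m \<cdot> u) = I" using u m mI by simp_all
    have r1: "rel R m f g" and r2: "rel R m' f' g'" using e(3) re se by (simp_all add: rel_def)
    have r3: "rel R (m \<cdot> u) (f \<cdot> u) (g \<cdot> u)"
      by (rule stab[OF m f g mu(1) _ _ _ r1, of _ "Idn S I"]) (use u mu mI idI m in \<open>simp_all add: hom_def\<close>)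
    have "rel R (m \<cdot> u) (f' \<cdot> u') (g' \<cdot> u')"
      by (rule stab[OF m' f' g' mu(1) _ _ _ r2, of _ "Idn S I"]) (use ue u mu mI idI m m' in \<open>simp_all add: hom_def\<close>)
    hence r4: "rel R (m \<cdot> u) (g \<cdot> u) (g' \<cdot> u')" using ue by simp
    have "rel R (m \<cdot> u) (f \<cdot> u) (g' \<cdot> u')"
      by (rule trans[OF mu(1) _ _ _ r3 r4]) (use u mu(2) fg in \<open>simp_all add: hom_def\<close>)
    moreover have "eval_tm S (Comp_rel S A (Var ''s'') (Var ''r'')) (Cod S m) env = img (m \<cdot> u) (tup S (f \<cdot> u) (g' \<cdot> u'))"
      by (rule eval_Comp_rel[where env = env, OF m f g m' _ f' g' re se pb]) (simp add: mI)
    ultimately show "forces S (Comp_rel S A (Var ''s'') (Var ''r'') \<^bold>\<in> R) I env"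
      using mI by (simp add: rel_def)
  qed simp
  ultimately show ?thesis using A R by (simp add: uniform_preorder_def)
qed

text \<open>Stability comes from downward closure: a commutative square makes the family over
  \<open>m'\<close> a subfamily of the reindexed one. Reflexivity is the case of the identity
  relation, the generic reflexive family over \<open>A \<rightarrow> 1\<close>, reindexed along
  \<open>f\<close>. Transitivity restricts the composite relation to pairs of equal indices.\<close>

lemma uniform_preorderD:
  assumes "uniform_preorder S (A, R)"
  shows "preorder_family A R"
proof -
  let ?X = "prd S A A"
  let ?P = "pow S ?X"
  have A: "A \<in> Obj S" and R: "is_mono S R" "Cod S R = ?P"
    and h1: "holds S (\<^bold>\<forall>''r'' \<^bold>: ?P \<^bold>. \<^bold>\<forall>''s'' \<^bold>: ?P \<^bold>.
       Var ''r'' \<^bold>\<in> R \<^bold>\<and> Subset S ?X (Var ''s'') (Var ''r'') \<^bold>\<longrightarrow> Var ''s'' \<^bold>\<in> R)"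
    and h2: "holds S (Id_rel S A \<^bold>\<in> R)"
    and h3: "holds S (\<^bold>\<forall>''r'' \<^bold>: ?P \<^bold>. \<^bold>\<forall>''s'' \<^bold>: ?P \<^bold>.
       Var ''r'' \<^bold>\<in> R \<^bold>\<and> Var ''s'' \<^bold>\<in> R \<^bold>\<longrightarrow> Comp_rel S A (Var ''s'') (Var ''r'') \<^bold>\<in> R)"
    using assms unfolding uniform_preorder_def prod.case by blast+
  have X: "?X \<in> Obj S" using A by simp
  have Ra: "R \<in> Arr S" using R by simp
  have stab: "rel R m' (f \<cdot> u) (g \<cdot> u)" if m: "m \<in> Arr S" and f: "f \<in> hom S (Dom S m) A" and g: "g \<in> hom S (Dom S m) A"
      and m': "m' \<in> Arr S" and u: "u \<in> hom S (Dom S m') (Dom S m)" and v: "v \<in> hom S (Cod S m') (Cod S m)"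
      and sq: "m \<cdot> u = v \<cdot> m'" and r: "rel R m f g" for m f g m' u v
  proof -
    note fg = homD[OF f] homD[OF g] and uv = homD[OF u] homD[OF v]
    let ?t = "tup S f g" and ?t' = "tup S (f \<cdot> u) (g \<cdot> u)"
    have t: "?t \<in> Arr S" "Dom S ?t = Dom S m" "Cod S ?t = ?X" using fg by simp_all
    have t': "?t' \<in> Arr S" "Dom S ?t' = Dom S m'" "Cod S ?t' = ?X" "?t \<cdot> u = ?t'" using fg uv by simp_all
    let ?r = "img m ?t \<cdot> v" and ?s = "img m' ?t'"
    have rr: "?r \<in> hom S (Cod S m') ?P" and ss: "?s \<in> hom S (Cod S m') ?P"
      using m m' t t' uv by (simp_all add: hom_def)
    have fr: "factors S ?r R"
      by (rule factors_cmp) (use r m t uv Ra in \<open>simp_all add: rel_def\<close>)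
    obtain env where env: "env ''r'' = ?r" "env ''s'' = ?s"
      "forces S (Var ''r'' \<^bold>\<in> R \<^bold>\<and> Subset S ?X (Var ''s'') (Var ''r'')) (Cod S m') env \<Longrightarrow> forces S (Var ''s'' \<^bold>\<in> R) (Cod S m') env"
      by (rule holds_forall2E[OF h1 _ rr ss], simp, rule that)
    have "forces S (Subset S ?X (Var ''s'') (Var ''r'')) (Cod S m') env"
    proof (subst forces_Subset[where env = env])
      show "\<forall>p a. p \<in> Arr S \<longrightarrow> a \<in> Arr S \<longrightarrow> Dom S a = Dom S p \<longrightarrow> Cod S p = Cod S m' \<longrightarrow> Cod S a = ?X \<longrightarrow>
         mb ?X a (env ''s'' \<cdot> p) \<longrightarrow> mb ?X a (env ''r'' \<cdot> p)"
      proof (intro allI impI)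
        fix p a assume p: "p \<in> Arr S" "a \<in> Arr S" "Dom S a = Dom S p" "Cod S p = Cod S m'" "Cod S a = ?X"
          "mb ?X a (env ''s'' \<cdot> p)"
        have "mb ?X a (img m' ?t' \<cdot> p)" using p(6) by (simp add: env(2))
        hence "imem m' ?t' p a" by (rule mb_img[THEN iffD1, rotated -1]) (use m' t'(1-3) p(1-5) in simp_all)
        then obtain q x where q: "is_epi S q" "q \<in> Arr S" "x \<in> Arr S" "Cod S q = Dom S p" "Dom S x = Dom S q"
          "Cod S x = Dom S m'" "m' \<cdot> x = p \<cdot> q" "?t' \<cdot> x = a \<cdot> q" by (rule imemE)
        have 1: "?t \<cdot> (u \<cdot> x) = a \<cdot> q" unfolding q(8)[symmetric] by (rule cmp_extend1) (use t t' uv q(3,6) in simp_all)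
        have "m \<cdot> (u \<cdot> x) = v \<cdot> (m' \<cdot> x)" by (rule cmp_extend[OF sq]) (use m m' uv q(3,6) in simp_all)
        hence 2: "m \<cdot> (u \<cdot> x) = (v \<cdot> p) \<cdot> q" unfolding q(7) using uv p(1,4) q(2,4) by simp
        have "imem m ?t (v \<cdot> p) a"
          by (rule imemI[OF q(1) _ _ _ _ 2 1]) (use q(2-6) uv p(1-4) in simp_all)
        hence "mb ?X a (img m ?t \<cdot> (v \<cdot> p))"
          by (rule mb_img[THEN iffD2, rotated -1]) (use m t uv p(1-5) in simp_all)
        thus "mb ?X a (env ''r'' \<cdot> p)" using m t uv p(1-5) by (simp add: env(1))
      qed
    qed (use rr ss env X in simp_all)
    hence "factors S ?s R" using env fr by simp
    thus ?thesis by (simp add: rel_def)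
  qed
  moreover have "rel R m f f" if m: "m \<in> Arr S" and f: "f \<in> hom S (Dom S m) A" for m f
  proof -
    note fD = homD[OF f]
    have "rel R (bang S A) (Idn S A) (Idn S A)"
      using h2 A by (simp add: holds_def eval_Id_rel rel_def)
    hence "rel R m (Idn S A \<cdot> f) (Idn S A \<cdot> f)"
      by (rule stab[rotated -1, where v = "bang S (Cod S m)"]) (use A m fD in \<open>simp_all add: hom_def\<close>)
    thus ?thesis using fD by simp
  qed
  moreover have "rel R m f h" if m: "m \<in> Arr S" and f: "f \<in> hom S (Dom S m) A" and g: "g \<in> hom S (Dom S m) A"
    and h: "h \<in> hom S (Dom S m) A" and r: "rel R m f g" "rel R m g h" for m f g h
  proof -
    note fg = homD[OF f] homD[OF g] homD[OF h]
    let ?r = "img m (tup S f g)" and ?s = "img m (tup S g h)"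
    have rs: "?r \<in> Arr S" "Cod S ?r = ?P" "Dom S ?r = Cod S m" "?s \<in> Arr S" "Cod S ?s = ?P" "Dom S ?s = Cod S m"
      using m fg by simp_all
    have rr: "?r \<in> hom S (Cod S m) ?P" "?s \<in> hom S (Cod S m) ?P" using rs by (simp_all add: hom_def)
    obtain env where env: "env ''r'' = ?r" "env ''s'' = ?s"
      "forces S (Var ''r'' \<^bold>\<in> R \<^bold>\<and> Var ''s'' \<^bold>\<in> R) (Cod S m) env \<Longrightarrow> forces S (Comp_rel S A (Var ''s'') (Var ''r'') \<^bold>\<in> R) (Cod S m) env"
      by (rule holds_forall2E[OF h3 _ rr], simp, rule that)
    let ?a = "tup S g m"
    have a: "?a \<in> Arr S" "Dom S ?a = Dom S m" using fg m by simp_all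
    obtain u u' where pb: "is_pullback S ?a ?a u u'" using pb_pullback[of ?a ?a] a by auto
    have u: "u \<in> Arr S" "u' \<in> Arr S" "Dom S u' = Dom S u" "Cod S u = Dom S m" "Cod S u' = Dom S m"
      using pullbackD[OF pb] a by simp_all
    have "eval_tm S (Comp_rel S A (Var ''s'') (Var ''r'')) (Cod S m) env = img (m \<cdot> u) (tup S (f \<cdot> u) (h \<cdot> u'))"
      by (rule eval_Comp_rel[where env = env, OF m f g m refl g h env(1,2) pb])
    hence rc: "rel R (m \<cdot> u) (f \<cdot> u) (h \<cdot> u')" using env r by (simp add: rel_def)
    \<comment> \<open>The diagonal \<open>d\<close> selects those composable pairs whose two indices
      coincide; along it the composite family becomes \<open>(f, h)\<close>.\<close>
    obtain d where d: "d \<in> Arr S" "Dom S d = Dom S (Idn S (Dom S m))" "Cod S d = Dom S u" "u \<cdot> d = Idn S (Dom S m)" "u' \<cdot> d = Idn S (Dom S m)"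
      by (rule pullback_lift[OF pb, of "Idn S (Dom S m)" "Idn S (Dom S m)"]) (use a m in simp_all)
    have dm: "Dom S d = Dom S m" using d(2) m by simp
    have "rel R m ((f \<cdot> u) \<cdot> d) ((h \<cdot> u') \<cdot> d)"
      by (rule stab[OF _ _ _ _ _ _ _ rc, where v = "Idn S (Cod S m)"])
        (use d(1,3-5) dm u m fg in \<open>simp_all add: hom_def\<close>)
    thus ?thesis using d(1,3-5) dm u fg by simp
  qed
  ultimately show ?thesis unfolding preorder_family_def using A R by blast
qed

text \<open>By \<open>pow_prd_is_img\<close> the internal quantifier over \<open>r\<close> is a
  quantifier over all families of pairs, and \<open>eval_Image_rel\<close> computes their
  images.\<close>

lemma upo_map_iff:
  assumes A: "A \<in> Obj S" and R: "is_mono S R" "Cod S R = pow S (prd S A A)"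
  shows "upo_map S (A, R) (B, R') h \<longleftrightarrow> h \<in> hom S A B \<and>
    (\<forall>m f g. m \<in> Arr S \<longrightarrow> f \<in> hom S (Dom S m) A \<longrightarrow> g \<in> hom S (Dom S m) A \<longrightarrow>
      rel R m f g \<longrightarrow> rel R' m (h \<cdot> f) (h \<cdot> g))" (is "?L \<longleftrightarrow> ?R")
proof
  assume L: ?L
  hence h: "h \<in> hom S A B" and H: "holds S (\<^bold>\<forall>''r'' \<^bold>: pow S (prd S A A) \<^bold>.
       Var ''r'' \<^bold>\<in> R \<^bold>\<longrightarrow> Image_rel S A B h (Var ''r'') \<^bold>\<in> R')"
    by (simp_all add: upo_map_def)
  show ?R
  proof (intro conjI allI impI h)
    fix m f g assume m: "m \<in> Arr S" and f: "f \<in> hom S (Dom S m) A" and g: "g \<in> hom S (Dom S m) A" and r: "rel R m f g"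
    note fg = homD[OF f] homD[OF g]
    let ?r = "img m (tup S f g)"
    obtain env where env: "env ''r'' = ?r"
      "forces S (Var ''r'' \<^bold>\<in> R) (Cod S m) env \<longrightarrow> forces S (Image_rel S A B h (Var ''r'') \<^bold>\<in> R') (Cod S m) env"
      using holds_forall1_impD[OF H, of ?r] m fg by auto
    show "rel R' m (h \<cdot> f) (h \<cdot> g)"
      using env r eval_Image_rel[where env = env, OF m f g h env(1)] by (simp add: rel_def)
  qed
next
  assume R: ?R
  hence h: "h \<in> hom S A B" by blast
  have "holds S (\<^bold>\<forall>''r'' \<^bold>: pow S (prd S A A) \<^bold>.
       Var ''r'' \<^bold>\<in> R \<^bold>\<longrightarrow> Image_rel S A B h (Var ''r'') \<^bold>\<in> R')"
  proof (rule holds_forall1_impI)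
    fix I env assume e: "env ''r'' \<in> hom S I (pow S (prd S A A))" "forces S (Var ''r'' \<^bold>\<in> R) I env"
    note r = homD[OF e(1)]
    obtain m f g where m: "m \<in> Arr S" and f: "f \<in> hom S (Dom S m) A" and g: "g \<in> hom S (Dom S m) A"
      and mr: "Cod S m = Dom S (env ''r'')" and re: "env ''r'' = img m (tup S f g)"
      using pow_prd_is_img[OF A r(1,3)] by metis
    have "rel R m f g" using e(2) re by (simp add: rel_def)
    hence "rel R' m (h \<cdot> f) (h \<cdot> g)" using R m f g by blast
    thus "forces S (Image_rel S A B h (Var ''r'') \<^bold>\<in> R') I env"
      using eval_Image_rel[where env = env, OF m f g h re] mr r by (simp add: rel_def)
  qed
  thus ?L using h by (simp add: upo_map_def)
qed

end

section \<open>Fibered preorders\<close>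

locale fib_loc = cat_loc +
  fixes X :: "('o, 'a, 'p) fpre"
  assumes fib: "fibered_preorder S X"
begin

lemma le_refl: "I \<in> Obj S \<Longrightarrow> \<phi> \<in> Preds X I \<Longrightarrow> Le X I \<phi> \<phi>"
  using fib unfolding fibered_preorder_def by blast

lemma le_trans: "I \<in> Obj S \<Longrightarrow> \<phi> \<in> Preds X I \<Longrightarrow> \<psi> \<in> Preds X I \<Longrightarrow> \<chi> \<in> Preds X I \<Longrightarrow>
    Le X I \<phi> \<psi> \<Longrightarrow> Le X I \<psi> \<chi> \<Longrightarrow> Le X I \<phi> \<chi>"
  using fib unfolding fibered_preorder_def by blast

lemma rdx_in: "f \<in> Arr S \<Longrightarrow> \<phi> \<in> Preds X (Cod S f) \<Longrightarrow> Rdx X f \<phi> \<in> Preds X (Dom S f)"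
  using fib unfolding fibered_preorder_def by blast

lemma rdx_mono: "f \<in> Arr S \<Longrightarrow> \<phi> \<in> Preds X (Cod S f) \<Longrightarrow> \<psi> \<in> Preds X (Cod S f) \<Longrightarrow> Le X (Cod S f) \<phi> \<psi> \<Longrightarrow>
    Le X (Dom S f) (Rdx X f \<phi>) (Rdx X f \<psi>)"
  using fib unfolding fibered_preorder_def by blast

lemma rdx_idn: "I \<in> Obj S \<Longrightarrow> \<phi> \<in> Preds X I \<Longrightarrow> iso_pred X I (Rdx X (Idn S I) \<phi>) \<phi>"
  using fib unfolding fibered_preorder_def by blast

lemma rdx_cmp: "f \<in> Arr S \<Longrightarrow> g \<in> Arr S \<Longrightarrow> Cod S f = Dom S g \<Longrightarrow> \<phi> \<in> Preds X (Cod S g) \<Longrightarrow>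
    iso_pred X (Dom S f) (Rdx X (g \<cdot> f) \<phi>) (Rdx X f (Rdx X g \<phi>))"
  using fib unfolding fibered_preorder_def by blast

lemma iso_refl: "I \<in> Obj S \<Longrightarrow> \<phi> \<in> Preds X I \<Longrightarrow> iso_pred X I \<phi> \<phi>"
  by (simp add: iso_pred_def le_refl)

lemma iso_sym: "iso_pred X I \<phi> \<psi> \<Longrightarrow> iso_pred X I \<psi> \<phi>"
  by (simp add: iso_pred_def)

lemma iso_trans: "iso_pred X I \<phi> \<psi> \<Longrightarrow> iso_pred X I \<psi> \<chi> \<Longrightarrow> I \<in> Obj S \<Longrightarrow> \<phi> \<in> Preds X I \<Longrightarrow> \<psi> \<in> Preds X I \<Longrightarrow> \<chi> \<in> Preds X I \<Longrightarrow>
    iso_pred X I \<phi> \<chi>"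
  unfolding iso_pred_def by (meson le_trans)

lemma rdx_iso: "f \<in> Arr S \<Longrightarrow> \<phi> \<in> Preds X (Cod S f) \<Longrightarrow> \<psi> \<in> Preds X (Cod S f) \<Longrightarrow> iso_pred X (Cod S f) \<phi> \<psi> \<Longrightarrow>
    iso_pred X (Dom S f) (Rdx X f \<phi>) (Rdx X f \<psi>)"
  by (simp add: iso_pred_def rdx_mono)

lemma le_iso_cong:
  assumes "iso_pred X I \<phi> \<phi>'" "iso_pred X I \<psi> \<psi>'" "I \<in> Obj S"
    "\<phi> \<in> Preds X I" "\<phi>' \<in> Preds X I" "\<psi> \<in> Preds X I" "\<psi>' \<in> Preds X I"
  shows "Le X I \<phi> \<psi> \<longleftrightarrow> Le X I \<phi>' \<psi>'"
  using assms unfolding iso_pred_def by (meson le_trans)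

lemma is_top_iso:
  assumes "is_top X I \<phi>" "iso_pred X I \<phi> \<phi>'" "I \<in> Obj S" "\<phi>' \<in> Preds X I"
  shows "is_top X I \<phi>'"
  using assms unfolding is_top_def iso_pred_def by (meson le_trans)

lemma top_unique: "is_top X I \<phi> \<Longrightarrow> is_top X I \<phi>' \<Longrightarrow> iso_pred X I \<phi> \<phi>'"
  unfolding is_top_def iso_pred_def by blast

lemma is_top_le:
  assumes "is_top X I \<phi>" "Le X I \<phi> \<phi>'" "I \<in> Obj S" "\<phi>' \<in> Preds X I"
  shows "is_top X I \<phi>'"
  using assms unfolding is_top_def by (meson le_trans)

lemma is_meet_iso:
  assumes "is_meet X I \<phi> \<psi> \<mu>" "iso_pred X I \<phi> \<phi>'" "iso_pred X I \<psi> \<psi>'" "iso_pred X I \<mu> \<mu>'" "I \<in> Obj S"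
    "\<phi> \<in> Preds X I" "\<phi>' \<in> Preds X I" "\<psi> \<in> Preds X I" "\<psi>' \<in> Preds X I" "\<mu>' \<in> Preds X I"
  shows "is_meet X I \<phi>' \<psi>' \<mu>'"
proof -
  have m: "\<mu> \<in> Preds X I" "\<forall>\<chi>\<in>Preds X I. Le X I \<chi> \<mu> \<longleftrightarrow> Le X I \<chi> \<phi> \<and> Le X I \<chi> \<psi>"
    using assms(1) unfolding is_meet_def by blast+
  have "Le X I \<chi> \<mu>' \<longleftrightarrow> Le X I \<chi> \<phi>' \<and> Le X I \<chi> \<psi>'" if c: "\<chi> \<in> Preds X I" for \<chi>
    using le_iso_cong[OF iso_refl[OF assms(5) c] assms(2)] le_iso_cong[OF iso_refl[OF assms(5) c] assms(3)]
      le_iso_cong[OF iso_refl[OF assms(5) c] assms(4)] c assms(5-) m by blast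
  thus ?thesis using assms(10) unfolding is_meet_def by blast
qed

lemma meet_unique: "is_meet X I \<phi> \<psi> \<mu> \<Longrightarrow> is_meet X I \<phi> \<psi> \<mu>' \<Longrightarrow> I \<in> Obj S \<Longrightarrow> iso_pred X I \<mu> \<mu>'"
  unfolding is_meet_def iso_pred_def by (meson le_refl)

lemma is_join_iso:
  assumes "is_join X I \<phi> \<psi> \<mu>" "iso_pred X I \<phi> \<phi>'" "iso_pred X I \<psi> \<psi>'" "iso_pred X I \<mu> \<mu>'" "I \<in> Obj S"
    "\<phi> \<in> Preds X I" "\<phi>' \<in> Preds X I" "\<psi> \<in> Preds X I" "\<psi>' \<in> Preds X I" "\<mu>' \<in> Preds X I"
  shows "is_join X I \<phi>' \<psi>' \<mu>'"
proof -
  have m: "\<mu> \<in> Preds X I" "\<forall>\<chi>\<in>Preds X I. Le X I \<mu> \<chi> \<longleftrightarrow> Le X I \<phi> \<chi> \<and> Le X I \<psi> \<chi>"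
    using assms(1) unfolding is_join_def by blast+
  have "Le X I \<mu>' \<chi> \<longleftrightarrow> Le X I \<phi>' \<chi> \<and> Le X I \<psi>' \<chi>" if c: "\<chi> \<in> Preds X I" for \<chi>
    using le_iso_cong[OF assms(2) iso_refl[OF assms(5) c]] le_iso_cong[OF assms(3) iso_refl[OF assms(5) c]]
      le_iso_cong[OF assms(4) iso_refl[OF assms(5) c]] c assms(5-) m by blast
  thus ?thesis using assms(10) unfolding is_join_def by blast
qed

lemma join_unique: "is_join X I \<phi> \<psi> \<mu> \<Longrightarrow> is_join X I \<phi> \<psi> \<mu>' \<Longrightarrow> I \<in> Obj S \<Longrightarrow> iso_pred X I \<mu> \<mu>'"
  unfolding is_join_def iso_pred_def by (meson le_refl)

text \<open>It suffices to find one top and one meet all of whose reindexings have the universal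
  property: reindexing along the identity gives existence, and any other choice is isomorphic to it,
  hence equally stable. The introduction rules for joins and implication work in the same
  way.\<close>

lemma has_finite_meetsI:
  assumes top: "\<And>I. I \<in> Obj S \<Longrightarrow> \<exists>\<tau>\<in>Preds X I. \<forall>f\<in>Arr S. Cod S f = I \<longrightarrow> is_top X (Dom S f) (Rdx X f \<tau>)"
    and meet: "\<And>I \<phi> \<psi>. I \<in> Obj S \<Longrightarrow> \<phi> \<in> Preds X I \<Longrightarrow> \<psi> \<in> Preds X I \<Longrightarrow>
      \<exists>\<mu>\<in>Preds X I. \<forall>f\<in>Arr S. Cod S f = I \<longrightarrow> is_meet X (Dom S f) (Rdx X f \<phi>) (Rdx X f \<psi>) (Rdx X f \<mu>)"
  shows "has_finite_meets S X"
proof -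
  have top': "\<exists>\<tau>. is_top X I \<tau> \<and> (\<forall>f\<in>Arr S. Cod S f = I \<longrightarrow> is_top X (Dom S f) (Rdx X f \<tau>))" if I: "I \<in> Obj S" for I
  proof -
    obtain \<tau> where t: "\<tau>\<in>Preds X I" "\<forall>f\<in>Arr S. Cod S f = I \<longrightarrow> is_top X (Dom S f) (Rdx X f \<tau>)"
      using top[OF I] by blast
    hence "is_top X I (Rdx X (Idn S I) \<tau>)" using I by (metis idn_arr idn_cod idn_dom)
    hence "is_top X I \<tau>" using is_top_iso rdx_idn I t by blast
    thus ?thesis using t by blast
  qed
  have meet': "\<exists>\<mu>. is_meet X I \<phi> \<psi> \<mu> \<and> (\<forall>f\<in>Arr S. Cod S f = I \<longrightarrow> is_meet X (Dom S f) (Rdx X f \<phi>) (Rdx X f \<psi>) (Rdx X f \<mu>))"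
    if I: "I \<in> Obj S" "\<phi> \<in> Preds X I" "\<psi> \<in> Preds X I" for I \<phi> \<psi>
  proof -
    obtain \<mu> where t: "\<mu>\<in>Preds X I" "\<forall>f\<in>Arr S. Cod S f = I \<longrightarrow> is_meet X (Dom S f) (Rdx X f \<phi>) (Rdx X f \<psi>) (Rdx X f \<mu>)"
      using meet[OF I] by blast
    hence "is_meet X I (Rdx X (Idn S I) \<phi>) (Rdx X (Idn S I) \<psi>) (Rdx X (Idn S I) \<mu>)" using I by (metis idn_arr idn_cod idn_dom)
    hence "is_meet X I \<phi> \<psi> \<mu>"
      by (rule is_meet_iso) (use rdx_idn[OF I(1)] I t(1) rdx_in[of "Idn S I"] in simp_all)
    thus ?thesis using t by blast
  qed
  show ?thesis
    unfolding has_finite_meets_def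
  proof (intro conjI ballI allI impI)
    fix f \<tau> assume f: "f \<in> Arr S" "is_top X (Cod S f) \<tau>"
    obtain \<tau>' where t: "is_top X (Cod S f) \<tau>'" "is_top X (Dom S f) (Rdx X f \<tau>')"
      using top'[of "Cod S f"] f by auto
    show "is_top X (Dom S f) (Rdx X f \<tau>)"
      by (rule is_top_iso[OF t(2) rdx_iso]) (use f t top_unique[OF t(1) f(2)] in \<open>auto simp: is_top_def intro: rdx_in\<close>)
  next
    fix f \<phi> \<psi> \<mu> assume f: "f \<in> Arr S" "\<phi> \<in> Preds X (Cod S f)" "\<psi> \<in> Preds X (Cod S f)" "is_meet X (Cod S f) \<phi> \<psi> \<mu>"
    obtain \<mu>' where t: "is_meet X (Cod S f) \<phi> \<psi> \<mu>'" "is_meet X (Dom S f) (Rdx X f \<phi>) (Rdx X f \<psi>) (Rdx X f \<mu>')"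
      using meet'[of "Cod S f" \<phi> \<psi>] f by auto
    have m: "\<mu> \<in> Preds X (Cod S f)" "\<mu>' \<in> Preds X (Cod S f)" using f t by (auto simp: is_meet_def)
    show "is_meet X (Dom S f) (Rdx X f \<phi>) (Rdx X f \<psi>) (Rdx X f \<mu>)"
      by (rule is_meet_iso[OF t(2)])
        (use f(1-3) m rdx_in iso_refl rdx_iso[OF _ _ _ meet_unique[OF t(1) f(4)]] in simp_all)
  qed (use top' meet' in blast)+
qed

lemma has_finite_joinsI:
  assumes bot: "\<And>I. I \<in> Obj S \<Longrightarrow> \<exists>\<beta>\<in>Preds X I. \<forall>f\<in>Arr S. Cod S f = I \<longrightarrow> is_bot X (Dom S f) (Rdx X f \<beta>)"
    and join: "\<And>I \<phi> \<psi>. I \<in> Obj S \<Longrightarrow> \<phi> \<in> Preds X I \<Longrightarrow> \<psi> \<in> Preds X I \<Longrightarrow>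
      \<exists>\<mu>\<in>Preds X I. \<forall>f\<in>Arr S. Cod S f = I \<longrightarrow> is_join X (Dom S f) (Rdx X f \<phi>) (Rdx X f \<psi>) (Rdx X f \<mu>)"
  shows "has_finite_joins S X"
proof -
  have bot_iso: "is_bot X I \<phi>'" if "is_bot X I \<phi>" "iso_pred X I \<phi> \<phi>'" "I \<in> Obj S" "\<phi>' \<in> Preds X I" for I \<phi> \<phi>'
    using that unfolding is_bot_def iso_pred_def by (meson le_trans)
  have bot': "\<exists>\<tau>. is_bot X I \<tau> \<and> (\<forall>f\<in>Arr S. Cod S f = I \<longrightarrow> is_bot X (Dom S f) (Rdx X f \<tau>))" if I: "I \<in> Obj S" for I
  proof -
    obtain \<tau> where t: "\<tau>\<in>Preds X I" "\<forall>f\<in>Arr S. Cod S f = I \<longrightarrow> is_bot X (Dom S f) (Rdx X f \<tau>)"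
      using bot[OF I] by blast
    hence "is_bot X I (Rdx X (Idn S I) \<tau>)" using I by (metis idn_arr idn_cod idn_dom)
    hence "is_bot X I \<tau>" using bot_iso rdx_idn I t by blast
    thus ?thesis using t by blast
  qed
  have join': "\<exists>\<mu>. is_join X I \<phi> \<psi> \<mu> \<and> (\<forall>f\<in>Arr S. Cod S f = I \<longrightarrow> is_join X (Dom S f) (Rdx X f \<phi>) (Rdx X f \<psi>) (Rdx X f \<mu>))"
    if I: "I \<in> Obj S" "\<phi> \<in> Preds X I" "\<psi> \<in> Preds X I" for I \<phi> \<psi>
  proof -
    obtain \<mu> where t: "\<mu>\<in>Preds X I" "\<forall>f\<in>Arr S. Cod S f = I \<longrightarrow> is_join X (Dom S f) (Rdx X f \<phi>) (Rdx X f \<psi>) (Rdx X f \<mu>)"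
      using join[OF I] by blast
    hence "is_join X I (Rdx X (Idn S I) \<phi>) (Rdx X (Idn S I) \<psi>) (Rdx X (Idn S I) \<mu>)" using I by (metis idn_arr idn_cod idn_dom)
    hence "is_join X I \<phi> \<psi> \<mu>"
      by (rule is_join_iso) (use rdx_idn[OF I(1)] I t(1) rdx_in[of "Idn S I"] in simp_all)
    thus ?thesis using t by blast
  qed
  show ?thesis
    unfolding has_finite_joins_def
  proof (intro conjI ballI allI impI)
    fix f \<tau> assume f: "f \<in> Arr S" "is_bot X (Cod S f) \<tau>"
    obtain \<tau>' where t: "is_bot X (Cod S f) \<tau>'" "is_bot X (Dom S f) (Rdx X f \<tau>')"
      using bot'[of "Cod S f"] f by auto
    have "iso_pred X (Cod S f) \<tau>' \<tau>" using f t unfolding is_bot_def iso_pred_def by blast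
    thus "is_bot X (Dom S f) (Rdx X f \<tau>)"
      by (intro bot_iso[OF t(2) rdx_iso]) (use f t in \<open>auto simp: is_bot_def intro: rdx_in\<close>)
  next
    fix f \<phi> \<psi> \<mu> assume f: "f \<in> Arr S" "\<phi> \<in> Preds X (Cod S f)" "\<psi> \<in> Preds X (Cod S f)" "is_join X (Cod S f) \<phi> \<psi> \<mu>"
    obtain \<mu>' where t: "is_join X (Cod S f) \<phi> \<psi> \<mu>'" "is_join X (Dom S f) (Rdx X f \<phi>) (Rdx X f \<psi>) (Rdx X f \<mu>')"
      using join'[of "Cod S f" \<phi> \<psi>] f by auto
    have m: "\<mu> \<in> Preds X (Cod S f)" "\<mu>' \<in> Preds X (Cod S f)" using f t by (auto simp: is_join_def)
    show "is_join X (Dom S f) (Rdx X f \<phi>) (Rdx X f \<psi>) (Rdx X f \<mu>)"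
      by (rule is_join_iso[OF t(2)])
        (use f(1-3) m rdx_in iso_refl rdx_iso[OF _ _ _ join_unique[OF t(1) f(4)]] in simp_all)
  qed (use bot' join' in blast)+
qed

text \<open>In the presence of meets, \<open>ent I \<chi> \<phi> \<psi>\<close> expresses \<open>\<chi> \<and> \<phi> \<le> \<psi>\<close> without choosing a meet.\<close>

definition ent :: "'o \<Rightarrow> 'p \<Rightarrow> 'p \<Rightarrow> 'p \<Rightarrow> bool" where
  "ent I \<chi> \<phi> \<psi> \<longleftrightarrow> (\<forall>\<xi>\<in>Preds X I. Le X I \<xi> \<chi> \<longrightarrow> Le X I \<xi> \<phi> \<longrightarrow> Le X I \<xi> \<psi>)"

lemma ent_meet:
  assumes "is_meet X I \<chi> \<phi> \<mu>" "I \<in> Obj S" "\<chi> \<in> Preds X I" "\<phi> \<in> Preds X I" "\<psi> \<in> Preds X I"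
  shows "ent I \<chi> \<phi> \<psi> \<longleftrightarrow> Le X I \<mu> \<psi>"
  using assms unfolding is_meet_def ent_def by (meson le_refl le_trans)

lemma ent_trans: "ent I \<chi> \<phi> \<psi> \<Longrightarrow> ent I \<chi> \<psi> \<theta> \<Longrightarrow> ent I \<chi> \<phi> \<theta>"
  unfolding ent_def by blast

lemma ent_weaken: "ent I \<chi> \<phi> \<psi> \<Longrightarrow> Le X I \<chi>' \<chi> \<Longrightarrow> I \<in> Obj S \<Longrightarrow> \<chi> \<in> Preds X I \<Longrightarrow> \<chi>' \<in> Preds X I \<Longrightarrow> ent I \<chi>' \<phi> \<psi>"
  unfolding ent_def by (meson le_trans)

lemma ent_le: "Le X I \<phi> \<psi> \<Longrightarrow> I \<in> Obj S \<Longrightarrow> \<phi> \<in> Preds X I \<Longrightarrow> \<psi> \<in> Preds X I \<Longrightarrow> ent I \<chi> \<phi> \<psi>"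
  unfolding ent_def by (meson le_trans)

lemma ent_top: "is_top X I \<chi> \<Longrightarrow> I \<in> Obj S \<Longrightarrow> \<phi> \<in> Preds X I \<Longrightarrow> \<psi> \<in> Preds X I \<Longrightarrow> ent I \<chi> \<phi> \<psi> \<longleftrightarrow> Le X I \<phi> \<psi>"
  unfolding ent_def is_top_def by (meson le_refl le_trans)

lemma ent_iso_cong:
  assumes "iso_pred X I \<chi> \<chi>'" "iso_pred X I \<phi> \<phi>'" "iso_pred X I \<psi> \<psi>'" "I \<in> Obj S"
    "\<chi> \<in> Preds X I" "\<chi>' \<in> Preds X I" "\<phi> \<in> Preds X I" "\<phi>' \<in> Preds X I" "\<psi> \<in> Preds X I" "\<psi>' \<in> Preds X I"
  shows "ent I \<chi> \<phi> \<psi> \<longleftrightarrow> ent I \<chi>' \<phi>' \<psi>'"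
proof -
  have "Le X I \<xi> \<chi> \<longleftrightarrow> Le X I \<xi> \<chi>'" "Le X I \<xi> \<phi> \<longleftrightarrow> Le X I \<xi> \<phi>'" "Le X I \<xi> \<psi> \<longleftrightarrow> Le X I \<xi> \<psi>'"
    if "\<xi> \<in> Preds X I" for \<xi>
    using le_iso_cong[OF iso_refl[OF assms(4) that]] that assms by blast+
  thus ?thesis unfolding ent_def by blast
qed

text \<open>\<open>is_imp\<close> refers to every choice of a meet; when meets exist, all choices
  express the same inequality, namely \<open>ent\<close>.\<close>

lemma is_imp_ent:
  assumes "has_finite_meets S X" "I \<in> Obj S" "\<phi> \<in> Preds X I" "\<psi> \<in> Preds X I"
  shows "is_imp X I \<phi> \<psi> \<iota> \<longleftrightarrow> \<iota> \<in> Preds X I \<and> (\<forall>\<chi>\<in>Preds X I. Le X I \<chi> \<iota> \<longleftrightarrow> ent I \<chi> \<phi> \<psi>)"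
proof -
  have "\<exists>\<mu>. is_meet X I \<chi> \<phi> \<mu>" if "\<chi> \<in> Preds X I" for \<chi>
    using assms that unfolding has_finite_meets_def by blast
  thus ?thesis using ent_meet assms unfolding is_imp_def by meson
qed

text \<open>\<open>ent\<close> quantifies over a whole fibre, so it is not visibly stable under
  reindexing. A meet turns it into a single inequality, which is; the reflection along
  \<open>e\<close> in the next lemma is obtained in the same way.\<close>

lemma ent_rdx:
  assumes "has_finite_meets S X" "f \<in> Arr S" "\<chi> \<in> Preds X (Cod S f)" "\<phi> \<in> Preds X (Cod S f)" "\<psi> \<in> Preds X (Cod S f)"
    "ent (Cod S f) \<chi> \<phi> \<psi>"
  shows "ent (Dom S f) (Rdx X f \<chi>) (Rdx X f \<phi>) (Rdx X f \<psi>)"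
proof -
  obtain \<mu> where m: "is_meet X (Cod S f) \<chi> \<phi> \<mu>"
    using assms cod_obj unfolding has_finite_meets_def by blast
  hence m': "is_meet X (Dom S f) (Rdx X f \<chi>) (Rdx X f \<phi>) (Rdx X f \<mu>)"
    using assms unfolding has_finite_meets_def by blast
  have "Le X (Cod S f) \<mu> \<psi>" using ent_meet[OF m] assms by simp
  hence "Le X (Dom S f) (Rdx X f \<mu>) (Rdx X f \<psi>)"
    using m assms by (intro rdx_mono) (auto simp: is_meet_def)
  thus ?thesis using ent_meet[OF m'] assms rdx_in by simp
qed

lemma ent_reflect:
  assumes "has_finite_meets S X" "reflects_le_along S E X" "E e" "e \<in> Arr S"
    "\<chi> \<in> Preds X (Cod S e)" "\<phi> \<in> Preds X (Cod S e)" "\<psi> \<in> Preds X (Cod S e)"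
    "ent (Dom S e) (Rdx X e \<chi>) (Rdx X e \<phi>) (Rdx X e \<psi>)"
  shows "ent (Cod S e) \<chi> \<phi> \<psi>"
proof -
  obtain \<mu> where m: "is_meet X (Cod S e) \<chi> \<phi> \<mu>"
    using assms cod_obj unfolding has_finite_meets_def by blast
  hence m': "is_meet X (Dom S e) (Rdx X e \<chi>) (Rdx X e \<phi>) (Rdx X e \<mu>)"
    using assms unfolding has_finite_meets_def by blast
  have "Le X (Dom S e) (Rdx X e \<mu>) (Rdx X e \<psi>)" using ent_meet[OF m'] assms rdx_in by simp
  moreover have "\<mu> \<in> Preds X (Cod S e)" using m by (simp add: is_meet_def)
  ultimately have "Le X (Cod S e) \<mu> \<psi>"
    using assms(2-7) unfolding reflects_le_along_def by blast
  thus ?thesis using ent_meet[OF m] assms by simp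
qed

lemma imp_unique:
  assumes "has_finite_meets S X" "I \<in> Obj S" "\<phi> \<in> Preds X I" "\<psi> \<in> Preds X I" "is_imp X I \<phi> \<psi> \<iota>" "is_imp X I \<phi> \<psi> \<iota>'"
  shows "iso_pred X I \<iota> \<iota>'"
  using assms(5,6) unfolding is_imp_ent[OF assms(1-4)] iso_pred_def using le_refl assms(2) by blast

lemma has_implicationI:
  assumes fm: "has_finite_meets S X"
    and imp: "\<And>I \<phi> \<psi>. I \<in> Obj S \<Longrightarrow> \<phi> \<in> Preds X I \<Longrightarrow> \<psi> \<in> Preds X I \<Longrightarrow>
      \<exists>\<iota>\<in>Preds X I. \<forall>f\<in>Arr S. Cod S f = I \<longrightarrow> (\<forall>\<chi>\<in>Preds X (Dom S f).
        Le X (Dom S f) \<chi> (Rdx X f \<iota>) \<longleftrightarrow> ent (Dom S f) \<chi> (Rdx X f \<phi>) (Rdx X f \<psi>))"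
  shows "has_implication S X"
proof -
  have imp': "\<exists>\<iota>. is_imp X I \<phi> \<psi> \<iota> \<and> (\<forall>f\<in>Arr S. Cod S f = I \<longrightarrow> is_imp X (Dom S f) (Rdx X f \<phi>) (Rdx X f \<psi>) (Rdx X f \<iota>))"
    if I: "I \<in> Obj S" "\<phi> \<in> Preds X I" "\<psi> \<in> Preds X I" for I \<phi> \<psi>
  proof -
    obtain \<iota> where i: "\<iota>\<in>Preds X I" "\<forall>f\<in>Arr S. Cod S f = I \<longrightarrow> (\<forall>\<chi>\<in>Preds X (Dom S f).
        Le X (Dom S f) \<chi> (Rdx X f \<iota>) \<longleftrightarrow> ent (Dom S f) \<chi> (Rdx X f \<phi>) (Rdx X f \<psi>))"
      using imp[OF I] by blast
    have 1: "is_imp X (Dom S f) (Rdx X f \<phi>) (Rdx X f \<psi>) (Rdx X f \<iota>)" if "f \<in> Arr S" "Cod S f = I" for f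
      using is_imp_ent[OF fm, of "Dom S f" "Rdx X f \<phi>" "Rdx X f \<psi>" "Rdx X f \<iota>"] that I i rdx_in by simp
    have "Le X I \<chi> \<iota> \<longleftrightarrow> ent I \<chi> \<phi> \<psi>" if c: "\<chi> \<in> Preds X I" for \<chi>
    proof -
      note r = rdx_in[of "Idn S I"] rdx_idn[OF I(1)]
      have "Le X I \<chi> (Rdx X (Idn S I) \<iota>) \<longleftrightarrow> ent I \<chi> (Rdx X (Idn S I) \<phi>) (Rdx X (Idn S I) \<psi>)"
        using i(2)[rule_format, of "Idn S I" \<chi>] I c by simp
      moreover have "Le X I \<chi> (Rdx X (Idn S I) \<iota>) \<longleftrightarrow> Le X I \<chi> \<iota>"
        by (rule le_iso_cong) (use I i c r iso_refl in simp_all)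
      moreover have "ent I \<chi> (Rdx X (Idn S I) \<phi>) (Rdx X (Idn S I) \<psi>) \<longleftrightarrow> ent I \<chi> \<phi> \<psi>"
        by (rule ent_iso_cong) (use I i c r iso_refl in simp_all)
      ultimately show ?thesis by simp
    qed
    hence "is_imp X I \<phi> \<psi> \<iota>" using is_imp_ent[OF fm I] i by simp
    thus ?thesis using 1 by blast
  qed
  show ?thesis
    unfolding has_implication_def
  proof (intro conjI ballI allI impI)
    fix f \<phi> \<psi> \<iota> assume f: "f \<in> Arr S" "\<phi> \<in> Preds X (Cod S f)" "\<psi> \<in> Preds X (Cod S f)" "is_imp X (Cod S f) \<phi> \<psi> \<iota>"
    obtain \<iota>' where t: "is_imp X (Cod S f) \<phi> \<psi> \<iota>'" "is_imp X (Dom S f) (Rdx X f \<phi>) (Rdx X f \<psi>) (Rdx X f \<iota>')"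
      using imp'[of "Cod S f" \<phi> \<psi>] f by auto
    have m: "\<iota> \<in> Preds X (Cod S f)" "\<iota>' \<in> Preds X (Cod S f)" using f t by (auto simp: is_imp_def)
    have iso: "iso_pred X (Dom S f) (Rdx X f \<iota>') (Rdx X f \<iota>)"
      by (rule rdx_iso) (use f m imp_unique[OF fm _ _ _ t(1) f(4)] in simp_all)
    have "Le X (Dom S f) \<chi> (Rdx X f \<iota>') \<longleftrightarrow> Le X (Dom S f) \<chi> (Rdx X f \<iota>)" if "\<chi> \<in> Preds X (Dom S f)" for \<chi>
      by (rule le_iso_cong) (use iso that f(1) m rdx_in iso_refl in simp_all)
    thus "is_imp X (Dom S f) (Rdx X f \<phi>) (Rdx X f \<psi>) (Rdx X f \<iota>)"
      using t(2) f(1) m rdx_in unfolding is_imp_def by blast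
  qed (use imp' in blast)+
qed

text \<open>The Beck--Chevalley condition for one pullback of each cospan implies it for all of them:
  the comparison maps in both directions suffice.\<close>

lemma has_forallI:
  assumes "\<And>f \<phi>. f \<in> Arr S \<Longrightarrow> W f \<Longrightarrow> \<phi> \<in> Preds X (Dom S f) \<Longrightarrow>
    \<exists>\<chi>. is_forall S X f \<phi> \<chi> \<and> (\<forall>g\<in>Arr S. Cod S g = Cod S f \<longrightarrow>
       (\<exists>g' f'. is_pullback S f g g' f' \<and> is_forall S X f' (Rdx X g' \<phi>) (Rdx X g \<chi>)))"
  shows "has_forall S W X"
  unfolding has_forall_def
proof (intro conjI ballI allI impI)
  fix f \<phi> assume "f \<in> Arr S" "W f" "\<phi> \<in> Preds X (Dom S f)"
  thus "\<exists>\<chi>. is_forall S X f \<phi> \<chi>" using assms by blast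
next
  fix f g f' g' \<phi> \<chi> assume h: "W f" "is_pullback S f g g' f'" "\<phi> \<in> Preds X (Dom S f)" "is_forall S X f \<phi> \<chi>"
  note pD = pullbackD[OF h(2)]
  obtain \<chi>0 g0 f0 where 0: "is_forall S X f \<phi> \<chi>0" "is_pullback S f g g0 f0" "is_forall S X f0 (Rdx X g0 \<phi>) (Rdx X g \<chi>0)"
    using assms[of f \<phi>] pD h by metis
  note p0 = pullbackD[OF 0(2)]
  have c: "\<chi> \<in> Preds X (Cod S f)" "\<chi>0 \<in> Preds X (Cod S f)" using h(4) 0(1) by (simp_all add: is_forall_def)
  have "iso_pred X (Cod S f) \<chi>0 \<chi>"
    using h(4) 0(1) c le_refl[OF cod_obj[OF pD(1)]] unfolding is_forall_def iso_pred_def by blast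
  hence i: "iso_pred X (Dom S g) (Rdx X g \<chi>0) (Rdx X g \<chi>)"
    by (intro rdx_iso) (use pD c in simp_all)
  obtain k where k: "k \<in> Arr S" "Dom S k = Dom S g0" "Cod S k = Dom S g'" "g' \<cdot> k = g0" "f' \<cdot> k = f0"
    using pullback_cong[OF h(2) 0(2)] by blast
  obtain l where l: "l \<in> Arr S" "Dom S l = Dom S g'" "Cod S l = Dom S g0" "g0 \<cdot> l = g'" "f0 \<cdot> l = f'"
    using pullback_cong[OF 0(2) h(2)] by blast
  have gc: "Rdx X g \<chi> \<in> Preds X (Dom S g)" "Rdx X g \<chi>0 \<in> Preds X (Dom S g)" using rdx_in[of g] pD c by simp_all
  have fc: "Cod S f0 = Dom S g" "Cod S f' = Dom S g" using pD p0 by simp_all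
  \<comment> \<open>The inequality over one pullback cone is reindexed along the comparison map
    \<open>r\<close> to the other cone.\<close>
  have step: "Le X (Dom S q) (Rdx X q \<psi>) (Rdx X p \<phi>)"
    if "q' \<in> Arr S" "p' \<in> Arr S" "Cod S q' = Dom S g" "Cod S p' = Dom S f" "Dom S p' = Dom S q'"
      "r \<in> Arr S" "Cod S r = Dom S q'" "q' \<cdot> r = q" "p' \<cdot> r = p" "\<psi> \<in> Preds X (Dom S g)"
      "Le X (Dom S q') (Rdx X q' \<psi>) (Rdx X p' \<phi>)" for q' p' r q p \<psi>
  proof -
    have d: "Dom S q = Dom S r" using that by auto
    have e: "Rdx X q' \<psi> \<in> Preds X (Dom S q')" "Rdx X p' \<phi> \<in> Preds X (Dom S q')"
      "Rdx X q \<psi> \<in> Preds X (Dom S r)" "Rdx X p \<phi> \<in> Preds X (Dom S r)"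
      using that h(3) rdx_in[of q' \<psi>] rdx_in[of p' \<phi>] rdx_in[of "q' \<cdot> r" \<psi>] rdx_in[of "p' \<cdot> r" \<phi>] by auto
    have "Le X (Dom S r) (Rdx X r (Rdx X q' \<psi>)) (Rdx X r (Rdx X p' \<phi>))"
      using rdx_mono[of r "Rdx X q' \<psi>" "Rdx X p' \<phi>"] that e by simp
    moreover have "iso_pred X (Dom S r) (Rdx X q \<psi>) (Rdx X r (Rdx X q' \<psi>))"
      using rdx_cmp[of r q' \<psi>] that by simp
    moreover have "iso_pred X (Dom S r) (Rdx X p \<phi>) (Rdx X r (Rdx X p' \<phi>))"
      using rdx_cmp[of r p' \<phi>] that h(3) by simp
    ultimately show ?thesis
      using le_iso_cong[of "Dom S r" "Rdx X q \<psi>" "Rdx X r (Rdx X q' \<psi>)" "Rdx X p \<phi>" "Rdx X r (Rdx X p' \<phi>)"]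
        e rdx_in[of r "Rdx X q' \<psi>"] rdx_in[of r "Rdx X p' \<phi>"] that d by simp
  qed
  have "Le X (Dom S g) \<psi> (Rdx X g \<chi>) \<longleftrightarrow> Le X (Dom S f') (Rdx X f' \<psi>) (Rdx X g' \<phi>)" if ps: "\<psi> \<in> Preds X (Dom S g)" for \<psi>
  proof -
    have "Le X (Dom S g) \<psi> (Rdx X g \<chi>) \<longleftrightarrow> Le X (Dom S g) \<psi> (Rdx X g \<chi>0)"
      by (rule le_iso_cong[OF iso_refl iso_sym[OF i]]) (use ps gc pD in simp_all)
    also have "\<dots> \<longleftrightarrow> Le X (Dom S f0) (Rdx X f0 \<psi>) (Rdx X g0 \<phi>)"
      using 0(3) fc ps by (simp add: is_forall_def)
    also have "\<dots> \<longleftrightarrow> Le X (Dom S f') (Rdx X f' \<psi>) (Rdx X g' \<phi>)"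
      using step[of f0 g0 l f' g' \<psi>] step[of f' g' k f0 g0 \<psi>] k l pD p0 fc ps by metis
    finally show ?thesis .
  qed
  thus "is_forall S X f' (Rdx X g' \<phi>) (Rdx X g \<chi>)" using fc gc by (simp add: is_forall_def)
qed

end

section \<open>Equivalences of fibered preorders\<close>

lemma fib_map_in: "fib_map C X Y F \<Longrightarrow> I \<in> Obj C \<Longrightarrow> \<phi> \<in> Preds X I \<Longrightarrow> F I \<phi> \<in> Preds Y I"
  unfolding fib_map_def by blast

text \<open>The inverse is chosen by essential surjectivity. Its monotonicity and naturality are
  checked after applying \<open>F\<close>, which reflects the order.\<close>

lemma fib_equivI:
  assumes X: "fib_loc C X" and Y: "fib_loc C Y"
    and F: "\<And>I \<phi>. I \<in> Obj C \<Longrightarrow> \<phi> \<in> Preds X I \<Longrightarrow> F I \<phi> \<in> Preds Y I"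
    and ff: "\<And>I \<phi> \<psi>. I \<in> Obj C \<Longrightarrow> \<phi> \<in> Preds X I \<Longrightarrow> \<psi> \<in> Preds X I \<Longrightarrow> Le X I \<phi> \<psi> \<longleftrightarrow> Le Y I (F I \<phi>) (F I \<psi>)"
    and nat: "\<And>f \<phi>. f \<in> Arr C \<Longrightarrow> \<phi> \<in> Preds X (Cod C f) \<Longrightarrow>
      iso_pred Y (Dom C f) (F (Dom C f) (Rdx X f \<phi>)) (Rdx Y f (F (Cod C f) \<phi>))"
    and ess: "\<And>I \<psi>. I \<in> Obj C \<Longrightarrow> \<psi> \<in> Preds Y I \<Longrightarrow> \<exists>\<phi>\<in>Preds X I. iso_pred Y I (F I \<phi>) \<psi>"
  shows "\<exists>G. fib_equivalence C X Y F G"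
proof -
  interpret X: fib_loc C X by fact
  interpret Y: fib_loc C Y by fact
  define G where "G = (\<lambda>I \<psi>. SOME \<phi>. \<phi> \<in> Preds X I \<and> iso_pred Y I (F I \<phi>) \<psi>)"
  have G: "G I \<psi> \<in> Preds X I \<and> iso_pred Y I (F I (G I \<psi>)) \<psi>" if "I \<in> Obj C" "\<psi> \<in> Preds Y I" for I \<psi>
  proof -
    have "\<exists>\<phi>. \<phi> \<in> Preds X I \<and> iso_pred Y I (F I \<phi>) \<psi>" using ess[OF that] by blast
    thus ?thesis unfolding G_def by (rule someI_ex)
  qed
  have ffi: "iso_pred X I \<phi> \<psi> \<longleftrightarrow> iso_pred Y I (F I \<phi>) (F I \<psi>)" if "I \<in> Obj C" "\<phi> \<in> Preds X I" "\<psi> \<in> Preds X I" for I \<phi> \<psi>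
    using ff that unfolding iso_pred_def by blast
  have "fib_map C X Y F" using F ff nat unfolding fib_map_def by blast
  moreover have "fib_map C Y X G"
    unfolding fib_map_def
  proof (intro conjI ballI impI)
    fix I \<phi> \<psi> assume h: "I \<in> Obj C" "\<phi> \<in> Preds Y I" "\<psi> \<in> Preds Y I" "Le Y I \<phi> \<psi>"
    have "Le Y I (F I (G I \<phi>)) (F I (G I \<psi>)) \<longleftrightarrow> Le Y I \<phi> \<psi>"
      by (rule Y.le_iso_cong) (use G F h in blast)+
    thus "Le X I (G I \<phi>) (G I \<psi>)" using ff G h by blast
  next
    fix f \<phi> assume f: "f \<in> Arr C" "\<phi> \<in> Preds Y (Cod C f)"
    have o: "Dom C f \<in> Obj C" "Cod C f \<in> Obj C" using f by simp_all
    note G1 = G[OF o(2) f(2)] and G2 = G[OF o(1) Y.rdx_in[OF f]]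
    have "iso_pred Y (Dom C f) (F (Dom C f) (Rdx X f (G (Cod C f) \<phi>))) (Rdx Y f (F (Cod C f) (G (Cod C f) \<phi>)))"
      using nat f G1 by blast
    moreover have "iso_pred Y (Dom C f) (Rdx Y f (F (Cod C f) (G (Cod C f) \<phi>))) (Rdx Y f \<phi>)"
      using Y.rdx_iso f G1 F o by blast
    ultimately have "iso_pred Y (Dom C f) (F (Dom C f) (G (Dom C f) (Rdx Y f \<phi>))) (F (Dom C f) (Rdx X f (G (Cod C f) \<phi>)))"
      using Y.iso_trans Y.iso_sym G1 G2 o F X.rdx_in Y.rdx_in f by meson
    thus "iso_pred X (Dom C f) (G (Dom C f) (Rdx Y f \<phi>)) (Rdx X f (G (Cod C f) \<phi>))"
      using ffi[OF o(1)] G1 G2 X.rdx_in f by blast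
  qed (use G in blast)
  moreover have "iso_pred X I (G I (F I \<phi>)) \<phi>" if "I \<in> Obj C" "\<phi> \<in> Preds X I" for I \<phi>
    using ffi G F that by blast
  ultimately show ?thesis using G unfolding fib_equivalence_def by blast
qed

lemma fib_equivalence_le:
  assumes "fib_loc C X" "fib_loc C Y" "fib_equivalence C X Y F G" "I \<in> Obj C" "\<phi> \<in> Preds X I" "\<psi> \<in> Preds X I"
  shows "Le X I \<phi> \<psi> \<longleftrightarrow> Le Y I (F I \<phi>) (F I \<psi>)"
proof
  interpret X: fib_loc C X by fact
  have F: "fib_map C X Y F" "fib_map C Y X G" and i: "\<forall>I\<in>Obj C. \<forall>\<phi>\<in>Preds X I. iso_pred X I (G I (F I \<phi>)) \<phi>"
    using assms(3) unfolding fib_equivalence_def by blast+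
  {
    assume "Le X I \<phi> \<psi>"
    thus "Le Y I (F I \<phi>) (F I \<psi>)" using F(1) assms(4-) unfolding fib_map_def by blast
  next
    assume l: "Le Y I (F I \<phi>) (F I \<psi>)"
    have FP: "F I \<phi> \<in> Preds Y I" "F I \<psi> \<in> Preds Y I" using F(1) assms(4-) unfolding fib_map_def by blast+
    hence GP: "G I (F I \<phi>) \<in> Preds X I" "G I (F I \<psi>) \<in> Preds X I" using F(2) assms(4) unfolding fib_map_def by blast+
    have "Le X I (G I (F I \<phi>)) (G I (F I \<psi>))" using F(2) l FP assms(4) unfolding fib_map_def by blast
    thus "Le X I \<phi> \<psi>" using X.le_iso_cong i assms(4-) GP by blast
  }
qed

lemma fib_equivalence_sym: "fib_equivalence C X Y F G \<Longrightarrow> fib_equivalence C Y X G F"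
  unfolding fib_equivalence_def by blast

lemma fib_map_comp:
  assumes "fib_loc C Z" "fib_map C X Y F" "fib_map C Y Z H" "fib_loc C X" "fib_loc C Y"
  shows "fib_map C X Z (\<lambda>I \<phi>. H I (F I \<phi>))"
proof -
  interpret Z: fib_loc C Z by fact
  interpret X: fib_loc C X by fact
  interpret Y: fib_loc C Y by fact
  show ?thesis
    unfolding fib_map_def
  proof (intro conjI ballI impI)
    fix f \<phi> assume f: "f \<in> Arr C" "\<phi> \<in> Preds X (Cod C f)"
    have o: "Dom C f \<in> Obj C" "Cod C f \<in> Obj C" using f by simp_all
    have FP: "F I \<psi> \<in> Preds Y I" if "I \<in> Obj C" "\<psi> \<in> Preds X I" for I \<psi> using assms(2) that unfolding fib_map_def by blast
    have HP: "H I \<psi> \<in> Preds Z I" if "I \<in> Obj C" "\<psi> \<in> Preds Y I" for I \<psi> using assms(3) that unfolding fib_map_def by blast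
    have "iso_pred Y (Dom C f) (F (Dom C f) (Rdx X f \<phi>)) (Rdx Y f (F (Cod C f) \<phi>))"
      using assms(2) f unfolding fib_map_def by blast
    hence 1: "iso_pred Z (Dom C f) (H (Dom C f) (F (Dom C f) (Rdx X f \<phi>))) (H (Dom C f) (Rdx Y f (F (Cod C f) \<phi>)))"
      using assms(3) FP o X.rdx_in Y.rdx_in f unfolding fib_map_def iso_pred_def by blast
    have 2: "iso_pred Z (Dom C f) (H (Dom C f) (Rdx Y f (F (Cod C f) \<phi>))) (Rdx Z f (H (Cod C f) (F (Cod C f) \<phi>)))"
      using assms(3) FP f o unfolding fib_map_def by blast
    show "iso_pred Z (Dom C f) (H (Dom C f) (F (Dom C f) (Rdx X f \<phi>))) (Rdx Z f (H (Cod C f) (F (Cod C f) \<phi>)))"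
      by (rule Z.iso_trans[OF 1 2]) (use FP HP o X.rdx_in Y.rdx_in Z.rdx_in f in blast)+
  qed (use assms in \<open>auto simp: fib_map_def\<close>)
qed

lemma fib_equivalence_trans:
  assumes "fib_equivalence C X Y F G" "fib_equivalence C Y Z H K" "fib_loc C X" "fib_loc C Y" "fib_loc C Z"
  shows "fib_equivalence C X Z (\<lambda>I \<phi>. H I (F I \<phi>)) (\<lambda>I \<phi>. G I (K I \<phi>))"
proof -
  interpret Z: fib_loc C Z by fact
  interpret X: fib_loc C X by fact
  have m: "fib_map C X Y F" "fib_map C Y X G" "fib_map C Y Z H" "fib_map C Z Y K"
    and i: "\<forall>I\<in>Obj C. \<forall>\<phi>\<in>Preds X I. iso_pred X I (G I (F I \<phi>)) \<phi>" "\<forall>I\<in>Obj C. \<forall>\<phi>\<in>Preds Y I. iso_pred Y I (F I (G I \<phi>)) \<phi>"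
      "\<forall>I\<in>Obj C. \<forall>\<phi>\<in>Preds Y I. iso_pred Y I (K I (H I \<phi>)) \<phi>" "\<forall>I\<in>Obj C. \<forall>\<phi>\<in>Preds Z I. iso_pred Z I (H I (K I \<phi>)) \<phi>"
    using assms(1,2) unfolding fib_equivalence_def by blast+
  have P: "\<And>I \<phi>. I \<in> Obj C \<Longrightarrow> \<phi> \<in> Preds X I \<Longrightarrow> F I \<phi> \<in> Preds Y I" "\<And>I \<phi>. I \<in> Obj C \<Longrightarrow> \<phi> \<in> Preds Y I \<Longrightarrow> G I \<phi> \<in> Preds X I"
    "\<And>I \<phi>. I \<in> Obj C \<Longrightarrow> \<phi> \<in> Preds Y I \<Longrightarrow> H I \<phi> \<in> Preds Z I" "\<And>I \<phi>. I \<in> Obj C \<Longrightarrow> \<phi> \<in> Preds Z I \<Longrightarrow> K I \<phi> \<in> Preds Y I"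
    using fib_map_in[OF m(1)] fib_map_in[OF m(2)] fib_map_in[OF m(3)] fib_map_in[OF m(4)] by blast+
  have c: "iso_pred X I (G I \<phi>) (G I \<psi>)" if "I \<in> Obj C" "\<phi> \<in> Preds Y I" "\<psi> \<in> Preds Y I" "iso_pred Y I \<phi> \<psi>" for I \<phi> \<psi>
    using m(2) that unfolding fib_map_def iso_pred_def by blast
  have d: "iso_pred Z I (H I \<phi>) (H I \<psi>)" if "I \<in> Obj C" "\<phi> \<in> Preds Y I" "\<psi> \<in> Preds Y I" "iso_pred Y I \<phi> \<psi>" for I \<phi> \<psi>
    using m(3) that unfolding fib_map_def iso_pred_def by blast
  have "iso_pred X I (G I (K I (H I (F I \<phi>)))) \<phi>" if h: "I \<in> Obj C" "\<phi> \<in> Preds X I" for I \<phi>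
  proof (rule X.iso_trans[of I _ "G I (F I \<phi>)"])
    have FP: "F I \<phi> \<in> Preds Y I" using P(1) h .
    have KP: "K I (H I (F I \<phi>)) \<in> Preds Y I" using P(3,4) h(1) FP by simp
    show "iso_pred X I (G I (K I (H I (F I \<phi>)))) (G I (F I \<phi>))"
      by (rule c[OF h(1) KP FP]) (use i(3) h(1) FP in simp)
    show "G I (K I (H I (F I \<phi>))) \<in> Preds X I" "G I (F I \<phi>) \<in> Preds X I" using P(2) KP FP h(1) by simp_all
  qed (use h i(1) in simp_all)
  moreover have "iso_pred Z I (H I (F I (G I (K I \<phi>)))) \<phi>" if h: "I \<in> Obj C" "\<phi> \<in> Preds Z I" for I \<phi>
  proof (rule Z.iso_trans[of I _ "H I (K I \<phi>)"])
    have KP: "K I \<phi> \<in> Preds Y I" using P(4) h .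
    have FP: "F I (G I (K I \<phi>)) \<in> Preds Y I" using P(1,2) h(1) KP by simp
    show "iso_pred Z I (H I (F I (G I (K I \<phi>)))) (H I (K I \<phi>))"
      by (rule d[OF h(1) FP KP]) (use i(2) h(1) KP in simp)
    show "H I (F I (G I (K I \<phi>))) \<in> Preds Z I" "H I (K I \<phi>) \<in> Preds Z I" using P(3) KP FP h(1) by simp_all
  qed (use h i(4) in simp_all)
  moreover have "fib_map C X Z (\<lambda>I \<phi>. H I (F I \<phi>))" "fib_map C Z X (\<lambda>I \<phi>. G I (K I \<phi>))"
    using fib_map_comp m assms(3-5) by blast+
  ultimately show ?thesis unfolding fib_equivalence_def by blast
qed

section \<open>From uniform preorders to fibered triposes\<close>

lemma arrow_cat_simps [simp]:
  "Obj (arrow_cat C) = Arr C"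
  "Dom (arrow_cat C) (m, m', u, v) = m"
  "Cod (arrow_cat C) (m, m', u, v) = m'"
  "Idn (arrow_cat C) m = (m, m, Idn C (Dom C m), Idn C (Cod C m))"
  "Cmp (arrow_cat C) (m', m'', u', v') (m, k, u, v) = (m, m'', Cmp C u' u, Cmp C v' v)"
  by (simp_all add: arrow_cat_def)

lemma arrow_cat_Arr:
  "(m, m', u, v) \<in> Arr (arrow_cat C) \<longleftrightarrow> m \<in> Arr C \<and> m' \<in> Arr C \<and>
     u \<in> hom C (Dom C m) (Dom C m') \<and> v \<in> hom C (Cod C m) (Cod C m') \<and> Cmp C m' u = Cmp C v m"
  by (simp add: arrow_cat_def)

lemma vertical_iff [simp]: "vertical C (m, m', u, v) \<longleftrightarrow> Cod C m = Cod C m' \<and> v = Idn C (Cod C m)"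
  by (simp add: vertical_def)

context cat_loc
begin

lemma sqI:
  assumes "m \<in> Arr S" "m' \<in> Arr S" "u \<in> Arr S" "v \<in> Arr S" "Dom S u = Dom S m" "Cod S u = Dom S m'"
    "Dom S v = Cod S m" "Cod S v = Cod S m'" "m' \<cdot> u = v \<cdot> m"
  shows "(m, m', u, v) \<in> Arr (arrow_cat S)"
  using assms by (simp add: arrow_cat_Arr hom_def)

lemma sqD:
  assumes "(m, m', u, v) \<in> Arr (arrow_cat S)"
  shows "m \<in> Arr S" "m' \<in> Arr S" "u \<in> Arr S" "v \<in> Arr S" "Dom S u = Dom S m" "Cod S u = Dom S m'"
    "Dom S v = Cod S m" "Cod S v = Cod S m'" "m' \<cdot> u = v \<cdot> m"
  using assms by (simp_all add: arrow_cat_Arr hom_def)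

lemma sq_cmp:
  assumes "(m, m', u, v) \<in> Arr (arrow_cat S)" "(m', m'', u', v') \<in> Arr (arrow_cat S)"
  shows "(m, m'', u' \<cdot> u, v' \<cdot> v) \<in> Arr (arrow_cat S)"
proof -
  note a = sqD[OF assms(1)] and b = sqD[OF assms(2)]
  have "m'' \<cdot> (u' \<cdot> u) = v' \<cdot> (m' \<cdot> u)" by (rule cmp_extend) (use a(1-8) b in simp_all)
  also have "\<dots> = v' \<cdot> (v \<cdot> m)" using a(9) by simp
  also have "\<dots> = (v' \<cdot> v) \<cdot> m" using a(1-8) b(1-8) by simp
  finally show ?thesis by (intro sqI) (use a(1-8) b(1-8) in simp_all)
qed

lemma sq_idn: "m \<in> Arr S \<Longrightarrow> (m, m, Idn S (Dom S m), Idn S (Cod S m)) \<in> Arr (arrow_cat S)"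
  by (rule sqI) simp_all

lemma arrow_category: "category (arrow_cat S)"
  unfolding category_def
proof (intro conjI ballI impI)
  fix f assume "f \<in> Arr (arrow_cat S)"
  moreover obtain m m' u v where f: "f = (m, m', u, v)" by (cases f)
  ultimately have "(m, m', u, v) \<in> Arr (arrow_cat S)" by simp
  note a = sqD[OF this]
  show "Dom (arrow_cat S) f \<in> Obj (arrow_cat S)" "Cod (arrow_cat S) f \<in> Obj (arrow_cat S)"
    using a f by simp_all
  show "f \<cdot>\<^bsub>arrow_cat S\<^esub> Idn (arrow_cat S) (Dom (arrow_cat S) f) = f"
    "Idn (arrow_cat S) (Cod (arrow_cat S) f) \<cdot>\<^bsub>arrow_cat S\<^esub> f = f"
    using a(1-8) f by simp_all
next
  fix m assume "m \<in> Obj (arrow_cat S)"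
  thus "Idn (arrow_cat S) m \<in> hom (arrow_cat S) m m" using sq_idn by (simp add: hom_def)
next
  fix f g assume h: "f \<in> Arr (arrow_cat S)" "g \<in> Arr (arrow_cat S)" "Cod (arrow_cat S) f = Dom (arrow_cat S) g"
  obtain m m' u v where f: "f = (m, m', u, v)" by (cases f)
  obtain n n' w z where g: "g = (n, n', w, z)" by (cases g)
  show "g \<cdot>\<^bsub>arrow_cat S\<^esub> f \<in> hom (arrow_cat S) (Dom (arrow_cat S) f) (Cod (arrow_cat S) g)"
    using sq_cmp[of m m' u v n' w z] h f g by (simp add: hom_def)
next
  fix f g k assume h: "f \<in> Arr (arrow_cat S)" "g \<in> Arr (arrow_cat S)" "k \<in> Arr (arrow_cat S)"
    "Cod (arrow_cat S) f = Dom (arrow_cat S) g" "Cod (arrow_cat S) g = Dom (arrow_cat S) k"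
  obtain m m' u v where f: "f = (m, m', u, v)" by (cases f)
  obtain n n' w z where g: "g = (n, n', w, z)" by (cases g)
  obtain l l' x y where k: "k = (l, l', x, y)" by (cases k)
  have *: "(m, m', u, v) \<in> Arr (arrow_cat S)" "(n, n', w, z) \<in> Arr (arrow_cat S)" "(l, l', x, y) \<in> Arr (arrow_cat S)"
    "m' = n" "n' = l" using h f g k by simp_all
  note a = sqD(1-8)[OF *(1)] sqD(1-8)[OF *(2)] sqD(1-8)[OF *(3)]
  show "k \<cdot>\<^bsub>arrow_cat S\<^esub> (g \<cdot>\<^bsub>arrow_cat S\<^esub> f) = (k \<cdot>\<^bsub>arrow_cat S\<^esub> g) \<cdot>\<^bsub>arrow_cat S\<^esub> f"
    using a *(4,5) f g k by simp
qed

lemma arrow_loc: "cat_loc (arrow_cat S)"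
  by (rule cat_loc.intro) (rule arrow_category)

end

context topos_loc
begin

section \<open>The structure carried by \<open>ufam\<close>\<close>

lemma ufam_fib:
  assumes "preorder_family A R"
  shows "fib_loc (arrow_cat S) (ufam S (A, R))"
proof -
  have A: "A \<in> Obj S" and R: "is_mono S R" "Cod S R = pow S (prd S A A)"
    and refl: "\<And>m f. m \<in> Arr S \<Longrightarrow> f \<in> hom S (Dom S m) A \<Longrightarrow> rel R m f f"
    and trans: "\<And>m f g h. m \<in> Arr S \<Longrightarrow> f \<in> hom S (Dom S m) A \<Longrightarrow> g \<in> hom S (Dom S m) A \<Longrightarrow> h \<in> hom S (Dom S m) A \<Longrightarrow>
        rel R m f g \<Longrightarrow> rel R m g h \<Longrightarrow> rel R m f h"
    and stab: "\<And>m f g m' u v. m \<in> Arr S \<Longrightarrow> f \<in> hom S (Dom S m) A \<Longrightarrow> g \<in> hom S (Dom S m) A \<Longrightarrow>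
        m' \<in> Arr S \<Longrightarrow> u \<in> hom S (Dom S m') (Dom S m) \<Longrightarrow> v \<in> hom S (Cod S m') (Cod S m) \<Longrightarrow>
        m \<cdot> u = v \<cdot> m' \<Longrightarrow> rel R m f g \<Longrightarrow> rel R m' (f \<cdot> u) (g \<cdot> u)"
    using assms unfolding preorder_family_def by metis+
  note Le = ufam_Le[OF _ _ _ R]
  have "fibered_preorder (arrow_cat S) (ufam S (A, R))"
    unfolding fibered_preorder_def
  proof (intro conjI ballI impI)
    fix m f assume "m \<in> Obj (arrow_cat S)" "f \<in> Preds (ufam S (A, R)) m"
    thus "Le (ufam S (A, R)) m f f" using Le refl by simp
  next
    fix m f g h assume "m \<in> Obj (arrow_cat S)" "f \<in> Preds (ufam S (A, R)) m" "g \<in> Preds (ufam S (A, R)) m"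
      "h \<in> Preds (ufam S (A, R)) m" "Le (ufam S (A, R)) m f g" "Le (ufam S (A, R)) m g h"
    thus "Le (ufam S (A, R)) m f h" using Le trans[of m f g h] by simp
  next
    fix s f assume h: "s \<in> Arr (arrow_cat S)" "f \<in> Preds (ufam S (A, R)) (Cod (arrow_cat S) s)"
    obtain m m' u v where s: "s = (m, m', u, v)" by (cases s)
    note a = sqD[OF h(1)[unfolded s]]
    show "Rdx (ufam S (A, R)) s f \<in> Preds (ufam S (A, R)) (Dom (arrow_cat S) s)"
      using h s a(1-8) by (simp add: hom_def)
  next
    fix s f g assume h: "s \<in> Arr (arrow_cat S)" "f \<in> Preds (ufam S (A, R)) (Cod (arrow_cat S) s)"
      "g \<in> Preds (ufam S (A, R)) (Cod (arrow_cat S) s)" "Le (ufam S (A, R)) (Cod (arrow_cat S) s) f g"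
    obtain m m' u v where s: "s = (m, m', u, v)" by (cases s)
    note a = sqD[OF h(1)[unfolded s]]
    have fg: "f \<in> hom S (Dom S m') A" "g \<in> hom S (Dom S m') A" "rel R m' f g" using h s Le[of m' f g] a by simp_all
    have "rel R m (f \<cdot> u) (g \<cdot> u)"
      by (rule stab[OF a(2) fg(1,2) a(1) _ _ a(9) fg(3)]) (use a(1-8) in \<open>simp_all add: hom_def\<close>)
    thus "Le (ufam S (A, R)) (Dom (arrow_cat S) s) (Rdx (ufam S (A, R)) s f) (Rdx (ufam S (A, R)) s g)"
      using Le[of m "f \<cdot> u" "g \<cdot> u"] fg a(1-8) s by (simp add: hom_def)
  next
    fix m f assume "m \<in> Obj (arrow_cat S)" "f \<in> Preds (ufam S (A, R)) m"
    thus "iso_pred (ufam S (A, R)) m (Rdx (ufam S (A, R)) (Idn (arrow_cat S) m) f) f"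
      using Le[of m f f] refl[of m f] by (simp add: iso_pred_def homD)
  next
    fix s t f assume h: "s \<in> Arr (arrow_cat S)" "t \<in> Arr (arrow_cat S)" "Cod (arrow_cat S) s = Dom (arrow_cat S) t"
      "f \<in> Preds (ufam S (A, R)) (Cod (arrow_cat S) t)"
    obtain m m' u v where s: "s = (m, m', u, v)" by (cases s)
    obtain n n' w z where t: "t = (n, n', w, z)" by (cases t)
    note a = sqD(1-8)[OF h(1)[unfolded s]] sqD(1-8)[OF h(2)[unfolded t]]
    have mn: "m' = n" using h s t by simp
    have f: "f \<in> hom S (Dom S n') A" using h t by simp
    have e: "f \<cdot> (w \<cdot> u) = (f \<cdot> w) \<cdot> u" using a mn homD[OF f] by simp
    have "f \<cdot> (w \<cdot> u) \<in> hom S (Dom S m) A" using a mn homD[OF f] by (simp add: hom_def)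
    thus "iso_pred (ufam S (A, R)) (Dom (arrow_cat S) s) (Rdx (ufam S (A, R)) (t \<cdot>\<^bsub>arrow_cat S\<^esub> s) f)
       (Rdx (ufam S (A, R)) s (Rdx (ufam S (A, R)) t f))"
      unfolding s t using Le[of m "f \<cdot> (w \<cdot> u)" "f \<cdot> (w \<cdot> u)"] refl[of m "f \<cdot> (w \<cdot> u)"] a(1) e
      by (simp add: iso_pred_def del: assoc)
  qed
  thus ?thesis using arrow_loc by (simp add: fib_loc_def fib_loc_axioms_def)
qed

text \<open>Any parallel pair out of the domain of \<open>m'\<close> extends to two squares into an
  object over the terminal object, whose base components coincide by terminality.\<close>

lemma vertical_epi:
  assumes "is_epi (arrow_cat S) (m, m', u, v)"
  shows "is_epi S u"
proof -
  have s: "(m, m', u, v) \<in> Arr (arrow_cat S)" using assms unfolding is_epi_def by blast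
  note a = sqD[OF s]
  show ?thesis
  proof (rule epiI[OF a(3)])
    fix f g assume h: "f \<in> Arr S" "g \<in> Arr S" "Cod S f = Cod S g" "Dom S f = Cod S u" "Dom S g = Cod S u" "f \<cdot> u = g \<cdot> u"
    let ?b = "bang S (Cod S g)" and ?c = "bang S (Cod S m')"
    have f: "(m', ?b, f, ?c) \<in> Arr (arrow_cat S)" and g: "(m', ?b, g, ?c) \<in> Arr (arrow_cat S)"
      by (rule sqI; use h(1-5) a(1-8) in simp)+
    have "(m', ?b, f, ?c) \<cdot>\<^bsub>arrow_cat S\<^esub> (m, m', u, v) = (m', ?b, g, ?c) \<cdot>\<^bsub>arrow_cat S\<^esub> (m, m', u, v)"
      using h(6) by simp
    hence "(m', ?b, f, ?c) = (m', ?b, g, ?c)"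
      using cat_loc.epiD[OF arrow_loc assms _ f g] by simp
    thus "f = g" by simp
  qed
qed

text \<open>Restricting both predicates to \<open>V\<close> composes the family of pairs with
  \<open>V\<close>, so the question on which subobjects the inequality holds becomes one about
  inverse images of \<open>R\<close>.\<close>

lemma le_on_ufam:
  assumes m: "m \<in> Arr S" and f: "f \<in> hom S (Dom S m) A" and g: "g \<in> hom S (Dom S m) A"
    and R: "is_mono S R" "Cod S R = pow S (prd S A A)" and V: "V \<in> Arr S" "Cod S V = Cod S m"
  shows "le_on S (ufam S (A, R)) m f g V \<longleftrightarrow> factors S (img m (tup S f g) \<cdot> V) R"
proof -
  have p: "is_pullback S V m (fst (pb S V m)) (snd (pb S V m))" using V m by (intro pb_pullback) simp_all
  note pD = pullbackD[OF p]
  have "f \<cdot> snd (pb S V m) \<in> hom S (Dom S (fst (pb S V m))) A" "g \<cdot> snd (pb S V m) \<in> hom S (Dom S (fst (pb S V m))) A"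
    using pD homD[OF f] homD[OF g] by (simp_all add: hom_def)
  from ufam_Le[OF pD(3) this R] show ?thesis
    unfolding le_on_def base_change_sq_def base_change_def
    by (simp add: rel_pullback[OF m f g p])
qed

lemma sub_reindex:
  assumes "v \<in> Arr S" "is_mono S U" "Cod S U = Cod S v"
  shows "is_mono S (Rdx (sub_fib S) v U)" "Cod S (Rdx (sub_fib S) v U) = Dom S v"
    "h \<in> Arr S \<Longrightarrow> Cod S h = Dom S v \<Longrightarrow> factors S h (Rdx (sub_fib S) v U) \<longleftrightarrow> factors S (v \<cdot> h) U"
proof -
  have p: "is_pullback S v U (fst (pb S v U)) (snd (pb S v U))" using assms by (intro pb_pullback) simp_all
  show "is_mono S (Rdx (sub_fib S) v U)" "Cod S (Rdx (sub_fib S) v U) = Dom S v"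
    "h \<in> Arr S \<Longrightarrow> Cod S h = Dom S v \<Longrightarrow> factors S h (Rdx (sub_fib S) v U) \<longleftrightarrow> factors S (v \<cdot> h) U"
    using pullback_mono[OF p assms(2)] pullbackD[OF p] pullback_factors[OF p]
    by (simp_all add: sub_fib_def)
qed

lemma greatest_subI:
  assumes "is_mono S U" "Cod S U = L" "\<And>V. is_mono S V \<Longrightarrow> Cod S V = L \<Longrightarrow> Q V \<longleftrightarrow> factors S V U"
  shows "greatest_sub S L Q U"
  using assms factors_refl unfolding greatest_sub_def by auto

text \<open>The greatest subobject is the inverse image of \<open>R\<close> under the family
  \<open>?r\<close>. Base change along \<open>v\<close> composes the family with \<open>v\<close>,
  so stability is the pasting of inverse images.\<close>

lemma ufam_horizontally_definable:
  assumes "preorder_family A R"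
  shows "horizontally_definable S (ufam S (A, R))"
  unfolding horizontally_definable_def
proof (intro ballI)
  have A: "A \<in> Obj S" and R: "is_mono S R" "Cod S R = pow S (prd S A A)"
    using assms unfolding preorder_family_def by blast+
  fix m f g assume m: "m \<in> Arr S" and "f \<in> Preds (ufam S (A, R)) m" "g \<in> Preds (ufam S (A, R)) m"
  hence f: "f \<in> hom S (Dom S m) A" and g: "g \<in> hom S (Dom S m) A" by simp_all
  let ?r = "img m (tup S f g)"
  note fg = homD[OF f] homD[OF g]
  have r: "?r \<in> Arr S" "Dom S ?r = Cod S m" "Cod S ?r = Cod S R" using m fg R by simp_all
  obtain U where U: "is_mono S U" "Cod S U = Cod S m"
    "\<And>h. h \<in> Arr S \<Longrightarrow> Cod S h = Cod S m \<Longrightarrow> factors S h U \<longleftrightarrow> factors S (?r \<cdot> h) R"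
    using preimage[OF r(1) R(1) r(3)] unfolding r(2) by blast
  have "greatest_sub S (Cod S m) (le_on S (ufam S (A, R)) m f g) U"
    by (rule greatest_subI[OF U(1,2)]) (use U(3) le_on_ufam[OF m f g R] in simp)
  moreover have "greatest_sub S (Dom S v)
                 (le_on S (ufam S (A, R)) (base_change S m v)
                    (Rdx (ufam S (A, R)) (base_change_sq S m v) f) (Rdx (ufam S (A, R)) (base_change_sq S m v) g))
                 (Rdx (sub_fib S) v U)" if v: "v \<in> Arr S" "Cod S v = Cod S m" for v
  proof -
    have p: "is_pullback S v m (fst (pb S v m)) (snd (pb S v m))" using v m by (intro pb_pullback) simp_all
    note pD = pullbackD[OF p]
    let ?n = "fst (pb S v m)" and ?k = "snd (pb S v m)"
    have k: "f \<cdot> ?k \<in> hom S (Dom S ?n) A" "g \<cdot> ?k \<in> hom S (Dom S ?n) A" using pD fg by (simp_all add: hom_def)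
    have e: "img ?n (tup S (f \<cdot> ?k) (g \<cdot> ?k)) = ?r \<cdot> v"
    proof -
      have "?r \<cdot> v = img ?n (tup S f g \<cdot> ?k)" by (rule img_cmp[OF _ _ _ p]) (use m fg in simp_all)
      also have "tup S f g \<cdot> ?k = tup S (f \<cdot> ?k) (g \<cdot> ?k)" by (rule tup_cmp) (use fg pD in simp_all)
      finally show ?thesis by simp
    qed
    have vU: "Cod S U = Cod S v" using U v by simp
    note s = sub_reindex[OF v(1) U(1) vU]
    have "greatest_sub S (Dom S v) (le_on S (ufam S (A, R)) ?n (f \<cdot> ?k) (g \<cdot> ?k)) (Rdx (sub_fib S) v U)"
    proof (rule greatest_subI[OF s(1,2)])
      fix V assume V: "is_mono S V" "Cod S V = Dom S v"
      have Va: "V \<in> Arr S" using V by simp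
      have Vn: "Cod S V = Cod S ?n" using V pD by simp
      have "le_on S (ufam S (A, R)) ?n (f \<cdot> ?k) (g \<cdot> ?k) V \<longleftrightarrow> factors S ((?r \<cdot> v) \<cdot> V) R"
        using le_on_ufam[OF pD(3) k R Va Vn] e by simp
      also have "(?r \<cdot> v) \<cdot> V = ?r \<cdot> (v \<cdot> V)" using r v V Va by simp
      also have "factors S (?r \<cdot> (v \<cdot> V)) R \<longleftrightarrow> factors S V (Rdx (sub_fib S) v U)"
        using U(3)[of "v \<cdot> V"] s(3)[OF Va V(2)] v V Va by simp
      finally show "le_on S (ufam S (A, R)) ?n (f \<cdot> ?k) (g \<cdot> ?k) V \<longleftrightarrow> factors S V (Rdx (sub_fib S) v U)" .
    qed
    thus ?thesis by (simp add: base_change_def base_change_sq_def)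
  qed
  ultimately show "\<exists>U. greatest_sub S (Cod S m) (le_on S (ufam S (A, R)) m f g) U \<and>
            (\<forall>v\<in>Arr S. Cod S v = Cod S m \<longrightarrow>
               greatest_sub S (Dom S v)
                 (le_on S (ufam S (A, R)) (base_change S m v)
                    (Rdx (ufam S (A, R)) (base_change_sq S m v) f) (Rdx (ufam S (A, R)) (base_change_sq S m v) g))
                 (Rdx (sub_fib S) v U))"
    by blast
qed

lemma ufam_reflects:
  assumes "preorder_family A R"
  shows "reflects_le_along (arrow_cat S) (\<lambda>e. vertical S e \<and> is_epi (arrow_cat S) e) (ufam S (A, R))"
  unfolding reflects_le_along_def
proof (intro ballI impI)
  have R: "is_mono S R" "Cod S R = pow S (prd S A A)"
    using assms unfolding preorder_family_def by blast+
  fix s f g assume h: "s \<in> Arr (arrow_cat S)" "vertical S s \<and> is_epi (arrow_cat S) s"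
    "f \<in> Preds (ufam S (A, R)) (Cod (arrow_cat S) s)" "g \<in> Preds (ufam S (A, R)) (Cod (arrow_cat S) s)"
    "Le (ufam S (A, R)) (Dom (arrow_cat S) s) (Rdx (ufam S (A, R)) s f) (Rdx (ufam S (A, R)) s g)"
  obtain m m' u v where s: "s = (m, m', u, v)" by (cases s)
  note a = sqD[OF h(1)[unfolded s]]
  have v: "v = Idn S (Cod S m)" "Cod S m = Cod S m'" and e: "is_epi S u" using h(2) vertical_epi s by auto
  have mu: "m' \<cdot> u = m" using a(9) a(1) unfolding v(1) by simp
  have fg: "f \<in> hom S (Dom S m') A" "g \<in> hom S (Dom S m') A" using h s by simp_all
  have fu: "f \<cdot> u \<in> hom S (Dom S m) A" "g \<cdot> u \<in> hom S (Dom S m) A" using fg a(1-8) by (simp_all add: hom_def)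
  have "rel R m (f \<cdot> u) (g \<cdot> u)" using h(5) ufam_Le[OF a(1) fu R] s by simp
  hence "rel R m' f g" using rel_epi[OF a(2) fg e a(6)] mu by simp
  thus "Le (ufam S (A, R)) (Cod (arrow_cat S) s) f g" using ufam_Le[OF a(2) fg R] s by simp
qed

text \<open>The encodings are \<open>\<forall>x. x\<close> for bottom and \<open>\<forall>x.
  ((\<phi> \<Rightarrow> x) \<and> (\<psi> \<Rightarrow> x)) \<Rightarrow> x\<close> for joins, with
  \<open>x\<close> ranging over \<open>A\<close>, whose identity is the generic predicate. The
  universal property is checked directly over every reindexing, by instantiating \<open>x\<close> at
  the competitor \<open>\<chi>\<close>, so stability comes together with existence.\<close>

lemma ufam_joins:
  assumes pf: "preorder_family A R"
    and fm: "has_finite_meets (arrow_cat S) (ufam S (A, R))"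
    and im: "has_implication (arrow_cat S) (ufam S (A, R))"
    and fa: "has_forall (arrow_cat S) (vertical S) (ufam S (A, R))"
  shows "has_finite_joins (arrow_cat S) (ufam S (A, R))"
proof -
  let ?X = "ufam S (A, R)"
  have A: "A \<in> Obj S" using pf unfolding preorder_family_def by blast
  interpret X: fib_loc "arrow_cat S" ?X using ufam_fib[OF pf] .
  \<comment> \<open>\<open>\<sigma>\<close> is \<open>\<forall>x. \<theta>\<close>. The quantifier
    is taken along the projection that forgets \<open>x\<close>, a vertical map over
    \<open>Cod S m\<close>.\<close>
  have q: "\<exists>\<sigma>\<in>hom S (Dom S m) A. (\<forall>\<xi>\<in>hom S (Dom S m) A. Le ?X (m \<cdot> pr1 S (Dom S m) A) (\<xi> \<cdot> pr1 S (Dom S m) A) \<theta> \<longleftrightarrow> Le ?X m \<xi> \<sigma>)"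
    if m: "m \<in> Arr S" and t: "\<theta> \<in> hom S (prd S (Dom S m) A) A" for m \<theta>
  proof -
    let ?p = "pr1 S (Dom S m) A"
    have "(m \<cdot> ?p, m, ?p, Idn S (Cod S m)) \<in> Arr (arrow_cat S)" by (rule sqI) (use m A in simp_all)
    moreover have "vertical S (m \<cdot> ?p, m, ?p, Idn S (Cod S m))" using m A by simp
    moreover have "\<theta> \<in> Preds ?X (Dom (arrow_cat S) (m \<cdot> ?p, m, ?p, Idn S (Cod S m)))" using t m A by simp
    ultimately obtain \<sigma> where "is_forall (arrow_cat S) ?X (m \<cdot> ?p, m, ?p, Idn S (Cod S m)) \<theta> \<sigma>"
      using fa unfolding has_forall_def by blast
    thus ?thesis unfolding is_forall_def by auto
  qed
  \<comment> \<open>The map \<open>tup S u \<chi>\<close> reindexes along \<open>u\<close> and at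
    the same time instantiates the bound variable at \<open>\<chi>\<close>.\<close>
  have inst: "(n, m \<cdot> pr1 S (Dom S m) A, tup S u \<chi>, v) \<in> Arr (arrow_cat S)"
    "pr1 S (Dom S m) A \<cdot> tup S u \<chi> = u" "pr2 S (Dom S m) A \<cdot> tup S u \<chi> = \<chi>"
    if "(n, m, u, v) \<in> Arr (arrow_cat S)" "\<chi> \<in> hom S (Dom S n) A" for n m u v \<chi>
    using sqD[OF that(1)] homD[OF that(2)] A by (auto intro!: sqI)
  show ?thesis
  proof (rule X.has_finite_joinsI)
    fix m assume "m \<in> Obj (arrow_cat S)"
    hence m: "m \<in> Arr S" by simp
    let ?p = "pr1 S (Dom S m) A" and ?t = "pr2 S (Dom S m) A"
    have t: "?t \<in> hom S (prd S (Dom S m) A) A" using m A by (simp add: hom_def)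
    obtain \<sigma> where s: "\<sigma> \<in> hom S (Dom S m) A"
      "\<forall>\<xi>\<in>hom S (Dom S m) A. Le ?X (m \<cdot> ?p) (\<xi> \<cdot> ?p) ?t \<longleftrightarrow> Le ?X m \<xi> \<sigma>" using q[OF m t] by blast
    have st: "Le ?X (m \<cdot> ?p) (\<sigma> \<cdot> ?p) ?t" using s X.le_refl[of m \<sigma>] m by simp
    have "is_bot ?X (Dom (arrow_cat S) f) (Rdx ?X f \<sigma>)" if f: "f \<in> Arr (arrow_cat S)" "Cod (arrow_cat S) f = m" for f
    proof -
      obtain n u v where fe: "f = (n, m, u, v)" using f(2) by (cases f) simp
      note a = sqD[OF f(1)[unfolded fe]]
      have "Le ?X n (\<sigma> \<cdot> u) \<chi>" if c: "\<chi> \<in> hom S (Dom S n) A" for \<chi>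
      proof -
        note i = inst[OF f(1)[unfolded fe] c]
        have "Le ?X n ((\<sigma> \<cdot> ?p) \<cdot> tup S u \<chi>) (?t \<cdot> tup S u \<chi>)"
          using X.rdx_mono[OF i(1), of "\<sigma> \<cdot> ?p" ?t] st homD[OF s(1)] homD[OF t] m A by (simp add: hom_def)
        thus ?thesis using i(2,3) homD[OF s(1)] homD[OF c] a(1-8) A by simp
      qed
      thus ?thesis using fe s(1) a(1-8) by (simp add: is_bot_def hom_def)
    qed
    thus "\<exists>\<beta>\<in>Preds ?X m. \<forall>f\<in>Arr (arrow_cat S). Cod (arrow_cat S) f = m \<longrightarrow> is_bot ?X (Dom (arrow_cat S) f) (Rdx ?X f \<beta>)"
      using s(1) by (intro bexI[of _ \<sigma>]) simp_all
  next
    fix m \<phi> \<psi> assume "m \<in> Obj (arrow_cat S)" "\<phi> \<in> Preds ?X m" "\<psi> \<in> Preds ?X m"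
    hence m: "m \<in> Arr S" and p: "\<phi> \<in> hom S (Dom S m) A" and r: "\<psi> \<in> hom S (Dom S m) A" by simp_all
    note pr = homD[OF p] homD[OF r]
    let ?p = "pr1 S (Dom S m) A" and ?t = "pr2 S (Dom S m) A"
    let ?m = "m \<cdot> ?p"
    have m1: "?m \<in> Arr S" "Dom S ?m = prd S (Dom S m) A" "Cod S ?m = Cod S m" using m A by simp_all
    have t: "?t \<in> hom S (Dom S ?m) A" using m A by (simp add: hom_def)
    have pp: "\<phi> \<cdot> ?p \<in> hom S (Dom S ?m) A" "\<psi> \<cdot> ?p \<in> hom S (Dom S ?m) A" using pr m A by (simp_all add: hom_def)
    obtain \<iota>1 \<iota>2 where i: "is_imp ?X ?m (\<phi> \<cdot> ?p) ?t \<iota>1" "is_imp ?X ?m (\<psi> \<cdot> ?p) ?t \<iota>2"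
      using im pp t m1(1) unfolding has_implication_def by (metis arrow_cat_simps(1) ufam_simps(1))
    have iP: "\<iota>1 \<in> hom S (Dom S ?m) A" "\<iota>2 \<in> hom S (Dom S ?m) A" using i unfolding is_imp_def by simp_all
    obtain \<mu> where mu: "is_meet ?X ?m \<iota>1 \<iota>2 \<mu>"
      using fm iP m1(1) unfolding has_finite_meets_def by (metis arrow_cat_simps(1) ufam_simps(1))
    have mP: "\<mu> \<in> hom S (Dom S ?m) A" using mu unfolding is_meet_def by simp
    obtain \<theta> where th: "is_imp ?X ?m \<mu> ?t \<theta>"
      using im mP t m1(1) unfolding has_implication_def by (metis arrow_cat_simps(1) ufam_simps(1))
    have tP: "\<theta> \<in> hom S (Dom S ?m) A" using th unfolding is_imp_def by simp
    obtain \<sigma> where s: "\<sigma> \<in> hom S (Dom S m) A"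
      "\<forall>\<xi>\<in>hom S (Dom S m) A. Le ?X ?m (\<xi> \<cdot> ?p) \<theta> \<longleftrightarrow> Le ?X m \<xi> \<sigma>" using q[OF m tP[unfolded m1(2)]] by blast
    have sp: "\<sigma> \<cdot> ?p \<in> hom S (Dom S ?m) A" using homD[OF s(1)] m A by (simp add: hom_def)
    have st: "Le ?X ?m (\<sigma> \<cdot> ?p) \<theta>" using s X.le_refl[of m \<sigma>] m by simp
    have entI: "Le ?X ?m \<xi> \<iota> \<longleftrightarrow> X.ent ?m \<xi> \<alpha> ?t"
      if "is_imp ?X ?m \<alpha> ?t \<iota>" "\<alpha> \<in> hom S (Dom S ?m) A" "\<xi> \<in> hom S (Dom S ?m) A" for \<xi> \<alpha> \<iota>
      using X.is_imp_ent[OF fm, of ?m \<alpha> ?t \<iota>] that m1(1) t by simp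
    \<comment> \<open>Each disjunct lies below \<open>\<sigma>\<close>: in the presence of
      \<open>\<alpha>\<close> and \<open>\<mu>\<close>, the conjunct
      \<open>\<alpha> \<Rightarrow> x\<close> of \<open>\<mu>\<close> yields
      \<open>x\<close>.\<close>
    have up: "Le ?X m \<alpha> \<sigma>" if al: "\<alpha> \<in> hom S (Dom S m) A" "\<alpha> \<cdot> ?p \<in> hom S (Dom S ?m) A" and im: "is_imp ?X ?m (\<alpha> \<cdot> ?p) ?t \<iota>"
      and l: "\<forall>\<xi>\<in>hom S (Dom S ?m) A. Le ?X ?m \<xi> \<mu> \<longrightarrow> Le ?X ?m \<xi> \<iota>" for \<alpha> \<iota>
    proof -
      have "X.ent ?m (\<alpha> \<cdot> ?p) \<mu> ?t"
        unfolding X.ent_def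
      proof (intro ballI impI)
        fix \<xi> assume x: "\<xi> \<in> Preds ?X ?m" "Le ?X ?m \<xi> (\<alpha> \<cdot> ?p)" "Le ?X ?m \<xi> \<mu>"
        hence "X.ent ?m \<xi> (\<alpha> \<cdot> ?p) ?t" using entI[OF im al(2)] l by simp
        thus "Le ?X ?m \<xi> ?t" using x X.le_refl[of ?m \<xi>] m1(1) unfolding X.ent_def by simp
      qed
      hence "Le ?X ?m (\<alpha> \<cdot> ?p) \<theta>" using entI[OF th mP al(2)] by simp
      thus ?thesis using s(2) al by simp
    qed
    have le: "Le ?X m \<phi> \<sigma>" "Le ?X m \<psi> \<sigma>"
      by (rule up[OF p pp(1) i(1)], use mu in \<open>simp add: is_meet_def\<close>)
        (rule up[OF r pp(2) i(2)], use mu in \<open>simp add: is_meet_def\<close>)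
    have "is_join ?X (Dom (arrow_cat S) f) (Rdx ?X f \<phi>) (Rdx ?X f \<psi>) (Rdx ?X f \<sigma>)"
      if f: "f \<in> Arr (arrow_cat S)" "Cod (arrow_cat S) f = m" for f
    proof -
      obtain n u v where fe: "f = (n, m, u, v)" using f(2) by (cases f) simp
      have sq: "(n, m, u, v) \<in> Arr (arrow_cat S)" using f(1) fe by simp
      note a = sqD[OF sq]
      have u: "\<phi> \<cdot> u \<in> hom S (Dom S n) A" "\<psi> \<cdot> u \<in> hom S (Dom S n) A" "\<sigma> \<cdot> u \<in> hom S (Dom S n) A"
        using pr homD[OF s(1)] a(1-8) by (simp_all add: hom_def)
      have lu: "Le ?X n (\<phi> \<cdot> u) (\<sigma> \<cdot> u)" "Le ?X n (\<psi> \<cdot> u) (\<sigma> \<cdot> u)"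
        using X.rdx_mono[OF sq, of \<phi> \<sigma>] X.rdx_mono[OF sq, of \<psi> \<sigma>] le p r s(1) by simp_all
      have "Le ?X n (\<sigma> \<cdot> u) \<chi> \<longleftrightarrow> Le ?X n (\<phi> \<cdot> u) \<chi> \<and> Le ?X n (\<psi> \<cdot> u) \<chi>" if c: "\<chi> \<in> hom S (Dom S n) A" for \<chi>
      proof
        assume "Le ?X n (\<sigma> \<cdot> u) \<chi>"
        thus "Le ?X n (\<phi> \<cdot> u) \<chi> \<and> Le ?X n (\<psi> \<cdot> u) \<chi>"
          using X.le_trans[of n "\<phi> \<cdot> u" "\<sigma> \<cdot> u" \<chi>] X.le_trans[of n "\<psi> \<cdot> u" "\<sigma> \<cdot> u" \<chi>] lu u c a(1) by simp
      next
        assume l: "Le ?X n (\<phi> \<cdot> u) \<chi> \<and> Le ?X n (\<psi> \<cdot> u) \<chi>"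
        let ?w = "tup S u \<chi>"
        note ii = inst[OF sq c]
        have w: "?w \<in> Arr S" "Dom S ?w = Dom S n" "Cod S ?w = prd S (Dom S m) A"
          using sqD(3,5,6)[OF ii(1)] m1(2) by simp_all
        have e: "(\<phi> \<cdot> ?p) \<cdot> ?w = \<phi> \<cdot> u" "(\<psi> \<cdot> ?p) \<cdot> ?w = \<psi> \<cdot> u" "(\<sigma> \<cdot> ?p) \<cdot> ?w = \<sigma> \<cdot> u"
          using ii(2) w pr homD[OF s(1)] m A by (simp_all del: tup_cmp)
        have wP: "\<alpha> \<cdot> ?w \<in> hom S (Dom S n) A" if "\<alpha> \<in> hom S (Dom S ?m) A" for \<alpha>
          using homD[OF that] w m1 by (simp add: hom_def)
        have ient: "Le ?X n \<xi> (\<iota> \<cdot> ?w) \<longleftrightarrow> X.ent n \<xi> (\<alpha> \<cdot> ?w) \<chi>"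
          if "is_imp ?X ?m \<alpha> ?t \<iota>" "\<alpha> \<in> hom S (Dom S ?m) A" "\<xi> \<in> hom S (Dom S n) A" for \<xi> \<alpha> \<iota>
        proof -
          have "is_imp ?X n (\<alpha> \<cdot> ?w) (?t \<cdot> ?w) (\<iota> \<cdot> ?w)"
            using im[unfolded has_implication_def, THEN conjunct2, rule_format, OF ii(1), of \<alpha> ?t \<iota>] that t by simp
          hence "is_imp ?X n (\<alpha> \<cdot> ?w) \<chi> (\<iota> \<cdot> ?w)" using ii(3) by simp
          thus ?thesis using X.is_imp_ent[OF fm, of n "\<alpha> \<cdot> ?w" \<chi> "\<iota> \<cdot> ?w"] that wP c a(1) by simp
        qed
        \<comment> \<open>Instantiated at \<open>\<chi>\<close>, both implications hold by
          assumption, hence so does the premise \<open>\<mu>\<close> of the body of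
          \<open>\<sigma>\<close>, and \<open>\<chi>\<close> follows.\<close>
        have "Le ?X n (\<sigma> \<cdot> u) (\<iota>1 \<cdot> ?w)"
          using ient[OF i(1) pp(1) u(3)] X.ent_le[of n "\<phi> \<cdot> u" \<chi> "\<sigma> \<cdot> u"] l u c a(1) unfolding e by simp
        moreover have "Le ?X n (\<sigma> \<cdot> u) (\<iota>2 \<cdot> ?w)"
          using ient[OF i(2) pp(2) u(3)] X.ent_le[of n "\<psi> \<cdot> u" \<chi> "\<sigma> \<cdot> u"] l u c a(1) unfolding e by simp
        moreover have "is_meet ?X n (\<iota>1 \<cdot> ?w) (\<iota>2 \<cdot> ?w) (\<mu> \<cdot> ?w)"
          using fm[unfolded has_finite_meets_def, THEN conjunct2, THEN conjunct2, THEN conjunct2, rule_format, OF ii(1), of \<iota>1 \<iota>2 \<mu>]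
            iP mu by simp
        ultimately have sm: "Le ?X n (\<sigma> \<cdot> u) (\<mu> \<cdot> ?w)" using u unfolding is_meet_def by simp
        have "Le ?X n (\<sigma> \<cdot> u) (\<theta> \<cdot> ?w)"
          using X.rdx_mono[OF ii(1), of "\<sigma> \<cdot> ?p" \<theta>] st sp tP e(3) by simp
        hence "X.ent n (\<sigma> \<cdot> u) (\<mu> \<cdot> ?w) \<chi>" using ient[OF th mP u(3)] by simp
        thus "Le ?X n (\<sigma> \<cdot> u) \<chi>" using sm u(3) X.le_refl[of n "\<sigma> \<cdot> u"] a(1) unfolding X.ent_def by simp
      qed
      thus ?thesis using fe u by (simp add: is_join_def)
    qed
    thus "\<exists>\<mu>\<in>Preds ?X m. \<forall>f\<in>Arr (arrow_cat S). Cod (arrow_cat S) f = m \<longrightarrow>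
       is_join ?X (Dom (arrow_cat S) f) (Rdx ?X f \<phi>) (Rdx ?X f \<psi>) (Rdx ?X f \<mu>)"
      using s(1) by (intro bexI[of _ \<sigma>]) simp_all
  qed
qed

lemma ufam_generic:
  assumes pf: "preorder_family A R"
  shows "is_generic (arrow_cat S) (ufam S (A, R)) (bang S A) (Idn S A)"
proof -
  let ?X = "ufam S (A, R)"
  have A: "A \<in> Obj S" using pf unfolding preorder_family_def by blast
  interpret X: fib_loc "arrow_cat S" ?X using ufam_fib[OF pf] .
  have "\<exists>f\<in>hom (arrow_cat S) m (bang S A). iso_pred ?X m \<phi> (Rdx ?X f (Idn S A))"
    if m: "m \<in> Arr S" and p: "\<phi> \<in> hom S (Dom S m) A" for m \<phi>
  proof -
    note pD = homD[OF p]
    have "(m, bang S A, \<phi>, bang S (Cod S m)) \<in> Arr (arrow_cat S)" by (rule sqI) (use m pD A in simp_all)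
    hence "(m, bang S A, \<phi>, bang S (Cod S m)) \<in> hom (arrow_cat S) m (bang S A)" by (simp add: hom_def)
    moreover have "iso_pred ?X m \<phi> (Rdx ?X (m, bang S A, \<phi>, bang S (Cod S m)) (Idn S A))"
      using X.iso_refl[of m \<phi>] m p pD by simp
    ultimately show ?thesis by blast
  qed
  thus ?thesis using A unfolding is_generic_def by (auto simp: hom_def)
qed

lemma logical_uniform_preorder_family: "logical_uniform_preorder S (A, R) \<Longrightarrow> preorder_family A R"
  by (rule uniform_preorderD) (simp add: logical_uniform_preorder_def)

lemma logical_fibered_tripos:
  assumes "logical_uniform_preorder S U"
  shows "fibered_tripos S (ufam S U)"
proof -
  obtain A R where U: "U = (A, R)" by (cases U)
  have pf: "preorder_family A R" using assms logical_uniform_preorder_family U by simp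
  have h: "has_finite_meets (arrow_cat S) (ufam S (A, R))" "has_implication (arrow_cat S) (ufam S (A, R))"
    "has_forall (arrow_cat S) (vertical S) (ufam S (A, R))"
    using assms U unfolding logical_uniform_preorder_def by blast+
  have "A \<in> Obj S" using pf unfolding preorder_family_def by blast
  thus ?thesis
    unfolding fibered_tripos_def U
    using fib_loc.fib[OF ufam_fib[OF pf]] ufam_reflects[OF pf] ufam_horizontally_definable[OF pf] h
      ufam_joins[OF pf h] ufam_generic[OF pf] by blast
qed

text \<open>By representability: every predicate is a reindexing of the generic predicate
  \<open>Idn S A\<close> over \<open>A \<rightarrow> 1\<close>, so a fibered map out of
  \<open>ufam S (A, R)\<close> is, up to isomorphism, postcomposition with its value there.
  Monotonicity on all fibres is monotonicity of that map, by \<open>upo_map_iff\<close>.\<close>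

lemma upo_equiv_iff:
  assumes U: "uniform_preorder S U" and V: "uniform_preorder S V"
  shows "upo_equiv S U V \<longleftrightarrow> fib_equiv (arrow_cat S) (ufam S U) (ufam S V)"
proof -
  obtain A R B R' where UV: "U = (A, R)" "V = (B, R')" by (cases U, cases V)
  have pf: "preorder_family A R" "preorder_family B R'" using U V uniform_preorderD UV by simp_all
  have A: "A \<in> Obj S" "is_mono S R" "Cod S R = pow S (prd S A A)"
    using pf unfolding preorder_family_def by blast+
  have B: "B \<in> Obj S" "is_mono S R'" "Cod S R' = pow S (prd S B B)"
    using pf unfolding preorder_family_def by blast+
  let ?X = "ufam S (A, R)" and ?Y = "ufam S (B, R')"
  interpret X: fib_loc "arrow_cat S" ?X using ufam_fib[OF pf(1)] .
  interpret Y: fib_loc "arrow_cat S" ?Y using ufam_fib[OF pf(2)] .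
  \<comment> \<open>An inequality of maps is an inequality over \<open>D \<rightarrow> 1\<close>;
    reindexing it along \<open>\<phi>\<close> gives the inequality at an arbitrary
    predicate.\<close>
  have whisk: "Le (ufam S (D, Q)) m (f \<cdot> \<phi>) (g \<cdot> \<phi>)"
    if D: "D \<in> Obj S" "is_mono S Q" "Cod S Q = pow S (prd S D D)" "fib_loc (arrow_cat S) (ufam S (D, Q))"
      and f: "f \<in> hom S D D" and g: "g \<in> hom S D D" and l: "upo_map_le S (D, Q) (D, Q) f g"
      and m: "m \<in> Arr S" and p: "\<phi> \<in> hom S (Dom S m) D" for D Q f g m \<phi>
  proof -
    interpret Z: fib_loc "arrow_cat S" "ufam S (D, Q)" by fact
    note pD = homD[OF p]
    have sq: "(m, bang S D, \<phi>, bang S (Cod S m)) \<in> Arr (arrow_cat S)" by (rule sqI) (use m pD D in simp_all)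
    have "Le (ufam S (D, Q)) (bang S D) f g"
      using l upo_map_le_iff[OF f g] ufam_Le[OF _ _ _ D(2,3), of "bang S D" f g] f g D(1) by simp
    thus ?thesis using Z.rdx_mono[OF sq, of f g] f g D(1) by simp
  qed
  show ?thesis
  proof
    assume "upo_equiv S U V"
    then obtain f g where fg: "upo_map S (A, R) (B, R') f" "upo_map S (B, R') (A, R) g"
      "upo_map_le S (A, R) (A, R) (g \<cdot> f) (Idn S A)" "upo_map_le S (A, R) (A, R) (Idn S A) (g \<cdot> f)"
      "upo_map_le S (B, R') (B, R') (f \<cdot> g) (Idn S B)" "upo_map_le S (B, R') (B, R') (Idn S B) (f \<cdot> g)"
      unfolding upo_equiv_def UV by auto
    have f: "f \<in> hom S A B" "\<And>m p q. m \<in> Arr S \<Longrightarrow> p \<in> hom S (Dom S m) A \<Longrightarrow> q \<in> hom S (Dom S m) A \<Longrightarrow> rel R m p q \<Longrightarrow> rel R' m (f \<cdot> p) (f \<cdot> q)"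
      using fg(1) unfolding upo_map_iff[OF A] by blast+
    have g: "g \<in> hom S B A" "\<And>m p q. m \<in> Arr S \<Longrightarrow> p \<in> hom S (Dom S m) B \<Longrightarrow> q \<in> hom S (Dom S m) B \<Longrightarrow> rel R' m p q \<Longrightarrow> rel R m (g \<cdot> p) (g \<cdot> q)"
      using fg(2) unfolding upo_map_iff[OF B] by blast+
    note fgD = homD[OF f(1)] homD[OF g(1)]
    have i: "g \<cdot> f \<in> hom S A A" "Idn S A \<in> hom S A A" "f \<cdot> g \<in> hom S B B" "Idn S B \<in> hom S B B"
      using fgD A(1) B(1) by (simp_all add: hom_def)
    have fm: "fib_map (arrow_cat S) (ufam S (D, Q)) (ufam S (E, Q')) (\<lambda>m \<phi>. h \<cdot> \<phi>)"
      if D: "D \<in> Obj S" "is_mono S Q" "Cod S Q = pow S (prd S D D)" and E: "is_mono S Q'" "Cod S Q' = pow S (prd S E E)"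
        "fib_loc (arrow_cat S) (ufam S (E, Q'))"
       and h: "h \<in> hom S D E" "\<And>m p q. m \<in> Arr S \<Longrightarrow> p \<in> hom S (Dom S m) D \<Longrightarrow> q \<in> hom S (Dom S m) D \<Longrightarrow> rel Q m p q \<Longrightarrow> rel Q' m (h \<cdot> p) (h \<cdot> q)"
       for D E Q Q' h
    proof -
      interpret Z: fib_loc "arrow_cat S" "ufam S (E, Q')" by fact
      note hD = homD[OF h(1)]
      show ?thesis
        unfolding fib_map_def
      proof (intro conjI ballI impI)
        fix m \<phi> assume "m \<in> Obj (arrow_cat S)" "\<phi> \<in> Preds (ufam S (D, Q)) m"
        thus "h \<cdot> \<phi> \<in> Preds (ufam S (E, Q')) m" using hD by (simp add: hom_def)
      next
        fix m \<phi> \<psi> assume a: "m \<in> Obj (arrow_cat S)" "\<phi> \<in> Preds (ufam S (D, Q)) m" "\<psi> \<in> Preds (ufam S (D, Q)) m"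
          "Le (ufam S (D, Q)) m \<phi> \<psi>"
        hence "h \<cdot> \<phi> \<in> hom S (Dom S m) E" "h \<cdot> \<psi> \<in> hom S (Dom S m) E" using hD by (simp_all add: hom_def)
        thus "Le (ufam S (E, Q')) m (h \<cdot> \<phi>) (h \<cdot> \<psi>)"
          using a ufam_Le[OF _ _ _ D(2,3), of m \<phi> \<psi>] ufam_Le[OF _ _ _ E(1,2), of m "h \<cdot> \<phi>" "h \<cdot> \<psi>"] h(2)[of m \<phi> \<psi>] by simp
      next
        fix s \<phi> assume a: "s \<in> Arr (arrow_cat S)" "\<phi> \<in> Preds (ufam S (D, Q)) (Cod (arrow_cat S) s)"
        obtain m m' u v where s: "s = (m, m', u, v)" by (cases s)
        note sD = sqD[OF a(1)[unfolded s]]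
        have p: "\<phi> \<in> hom S (Dom S m') D" using a s by simp
        have "h \<cdot> (\<phi> \<cdot> u) \<in> hom S (Dom S m) E" "(h \<cdot> \<phi>) \<cdot> u = h \<cdot> (\<phi> \<cdot> u)"
          using hD homD[OF p] sD(1-8) by (simp_all add: hom_def)
        thus "iso_pred (ufam S (E, Q')) (Dom (arrow_cat S) s) (h \<cdot> Rdx (ufam S (D, Q)) s \<phi>) (Rdx (ufam S (E, Q')) s (h \<cdot> \<phi>))"
          using Z.iso_refl[of m "h \<cdot> (\<phi> \<cdot> u)"] sD(1) s by simp
      qed
    qed
    have "fib_equivalence (arrow_cat S) ?X ?Y (\<lambda>m \<phi>. f \<cdot> \<phi>) (\<lambda>m \<phi>. g \<cdot> \<phi>)"
      unfolding fib_equivalence_def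
    proof (intro conjI ballI)
      show "fib_map (arrow_cat S) ?X ?Y (\<lambda>m \<phi>. f \<cdot> \<phi>)" by (rule fm[OF A B(2,3) _ f]) (rule Y.fib_loc_axioms)
      show "fib_map (arrow_cat S) ?Y ?X (\<lambda>m \<phi>. g \<cdot> \<phi>)" by (rule fm[OF B A(2,3) _ g]) (rule X.fib_loc_axioms)
    next
      fix m \<phi> assume "m \<in> Obj (arrow_cat S)" "\<phi> \<in> Preds ?X m"
      hence m: "m \<in> Arr S" and p: "\<phi> \<in> hom S (Dom S m) A" by simp_all
      show "iso_pred ?X m (g \<cdot> (f \<cdot> \<phi>)) \<phi>"
        using whisk[OF A X.fib_loc_axioms i(1,2) fg(3) m p] whisk[OF A X.fib_loc_axioms i(2,1) fg(4) m p] fgD homD[OF p]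
        by (simp add: iso_pred_def)
    next
      fix m \<phi> assume "m \<in> Obj (arrow_cat S)" "\<phi> \<in> Preds ?Y m"
      hence m: "m \<in> Arr S" and p: "\<phi> \<in> hom S (Dom S m) B" by simp_all
      show "iso_pred ?Y m (f \<cdot> (g \<cdot> \<phi>)) \<phi>"
        using whisk[OF B Y.fib_loc_axioms i(3,4) fg(5) m p] whisk[OF B Y.fib_loc_axioms i(4,3) fg(6) m p] fgD homD[OF p]
        by (simp add: iso_pred_def)
    qed
    thus "fib_equiv (arrow_cat S) (ufam S U) (ufam S V)" unfolding fib_equiv_def UV by blast
  next
    assume "fib_equiv (arrow_cat S) (ufam S U) (ufam S V)"
    then obtain F G where FG: "fib_equivalence (arrow_cat S) ?X ?Y F G" unfolding fib_equiv_def UV by blast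
    \<comment> \<open>The Yoneda step: naturality of \<open>F\<close> at the square that classifies
      \<open>\<phi>\<close> expresses \<open>F m \<phi>\<close> through the value at the generic
      predicate.\<close>
    have repr: "F (bang S D) (Idn S D) \<in> hom S D E \<and> (\<forall>m\<in>Arr S. \<forall>\<phi>\<in>hom S (Dom S m) D.
         F (bang S D) (Idn S D) \<cdot> \<phi> \<in> hom S (Dom S m) E \<and> F m \<phi> \<in> hom S (Dom S m) E \<and>
         iso_pred (ufam S (E, Q')) m (F m \<phi>) (F (bang S D) (Idn S D) \<cdot> \<phi>)) \<and>
         upo_map S (D, Q) (E, Q') (F (bang S D) (Idn S D))"
      if D: "D \<in> Obj S" "is_mono S Q" "Cod S Q = pow S (prd S D D)" and E: "is_mono S Q'" "Cod S Q' = pow S (prd S E E)"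
        "fib_loc (arrow_cat S) (ufam S (E, Q'))" and F: "fib_map (arrow_cat S) (ufam S (D, Q)) (ufam S (E, Q')) F" for D E Q Q' F
    proof -
      interpret Z: fib_loc "arrow_cat S" "ufam S (E, Q')" by fact
      let ?f = "F (bang S D) (Idn S D)"
      have i: "Idn S D \<in> hom S D D" using D by (simp add: hom_def)
      have f: "?f \<in> hom S D E" using fib_map_in[OF F, of "bang S D" "Idn S D"] D i by simp
      have r: "?f \<cdot> \<phi> \<in> hom S (Dom S m) E \<and> F m \<phi> \<in> hom S (Dom S m) E \<and> iso_pred (ufam S (E, Q')) m (F m \<phi>) (?f \<cdot> \<phi>)"
        if m: "m \<in> Arr S" and p: "\<phi> \<in> hom S (Dom S m) D" for m \<phi>
      proof -
        note pD = homD[OF p]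
        have sq: "(m, bang S D, \<phi>, bang S (Cod S m)) \<in> Arr (arrow_cat S)" by (rule sqI) (use m pD D in simp_all)
        have "iso_pred (ufam S (E, Q')) m (F m (Idn S D \<cdot> \<phi>)) (?f \<cdot> \<phi>)"
          using F[unfolded fib_map_def, THEN conjunct2, THEN conjunct2, rule_format, OF sq, of "Idn S D"] i D by simp
        thus ?thesis using pD homD[OF f] fib_map_in[OF F, of m \<phi>] m p by (simp add: hom_def)
      qed
      have "rel Q' m (?f \<cdot> p) (?f \<cdot> q)"
        if m: "m \<in> Arr S" and p: "p \<in> hom S (Dom S m) D" and q: "q \<in> hom S (Dom S m) D" and l: "rel Q m p q" for m p q
      proof -
        have "Le (ufam S (D, Q)) m p q" using ufam_Le[OF m p q D(2,3)] l by simp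
        hence "Le (ufam S (E, Q')) m (F m p) (F m q)" using F m p q unfolding fib_map_def by simp
        hence "Le (ufam S (E, Q')) m (?f \<cdot> p) (?f \<cdot> q)"
          using Z.le_iso_cong[of m "F m p" "?f \<cdot> p" "F m q" "?f \<cdot> q"] r[OF m p] r[OF m q] m by simp
        thus ?thesis using ufam_Le[OF m _ _ E(1,2)] r[OF m p] r[OF m q] by simp
      qed
      thus ?thesis using f r upo_map_iff[OF D] by blast
    qed
    have F: "fib_map (arrow_cat S) ?X ?Y F" and G: "fib_map (arrow_cat S) ?Y ?X G"
      and GF: "\<And>m \<phi>. m \<in> Arr S \<Longrightarrow> \<phi> \<in> hom S (Dom S m) A \<Longrightarrow> iso_pred ?X m (G m (F m \<phi>)) \<phi>"
      and FG': "\<And>m \<phi>. m \<in> Arr S \<Longrightarrow> \<phi> \<in> hom S (Dom S m) B \<Longrightarrow> iso_pred ?Y m (F m (G m \<phi>)) \<phi>"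
      using FG unfolding fib_equivalence_def by simp_all
    let ?f = "F (bang S A) (Idn S A)" and ?g = "G (bang S B) (Idn S B)"
    note f = repr[OF A B(2,3) Y.fib_loc_axioms F] and g = repr[OF B A(2,3) X.fib_loc_axioms G]
    have fh: "?f \<in> hom S A B" and gh: "?g \<in> hom S B A" using f g by blast+
    have i: "?g \<cdot> ?f \<in> hom S A A" "Idn S A \<in> hom S A A" "?f \<cdot> ?g \<in> hom S B B" "Idn S B \<in> hom S B B"
      using homD[OF fh] homD[OF gh] A(1) B(1) by (simp_all add: hom_def)
    have b: "bang S A \<in> Arr S" "Dom S (bang S A) = A" "bang S B \<in> Arr S" "Dom S (bang S B) = B" using A(1) B(1) by simp_all
    note gA = g[THEN conjunct2, THEN conjunct1, rule_format, OF b(1), unfolded b(2), OF fh]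
      and fB = f[THEN conjunct2, THEN conjunct1, rule_format, OF b(3), unfolded b(4), OF gh]
    have 1: "iso_pred ?X (bang S A) (?g \<cdot> ?f) (Idn S A)"
    proof (rule X.iso_trans[OF X.iso_sym])
      show "iso_pred ?X (bang S A) (G (bang S A) ?f) (?g \<cdot> ?f)" using gA by simp
      show "iso_pred ?X (bang S A) (G (bang S A) ?f) (Idn S A)" using GF[of "bang S A" "Idn S A"] b i(2) by simp
    qed (use b i gA in simp_all)
    have 2: "iso_pred ?Y (bang S B) (?f \<cdot> ?g) (Idn S B)"
    proof (rule Y.iso_trans[OF Y.iso_sym])
      show "iso_pred ?Y (bang S B) (F (bang S B) ?g) (?f \<cdot> ?g)" using fB by simp
      show "iso_pred ?Y (bang S B) (F (bang S B) ?g) (Idn S B)" using FG'[of "bang S B" "Idn S B"] b i(4) by simp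
    qed (use b i fB in simp_all)
    have "upo_map_le S (A, R) (A, R) (?g \<cdot> ?f) (Idn S A)" "upo_map_le S (A, R) (A, R) (Idn S A) (?g \<cdot> ?f)"
      using 1 upo_map_le_iff[OF i(1,2)] upo_map_le_iff[OF i(2,1)] ufam_Le[OF b(1) _ _ A(2,3)] i(1,2) b(2)
      unfolding iso_pred_def by simp_all
    moreover have "upo_map_le S (B, R') (B, R') (?f \<cdot> ?g) (Idn S B)" "upo_map_le S (B, R') (B, R') (Idn S B) (?f \<cdot> ?g)"
      using 2 upo_map_le_iff[OF i(3,4)] upo_map_le_iff[OF i(4,3)] ufam_Le[OF b(3) _ _ B(2,3)] i(3,4) b(4)
      unfolding iso_pred_def by simp_all
    moreover have "upo_map S (A, R) (B, R') ?f" "upo_map S (B, R') (A, R) ?g" using f g by blast+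
    ultimately show "upo_equiv S U V" unfolding upo_equiv_def UV by auto
  qed
qed

end

section \<open>From triposes with gamma to uniform preorders\<close>

context cat_loc
begin

text \<open>The base component of a vertical square is an identity, so the pullback is computed on
  domains only and its projection is again vertical. Beck-Chevalley along vertical maps thereby
  reduces to pullback squares of the base category.\<close>

lemma arrow_pullback:
  assumes pb: "is_pullback S u w w' u'" and s: "(m, m', u, Idn S (Cod S m)) \<in> Arr (arrow_cat S)" "Cod S m = Cod S m'"
    and g: "(n', m', w, v) \<in> Arr (arrow_cat S)"
  shows "is_pullback (arrow_cat S) (m, m', u, Idn S (Cod S m)) (n', m', w, v)
    (n' \<cdot> u', m, w', v) (n' \<cdot> u', n', u', Idn S (Cod S n'))"
proof (rule cat_loc.pullbackI[OF arrow_loc])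
  note pD = pullbackD[OF pb] and sD = sqD[OF s(1)] and gD = sqD[OF g]
  have mu: "m' \<cdot> u = m" using sD(9) sD(1) s(2) by simp
  let ?n = "n' \<cdot> u'"
  have n: "?n \<in> Arr S" "Dom S ?n = Dom S w'" "Cod S ?n = Cod S n'" using pD gD(1-8) by simp_all
  have "m \<cdot> w' = m' \<cdot> (u \<cdot> w')" unfolding mu[symmetric] using pD(1-8) sD(1-8) gD(1-8) by simp
  also have "\<dots> = m' \<cdot> (w \<cdot> u')" using pD(9) by simp
  also have "\<dots> = v \<cdot> (n' \<cdot> u')" by (rule cmp_extend[OF gD(9)]) (use pD(1-8) sD(1-8) gD(1-8) in simp_all)
  finally have e: "m \<cdot> w' = v \<cdot> (n' \<cdot> u')" .
  show "(?n, m, w', v) \<in> Arr (arrow_cat S)"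
    by (rule sqI) (use e n pD(1-8) sD(1-8) gD(1-8) s(2) in simp_all)
  show "(?n, n', u', Idn S (Cod S n')) \<in> Arr (arrow_cat S)"
    by (rule sqI) (use n pD(1-8) sD(1-8) gD(1-8) in simp_all)
  show "(m, m', u, Idn S (Cod S m)) \<cdot>\<^bsub>arrow_cat S\<^esub> (?n, m, w', v) = (n', m', w, v) \<cdot>\<^bsub>arrow_cat S\<^esub> (?n, n', u', Idn S (Cod S n'))"
    using pD sD(1-8) gD(1-8) s(2) by simp
  {
    fix x y assume h: "x \<in> Arr (arrow_cat S)" "y \<in> Arr (arrow_cat S)" "Dom (arrow_cat S) x = Dom (arrow_cat S) y"
      "Cod (arrow_cat S) x = Dom (arrow_cat S) (m, m', u, Idn S (Cod S m))"
      "Cod (arrow_cat S) y = Dom (arrow_cat S) (n', m', w, v)"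
      "(m, m', u, Idn S (Cod S m)) \<cdot>\<^bsub>arrow_cat S\<^esub> x = (n', m', w, v) \<cdot>\<^bsub>arrow_cat S\<^esub> y"
    obtain z x1 x2 where x: "x = (z, m, x1, x2)" using h(4) by (cases x) simp
    obtain y1 y2 where y: "y = (z, n', y1, y2)" using h(3,5) x by (cases y) simp
    note xD = sqD[OF h(1)[unfolded x]] and yD = sqD[OF h(2)[unfolded y]]
    have u1: "u \<cdot> x1 = w \<cdot> y1" and u2: "x2 = v \<cdot> y2" using h(6) x y xD(1-8) by simp_all
    obtain h1 where h1: "h1 \<in> Arr S" "Dom S h1 = Dom S x1" "Cod S h1 = Dom S w'" "w' \<cdot> h1 = x1" "u' \<cdot> h1 = y1"
      by (rule pullback_lift[OF pb, of x1 y1]) (use u1 xD(1-8) yD(1-8) pD sD(1-8) gD(1-8) in simp_all)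
    have "?n \<cdot> h1 = n' \<cdot> (u' \<cdot> h1)" using h1(1,3) pD gD(1-8) by simp
    also have "\<dots> = y2 \<cdot> z" unfolding h1(5) using yD(9) .
    finally have hz: "?n \<cdot> h1 = y2 \<cdot> z" .
    have "(z, ?n, h1, y2) \<in> Arr (arrow_cat S)"
      by (rule sqI[OF _ _ _ _ _ _ _ _ hz]) (use h1(1-3) xD(1-8) yD(1-8) n in simp_all)
    moreover have "(?n, m, w', v) \<cdot>\<^bsub>arrow_cat S\<^esub> (z, ?n, h1, y2) = x"
      "(?n, n', u', Idn S (Cod S n')) \<cdot>\<^bsub>arrow_cat S\<^esub> (z, ?n, h1, y2) = y"
      using x y h1(4,5) u2 yD(1-8) by simp_all
    ultimately show "\<exists>h\<in>Arr (arrow_cat S). Dom (arrow_cat S) h = Dom (arrow_cat S) x \<and>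
      Cod (arrow_cat S) h = Dom (arrow_cat S) (?n, m, w', v) \<and>
      (?n, m, w', v) \<cdot>\<^bsub>arrow_cat S\<^esub> h = x \<and> (?n, n', u', Idn S (Cod S n')) \<cdot>\<^bsub>arrow_cat S\<^esub> h = y"
      using x by (intro bexI[of _ "(z, ?n, h1, y2)"]) simp_all
  next
    fix h k assume h: "h \<in> Arr (arrow_cat S)" "k \<in> Arr (arrow_cat S)" "Dom (arrow_cat S) h = Dom (arrow_cat S) k"
      "Cod (arrow_cat S) h = Dom (arrow_cat S) (?n, m, w', v)" "Cod (arrow_cat S) k = Dom (arrow_cat S) (?n, m, w', v)"
      "(?n, m, w', v) \<cdot>\<^bsub>arrow_cat S\<^esub> h = (?n, m, w', v) \<cdot>\<^bsub>arrow_cat S\<^esub> k"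
      "(?n, n', u', Idn S (Cod S n')) \<cdot>\<^bsub>arrow_cat S\<^esub> h = (?n, n', u', Idn S (Cod S n')) \<cdot>\<^bsub>arrow_cat S\<^esub> k"
    obtain z h1 h2 where he: "h = (z, ?n, h1, h2)" using h(4) by (cases h) simp
    obtain k1 k2 where ke: "k = (z, ?n, k1, k2)" using h(3,5) he by (cases k) simp
    note hD = sqD[OF h(1)[unfolded he]] and kD = sqD[OF h(2)[unfolded ke]]
    have "h1 = k1"
      by (rule pullback_unique[OF pb]) (use h(6,7) he ke hD(1-8) kD(1-8) n in simp_all)
    moreover have "h2 = k2" using h(7) he ke hD(1-8) kD(1-8) n by simp
    ultimately show "h = k" using he ke by simp
  }
qed (use s(1) g in \<open>simp_all only: arrow_cat_simps\<close>)

end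

section \<open>Triposes with \<open>\<gamma>\<close>\<close>

locale gamma_tripos = topos_loc S for S :: "('o, 'a) cat" (structure) +
  fixes P :: "('o, 'a, 'p) fpre" and \<gamma> :: "'o \<Rightarrow> 'p \<Rightarrow> 'a"
  assumes gt: "tripos_with_gamma S (P, \<gamma>)"

sublocale gamma_tripos \<subseteq> fib_loc S P
  using gt by unfold_locales (simp add: tripos_with_gamma_def)

context gamma_tripos
begin

lemma gt_props:
  shows refl_epi: "reflects_le_along S (is_epi S) P"
    and finite_meets: "has_finite_meets S P" and implication: "has_implication S P" and foralls: "has_forall S (\<lambda>_. True) P"
    and generic: "\<exists>Prp tr. is_generic S P Prp tr"
    and gamma_map: "fib_map S P (sub_fib S) \<gamma>"
    and gamma_top: "\<And>M \<tau>. M \<in> Obj S \<Longrightarrow> is_top P M \<tau> \<Longrightarrow> is_top (sub_fib S) M (\<gamma> M \<tau>)"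
    and gamma_meet: "\<And>M \<phi> \<psi> \<mu>. M \<in> Obj S \<Longrightarrow> \<phi> \<in> Preds P M \<Longrightarrow> \<psi> \<in> Preds P M \<Longrightarrow> is_meet P M \<phi> \<psi> \<mu> \<Longrightarrow>
        is_meet (sub_fib S) M (\<gamma> M \<phi>) (\<gamma> M \<psi>) (\<gamma> M \<mu>)"
    and gamma_one: "\<And>p. p \<in> Preds P (one S) \<Longrightarrow> is_top (sub_fib S) (one S) (\<gamma> (one S) p) \<Longrightarrow> is_top P (one S) p"
  using gt unfolding tripos_with_gamma_def prod.case by blast+

lemma top_exists: "I \<in> Obj S \<Longrightarrow> \<exists>\<tau>. is_top P I \<tau>"
  and meet_exists: "I \<in> Obj S \<Longrightarrow> \<phi> \<in> Preds P I \<Longrightarrow> \<psi> \<in> Preds P I \<Longrightarrow> \<exists>\<mu>. is_meet P I \<phi> \<psi> \<mu>"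
  and top_rdx: "f \<in> Arr S \<Longrightarrow> is_top P (Cod S f) \<tau> \<Longrightarrow> is_top P (Dom S f) (Rdx P f \<tau>)"
  and meet_rdx: "f \<in> Arr S \<Longrightarrow> \<phi> \<in> Preds P (Cod S f) \<Longrightarrow> \<psi> \<in> Preds P (Cod S f) \<Longrightarrow> is_meet P (Cod S f) \<phi> \<psi> \<mu> \<Longrightarrow>
        is_meet P (Dom S f) (Rdx P f \<phi>) (Rdx P f \<psi>) (Rdx P f \<mu>)"
  using finite_meets unfolding has_finite_meets_def by blast+

lemma imp_exists: "I \<in> Obj S \<Longrightarrow> \<phi> \<in> Preds P I \<Longrightarrow> \<psi> \<in> Preds P I \<Longrightarrow> \<exists>\<mu>. is_imp P I \<phi> \<psi> \<mu>"
  and imp_rdx: "f \<in> Arr S \<Longrightarrow> \<phi> \<in> Preds P (Cod S f) \<Longrightarrow> \<psi> \<in> Preds P (Cod S f) \<Longrightarrow> is_imp P (Cod S f) \<phi> \<psi> \<mu> \<Longrightarrow>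
        is_imp P (Dom S f) (Rdx P f \<phi>) (Rdx P f \<psi>) (Rdx P f \<mu>)"
  using implication unfolding has_implication_def by blast+

lemma forall_exists: "f \<in> Arr S \<Longrightarrow> \<phi> \<in> Preds P (Dom S f) \<Longrightarrow> \<exists>\<chi>. is_forall S P f \<phi> \<chi>"
  and forall_rdx: "is_pullback S f g g' f' \<Longrightarrow> \<phi> \<in> Preds P (Dom S f) \<Longrightarrow> is_forall S P f \<phi> \<chi> \<Longrightarrow>
           is_forall S P f' (Rdx P g' \<phi>) (Rdx P g \<chi>)"
  using foralls unfolding has_forall_def by blast+

lemma gamma_sub: "M \<in> Obj S \<Longrightarrow> \<chi> \<in> Preds P M \<Longrightarrow> is_mono S (\<gamma> M \<chi>) \<and> Cod S (\<gamma> M \<chi>) = M"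
  using fib_map_in[OF gamma_map, of M \<chi>] by (simp add: sub_fib_def)

text \<open>Naturality of \<open>\<gamma>\<close> is an isomorphism with a chosen inverse image; on
  generalized elements neither the choice nor the isomorphism is visible.\<close>

lemma gamma_rdx:
  assumes "v \<in> Arr S" "\<chi> \<in> Preds P (Cod S v)" "h \<in> Arr S" "Cod S h = Dom S v"
  shows "factors S h (\<gamma> (Dom S v) (Rdx P v \<chi>)) \<longleftrightarrow> factors S (v \<cdot> h) (\<gamma> (Cod S v) \<chi>)"
proof -
  let ?a = "\<gamma> (Dom S v) (Rdx P v \<chi>)" and ?b = "Rdx (sub_fib S) v (\<gamma> (Cod S v) \<chi>)"
  have g: "is_mono S (\<gamma> (Cod S v) \<chi>)" "Cod S (\<gamma> (Cod S v) \<chi>) = Cod S v" using gamma_sub assms by simp_all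
  note s = sub_reindex[OF assms(1) g]
  have a: "?a \<in> Arr S" "?b \<in> Arr S" using gamma_sub[of "Dom S v" "Rdx P v \<chi>"] rdx_in assms s by simp_all
  have "iso_pred (sub_fib S) (Dom S v) ?a ?b" using gamma_map assms unfolding fib_map_def by blast
  hence "factors S ?a ?b" "factors S ?b ?a" by (simp_all add: iso_pred_def sub_fib_def)
  hence "factors S h ?a \<longleftrightarrow> factors S h ?b" using factors_trans a by blast
  thus ?thesis using s(3) assms by simp
qed

definition gtop :: "'o \<Rightarrow> 'p \<Rightarrow> bool" where
  "gtop L \<chi> \<longleftrightarrow> \<chi> \<in> Preds P L \<and> factors S (Idn S L) (\<gamma> L \<chi>)"

text \<open>With this, most later arguments can track which predicates have maximal
  \<open>\<gamma>\<close> instead of the monos themselves.\<close>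

lemma factors_gamma:
  assumes "h \<in> Arr S" "\<chi> \<in> Preds P (Cod S h)"
  shows "factors S h (\<gamma> (Cod S h) \<chi>) \<longleftrightarrow> gtop (Dom S h) (Rdx P h \<chi>)"
  using gamma_rdx[OF assms, of "Idn S (Dom S h)"] rdx_in assms by (simp add: gtop_def)

lemma gtop_in: "gtop L \<chi> \<Longrightarrow> \<chi> \<in> Preds P L"
  by (simp add: gtop_def)

lemma gtop_top: "L \<in> Obj S \<Longrightarrow> is_top P L \<tau> \<Longrightarrow> gtop L \<tau>"
  using gamma_top[of L \<tau>] by (simp add: gtop_def is_top_def sub_fib_def)

lemma gtop_meet:
  assumes "L \<in> Obj S" "gtop L \<chi>" "gtop L \<chi>'" "is_meet P L \<chi> \<chi>' \<mu>"
  shows "gtop L \<mu>"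
proof -
  have "is_meet (sub_fib S) L (\<gamma> L \<chi>) (\<gamma> L \<chi>') (\<gamma> L \<mu>)"
    using gamma_meet assms gtop_in by blast
  thus ?thesis using assms by (simp add: gtop_def is_meet_def sub_fib_def)
qed

lemma gtop_mono:
  assumes "L \<in> Obj S" "gtop L \<chi>" "Le P L \<chi> \<chi>'" "\<chi>' \<in> Preds P L"
  shows "gtop L \<chi>'"
proof -
  have "factors S (\<gamma> L \<chi>) (\<gamma> L \<chi>')"
    using gamma_map assms gtop_in[OF assms(2)] unfolding fib_map_def by (simp add: sub_fib_def)
  thus ?thesis
    using factors_trans assms gamma_sub[OF assms(1)] gtop_in[OF assms(2)] mono_arr unfolding gtop_def by blast
qed

lemma gtop_rdx:
  assumes "v \<in> Arr S" "gtop (Cod S v) \<chi>"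
  shows "gtop (Dom S v) (Rdx P v \<chi>)"
proof -
  have c: "\<chi> \<in> Preds P (Cod S v)" and f: "factors S (Idn S (Cod S v)) (\<gamma> (Cod S v) \<chi>)"
    using assms(2) unfolding gtop_def by blast+
  have "factors S (Idn S (Cod S v) \<cdot> v) (\<gamma> (Cod S v) \<chi>)"
    by (rule factors_cmp[OF f]) (use gamma_sub[OF _ c] assms(1) in simp_all)
  thus ?thesis using factors_gamma assms(1) c by simp
qed

lemma gtop_one: "gtop (one S) p \<Longrightarrow> is_top P (one S) p"
proof -
  assume a: "gtop (one S) p"
  have p: "p \<in> Preds P (one S)" using a by (rule gtop_in)
  note g = gamma_sub[OF one_obj p]
  have "factors S u (\<gamma> (one S) p)" if "is_mono S u" "Cod S u = one S" for u
    by (rule idn_factors) (use a g that in \<open>simp_all add: gtop_def\<close>)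
  hence "is_top (sub_fib S) (one S) (\<gamma> (one S) p)"
    using g by (simp add: is_top_def sub_fib_def)
  thus ?thesis using gamma_one p by simp
qed

text \<open>The order of the fibered tripos over \<open>m\<close> that corresponds to \<open>(P, \<gamma>)\<close>. In terms of
  quantifiers, \<open>tle m \<phi> \<psi>\<close> says that \<open>\<gamma>\<close> of \<open>\<forall>\<^sub>m (\<phi> \<Rightarrow> \<psi>)\<close> is the maximal subobject.\<close>

definition tle :: "'a \<Rightarrow> 'p \<Rightarrow> 'p \<Rightarrow> bool" where
  "tle m \<phi> \<psi> \<longleftrightarrow> (\<exists>\<chi>. gtop (Cod S m) \<chi> \<and> ent (Dom S m) (Rdx P m \<chi>) \<phi> \<psi>)"

section \<open>Properties of the recovered order\<close>

lemma tle_le: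
  assumes "m \<in> Arr S" "\<phi> \<in> Preds P (Dom S m)" "\<psi> \<in> Preds P (Dom S m)" "Le P (Dom S m) \<phi> \<psi>"
  shows "tle m \<phi> \<psi>"
proof -
  obtain \<tau> where "is_top P (Cod S m) \<tau>" using top_exists assms(1) cod_obj by blast
  thus ?thesis using gtop_top assms ent_le unfolding tle_def by (meson cod_obj dom_obj)
qed

text \<open>The meet of the two witnesses serves for both, and its \<open>\<gamma>\<close> is still
  maximal because \<open>\<gamma>\<close> preserves meets.\<close>

lemma tle_common:
  assumes "m \<in> Arr S" "tle m \<phi> \<psi>" "tle m \<phi>' \<psi>'"
  shows "\<exists>\<chi>. gtop (Cod S m) \<chi> \<and> ent (Dom S m) (Rdx P m \<chi>) \<phi> \<psi> \<and> ent (Dom S m) (Rdx P m \<chi>) \<phi>' \<psi>'"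
proof -
  obtain \<chi> \<chi>' where c: "gtop (Cod S m) \<chi>" "ent (Dom S m) (Rdx P m \<chi>) \<phi> \<psi>"
      "gtop (Cod S m) \<chi>'" "ent (Dom S m) (Rdx P m \<chi>') \<phi>' \<psi>'"
    using assms unfolding tle_def by blast
  note cP = gtop_in[OF c(1)] gtop_in[OF c(3)]
  obtain \<mu> where mu: "is_meet P (Cod S m) \<chi> \<chi>' \<mu>" using meet_exists cP assms(1) by fastforce
  have "is_meet P (Dom S m) (Rdx P m \<chi>) (Rdx P m \<chi>') (Rdx P m \<mu>)" using meet_rdx mu assms(1) cP by blast
  hence "Le P (Dom S m) (Rdx P m \<mu>) (Rdx P m \<chi>)" "Le P (Dom S m) (Rdx P m \<mu>) (Rdx P m \<chi>')" "Rdx P m \<mu> \<in> Preds P (Dom S m)"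
    using le_refl assms(1) unfolding is_meet_def by (meson dom_obj)+
  hence "ent (Dom S m) (Rdx P m \<mu>) \<phi> \<psi>" "ent (Dom S m) (Rdx P m \<mu>) \<phi>' \<psi>'"
    using ent_weaken c rdx_in cP assms(1) by (meson dom_obj)+
  thus ?thesis using gtop_meet[OF _ c(1,3) mu] assms(1) by auto
qed

lemma tle_trans:
  assumes "m \<in> Arr S" "tle m \<phi> \<psi>" "tle m \<psi> \<theta>"
  shows "tle m \<phi> \<theta>"
  using tle_common[OF assms] ent_trans unfolding tle_def by blast

lemma tle_cong:
  assumes "m \<in> Arr S" "iso_pred P (Dom S m) \<phi> \<phi>'" "iso_pred P (Dom S m) \<psi> \<psi>'"
    "\<phi> \<in> Preds P (Dom S m)" "\<phi>' \<in> Preds P (Dom S m)" "\<psi> \<in> Preds P (Dom S m)" "\<psi>' \<in> Preds P (Dom S m)"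
  shows "tle m \<phi> \<psi> \<longleftrightarrow> tle m \<phi>' \<psi>'"
proof -
  have "ent (Dom S m) (Rdx P m \<chi>) \<phi> \<psi> \<longleftrightarrow> ent (Dom S m) (Rdx P m \<chi>) \<phi>' \<psi>'" if "gtop (Cod S m) \<chi>" for \<chi>
    by (rule ent_iso_cong) (use assms that gtop_in iso_refl rdx_in in simp_all)
  thus ?thesis unfolding tle_def by blast
qed

text \<open>The witness is reindexed along the base component \<open>v\<close>; commutativity of the
  square identifies its two reindexings to \<open>Dom S m'\<close>.\<close>

lemma tle_rdx:
  assumes sq: "(m', m, u, v) \<in> Arr (arrow_cat S)" and p: "\<phi> \<in> Preds P (Dom S m)" "\<psi> \<in> Preds P (Dom S m)"
    and l: "tle m \<phi> \<psi>"
  shows "tle m' (Rdx P u \<phi>) (Rdx P u \<psi>)"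
proof -
  note a = sqD[OF sq]
  obtain \<chi> where c: "gtop (Cod S m) \<chi>" "ent (Dom S m) (Rdx P m \<chi>) \<phi> \<psi>" using l unfolding tle_def by blast
  note cP = gtop_in[OF c(1)]
  have mc: "Rdx P m \<chi> \<in> Preds P (Dom S m)" using rdx_in a(2) cP by simp
  have vc: "Rdx P v \<chi> \<in> Preds P (Cod S m')" using rdx_in[of v \<chi>] a cP by simp
  have "ent (Dom S m') (Rdx P u (Rdx P m \<chi>)) (Rdx P u \<phi>) (Rdx P u \<psi>)"
    using ent_rdx[OF finite_meets a(3), of "Rdx P m \<chi>" \<phi> \<psi>] c(2) p mc a(5,6) by simp
  moreover have "iso_pred P (Dom S m') (Rdx P (m \<cdot> u) \<chi>) (Rdx P u (Rdx P m \<chi>))"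
    using rdx_cmp[of u m \<chi>] a cP by simp
  moreover have "iso_pred P (Dom S m') (Rdx P (m \<cdot> u) \<chi>) (Rdx P m' (Rdx P v \<chi>))"
    unfolding a(9) using rdx_cmp[of m' v \<chi>] a(1-8) cP by simp
  moreover have ins: "Rdx P u (Rdx P m \<chi>) \<in> Preds P (Dom S m')" "Rdx P (m \<cdot> u) \<chi> \<in> Preds P (Dom S m')" "Rdx P m' (Rdx P v \<chi>) \<in> Preds P (Dom S m')"
    using rdx_in[of u "Rdx P m \<chi>"] rdx_in[of "m \<cdot> u" \<chi>] rdx_in[of m' "Rdx P v \<chi>"] mc vc cP a(1-8) by simp_all
  ultimately have "ent (Dom S m') (Rdx P m' (Rdx P v \<chi>)) (Rdx P u \<phi>) (Rdx P u \<psi>)"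
    using ent_weaken[of "Dom S m'" "Rdx P u (Rdx P m \<chi>)" "Rdx P u \<phi>" "Rdx P u \<psi>" "Rdx P m' (Rdx P v \<chi>)"]
      iso_trans[of "Dom S m'" "Rdx P m' (Rdx P v \<chi>)" "Rdx P (m \<cdot> u) \<chi>" "Rdx P u (Rdx P m \<chi>)"] iso_sym a(1)
    unfolding iso_pred_def by simp
  moreover have "gtop (Cod S m') (Rdx P v \<chi>)" using gtop_rdx[of v \<chi>] c(1) a by simp
  ultimately show ?thesis unfolding tle_def by blast
qed

text \<open>The predicate \<open>\<chi>\<close> lives over the codomain of \<open>m\<close>,
  untouched by the cover \<open>e\<close> of the domain, so the pre-stack condition can be applied
  with \<open>\<chi>\<close> held fixed.\<close>

lemma tle_epi:
  assumes m: "m \<in> Arr S" and e: "is_epi S e" "Cod S e = Dom S m" and p: "\<phi> \<in> Preds P (Dom S m)" "\<psi> \<in> Preds P (Dom S m)"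
    and l: "ent (Dom S e) (Rdx P (m \<cdot> e) \<chi>) (Rdx P e \<phi>) (Rdx P e \<psi>)" and c: "\<chi> \<in> Preds P (Cod S m)"
  shows "ent (Dom S m) (Rdx P m \<chi>) \<phi> \<psi>"
proof -
  have ea: "e \<in> Arr S" using e by simp
  have mc: "Rdx P m \<chi> \<in> Preds P (Dom S m)" using rdx_in m c by simp
  have "iso_pred P (Dom S e) (Rdx P (m \<cdot> e) \<chi>) (Rdx P e (Rdx P m \<chi>))" using rdx_cmp[of e m \<chi>] ea m e c by simp
  hence "ent (Dom S e) (Rdx P e (Rdx P m \<chi>)) (Rdx P e \<phi>) (Rdx P e \<psi>)"
    using ent_weaken[OF l] rdx_in[of "m \<cdot> e" \<chi>] rdx_in[of e "Rdx P m \<chi>"] mc c m ea e unfolding iso_pred_def by simp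
  thus ?thesis using ent_reflect[OF finite_meets refl_epi e(1) ea, of "Rdx P m \<chi>" \<phi> \<psi>] e(2) mc p by simp
qed

text \<open>One direction is reindexing followed by the counit. In the other the same witness
  \<open>\<kappa>\<close> works, since it lives over \<open>Cod S m\<close> and the adjunction for
  \<open>u\<close> applies to each \<open>\<eta>\<close> below \<open>\<xi>\<close> and the
  reindexed \<open>\<kappa>\<close>.\<close>

lemma tle_forall:
  assumes u: "u \<in> Arr S" and m: "m \<in> Arr S" "Dom S m = Cod S u" and p: "\<phi> \<in> Preds P (Dom S u)" "\<xi> \<in> Preds P (Cod S u)"
    and f: "is_forall S P u \<phi> \<chi>"
  shows "tle m \<xi> \<chi> \<longleftrightarrow> tle (m \<cdot> u) (Rdx P u \<xi>) \<phi>"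
proof
  have c: "\<chi> \<in> Preds P (Cod S u)" and f': "\<And>\<psi>. \<psi> \<in> Preds P (Cod S u) \<Longrightarrow> Le P (Cod S u) \<psi> \<chi> \<longleftrightarrow> Le P (Dom S u) (Rdx P u \<psi>) \<phi>"
    using f unfolding is_forall_def by blast+
  have mu: "m \<cdot> u \<in> Arr S" "Dom S (m \<cdot> u) = Dom S u" "Cod S (m \<cdot> u) = Cod S m" using u m by simp_all
  have uP: "Rdx P u \<chi> \<in> Preds P (Dom S u)" "Rdx P u \<xi> \<in> Preds P (Dom S u)" using rdx_in u c p by simp_all
  {
    assume l: "tle m \<xi> \<chi>"
    have "(m \<cdot> u, m, u, Idn S (Cod S m)) \<in> Arr (arrow_cat S)" by (rule sqI) (use u m in simp_all)
    hence "tle (m \<cdot> u) (Rdx P u \<xi>) (Rdx P u \<chi>)" by (rule tle_rdx) (use p c l m in simp_all)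
    moreover have "tle (m \<cdot> u) (Rdx P u \<chi>) \<phi>"
      by (rule tle_le) (use mu uP p f'[OF c] le_refl[OF cod_obj[OF u] c] in simp_all)
    ultimately show "tle (m \<cdot> u) (Rdx P u \<xi>) \<phi>" using tle_trans mu(1) by blast
  next
    assume "tle (m \<cdot> u) (Rdx P u \<xi>) \<phi>"
    then obtain \<kappa> where k: "gtop (Cod S m) \<kappa>" "ent (Dom S u) (Rdx P (m \<cdot> u) \<kappa>) (Rdx P u \<xi>) \<phi>"
      unfolding tle_def mu(2,3) by blast
    note kP = gtop_in[OF k(1)]
    have mk: "Rdx P m \<kappa> \<in> Preds P (Cod S u)" using rdx_in[of m \<kappa>] m kP by simp
    have i: "iso_pred P (Dom S u) (Rdx P (m \<cdot> u) \<kappa>) (Rdx P u (Rdx P m \<kappa>))" using rdx_cmp[of u m \<kappa>] u m kP by simp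
    have iP: "Rdx P (m \<cdot> u) \<kappa> \<in> Preds P (Dom S u)" "Rdx P u (Rdx P m \<kappa>) \<in> Preds P (Dom S u)"
      using rdx_in[of "m \<cdot> u" \<kappa>] rdx_in[of u "Rdx P m \<kappa>"] mk mu kP u by simp_all
    have "ent (Dom S m) (Rdx P m \<kappa>) \<xi> \<chi>"
      unfolding ent_def m(2)
    proof (intro ballI impI)
      fix \<eta> assume e: "\<eta> \<in> Preds P (Cod S u)" "Le P (Cod S u) \<eta> (Rdx P m \<kappa>)" "Le P (Cod S u) \<eta> \<xi>"
      have ue: "Rdx P u \<eta> \<in> Preds P (Dom S u)" using rdx_in u e by simp
      have "Le P (Dom S u) (Rdx P u \<eta>) (Rdx P u (Rdx P m \<kappa>))" using rdx_mono u e mk by simp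
      hence "Le P (Dom S u) (Rdx P u \<eta>) (Rdx P (m \<cdot> u) \<kappa>)"
        using le_trans[of "Dom S u" "Rdx P u \<eta>" "Rdx P u (Rdx P m \<kappa>)" "Rdx P (m \<cdot> u) \<kappa>"] i iP ue u unfolding iso_pred_def by simp
      moreover have "Le P (Dom S u) (Rdx P u \<eta>) (Rdx P u \<xi>)" using rdx_mono u e p by simp
      ultimately have "Le P (Dom S u) (Rdx P u \<eta>) \<phi>" using k(2) ue unfolding ent_def by blast
      thus "Le P (Cod S u) \<eta> \<chi>" using f' e(1) by simp
    qed
    thus "tle m \<xi> \<chi>" using k(1) unfolding tle_def by blast
  }
qed

text \<open>Here the condition on \<open>\<gamma>\<close> over the terminal object enters: a witness
  over \<open>1\<close> is top, and so is its reindexing to \<open>M\<close>, hence it drops out of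
  the entailment.\<close>

lemma tle_bang:
  assumes "M \<in> Obj S" "\<phi> \<in> Preds P M" "\<psi> \<in> Preds P M"
  shows "tle (bang S M) \<phi> \<psi> \<longleftrightarrow> Le P M \<phi> \<psi>"
proof
  assume "tle (bang S M) \<phi> \<psi>"
  then obtain \<chi> where c: "gtop (one S) \<chi>" "ent M (Rdx P (bang S M) \<chi>) \<phi> \<psi>" using assms unfolding tle_def by auto
  have "is_top P M (Rdx P (bang S M) \<chi>)" using top_rdx[of "bang S M" \<chi>] gtop_one[OF c(1)] assms(1) by simp
  thus "Le P M \<phi> \<psi>" using ent_top c(2) assms by blast
next
  assume "Le P M \<phi> \<psi>"
  thus "tle (bang S M) \<phi> \<psi>" using tle_le[of "bang S M" \<phi> \<psi>] assms by simp
qed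

text \<open>Over an identity the predicate itself can be the witness. In this way
  \<open>\<gamma>\<close> is recovered from the order.\<close>

lemma tle_idn:
  assumes "K \<in> Obj S" "is_top P K \<tau>" "\<phi> \<in> Preds P K"
  shows "tle (Idn S K) \<tau> \<phi> \<longleftrightarrow> gtop K \<phi>"
proof
  assume "tle (Idn S K) \<tau> \<phi>"
  then obtain \<chi> where c: "gtop K \<chi>" "ent K (Rdx P (Idn S K) \<chi>) \<tau> \<phi>" using assms unfolding tle_def by auto
  note cP = gtop_in[OF c(1)]
  have "Le P K \<chi> (Rdx P (Idn S K) \<chi>)" using rdx_idn assms(1) cP unfolding iso_pred_def by blast
  hence "Le P K \<chi> \<phi>" using c(2) cP assms unfolding ent_def is_top_def by blast
  thus "gtop K \<phi>" using gtop_mono c(1) assms by blast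
next
  assume g: "gtop K \<phi>"
  have "Le P K (Rdx P (Idn S K) \<phi>) \<phi>" "Rdx P (Idn S K) \<phi> \<in> Preds P K"
    using rdx_idn[of K \<phi>] rdx_in[of "Idn S K" \<phi>] assms unfolding iso_pred_def by simp_all
  hence "ent K (Rdx P (Idn S K) \<phi>) \<tau> \<phi>" using le_trans assms unfolding ent_def by blast
  thus "tle (Idn S K) \<tau> \<phi>" using g assms(1) unfolding tle_def by auto
qed

text \<open>On a family \<open>?r\<close>, Beck-Chevalley turns the quantifier that defines
  \<open>R\<close> into one over the object of pairs in the family, while \<open>tle m\<close>
  quantifies over the index object \<open>Dom S m\<close>. The index object covers the object of
  pairs; the two sides are matched by reindexing in one direction and by the pre-stack condition in
  the other.\<close>

lemma classifying_relation:
  assumes gen: "is_generic S P A tr"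
  obtains R where "is_mono S R" "Cod S R = pow S (prd S A A)"
    "\<And>m f g. m \<in> Arr S \<Longrightarrow> f \<in> hom S (Dom S m) A \<Longrightarrow> g \<in> hom S (Dom S m) A \<Longrightarrow>
      rel R m f g \<longleftrightarrow> tle m (Rdx P f tr) (Rdx P g tr)"
proof -
  have A: "A \<in> Obj S" and tr: "tr \<in> Preds P A" using gen unfolding is_generic_def by blast+
  let ?X = "prd S A A"
  let ?Q = "pow S ?X"
  let ?e = "mem S ?X"
  have X: "?X \<in> Obj S" using A by simp
  define E where "E = Dom S ?e"
  have e: "?e \<in> Arr S" "Dom S ?e = E" "Cod S ?e = prd S ?X ?Q" "E \<in> Obj S" using X by (simp_all add: E_def)
  define e1 where "e1 = pr1 S ?X ?Q \<cdot> ?e"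
  define e2 where "e2 = pr2 S ?X ?Q \<cdot> ?e"
  have e12: "e1 \<in> Arr S" "Dom S e1 = E" "Cod S e1 = ?X" "e2 \<in> Arr S" "Dom S e2 = E" "Cod S e2 = ?Q"
    unfolding e1_def e2_def using e X by simp_all
  have et: "tup S e1 e2 = ?e" unfolding e1_def e2_def by (rule tup_eta) (use e X in simp_all)
  define a1 where "a1 = pr1 S A A \<cdot> e1"
  define a2 where "a2 = pr2 S A A \<cdot> e1"
  have a12: "a1 \<in> Arr S" "Dom S a1 = E" "Cod S a1 = A" "a2 \<in> Arr S" "Dom S a2 = E" "Cod S a2 = A"
    unfolding a1_def a2_def using e12 A by simp_all
  have at: "tup S a1 a2 = e1" unfolding a1_def a2_def by (rule tup_eta) (use e12 A in simp_all)
  let ?t1 = "Rdx P a1 tr" and ?t2 = "Rdx P a2 tr"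
  have t: "?t1 \<in> Preds P E" "?t2 \<in> Preds P E" using rdx_in[of a1 tr] rdx_in[of a2 tr] a12 tr by simp_all
  obtain \<iota> where io: "is_imp P E ?t1 ?t2 \<iota>" using imp_exists[OF e(4) t] by blast
  have iP: "\<iota> \<in> Preds P E" using io unfolding is_imp_def by blast
  have "\<iota> \<in> Preds P (Dom S e2)" using iP e12 by simp
  then obtain \<chi> where ch: "is_forall S P e2 \<iota> \<chi>" using forall_exists[OF e12(4)] by blast
  have cP: "\<chi> \<in> Preds P ?Q" using ch e12 unfolding is_forall_def by simp
  let ?R = "\<gamma> ?Q \<chi>"
  have R: "is_mono S ?R" "Cod S ?R = ?Q" using gamma_sub[OF _ cP] X by simp_all
  have "rel ?R m f g \<longleftrightarrow> tle m (Rdx P f tr) (Rdx P g tr)"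
    if m: "m \<in> Arr S" and f: "f \<in> hom S (Dom S m) A" and g: "g \<in> hom S (Dom S m) A" for m f g
  proof -
    note fg = homD[OF f] homD[OF g]
    let ?t = "tup S f g"
    let ?r = "img m ?t"
    have tt: "?t \<in> Arr S" "Dom S ?t = Dom S m" "Cod S ?t = ?X" using fg by simp_all
    have r: "?r \<in> Arr S" "Dom S ?r = Cod S m" "Cod S ?r = ?Q" using m tt by simp_all
    have fgP: "Rdx P f tr \<in> Preds P (Dom S m)" "Rdx P g tr \<in> Preds P (Dom S m)"
      using rdx_in[of f tr] rdx_in[of g tr] fg tr by simp_all
    have rc: "Rdx P ?r \<chi> \<in> Preds P (Cod S m)" using rdx_in[of ?r \<chi>] r cP by simp
    have fr: "rel ?R m f g \<longleftrightarrow> gtop (Cod S m) (Rdx P ?r \<chi>)"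
      unfolding rel_def using factors_gamma[of ?r \<chi>] r cP by simp
    \<comment> \<open>The object \<open>?N\<close> consists of the pairs that belong to
      \<open>?r\<close> at some point of the base: \<open>n\<close> gives the point and
      \<open>k\<close> the pair with its membership.\<close>
    obtain n k where pb: "is_pullback S e2 ?r k n" using pb_pullback[of e2 ?r] e12 r by auto
    note pD = pullbackD[OF pb]
    have nk: "n \<in> Arr S" "k \<in> Arr S" "Dom S k = Dom S n" "Cod S n = Cod S m" "Cod S k = E" using pD e12 r by simp_all
    let ?N = "Dom S n"
    have bc: "is_forall S P n (Rdx P k \<iota>) (Rdx P ?r \<chi>)" using forall_rdx[OF pb _ ch] iP e12 by simp
    have ki: "is_imp P ?N (Rdx P k ?t1) (Rdx P k ?t2) (Rdx P k \<iota>)" using imp_rdx[of k ?t1 ?t2 \<iota>] io t nk by simp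
    have kP: "Rdx P k ?t1 \<in> Preds P ?N" "Rdx P k ?t2 \<in> Preds P ?N" "Rdx P k \<iota> \<in> Preds P ?N"
      using rdx_in[of k] nk t iP by simp_all
    have kent: "Le P ?N \<xi> (Rdx P k \<iota>) \<longleftrightarrow> ent ?N \<xi> (Rdx P k ?t1) (Rdx P k ?t2)" if "\<xi> \<in> Preds P ?N" for \<xi>
      using is_imp_ent[OF finite_meets, of ?N "Rdx P k ?t1" "Rdx P k ?t2"] kP ki nk that by simp
    have isoc: "iso_pred P (Dom S y) (Rdx P (x \<cdot> y) \<theta>) (Rdx P y (Rdx P x \<theta>))" "Rdx P (x \<cdot> y) \<theta> \<in> Preds P (Dom S y)"
        "Rdx P y (Rdx P x \<theta>) \<in> Preds P (Dom S y)"
      if "x \<in> Arr S" "y \<in> Arr S" "Cod S y = Dom S x" "\<theta> \<in> Preds P (Cod S x)" for x y \<theta>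
      using rdx_cmp[of y x \<theta>] rdx_in[of y "Rdx P x \<theta>"] rdx_in[of x \<theta>] rdx_in[of "x \<cdot> y" \<theta>] that by simp_all
    have main: "Le P (Cod S m) \<kappa> (Rdx P ?r \<chi>) \<longleftrightarrow> ent ?N (Rdx P n \<kappa>) (Rdx P (a1 \<cdot> k) tr) (Rdx P (a2 \<cdot> k) tr)"
      if k: "\<kappa> \<in> Preds P (Cod S m)" for \<kappa>
    proof -
      have nP: "Rdx P n \<kappa> \<in> Preds P ?N" using rdx_in[of n \<kappa>] nk k by simp
      have "Le P (Cod S m) \<kappa> (Rdx P ?r \<chi>) \<longleftrightarrow> Le P ?N (Rdx P n \<kappa>) (Rdx P k \<iota>)"
        using bc k nk unfolding is_forall_def by simp
      also have "\<dots> \<longleftrightarrow> ent ?N (Rdx P n \<kappa>) (Rdx P k ?t1) (Rdx P k ?t2)" using kent[OF nP] .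
      also have "\<dots> \<longleftrightarrow> ent ?N (Rdx P n \<kappa>) (Rdx P (a1 \<cdot> k) tr) (Rdx P (a2 \<cdot> k) tr)"
        by (rule ent_iso_cong) (use isoc[of a1 k tr] isoc[of a2 k tr] iso_refl iso_sym nP a12 nk tr kP in simp_all)
      finally show ?thesis .
    qed
    show ?thesis
    proof
      assume "rel ?R m f g"
      hence gt: "gtop (Cod S m) (Rdx P ?r \<chi>)" using fr by simp
      have ea: "ent ?N (Rdx P n (Rdx P ?r \<chi>)) (Rdx P (a1 \<cdot> k) tr) (Rdx P (a2 \<cdot> k) tr)"
        using main[OF rc] le_refl[OF _ rc] m by simp
      \<comment> \<open>The generic pair \<open>(f, g)\<close> belongs to the family, which gives a
        map \<open>w\<close> from \<open>Dom S m\<close> to \<open>?N\<close> over the base.\<close>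
      have "mb ?X ?t (?r \<cdot> m)"
        by (rule mb_img[THEN iffD2, rotated -1, OF imem_self]) (use m tt in simp_all)
      then obtain j where j: "j \<in> Arr S" "Dom S j = Dom S (tup S ?t (?r \<cdot> m))" "Cod S j = E" "?e \<cdot> j = tup S ?t (?r \<cdot> m)"
        using e by (elim factorsE) simp_all
      have jd: "Dom S j = Dom S m" using j(2) m tt r by simp
      have "tup S (e1 \<cdot> j) (e2 \<cdot> j) = tup S ?t (?r \<cdot> m)" using j(1,3,4) e12 unfolding et[symmetric] by simp
      hence ej: "e1 \<cdot> j = ?t \<and> e2 \<cdot> j = ?r \<cdot> m" by (rule tup_inj) (use j(1,3) jd e12 m tt r in simp_all)
      obtain w where w: "w \<in> Arr S" "Dom S w = Dom S j" "Cod S w = Dom S k" "k \<cdot> w = j" "n \<cdot> w = m"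
        by (rule pullback_lift[OF pb, of j m]) (use j(1,3) jd ej e12 m r in simp_all)
      have "tup S (a1 \<cdot> j) (a2 \<cdot> j) = tup S f g" using ej j(1,3) a12 unfolding at[symmetric] by simp
      hence aj: "a1 \<cdot> j = f \<and> a2 \<cdot> j = g" by (rule tup_inj) (use j(1,3) jd a12 fg in simp_all)
      have akw: "(a1 \<cdot> k) \<cdot> w = f" "(a2 \<cdot> k) \<cdot> w = g" using aj w(1,3,4) a12 nk by simp_all
      have wd: "Dom S w = Dom S m" "Cod S w = ?N" using w(2,3) jd nk by simp_all
      have nrc: "Rdx P n (Rdx P ?r \<chi>) \<in> Preds P ?N" using rdx_in[of n "Rdx P ?r \<chi>"] rc nk by simp
      have akP: "Rdx P (a1 \<cdot> k) tr \<in> Preds P ?N" "Rdx P (a2 \<cdot> k) tr \<in> Preds P ?N"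
        using rdx_in[of "a1 \<cdot> k" tr] rdx_in[of "a2 \<cdot> k" tr] a12 nk tr by simp_all
      have "ent (Dom S m) (Rdx P w (Rdx P n (Rdx P ?r \<chi>))) (Rdx P w (Rdx P (a1 \<cdot> k) tr)) (Rdx P w (Rdx P (a2 \<cdot> k) tr))"
        using ent_rdx[OF finite_meets w(1), of "Rdx P n (Rdx P ?r \<chi>)"] ea nrc akP wd by simp
      moreover have "iso_pred P (Dom S m) (Rdx P m (Rdx P ?r \<chi>)) (Rdx P w (Rdx P n (Rdx P ?r \<chi>)))"
        using rdx_cmp[of w n "Rdx P ?r \<chi>"] w(1,5) wd nk rc by simp
      moreover have "iso_pred P (Dom S m) (Rdx P f tr) (Rdx P w (Rdx P (a1 \<cdot> k) tr))"
        using rdx_cmp[of w "a1 \<cdot> k" tr] w(1) wd nk a12 tr akw(1) by simp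
      moreover have "iso_pred P (Dom S m) (Rdx P g tr) (Rdx P w (Rdx P (a2 \<cdot> k) tr))"
        using rdx_cmp[of w "a2 \<cdot> k" tr] w(1) wd nk a12 tr akw(2) by simp
      ultimately have "ent (Dom S m) (Rdx P m (Rdx P ?r \<chi>)) (Rdx P f tr) (Rdx P g tr)"
        using ent_iso_cong[of "Dom S m" "Rdx P m (Rdx P ?r \<chi>)" "Rdx P w (Rdx P n (Rdx P ?r \<chi>))" "Rdx P f tr"
           "Rdx P w (Rdx P (a1 \<cdot> k) tr)" "Rdx P g tr" "Rdx P w (Rdx P (a2 \<cdot> k) tr)"]
          rdx_in[of m "Rdx P ?r \<chi>"] rdx_in[of w] nrc akP rc fgP m w(1) wd by simp
      thus "tle m (Rdx P f tr) (Rdx P g tr)" using gt unfolding tle_def by blast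
    next
      assume "tle m (Rdx P f tr) (Rdx P g tr)"
      then obtain \<kappa> where kap: "gtop (Cod S m) \<kappa>" "ent (Dom S m) (Rdx P m \<kappa>) (Rdx P f tr) (Rdx P g tr)"
        unfolding tle_def by blast
      note kapP = gtop_in[OF kap(1)]
      have "?e \<cdot> k = tup S (e1 \<cdot> k) (e2 \<cdot> k)" unfolding et[symmetric] by (rule tup_cmp) (use e12 nk in simp_all)
      hence ek: "?e \<cdot> k = tup S (e1 \<cdot> k) (?r \<cdot> n)" using pD(9) by simp
      \<comment> \<open>An element of \<open>?N\<close> is only locally of the form
        \<open>(f x, g x)\<close>. The entailment is obtained on a cover \<open>q\<close> of
        \<open>?N\<close> and then brought down.\<close>
      have "mb ?X (e1 \<cdot> k) (?r \<cdot> n)" by (rule factorsI[OF ek]) (use nk e in simp_all)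
      hence "imem m ?t n (e1 \<cdot> k)"
        by (rule mb_img[THEN iffD1, rotated -1]) (use m tt nk e12 in simp_all)
      then obtain q x where q: "is_epi S q" "q \<in> Arr S" "x \<in> Arr S" "Cod S q = ?N" "Dom S x = Dom S q"
        "Cod S x = Dom S m" "m \<cdot> x = n \<cdot> q" "?t \<cdot> x = (e1 \<cdot> k) \<cdot> q" by (rule imemE)
      have "tup S (f \<cdot> x) (g \<cdot> x) = tup S (a1 \<cdot> (k \<cdot> q)) (a2 \<cdot> (k \<cdot> q))"
        using q(2-6,8) nk e12 a12 fg unfolding at[symmetric] by simp
      hence fx: "f \<cdot> x = a1 \<cdot> (k \<cdot> q) \<and> g \<cdot> x = a2 \<cdot> (k \<cdot> q)"
        by (rule tup_inj) (use q(2-6) nk a12 fg in simp_all)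
      have fx1: "(a1 \<cdot> k) \<cdot> q = f \<cdot> x" "(a2 \<cdot> k) \<cdot> q = g \<cdot> x" using fx q(2,4) nk a12 by simp_all
      have akP: "Rdx P (a1 \<cdot> k) tr \<in> Preds P ?N" "Rdx P (a2 \<cdot> k) tr \<in> Preds P ?N"
        using rdx_in[of "a1 \<cdot> k" tr] rdx_in[of "a2 \<cdot> k" tr] a12 nk tr by simp_all
      have mkP: "Rdx P m \<kappa> \<in> Preds P (Dom S m)" using rdx_in m kapP by simp
      have "ent (Dom S q) (Rdx P x (Rdx P m \<kappa>)) (Rdx P x (Rdx P f tr)) (Rdx P x (Rdx P g tr))"
        using ent_rdx[OF finite_meets q(3), of "Rdx P m \<kappa>" "Rdx P f tr" "Rdx P g tr"] kap(2) mkP fgP q(5,6) by simp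
      moreover have "iso_pred P (Dom S q) (Rdx P x (Rdx P m \<kappa>)) (Rdx P (n \<cdot> q) \<kappa>)"
        using isoc(1)[of m x \<kappa>] m q(3,5,6) kapP unfolding q(7) by (simp add: iso_sym)
      moreover have "iso_pred P (Dom S q) (Rdx P x (Rdx P f tr)) (Rdx P q (Rdx P (a1 \<cdot> k) tr))"
      proof (rule iso_trans)
        show "iso_pred P (Dom S q) (Rdx P x (Rdx P f tr)) (Rdx P (f \<cdot> x) tr)"
          using isoc(1)[of f x tr] fg q(3,5,6) tr by (simp add: iso_sym)
        show "iso_pred P (Dom S q) (Rdx P (f \<cdot> x) tr) (Rdx P q (Rdx P (a1 \<cdot> k) tr))"
          unfolding fx1(1)[symmetric] using isoc(1)[of "a1 \<cdot> k" q tr] a12 nk q(2,4) tr by simp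
      qed (use isoc(2,3)[of f x tr] rdx_in[of q "Rdx P (a1 \<cdot> k) tr"] akP fg q(2-6) tr in simp_all)
      moreover have "iso_pred P (Dom S q) (Rdx P x (Rdx P g tr)) (Rdx P q (Rdx P (a2 \<cdot> k) tr))"
      proof (rule iso_trans)
        show "iso_pred P (Dom S q) (Rdx P x (Rdx P g tr)) (Rdx P (g \<cdot> x) tr)"
          using isoc(1)[of g x tr] fg q(3,5,6) tr by (simp add: iso_sym)
        show "iso_pred P (Dom S q) (Rdx P (g \<cdot> x) tr) (Rdx P q (Rdx P (a2 \<cdot> k) tr))"
          unfolding fx1(2)[symmetric] using isoc(1)[of "a2 \<cdot> k" q tr] a12 nk q(2,4) tr by simp
      qed (use isoc(2,3)[of g x tr] rdx_in[of q "Rdx P (a2 \<cdot> k) tr"] akP fg q(2-6) tr in simp_all)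
      ultimately have "ent (Dom S q) (Rdx P (n \<cdot> q) \<kappa>) (Rdx P q (Rdx P (a1 \<cdot> k) tr)) (Rdx P q (Rdx P (a2 \<cdot> k) tr))"
        by (rule ent_iso_cong[THEN iffD1, rotated -1])
          (use rdx_in[of x] rdx_in[of q] rdx_in[of "n \<cdot> q" \<kappa>] mkP fgP akP kapP q(2-6) nk in simp_all)
      hence "ent ?N (Rdx P n \<kappa>) (Rdx P (a1 \<cdot> k) tr) (Rdx P (a2 \<cdot> k) tr)"
        by (intro tle_epi[OF nk(1) q(1,4) akP]) (use kapP nk in simp_all)
      hence "Le P (Cod S m) \<kappa> (Rdx P ?r \<chi>)" using main[OF kapP] by simp
      hence "gtop (Cod S m) (Rdx P ?r \<chi>)" using gtop_mono kap(1) rc m by simp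
      thus "rel ?R m f g" using fr by simp
    qed
  qed
  thus ?thesis using that R by blast
qed

end

section \<open>Logical structure of the constructed uniform preorder\<close>

locale represented_tripos = gamma_tripos S P \<gamma> for S :: "('o, 'a) cat" (structure) and P :: "('o, 'a, 'p) fpre" and \<gamma> +
  fixes A :: 'o and R :: 'a and tr :: 'p
  assumes gen: "is_generic S P A tr"
    and R: "is_mono S R" "Cod S R = pow S (prd S A A)"
    and rel_tle: "\<And>m f g. m \<in> Arr S \<Longrightarrow> f \<in> hom S (Dom S m) A \<Longrightarrow> g \<in> hom S (Dom S m) A \<Longrightarrow>
      rel R m f g \<longleftrightarrow> tle m (Rdx P f tr) (Rdx P g tr)"
begin

lemma A_obj [simp]: "A \<in> Obj S" and tr_in: "tr \<in> Preds P A"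
  using gen unfolding is_generic_def by blast+

text \<open>Arrows into \<open>A\<close> act as codes of predicates, decoded by reindexing the
  generic predicate. Composing a code with an arrow and reindexing its predicate agree only up to
  isomorphism.\<close>

abbreviation d :: "'a \<Rightarrow> 'p" where "d f \<equiv> Rdx P f tr"

lemma d_in: "f \<in> hom S M A \<Longrightarrow> d f \<in> Preds P M"
  using rdx_in[of f tr] tr_in by (simp add: hom_def)

lemma d_cmp: "f \<in> hom S M A \<Longrightarrow> u \<in> Arr S \<Longrightarrow> Cod S u = M \<Longrightarrow> iso_pred P (Dom S u) (d (f \<cdot> u)) (Rdx P u (d f))"
  using rdx_cmp[of u f tr] tr_in by (simp add: hom_def)

lemma d_ex: "M \<in> Obj S \<Longrightarrow> \<phi> \<in> Preds P M \<Longrightarrow> \<exists>f\<in>hom S M A. iso_pred P M \<phi> (d f)"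
  using gen unfolding is_generic_def by blast

lemma d_in_cmp: "f \<in> hom S M A \<Longrightarrow> u \<in> Arr S \<Longrightarrow> Cod S u = M \<Longrightarrow> f \<cdot> u \<in> hom S (Dom S u) A"
  by (simp add: hom_def)

abbreviation X where "X \<equiv> ufam S (A, R)"

lemma X_Le: "m \<in> Arr S \<Longrightarrow> f \<in> hom S (Dom S m) A \<Longrightarrow> g \<in> hom S (Dom S m) A \<Longrightarrow> Le X m f g \<longleftrightarrow> tle m (d f) (d g)"
  using ufam_Le[OF _ _ _ R] rel_tle by blast

lemma family: "preorder_family A R"
  unfolding preorder_family_def
proof (intro conjI allI impI)
  fix m f assume h: "m \<in> Arr S" "f \<in> hom S (Dom S m) A"
  show "rel R m f f" using rel_tle h tle_le[of m "d f" "d f"] le_refl d_in by simp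
next
  fix m f g h assume h: "m \<in> Arr S" "f \<in> hom S (Dom S m) A" "g \<in> hom S (Dom S m) A" "h \<in> hom S (Dom S m) A"
    "rel R m f g" "rel R m g h"
  thus "rel R m f h" using rel_tle tle_trans[of m "d f" "d g" "d h"] by simp
next
  fix m f g m' u v assume h: "m \<in> Arr S" "f \<in> hom S (Dom S m) A" "g \<in> hom S (Dom S m) A"
    "m' \<in> Arr S" "u \<in> hom S (Dom S m') (Dom S m)" "v \<in> hom S (Cod S m') (Cod S m)" "m \<cdot> u = v \<cdot> m'" "rel R m f g"
  have sq: "(m', m, u, v) \<in> Arr (arrow_cat S)" using h by (simp add: arrow_cat_Arr)
  note u = homD[OF h(5)]
  have "tle m' (Rdx P u (d f)) (Rdx P u (d g))"
    by (rule tle_rdx[OF sq]) (use h rel_tle d_in in simp_all)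
  hence "tle m' (d (f \<cdot> u)) (d (g \<cdot> u))"
    by (rule tle_cong[THEN iffD1, rotated -1])
      (use d_cmp[OF h(2) u(1,3)] d_cmp[OF h(3) u(1,3)] iso_sym u h(4) rdx_in[of u] d_in[OF h(2)] d_in[OF h(3)]
        d_in[OF d_in_cmp[OF h(2) u(1,3)]] d_in[OF d_in_cmp[OF h(3) u(1,3)]] in simp_all)
  thus "rel R m' (f \<cdot> u) (g \<cdot> u)"
    using rel_tle[of m' "f \<cdot> u" "g \<cdot> u"] h(4) d_in_cmp[OF h(2) u(1,3)] d_in_cmp[OF h(3) u(1,3)] u(2) by simp
qed (use R in simp_all)

sublocale X: fib_loc "arrow_cat S" X
  by (rule ufam_fib[OF family])

text \<open>Two inequalities with the same left-hand side have a common witness, and in the context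
  of that witness the meet of \<open>P\<close> has its defining property.\<close>

lemma X_meet:
  assumes n: "n \<in> Arr S" and f: "f \<in> hom S (Dom S n) A" "g \<in> hom S (Dom S n) A" "h \<in> hom S (Dom S n) A"
    and m: "is_meet P (Dom S n) (d f) (d g) (d h)"
  shows "is_meet X n f g h"
proof -
  have l: "Le P (Dom S n) (d h) (d f)" "Le P (Dom S n) (d h) (d g)"
    using m le_refl[of "Dom S n" "d h"] n unfolding is_meet_def by simp_all
  have "tle n (d x) (d h) \<longleftrightarrow> tle n (d x) (d f) \<and> tle n (d x) (d g)" for x
  proof
    assume "tle n (d x) (d h)"
    thus "tle n (d x) (d f) \<and> tle n (d x) (d g)"
      using tle_trans[OF n] tle_le[OF n] l d_in f by blast
  next
    assume "tle n (d x) (d f) \<and> tle n (d x) (d g)"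
    then obtain \<chi> where "gtop (Cod S n) \<chi>" "ent (Dom S n) (Rdx P n \<chi>) (d x) (d f)" "ent (Dom S n) (Rdx P n \<chi>) (d x) (d g)"
      using tle_common[OF n] by blast
    moreover from this have "ent (Dom S n) (Rdx P n \<chi>) (d x) (d h)" using m unfolding ent_def is_meet_def by blast
    ultimately show "tle n (d x) (d h)" unfolding tle_def by blast
  qed
  thus ?thesis using X_Le n f unfolding is_meet_def by simp
qed

lemma X_finite_meets: "has_finite_meets (arrow_cat S) X"
proof (rule X.has_finite_meetsI)
  fix m assume "m \<in> Obj (arrow_cat S)"
  hence m: "m \<in> Arr S" by simp
  obtain \<tau> where t: "is_top P (Dom S m) \<tau>" using top_exists m by fastforce
  have tP: "\<tau> \<in> Preds P (Dom S m)" using t unfolding is_top_def by blast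
  obtain f where f: "f \<in> hom S (Dom S m) A" "iso_pred P (Dom S m) \<tau> (d f)" using d_ex[OF _ tP] m by auto
  have ft: "is_top P (Dom S m) (d f)" using is_top_iso[OF t f(2)] d_in[OF f(1)] m by simp
  have "is_top X (Dom (arrow_cat S) s) (Rdx X s f)" if s: "s \<in> Arr (arrow_cat S)" "Cod (arrow_cat S) s = m" for s
  proof -
    obtain n u v where se: "s = (n, m, u, v)" using s(2) by (cases s) simp
    note a = sqD[OF s(1)[unfolded se]]
    have fu: "f \<cdot> u \<in> hom S (Dom S n) A" using d_in_cmp[OF f(1) a(3,6)] a(5) by simp
    have "is_top P (Dom S n) (Rdx P u (d f))" using top_rdx[OF a(3)] ft a(5,6) by simp
    hence "is_top P (Dom S n) (d (f \<cdot> u))"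
      using is_top_iso[of "Dom S n" "Rdx P u (d f)" "d (f \<cdot> u)"] d_cmp[OF f(1) a(3,6)] iso_sym a(1,5) d_in[OF fu] by simp
    hence "Le X n g (f \<cdot> u)" if "g \<in> hom S (Dom S n) A" for g
      using X_Le[OF a(1) that fu] tle_le[of n "d g" "d (f \<cdot> u)"] that fu d_in a(1) unfolding is_top_def by simp
    thus ?thesis using se fu by (simp add: is_top_def)
  qed
  thus "\<exists>\<tau>\<in>Preds X m. \<forall>s\<in>Arr (arrow_cat S). Cod (arrow_cat S) s = m \<longrightarrow> is_top X (Dom (arrow_cat S) s) (Rdx X s \<tau>)"
    using f(1) by (intro bexI[of _ f]) simp_all
next
  fix m f g assume "m \<in> Obj (arrow_cat S)" "f \<in> Preds X m" "g \<in> Preds X m"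
  hence m: "m \<in> Arr S" and f: "f \<in> hom S (Dom S m) A" and g: "g \<in> hom S (Dom S m) A" by simp_all
  obtain \<mu> where mu: "is_meet P (Dom S m) (d f) (d g) \<mu>" using meet_exists[OF _ d_in[OF f] d_in[OF g]] m by auto
  have mP: "\<mu> \<in> Preds P (Dom S m)" using mu unfolding is_meet_def by blast
  obtain h where h: "h \<in> hom S (Dom S m) A" "iso_pred P (Dom S m) \<mu> (d h)" using d_ex[OF _ mP] m by auto
  have "is_meet X (Dom (arrow_cat S) s) (Rdx X s f) (Rdx X s g) (Rdx X s h)" if s: "s \<in> Arr (arrow_cat S)" "Cod (arrow_cat S) s = m" for s
  proof -
    obtain n u v where se: "s = (n, m, u, v)" using s(2) by (cases s) simp
    note a = sqD[OF s(1)[unfolded se]]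
    have u: "f \<cdot> u \<in> hom S (Dom S n) A" "g \<cdot> u \<in> hom S (Dom S n) A" "h \<cdot> u \<in> hom S (Dom S n) A"
      using d_in_cmp[OF _ a(3,6)] f g h(1) a(5) by simp_all
    have mu': "is_meet P (Dom S n) (Rdx P u (d f)) (Rdx P u (d g)) (Rdx P u \<mu>)"
      using meet_rdx[OF a(3)] mu d_in f g a(5,6) by simp
    have iso: "iso_pred P (Dom S n) (Rdx P u (d f)) (d (f \<cdot> u))" "iso_pred P (Dom S n) (Rdx P u (d g)) (d (g \<cdot> u))"
      using d_cmp[OF f a(3,6)] d_cmp[OF g a(3,6)] iso_sym a(5) by simp_all
    have iso3: "iso_pred P (Dom S n) (Rdx P u \<mu>) (d (h \<cdot> u))"
      using iso_trans[of "Dom S n" "Rdx P u \<mu>" "Rdx P u (d h)" "d (h \<cdot> u)"] rdx_iso[OF a(3), of \<mu> "d h"] h mP d_in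
        d_cmp[OF h(1) a(3,6)] iso_sym rdx_in[OF a(3)] a(1,5,6) u by simp
    have "is_meet P (Dom S n) (d (f \<cdot> u)) (d (g \<cdot> u)) (d (h \<cdot> u))"
      by (rule is_meet_iso[OF mu' iso iso3]) (use rdx_in[OF a(3)] d_in f g a(1,5,6) u in simp_all)
    thus ?thesis using X_meet[OF a(1) u] se by simp
  qed
  thus "\<exists>\<mu>\<in>Preds X m. \<forall>s\<in>Arr (arrow_cat S). Cod (arrow_cat S) s = m \<longrightarrow>
     is_meet X (Dom (arrow_cat S) s) (Rdx X s f) (Rdx X s g) (Rdx X s \<mu>)"
    using h(1) by (intro bexI[of _ h]) simp_all
qed

text \<open>The usual argument about implication runs inside the context of a witness
  \<open>\<chi>\<close>, so one implication of \<open>P\<close> over \<open>Dom S n\<close> serves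
  for every \<open>n\<close> with that domain.\<close>

lemma X_imp:
  assumes n: "n \<in> Arr S" and f: "f \<in> hom S (Dom S n) A" "g \<in> hom S (Dom S n) A" "h \<in> hom S (Dom S n) A" "x \<in> hom S (Dom S n) A"
    and i: "is_imp P (Dom S n) (d f) (d g) (d h)"
  shows "Le X n x h \<longleftrightarrow> X.ent n x f g"
proof -
  have N: "Dom S n \<in> Obj S" using n by simp
  have ie: "Le P (Dom S n) \<eta> (d h) \<longleftrightarrow> ent (Dom S n) \<eta> (d f) (d g)" if "\<eta> \<in> Preds P (Dom S n)" for \<eta>
    using is_imp_ent[OF finite_meets N, of "d f" "d g" "d h"] d_in f i that by simp
  show ?thesis
  proof
    assume l: "Le X n x h"
    show "X.ent n x f g"
      unfolding X.ent_def
    proof (intro ballI impI)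
      fix t assume t: "t \<in> Preds X n" "Le X n t x" "Le X n t f"
      have tH: "t \<in> hom S (Dom S n) A" using t by simp
      have "Le X n t h" using X.le_trans[of n t x h] t l f n by simp
      hence "tle n (d t) (d h)" "tle n (d t) (d f)" using X_Le n f tH t by simp_all
      then obtain \<chi> where c: "gtop (Cod S n) \<chi>" "ent (Dom S n) (Rdx P n \<chi>) (d t) (d h)" "ent (Dom S n) (Rdx P n \<chi>) (d t) (d f)"
        using tle_common[OF n] by blast
      have "ent (Dom S n) (Rdx P n \<chi>) (d t) (d g)"
        unfolding ent_def
      proof (intro ballI impI)
        fix \<eta> assume e: "\<eta> \<in> Preds P (Dom S n)" "Le P (Dom S n) \<eta> (Rdx P n \<chi>)" "Le P (Dom S n) \<eta> (d t)"
        have "Le P (Dom S n) \<eta> (d h)" "Le P (Dom S n) \<eta> (d f)" using c(2,3) e unfolding ent_def by blast+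
        thus "Le P (Dom S n) \<eta> (d g)" using ie[OF e(1)] le_refl[OF N e(1)] e(1) unfolding ent_def by blast
      qed
      thus "Le X n t g" using X_Le[OF n tH f(2)] c(1) unfolding tle_def by blast
    qed
  next
    assume l: "X.ent n x f g"
    \<comment> \<open>The hypothesis quantifies over codes; it is used at a code \<open>t\<close> of
      the meet of \<open>d x\<close> and \<open>d f\<close>.\<close>
    obtain \<mu> where mu: "is_meet P (Dom S n) (d x) (d f) \<mu>" using meet_exists[OF N] d_in f by blast
    have mP: "\<mu> \<in> Preds P (Dom S n)" using mu unfolding is_meet_def by blast
    obtain t where t: "t \<in> hom S (Dom S n) A" "iso_pred P (Dom S n) \<mu> (d t)" using d_ex[OF N mP] by blast
    have tm: "is_meet P (Dom S n) (d x) (d f) (d t)"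
      by (rule is_meet_iso[OF mu iso_refl iso_refl t(2)]) (use N d_in f t in simp_all)
    have "Le P (Dom S n) (d t) (d x)" "Le P (Dom S n) (d t) (d f)"
      using tm le_refl[OF N d_in[OF t(1)]] d_in[OF t(1)] unfolding is_meet_def by blast+
    hence "Le X n t x" "Le X n t f" using X_Le[OF n t(1)] f tle_le[OF n] d_in t(1) by simp_all
    hence "tle n (d t) (d g)" using l t(1) X_Le[OF n t(1) f(2)] unfolding X.ent_def by simp
    then obtain \<chi> where c: "gtop (Cod S n) \<chi>" "ent (Dom S n) (Rdx P n \<chi>) (d t) (d g)" unfolding tle_def by blast
    have cP: "Rdx P n \<chi> \<in> Preds P (Dom S n)" using rdx_in[OF n] gtop_in[OF c(1)] by blast
    have "ent (Dom S n) (Rdx P n \<chi>) (d x) (d h)"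
      unfolding ent_def
    proof (intro ballI impI)
      fix \<eta> assume e: "\<eta> \<in> Preds P (Dom S n)" "Le P (Dom S n) \<eta> (Rdx P n \<chi>)" "Le P (Dom S n) \<eta> (d x)"
      have "ent (Dom S n) \<eta> (d f) (d g)"
        unfolding ent_def
      proof (intro ballI impI)
        fix \<zeta> assume z: "\<zeta> \<in> Preds P (Dom S n)" "Le P (Dom S n) \<zeta> \<eta>" "Le P (Dom S n) \<zeta> (d f)"
        have "Le P (Dom S n) \<zeta> (Rdx P n \<chi>)" "Le P (Dom S n) \<zeta> (d x)"
          using le_trans[OF N z(1) e(1)] z(2) e cP d_in[OF f(4)] by blast+
        moreover from this have "Le P (Dom S n) \<zeta> (d t)" using tm z unfolding is_meet_def by blast
        ultimately show "Le P (Dom S n) \<zeta> (d g)" using c(2) z(1) unfolding ent_def by blast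
      qed
      thus "Le P (Dom S n) \<eta> (d h)" using ie e(1) by simp
    qed
    thus "Le X n x h" using X_Le[OF n f(4,3)] c(1) unfolding tle_def by blast
  qed
qed

lemma X_implication: "has_implication (arrow_cat S) X"
proof (rule X.has_implicationI[OF X_finite_meets])
  fix m f g assume "m \<in> Obj (arrow_cat S)" "f \<in> Preds X m" "g \<in> Preds X m"
  hence m: "m \<in> Arr S" and f: "f \<in> hom S (Dom S m) A" and g: "g \<in> hom S (Dom S m) A" by simp_all
  have M: "Dom S m \<in> Obj S" using m by simp
  obtain \<iota> where io: "is_imp P (Dom S m) (d f) (d g) \<iota>" using imp_exists[OF M d_in[OF f] d_in[OF g]] by blast
  have iP: "\<iota> \<in> Preds P (Dom S m)" using io unfolding is_imp_def by blast
  obtain h where h: "h \<in> hom S (Dom S m) A" "iso_pred P (Dom S m) \<iota> (d h)" using d_ex[OF M iP] by blast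
  have "Le X (Dom (arrow_cat S) s) x (Rdx X s h) \<longleftrightarrow> X.ent (Dom (arrow_cat S) s) x (Rdx X s f) (Rdx X s g)"
    if s: "s \<in> Arr (arrow_cat S)" "Cod (arrow_cat S) s = m" and x: "x \<in> Preds X (Dom (arrow_cat S) s)" for s x
  proof -
    obtain n u v where se: "s = (n, m, u, v)" using s(2) by (cases s) simp
    note a = sqD[OF s(1)[unfolded se]]
    have N: "Dom S n \<in> Obj S" using a(1) by simp
    have u: "f \<cdot> u \<in> hom S (Dom S n) A" "g \<cdot> u \<in> hom S (Dom S n) A" "h \<cdot> u \<in> hom S (Dom S n) A"
      using d_in_cmp[OF _ a(3,6)] f g h(1) a(5) by simp_all
    have i1: "is_imp P (Dom S n) (Rdx P u (d f)) (Rdx P u (d g)) (Rdx P u \<iota>)"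
      using imp_rdx[OF a(3)] io d_in f g a(5,6) by simp
    have iso1: "iso_pred P (Dom S n) (Rdx P u \<iota>) (d (h \<cdot> u))"
      using iso_trans[of "Dom S n" "Rdx P u \<iota>" "Rdx P u (d h)" "d (h \<cdot> u)"] rdx_iso[OF a(3), of \<iota> "d h"] h iP d_in
        d_cmp[OF h(1) a(3,6)] iso_sym rdx_in[OF a(3)] a(1,5,6) u by simp
    have iso2: "iso_pred P (Dom S n) (Rdx P u (d f)) (d (f \<cdot> u))" "iso_pred P (Dom S n) (Rdx P u (d g)) (d (g \<cdot> u))"
      using d_cmp[OF f a(3,6)] d_cmp[OF g a(3,6)] iso_sym a(5) by simp_all
    have rP: "Rdx P u (d f) \<in> Preds P (Dom S n)" "Rdx P u (d g) \<in> Preds P (Dom S n)" "Rdx P u \<iota> \<in> Preds P (Dom S n)"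
      using rdx_in[OF a(3)] d_in f g iP a(5,6) by simp_all
    have "Le P (Dom S n) \<eta> (d (h \<cdot> u)) \<longleftrightarrow> ent (Dom S n) \<eta> (d (f \<cdot> u)) (d (g \<cdot> u))" if e: "\<eta> \<in> Preds P (Dom S n)" for \<eta>
    proof -
      have "Le P (Dom S n) \<eta> (d (h \<cdot> u)) \<longleftrightarrow> Le P (Dom S n) \<eta> (Rdx P u \<iota>)"
        by (rule le_iso_cong[OF iso_refl iso_sym[OF iso1]]) (use N e rP d_in u in simp_all)
      also have "\<dots> \<longleftrightarrow> ent (Dom S n) \<eta> (Rdx P u (d f)) (Rdx P u (d g))"
        using is_imp_ent[OF finite_meets N rP(1,2), of "Rdx P u \<iota>"] i1 e by simp
      also have "\<dots> \<longleftrightarrow> ent (Dom S n) \<eta> (d (f \<cdot> u)) (d (g \<cdot> u))"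
        by (rule ent_iso_cong[OF iso_refl iso2]) (use N e rP d_in u in simp_all)
      finally show ?thesis .
    qed
    hence "is_imp P (Dom S n) (d (f \<cdot> u)) (d (g \<cdot> u)) (d (h \<cdot> u))"
      using is_imp_ent[OF finite_meets N, of "d (f \<cdot> u)" "d (g \<cdot> u)"] d_in u by simp
    thus ?thesis using X_imp[OF a(1) u, of x] x se by simp
  qed
  thus "\<exists>\<iota>\<in>Preds X m. \<forall>s\<in>Arr (arrow_cat S). Cod (arrow_cat S) s = m \<longrightarrow> (\<forall>x\<in>Preds X (Dom (arrow_cat S) s).
        Le X (Dom (arrow_cat S) s) x (Rdx X s \<iota>) \<longleftrightarrow> X.ent (Dom (arrow_cat S) s) x (Rdx X s f) (Rdx X s g))"
    using h(1) by (intro bexI[of _ h]) simp_all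
qed

text \<open>\<open>tle_forall\<close> carried over from predicates to codes. The predicates
  \<open>\<phi>\<close> and \<open>\<chi>\<close> are only isomorphic to the decoded
  \<open>f\<close> and \<open>h\<close>, because in the Beck-Chevalley condition the reindexed
  predicates appear on one side and the composed codes on the other.\<close>

lemma X_forall_at:
  assumes u: "u \<in> Arr S" and m': "m' \<in> Arr S" "Dom S m' = Cod S u" and m: "m = m' \<cdot> u"
    and f: "f \<in> hom S (Dom S u) A" and h: "h \<in> hom S (Cod S u) A"
    and \<phi>: "\<phi> \<in> Preds P (Dom S u)" "iso_pred P (Dom S u) \<phi> (d f)" and \<chi>: "iso_pred P (Cod S u) \<chi> (d h)"
    and fa: "is_forall S P u \<phi> \<chi>"
  shows "is_forall (arrow_cat S) X (m, m', u, w) f h"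
proof -
  have cP: "\<chi> \<in> Preds P (Cod S u)" using fa unfolding is_forall_def by blast
  have md: "m \<in> Arr S" "Dom S m = Dom S u" using u m' m by simp_all
  have "Le X m' x h \<longleftrightarrow> Le X m (x \<cdot> u) f" if x: "x \<in> hom S (Cod S u) A" for x
  proof -
    have xu: "x \<cdot> u \<in> hom S (Dom S u) A" using d_in_cmp[OF x u] by simp
    have "Le X m' x h \<longleftrightarrow> tle m' (d x) (d h)" using X_Le m' x h by simp
    also have "\<dots> \<longleftrightarrow> tle m' (d x) \<chi>"
      by (rule tle_cong) (use m' x h d_in iso_refl[OF _ d_in[OF x]] iso_sym[OF \<chi>] cP u in simp_all)
    also have "\<dots> \<longleftrightarrow> tle m (Rdx P u (d x)) \<phi>" unfolding m by (rule tle_forall) (use u m' \<phi>(1) fa d_in[OF x] in simp_all)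
    also have "\<dots> \<longleftrightarrow> tle m (d (x \<cdot> u)) (d f)"
      by (rule tle_cong) (use md \<phi> d_in[OF xu] d_in[OF f] d_in[OF x] iso_sym[OF d_cmp[OF x u]] rdx_in[OF u] in simp_all)
    also have "\<dots> \<longleftrightarrow> Le X m (x \<cdot> u) f" using X_Le md xu f by simp
    finally show ?thesis .
  qed
  thus ?thesis using h m' by (simp add: is_forall_def)
qed

lemma X_forall: "has_forall (arrow_cat S) (vertical S) X"
proof (rule X.has_forallI)
  fix s f assume s: "s \<in> Arr (arrow_cat S)" "vertical S s" "f \<in> Preds X (Dom (arrow_cat S) s)"
  obtain m m' u v where se: "s = (m, m', u, v)" by (cases s)
  have v: "v = Idn S (Cod S m)" "Cod S m = Cod S m'" using s(2) se by simp_all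
  have sq: "(m, m', u, Idn S (Cod S m)) \<in> Arr (arrow_cat S)" using s(1) se v by simp
  note a = sqD[OF sq]
  have mu: "m = m' \<cdot> u" using a(9) a(1) by simp
  have f: "f \<in> hom S (Dom S u) A" using s(3) se a by simp
  obtain \<chi> where c: "is_forall S P u (d f) \<chi>" using forall_exists[OF a(3) d_in[OF f]] by blast
  have cP: "\<chi> \<in> Preds P (Cod S u)" using c unfolding is_forall_def by blast
  obtain h where h: "h \<in> hom S (Cod S u) A" "iso_pred P (Cod S u) \<chi> (d h)" using d_ex[OF cod_obj[OF a(3)] cP] by blast
  have 1: "is_forall (arrow_cat S) X s f h"
    unfolding se
    by (rule X_forall_at[OF a(3) a(2) a(6)[symmetric] mu f h(1) d_in[OF f] iso_refl[OF dom_obj[OF a(3)] d_in[OF f]] h(2) c])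
  have 2: "\<exists>g' f'. is_pullback (arrow_cat S) s g g' f' \<and> is_forall (arrow_cat S) X f' (Rdx X g' f) (Rdx X g h)"
    if g: "g \<in> Arr (arrow_cat S)" "Cod (arrow_cat S) g = Cod (arrow_cat S) s" for g
  proof -
    obtain n' w z where ge: "g = (n', m', w, z)" using g(2) se by (cases g) simp
    have gq: "(n', m', w, z) \<in> Arr (arrow_cat S)" using g ge by simp
    note b = sqD[OF gq]
    obtain w' u' where pb: "is_pullback S u w w' u'" using pb_pullback[of u w] a(3,6) b(3,6) by auto
    note p = pullbackD[OF pb]
    note apb = arrow_pullback[OF pb sq v(2) gq]
    have fw: "f \<cdot> w' \<in> hom S (Dom S u') A" using d_in_cmp[OF f p(3,7)] p(6) by simp
    have hw: "h \<cdot> w \<in> hom S (Cod S u') A" using d_in_cmp[OF h(1) b(3)] a(6) b(6) p(8) by simp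
    have cwf: "is_forall S P u' (Rdx P w' (d f)) (Rdx P w \<chi>)" using forall_rdx[OF pb d_in[OF f] c] .
    have rP: "Rdx P w' (d f) \<in> Preds P (Dom S u')" using rdx_in[OF p(3)] d_in[OF f] p(6,7) by simp
    have i1: "iso_pred P (Dom S u') (Rdx P w' (d f)) (d (f \<cdot> w'))" using d_cmp[OF f p(3,7)] p(6) iso_sym by simp
    have wc: "Cod S w = Cod S u" using a(6) b(6) by simp
    have i2: "iso_pred P (Cod S u') (Rdx P w \<chi>) (d (h \<cdot> w))"
      using iso_trans[of "Dom S w" "Rdx P w \<chi>" "Rdx P w (d h)" "d (h \<cdot> w)"] rdx_iso[OF b(3), of \<chi> "d h"] h cP d_in
        d_cmp[OF h(1) b(3) wc] iso_sym rdx_in[OF b(3)] b(3) p(8) wc hw by simp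
    have "is_forall (arrow_cat S) X (n' \<cdot> u', n', u', Idn S (Cod S n')) (f \<cdot> w') (h \<cdot> w)"
      by (rule X_forall_at[OF p(4) b(1) _ refl fw hw rP i1 i2 cwf]) (use p(8) b(5) in simp)
    thus ?thesis using apb se v(1) ge by (intro exI[of _ "(n' \<cdot> u', m, w', z)"] exI[of _ "(n' \<cdot> u', n', u', Idn S (Cod S n'))"]) simp
  qed
  show "\<exists>\<chi>. is_forall (arrow_cat S) X s f \<chi> \<and> (\<forall>g\<in>Arr (arrow_cat S). Cod (arrow_cat S) g = Cod (arrow_cat S) s \<longrightarrow>
       (\<exists>g' f'. is_pullback (arrow_cat S) s g g' f' \<and> is_forall (arrow_cat S) X f' (Rdx X g' f) (Rdx X g \<chi>)))"
    using 1 2 by blast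
qed

lemma logical: "logical_uniform_preorder S (A, R)"
  using uniform_preorderI[OF family] X_finite_meets X_implication X_forall
  by (simp add: logical_uniform_preorder_def)

end

lemma (in gamma_tripos) representation:
  obtains A R tr where "represented_tripos S P \<gamma> A R tr"
proof -
  obtain A tr where g: "is_generic S P A tr" using generic by blast
  obtain R where "is_mono S R" "Cod S R = pow S (prd S A A)"
    "\<And>m f g. m \<in> Arr S \<Longrightarrow> f \<in> hom S (Dom S m) A \<Longrightarrow> g \<in> hom S (Dom S m) A \<Longrightarrow>
      rel R m f g \<longleftrightarrow> tle m (Rdx P f tr) (Rdx P g tr)"
    using classifying_relation[OF g] by blast
  hence "represented_tripos S P \<gamma> A R tr" using g by unfold_locales
  thus ?thesis by (rule that)
qed

section \<open>From fibered triposes to triposes with gamma\<close>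

lemma is_top_equiv:
  assumes X: "fib_loc C X" and Y: "fib_loc C Y" and e: "fib_equivalence C X Y F G" and I: "I \<in> Obj C" "\<tau> \<in> Preds X I"
  shows "is_top X I \<tau> \<longleftrightarrow> is_top Y I (F I \<tau>)"
proof
  interpret Y: fib_loc C Y by fact
  have F: "fib_map C X Y F" and G: "fib_map C Y X G" and i: "\<And>\<psi>. \<psi> \<in> Preds Y I \<Longrightarrow> iso_pred Y I (F I (G I \<psi>)) \<psi>"
    using e I(1) unfolding fib_equivalence_def by blast+
  note le = fib_equivalence_le[OF X Y e I(1)]
  note FP = fib_map_in[OF F I(1)] and GP = fib_map_in[OF G I(1)]
  {
    assume t: "is_top X I \<tau>"
    have "Le Y I \<psi> (F I \<tau>)" if "\<psi> \<in> Preds Y I" for \<psi>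
    proof -
      have "Le Y I (F I (G I \<psi>)) (F I \<tau>)" using le[OF GP[OF that] I(2)] t GP[OF that] unfolding is_top_def by blast
      thus ?thesis using Y.le_trans[OF I(1) that FP[OF GP[OF that]] FP[OF I(2)]] i[OF that] unfolding iso_pred_def by blast
    qed
    thus "is_top Y I (F I \<tau>)" using FP[OF I(2)] unfolding is_top_def by blast
  next
    assume "is_top Y I (F I \<tau>)"
    thus "is_top X I \<tau>" using le I(2) FP unfolding is_top_def by blast
  }
qed

lemma fib_equivalence_refl:
  assumes "fib_loc C X"
  shows "fib_equivalence C X X (\<lambda>I \<phi>. \<phi>) (\<lambda>I \<phi>. \<phi>)"
proof -
  interpret fib_loc C X by fact
  show ?thesis unfolding fib_equivalence_def fib_map_def using iso_refl rdx_in by simp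
qed

context topos_loc
begin

lemma sub_isoI:
  assumes "u \<in> Arr S" "w \<in> Arr S" "Cod S u = M" "Cod S w = M"
    "\<And>h. h \<in> Arr S \<Longrightarrow> Cod S h = M \<Longrightarrow> factors S h u \<longleftrightarrow> factors S h w"
  shows "iso_pred (sub_fib S) M u w"
  using assms(5)[of u] assms(5)[of w] factors_refl assms(1-4) by (simp add: iso_pred_def sub_fib_def)

end

section \<open>The subobject \<open>\<gamma> \<phi>\<close> of a fibered tripos\<close>

locale fib_tripos = topos_loc S for S :: "('o, 'a) cat" (structure) +
  fixes X :: "('a, 'a sq, 'p) fpre"
  assumes ft: "fibered_tripos S X"

sublocale fib_tripos \<subseteq> X: fib_loc "arrow_cat S" X
proof -
  have "fibered_preorder (arrow_cat S) X" using ft by (simp add: fibered_tripos_def)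
  thus "fib_loc (arrow_cat S) X" using arrow_loc by (simp add: fib_loc_def fib_loc_axioms_def)
qed

context fib_tripos
begin

lemma X_props:
  shows X_reflects: "reflects_le_along (arrow_cat S) (\<lambda>e. vertical S e \<and> is_epi (arrow_cat S) e) X"
    and X_horizontally_definable: "horizontally_definable S X"
    and X_finite_meets: "has_finite_meets (arrow_cat S) X" and X_implication: "has_implication (arrow_cat S) X"
    and X_forall: "has_forall (arrow_cat S) (vertical S) X"
    and X_generic: "\<exists>Prp\<in>Obj S. \<exists>tr. is_generic (arrow_cat S) X (bang S Prp) tr"
  using ft unfolding fibered_tripos_def by blast+

lemma X_top_rdx: "f \<in> Arr (arrow_cat S) \<Longrightarrow> is_top X (Cod (arrow_cat S) f) \<tau> \<Longrightarrow> is_top X (Dom (arrow_cat S) f) (Rdx X f \<tau>)"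
  and X_meet_rdx: "f \<in> Arr (arrow_cat S) \<Longrightarrow> \<phi> \<in> Preds X (Cod (arrow_cat S) f) \<Longrightarrow> \<psi> \<in> Preds X (Cod (arrow_cat S) f) \<Longrightarrow>
        is_meet X (Cod (arrow_cat S) f) \<phi> \<psi> \<mu> \<Longrightarrow> is_meet X (Dom (arrow_cat S) f) (Rdx X f \<phi>) (Rdx X f \<psi>) (Rdx X f \<mu>)"
  and X_top_exists: "m \<in> Arr S \<Longrightarrow> \<exists>\<tau>. is_top X m \<tau>"
  using X_finite_meets unfolding has_finite_meets_def by (blast, blast, simp)

lemma top_cmp:
  assumes g: "(m, n, u, v) \<in> Arr (arrow_cat S)" and k: "(l, m, x, y) \<in> Arr (arrow_cat S)"
    and p: "\<psi> \<in> Preds X n" and t: "is_top X m (Rdx X (m, n, u, v) \<psi>)"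
  shows "is_top X l (Rdx X (l, n, u \<cdot> x, v \<cdot> y) \<psi>)"
proof -
  have "is_top X l (Rdx X (l, m, x, y) (Rdx X (m, n, u, v) \<psi>))" using X_top_rdx[OF k] t by simp
  moreover have "iso_pred X l (Rdx X (l, n, u \<cdot> x, v \<cdot> y) \<psi>) (Rdx X (l, m, x, y) (Rdx X (m, n, u, v) \<psi>))"
    using X.rdx_cmp[OF k g] p by simp
  moreover have "Rdx X (l, n, u \<cdot> x, v \<cdot> y) \<psi> \<in> Preds X l" using X.rdx_in[OF sq_cmp[OF k g]] p by simp
  ultimately show ?thesis using X.is_top_iso X.iso_sym sqD(1)[OF k] by simp
qed

text \<open>What it should mean that \<open>h\<close> lies in \<open>\<gamma> \<phi>\<close>, for an
  arbitrary \<open>h\<close> and not just a mono. Truth is tested over an identity because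
  \<open>\<gamma>\<close> is defined from \<open>bar\<close>.\<close>

definition Top :: "'o \<Rightarrow> 'p \<Rightarrow> 'a \<Rightarrow> bool" where
  "Top M \<phi> h \<longleftrightarrow> is_top X (Idn S (Dom S h)) (Rdx X (Idn S (Dom S h), bang S M, h, bang S (Dom S h)) \<phi>)"

lemma Top_sq: "h \<in> Arr S \<Longrightarrow> Cod S h = M \<Longrightarrow> (Idn S (Dom S h), bang S M, h, bang S (Dom S h)) \<in> Arr (arrow_cat S)"
  by (rule sqI) auto

lemma Top_cmp:
  assumes "h \<in> Arr S" "Cod S h = M" "\<phi> \<in> Preds X (bang S M)" "Top M \<phi> h" "k \<in> Arr S" "Cod S k = Dom S h"
  shows "Top M \<phi> (h \<cdot> k)"
proof -
  have "(Idn S (Dom S k), Idn S (Dom S h), k, k) \<in> Arr (arrow_cat S)" by (rule sqI) (use assms in simp_all)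
  from top_cmp[OF Top_sq[OF assms(1,2)] this assms(3) assms(4)[unfolded Top_def]] show ?thesis
    using assms by (simp add: Top_def)
qed

text \<open>A chosen pullback of an identity is not itself an identity. The squares formed from
  \<open>p\<close> and its section \<open>s\<close> carry truth in both directions, so truth over
  \<open>p\<close> can be replaced by truth over the identity of \<open>J\<close>.\<close>

lemma Top_split:
  assumes p: "p \<in> Arr S" "Cod S p = J" and s: "s \<in> Arr S" "Dom S s = J" "Cod S s = Dom S p" "p \<cdot> s = Idn S J"
    and x: "x \<in> Arr S" "Dom S x = Dom S p" "Cod S x = M" and y: "y \<in> Arr S" "Dom S y = J" "Cod S y = M"
    and e: "x \<cdot> s = y" "y \<cdot> p = x" and phi: "\<phi> \<in> Preds X (bang S M)"
  shows "is_top X p (Rdx X (p, bang S M, x, bang S J) \<phi>) \<longleftrightarrow> Top M \<phi> y"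
proof
  have J: "J \<in> Obj S" and M: "M \<in> Obj S" using p x by auto
  have 1: "(p, bang S M, x, bang S J) \<in> Arr (arrow_cat S)" by (rule sqI) (use p x M J in simp_all)
  have 2: "(Idn S J, p, s, Idn S J) \<in> Arr (arrow_cat S)" by (rule sqI) (use p s J in simp_all)
  have 3: "(p, Idn S J, p, Idn S J) \<in> Arr (arrow_cat S)" by (rule sqI) (use p J in simp_all)
  have 4: "(Idn S J, bang S M, y, bang S J) \<in> Arr (arrow_cat S)" using Top_sq[OF y(1,3)] y(2) by simp
  {
    assume "is_top X p (Rdx X (p, bang S M, x, bang S J) \<phi>)"
    from top_cmp[OF 1 2 phi this] show "Top M \<phi> y" using e(1) y J by (simp add: Top_def)
  next
    assume "Top M \<phi> y"
    hence "is_top X (Idn S J) (Rdx X (Idn S J, bang S M, y, bang S J) \<phi>)" using y(2) by (simp add: Top_def)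
    from top_cmp[OF 4 3 phi this] show "is_top X p (Rdx X (p, bang S M, x, bang S J) \<phi>)"
      using e(2) J by simp
  }
qed

lemma bar_sq: "M \<in> Obj S \<Longrightarrow> (Idn S M, bang S M, Idn S M, bang S M) \<in> Arr (arrow_cat S)"
  by (rule sqI) auto

lemma bar_in: "M \<in> Obj S \<Longrightarrow> \<phi> \<in> Preds X (bang S M) \<Longrightarrow> bar S X M \<phi> \<in> Preds X (Idn S M)"
  unfolding bar_def using X.rdx_in[OF bar_sq, of M \<phi>] by simp

lemma base_change_idn:
  assumes "V \<in> Arr S" "Cod S V = M"
  obtains p q s where "pb S V (Idn S M) = (p, q)" "p \<in> Arr S" "q \<in> Arr S" "Dom S q = Dom S p" "Cod S p = Dom S V" "Cod S q = M"
    "V \<cdot> p = q" "s \<in> Arr S" "Dom S s = Dom S V" "Cod S s = Dom S p" "p \<cdot> s = Idn S (Dom S V)" "q \<cdot> s = V"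
proof -
  have M: "M \<in> Obj S" using assms by auto
  let ?p = "fst (pb S V (Idn S M))" and ?q = "snd (pb S V (Idn S M))"
  have pb: "is_pullback S V (Idn S M) ?p ?q" by (rule pb_pullback) (use assms M in simp_all)
  note pD = pullbackD[OF pb]
  obtain s where s: "s \<in> Arr S" "Dom S s = Dom S (Idn S (Dom S V))" "Cod S s = Dom S ?p" "?p \<cdot> s = Idn S (Dom S V)" "?q \<cdot> s = V"
    by (rule pullback_lift[OF pb, of "Idn S (Dom S V)" V]) (use assms M in simp_all)
  show ?thesis by (rule that[of ?p ?q s]) (use pD s assms M in simp_all)
qed

lemma bar_top_iff:
  assumes sq: "(p, Idn S M, x, v) \<in> Arr (arrow_cat S)" and \<phi>: "\<phi> \<in> Preds X (bang S M)" and M: "M \<in> Obj S"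
  shows "is_top X p (Rdx X (p, Idn S M, x, v) (bar S X M \<phi>)) \<longleftrightarrow> is_top X p (Rdx X (p, bang S M, x, bang S (Cod S p)) \<phi>)"
proof -
  note a = sqD[OF sq]
  have i: "iso_pred X p (Rdx X (p, bang S M, x, bang S (Cod S p)) \<phi>) (Rdx X (p, Idn S M, x, v) (bar S X M \<phi>))"
    unfolding bar_def using X.rdx_cmp[OF sq bar_sq[OF M], of \<phi>] \<phi> a(1-8) M by simp
  have "Rdx X (p, Idn S M, x, v) (bar S X M \<phi>) \<in> Preds X p" using X.rdx_in[OF sq] bar_in[OF M \<phi>] by simp
  moreover have "Rdx X (p, bang S M, x, bang S (Cod S p)) \<phi> \<in> Preds X p"
    using X.rdx_in[OF sq_cmp[OF sq bar_sq[OF M]]] \<phi> a(1-8) M by simp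
  ultimately show ?thesis using X.is_top_iso i X.iso_sym a(1) by (metis arrow_cat_simps(1))
qed

lemma gamma_pred:
  assumes V: "V \<in> Arr S" "Cod S V = M" and \<phi>: "\<phi> \<in> Preds X (bang S M)"
  shows "is_top X (base_change S (Idn S M) V) (Rdx X (base_change_sq S (Idn S M) V) (bar S X M \<phi>)) \<longleftrightarrow> Top M \<phi> V"
proof -
  have M: "M \<in> Obj S" using V by auto
  obtain p q s where pq: "pb S V (Idn S M) = (p, q)" "p \<in> Arr S" "q \<in> Arr S" "Dom S q = Dom S p" "Cod S p = Dom S V" "Cod S q = M"
    "V \<cdot> p = q" "s \<in> Arr S" "Dom S s = Dom S V" "Cod S s = Dom S p" "p \<cdot> s = Idn S (Dom S V)" "q \<cdot> s = V"
    using base_change_idn[OF V] by blast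
  have sq: "(p, Idn S M, q, V) \<in> Arr (arrow_cat S)" by (rule sqI) (use pq V M in simp_all)
  have "is_top X p (Rdx X (p, bang S M, q, bang S (Dom S V)) \<phi>) \<longleftrightarrow> Top M \<phi> V"
    by (rule Top_split[where s = s]) (use pq V \<phi> in simp_all)
  thus ?thesis using bar_top_iff[OF sq \<phi> M] pq(1,5) by (simp add: base_change_def base_change_sq_def)
qed

lemma le_top_iff: "is_top X m \<tau> \<Longrightarrow> m \<in> Arr S \<Longrightarrow> \<psi> \<in> Preds X m \<Longrightarrow> Le X m \<tau> \<psi> \<longleftrightarrow> is_top X m \<psi>"
  using X.is_top_le[of m \<tau> \<psi>] unfolding is_top_def by auto

text \<open>Horizontal definability is applied to a top predicate and
  \<open>bar S X M \<phi>\<close>. For a general \<open>h\<close>, its stability clause makes the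
  inverse image of \<open>U\<close> along \<open>h\<close> greatest among the subobjects of
  \<open>Dom S h\<close> on which the reindexed predicate holds. Now \<open>h\<close> factors
  through \<open>U\<close> iff this inverse image is maximal, that is, iff the predicate holds on
  all of \<open>Dom S h\<close>.\<close>

lemma gamma_greatest:
  assumes \<phi>: "\<phi> \<in> Preds X (bang S M)" and M: "M \<in> Obj S"
  obtains U where "is_mono S U" "Cod S U = M" "\<And>h. h \<in> Arr S \<Longrightarrow> Cod S h = M \<Longrightarrow> factors S h U \<longleftrightarrow> Top M \<phi> h"
proof -
  obtain \<tau> where t: "is_top X (Idn S M) \<tau>" using X_top_exists[of "Idn S M"] M by auto
  have tP: "\<tau> \<in> Preds X (Idn S M)" using t unfolding is_top_def by blast
  obtain U where U: "greatest_sub S M (le_on S X (Idn S M) \<tau> (bar S X M \<phi>)) U"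
    and st: "\<And>v. v \<in> Arr S \<Longrightarrow> Cod S v = M \<Longrightarrow> greatest_sub S (Dom S v)
                 (le_on S X (base_change S (Idn S M) v)
                    (Rdx X (base_change_sq S (Idn S M) v) \<tau>) (Rdx X (base_change_sq S (Idn S M) v) (bar S X M \<phi>)))
                 (Rdx (sub_fib S) v U)"
    using X_horizontally_definable[unfolded horizontally_definable_def, rule_format, of "Idn S M" \<tau> "bar S X M \<phi>"] tP bar_in[OF M \<phi>] M by auto
  have um: "is_mono S U" "Cod S U = M" using U unfolding greatest_sub_def by blast+
  have "factors S h U \<longleftrightarrow> Top M \<phi> h" if h: "h \<in> Arr S" "Cod S h = M" for h
  proof -
    obtain p q s where pq: "pb S h (Idn S M) = (p, q)" "p \<in> Arr S" "q \<in> Arr S" "Dom S q = Dom S p" "Cod S p = Dom S h" "Cod S q = M"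
      "h \<cdot> p = q" "s \<in> Arr S" "Dom S s = Dom S h" "Cod S s = Dom S p" "p \<cdot> s = Idn S (Dom S h)" "q \<cdot> s = h"
      using base_change_idn[OF h] by blast
    have sq: "(p, Idn S M, q, h) \<in> Arr (arrow_cat S)" by (rule sqI) (use pq h M in simp_all)
    have Uh: "Cod S U = Cod S h" using um h by simp
    note sr = sub_reindex[OF h(1) um(1) Uh]
    let ?W = "Rdx (sub_fib S) h U"
    have Wa: "?W \<in> Arr S" using sr by simp
    let ?Q = "le_on S X p (Rdx X (p, Idn S M, q, h) \<tau>) (Rdx X (p, Idn S M, q, h) (bar S X M \<phi>))"
    have g: "greatest_sub S (Dom S h) ?Q ?W"
      using st[OF h] pq(1) by (simp add: base_change_def base_change_sq_def)
    \<comment> \<open>Two successive chosen pullbacks are compared with an identity by means of the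
      section \<open>s'\<close>.\<close>
    have Q: "?Q V \<longleftrightarrow> Top M \<phi> (h \<cdot> V)" if V: "V \<in> Arr S" "Cod S V = Dom S h" for V
    proof -
      let ?p = "fst (pb S V p)" and ?q = "snd (pb S V p)"
      have pb: "is_pullback S V p ?p ?q" by (rule pb_pullback) (use V pq in simp_all)
      note pD = pullbackD[OF pb]
      obtain s' where s': "s' \<in> Arr S" "Dom S s' = Dom S (Idn S (Dom S V))" "Cod S s' = Dom S ?p" "?p \<cdot> s' = Idn S (Dom S V)" "?q \<cdot> s' = s \<cdot> V"
      proof (rule pullback_lift[OF pb, of "Idn S (Dom S V)" "s \<cdot> V"])
        have "p \<cdot> (s \<cdot> V) = Idn S (Dom S h) \<cdot> V" by (rule cmp_extend1[OF pq(11)]) (use pq V in simp_all)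
        thus "V \<cdot> Idn S (Dom S V) = p \<cdot> (s \<cdot> V)" using V by simp
      qed (use V pq in simp_all)
      have sq2: "(?p, p, ?q, V) \<in> Arr (arrow_cat S)" by (rule sqI) (use pD V in simp_all)
      note sq3 = sq_cmp[OF sq2 sq]
      have tt: "is_top X ?p (Rdx X (?p, p, ?q, V) (Rdx X (p, Idn S M, q, h) \<tau>))"
        using X_top_rdx[OF sq2] X_top_rdx[OF sq] t by simp
      have bP: "Rdx X (p, Idn S M, q, h) (bar S X M \<phi>) \<in> Preds X p" using X.rdx_in[OF sq] bar_in[OF M \<phi>] by simp
      have bP2: "Rdx X (?p, p, ?q, V) (Rdx X (p, Idn S M, q, h) (bar S X M \<phi>)) \<in> Preds X ?p"
        using X.rdx_in[OF sq2] bP by simp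
      have bP3: "Rdx X (?p, Idn S M, q \<cdot> ?q, h \<cdot> V) (bar S X M \<phi>) \<in> Preds X ?p"
        using X.rdx_in[OF sq3] bar_in[OF M \<phi>] by simp
      have iso: "iso_pred X ?p (Rdx X (?p, Idn S M, q \<cdot> ?q, h \<cdot> V) (bar S X M \<phi>)) (Rdx X (?p, p, ?q, V) (Rdx X (p, Idn S M, q, h) (bar S X M \<phi>)))"
        using X.rdx_cmp[OF sq2 sq] bar_in[OF M \<phi>] by simp
      have "?Q V \<longleftrightarrow> is_top X ?p (Rdx X (?p, p, ?q, V) (Rdx X (p, Idn S M, q, h) (bar S X M \<phi>)))"
        unfolding le_on_def base_change_def base_change_sq_def
        using le_top_iff[OF tt pD(3) bP2] .
      also have "\<dots> \<longleftrightarrow> is_top X ?p (Rdx X (?p, Idn S M, q \<cdot> ?q, h \<cdot> V) (bar S X M \<phi>))"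
        using X.is_top_iso iso X.iso_sym bP2 bP3 pD(3) by (metis arrow_cat_simps(1))
      also have "\<dots> \<longleftrightarrow> is_top X ?p (Rdx X (?p, bang S M, q \<cdot> ?q, bang S (Cod S ?p)) \<phi>)"
        by (rule bar_top_iff[OF sq3 \<phi> M])
      also have "\<dots> \<longleftrightarrow> Top M \<phi> (h \<cdot> V)"
      proof (rule Top_split[where s = s'])
        have "(q \<cdot> ?q) \<cdot> s' = q \<cdot> (s \<cdot> V)" using s' pD pq by simp
        also have "\<dots> = h \<cdot> V" by (rule cmp_extend1[OF pq(12)]) (use pq V in simp_all)
        finally show "(q \<cdot> ?q) \<cdot> s' = h \<cdot> V" .
        have "h \<cdot> (V \<cdot> ?p) = h \<cdot> (p \<cdot> ?q)" using pD(9) by simp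
        also have "\<dots> = q \<cdot> ?q" by (rule cmp_extend1[OF pq(7)]) (use pD(1-8) pq h in simp_all)
        finally show "(h \<cdot> V) \<cdot> ?p = q \<cdot> ?q" using pD(1-8) h V by simp
      qed (use pD(1-8) pq(2-10) s' V h \<phi> in simp_all)
      finally show ?thesis .
    qed
    have "factors S h U \<longleftrightarrow> factors S (Idn S (Dom S h)) ?W" using sr(3)[of "Idn S (Dom S h)"] h by simp
    also have "\<dots> \<longleftrightarrow> Top M \<phi> h"
    proof
      assume "factors S (Idn S (Dom S h)) ?W"
      then obtain k where k: "k \<in> Arr S" "Dom S k = Dom S (Idn S (Dom S h))" "Cod S k = Dom S ?W" "?W \<cdot> k = Idn S (Dom S h)"
        using Wa by (rule factorsE)
      have "Top M \<phi> (h \<cdot> ?W)" using g Q[OF Wa sr(2)] unfolding greatest_sub_def by blast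
      hence "Top M \<phi> ((h \<cdot> ?W) \<cdot> k)" by (rule Top_cmp[rotated 3]) (use h Wa sr k \<phi> in simp_all)
      thus "Top M \<phi> h" using h Wa sr(2) k by simp
    next
      assume "Top M \<phi> h"
      hence "?Q (Idn S (Dom S h))" using Q[of "Idn S (Dom S h)"] h by simp
      thus "factors S (Idn S (Dom S h)) ?W" using g h unfolding greatest_sub_def by simp
    qed
    finally show ?thesis .
  qed
  thus ?thesis using that um by blast
qed

text \<open>The choice in \<open>gamma_of\<close> is harmless, because greatest subobjects factor
  through each other.\<close>

lemma gamma_char:
  assumes \<phi>: "\<phi> \<in> Preds X (bang S M)" and M: "M \<in> Obj S"
  shows "is_mono S (gamma_of S X M \<phi>)" "Cod S (gamma_of S X M \<phi>) = M"
    "h \<in> Arr S \<Longrightarrow> Cod S h = M \<Longrightarrow> factors S h (gamma_of S X M \<phi>) \<longleftrightarrow> Top M \<phi> h"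
proof -
  obtain U where U: "is_mono S U" "Cod S U = M" "\<And>h. h \<in> Arr S \<Longrightarrow> Cod S h = M \<Longrightarrow> factors S h U \<longleftrightarrow> Top M \<phi> h"
    using gamma_greatest[OF assms] by blast
  let ?Q = "\<lambda>V. is_top X (base_change S (Idn S M) V) (Rdx X (base_change_sq S (Idn S M) V) (bar S X M \<phi>))"
  let ?G = "gamma_of S X M \<phi>"
  have "greatest_sub S M ?Q U" by (rule greatest_subI[OF U(1,2)]) (use U(3) gamma_pred \<phi> in simp)
  hence G: "greatest_sub S M ?Q ?G" unfolding gamma_of_def by (rule someI)
  thus g: "is_mono S ?G" "Cod S ?G = M" unfolding greatest_sub_def by blast+
  have "?Q ?G" using G unfolding greatest_sub_def by blast
  hence "factors S ?G U" using gamma_pred[OF _ _ \<phi>, of ?G] g U(3) by simp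
  moreover have "Top M \<phi> U" using U(3)[of U] U(1,2) factors_refl[of U] by simp
  hence "factors S U ?G" using gamma_pred[OF _ _ \<phi>, of U] U G unfolding greatest_sub_def by simp
  ultimately show "h \<in> Arr S \<Longrightarrow> Cod S h = M \<Longrightarrow> factors S h ?G \<longleftrightarrow> Top M \<phi> h"
    using U factors_trans g mono_arr by metis
qed

section \<open>The tripos structure of the first level\<close>

lemma first_level_simps [simp]:
  "Preds (first_level S X) M = Preds X (bang S M)"
  "Le (first_level S X) M = Le X (bang S M)"
  "Rdx (first_level S X) f = Rdx X (bang S (Dom S f), bang S (Cod S f), f, Idn S (one S))"
  by (simp_all add: first_level_def)

lemma first_sq: "f \<in> Arr S \<Longrightarrow> Dom S f = N \<Longrightarrow> Cod S f = M \<Longrightarrow> (bang S N, bang S M, f, Idn S (one S)) \<in> Arr (arrow_cat S)"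
  by (rule sqI) auto

lemma first_level_is:
  "is_top (first_level S X) M = is_top X (bang S M)"
  "is_meet (first_level S X) M = is_meet X (bang S M)"
  "is_imp (first_level S X) M = is_imp X (bang S M)"
  "iso_pred (first_level S X) M = iso_pred X (bang S M)"
  "f \<in> Arr S \<Longrightarrow> is_forall S (first_level S X) f = is_forall (arrow_cat S) X (bang S (Dom S f), bang S (Cod S f), f, Idn S (one S))"
  by (intro ext; simp add: is_top_def is_meet_def is_imp_def iso_pred_def is_forall_def)+

lemma first_level_fib: "fibered_preorder S (first_level S X)"
  unfolding fibered_preorder_def
proof (intro conjI ballI impI)
  fix f \<phi> assume h: "f \<in> Arr S" "\<phi> \<in> Preds (first_level S X) (Cod S f)"
  show "Rdx (first_level S X) f \<phi> \<in> Preds (first_level S X) (Dom S f)"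
    using X.rdx_in[OF first_sq[OF h(1) refl refl]] h by simp
next
  fix f \<phi> \<psi> assume h: "f \<in> Arr S" "\<phi> \<in> Preds (first_level S X) (Cod S f)" "\<psi> \<in> Preds (first_level S X) (Cod S f)"
    "Le (first_level S X) (Cod S f) \<phi> \<psi>"
  show "Le (first_level S X) (Dom S f) (Rdx (first_level S X) f \<phi>) (Rdx (first_level S X) f \<psi>)"
    using X.rdx_mono[OF first_sq[OF h(1) refl refl]] h by simp
next
  fix I \<phi> assume h: "I \<in> Obj S" "\<phi> \<in> Preds (first_level S X) I"
  show "iso_pred (first_level S X) I (Rdx (first_level S X) (Idn S I) \<phi>) \<phi>"
    using X.rdx_idn[of "bang S I" \<phi>] h by (simp add: first_level_is)
next
  fix f g \<phi> assume h: "f \<in> Arr S" "g \<in> Arr S" "Cod S f = Dom S g" "\<phi> \<in> Preds (first_level S X) (Cod S g)"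
  show "iso_pred (first_level S X) (Dom S f) (Rdx (first_level S X) (g \<cdot> f) \<phi>)
     (Rdx (first_level S X) f (Rdx (first_level S X) g \<phi>))"
    using X.rdx_cmp[OF first_sq[OF h(1) refl h(3)] first_sq[OF h(2) refl refl], of \<phi>] h by (simp add: first_level_is)
next
  fix I \<phi> \<psi> \<chi> assume h: "I \<in> Obj S" "\<phi> \<in> Preds (first_level S X) I" "\<psi> \<in> Preds (first_level S X) I" "\<chi> \<in> Preds (first_level S X) I"
    "Le (first_level S X) I \<phi> \<psi>" "Le (first_level S X) I \<psi> \<chi>"
  thus "Le (first_level S X) I \<phi> \<chi>" using X.le_trans[of "bang S I" \<phi> \<psi> \<chi>] by simp
qed (use X.le_refl in simp)

text \<open>The base component is the identity of the terminal object, so only the domain component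
  has to be cancelled.\<close>

lemma first_epi:
  assumes "is_epi S e" "Dom S e = N" "Cod S e = M"
  shows "is_epi (arrow_cat S) (bang S N, bang S M, e, Idn S (one S))"
proof (rule cat_loc.epiI[OF arrow_loc])
  have e: "e \<in> Arr S" using assms by simp
  show "(bang S N, bang S M, e, Idn S (one S)) \<in> Arr (arrow_cat S)" by (rule first_sq[OF e assms(2,3)])
  fix f g assume h: "f \<in> Arr (arrow_cat S)" "g \<in> Arr (arrow_cat S)" "Cod (arrow_cat S) f = Cod (arrow_cat S) g"
    "Dom (arrow_cat S) f = Cod (arrow_cat S) (bang S N, bang S M, e, Idn S (one S))"
    "Dom (arrow_cat S) g = Cod (arrow_cat S) (bang S N, bang S M, e, Idn S (one S))"
    "f \<cdot>\<^bsub>arrow_cat S\<^esub> (bang S N, bang S M, e, Idn S (one S)) = g \<cdot>\<^bsub>arrow_cat S\<^esub> (bang S N, bang S M, e, Idn S (one S))"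
  obtain n x y where f: "f = (bang S M, n, x, y)" using h(4) by (cases f) simp
  obtain z w where g: "g = (bang S M, n, z, w)" using h(3,5) f by (cases g) simp
  note a = sqD[OF h(1)[unfolded f]] and b = sqD[OF h(2)[unfolded g]]
  have M: "M \<in> Obj S" using e assms(3) by auto
  have "x = z" by (rule epiD[OF assms(1)]) (use h(6) f g a(1-8) b(1-8) M assms(3) in simp_all)
  moreover have "y = w" using h(6) f g a(1-8) b(1-8) M by simp
  ultimately show "f = g" using f g by simp
qed

lemma first_level_reflects: "reflects_le_along S (is_epi S) (first_level S X)"
  unfolding reflects_le_along_def
proof (intro ballI impI)
  fix e \<phi> \<psi> assume h: "e \<in> Arr S" "is_epi S e" "\<phi> \<in> Preds (first_level S X) (Cod S e)" "\<psi> \<in> Preds (first_level S X) (Cod S e)"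
     "Le (first_level S X) (Dom S e) (Rdx (first_level S X) e \<phi>) (Rdx (first_level S X) e \<psi>)"
  show "Le (first_level S X) (Cod S e) \<phi> \<psi>"
    using X_reflects[unfolded reflects_le_along_def, rule_format, OF first_sq[OF h(1) refl refl], of \<phi> \<psi>]
      first_epi[OF h(2) refl refl] h by simp
qed

lemma first_level_meets: "has_finite_meets S (first_level S X)"
  unfolding has_finite_meets_def first_level_is first_level_simps
proof (intro conjI ballI allI impI)
  fix I assume I: "I \<in> Obj S"
  thus "\<exists>\<tau>. is_top X (bang S I) \<tau>" using X_top_exists by simp
  fix \<phi> \<psi> assume "\<phi> \<in> Preds X (bang S I)" "\<psi> \<in> Preds X (bang S I)"
  thus "\<exists>\<mu>. is_meet X (bang S I) \<phi> \<psi> \<mu>" using X_finite_meets I unfolding has_finite_meets_def by simp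
next
  fix f \<tau> assume f: "f \<in> Arr S" and t: "is_top X (bang S (Cod S f)) \<tau>"
  thus "is_top X (bang S (Dom S f)) (Rdx X (bang S (Dom S f), bang S (Cod S f), f, Idn S (one S)) \<tau>)"
    using X_top_rdx[OF first_sq[OF f refl refl]] by simp
next
  fix f \<phi> \<psi> \<mu> assume f: "f \<in> Arr S" and t: "\<phi> \<in> Preds X (bang S (Cod S f))" "\<psi> \<in> Preds X (bang S (Cod S f))"
    "is_meet X (bang S (Cod S f)) \<phi> \<psi> \<mu>"
  thus "is_meet X (bang S (Dom S f)) (Rdx X (bang S (Dom S f), bang S (Cod S f), f, Idn S (one S)) \<phi>)
     (Rdx X (bang S (Dom S f), bang S (Cod S f), f, Idn S (one S)) \<psi>) (Rdx X (bang S (Dom S f), bang S (Cod S f), f, Idn S (one S)) \<mu>)"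
    using X_meet_rdx[OF first_sq[OF f refl refl]] by simp
qed

lemma first_level_implication: "has_implication S (first_level S X)"
  unfolding has_implication_def first_level_is first_level_simps
proof (intro conjI ballI allI impI)
  fix I \<phi> \<psi> assume "I \<in> Obj S" "\<phi> \<in> Preds X (bang S I)" "\<psi> \<in> Preds X (bang S I)"
  thus "\<exists>\<mu>. is_imp X (bang S I) \<phi> \<psi> \<mu>" using X_implication unfolding has_implication_def by simp
next
  fix f \<phi> \<psi> \<mu> assume f: "f \<in> Arr S" and t: "\<phi> \<in> Preds X (bang S (Cod S f))" "\<psi> \<in> Preds X (bang S (Cod S f))"
    "is_imp X (bang S (Cod S f)) \<phi> \<psi> \<mu>"
  thus "is_imp X (bang S (Dom S f)) (Rdx X (bang S (Dom S f), bang S (Cod S f), f, Idn S (one S)) \<phi>)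
     (Rdx X (bang S (Dom S f), bang S (Cod S f), f, Idn S (one S)) \<psi>) (Rdx X (bang S (Dom S f), bang S (Cod S f), f, Idn S (one S)) \<mu>)"
    using X_implication[unfolded has_implication_def, THEN conjunct2, rule_format, OF first_sq[OF f refl refl]] by simp
qed

text \<open>Maps between objects over \<open>1\<close> are vertical, and their pullbacks lie over
  \<open>1\<close> again, so quantification along all maps of the topos is a special case of
  quantification along vertical maps.\<close>

lemma first_level_forall: "has_forall S (\<lambda>_. True) (first_level S X)"
  unfolding has_forall_def
proof (intro conjI ballI allI impI)
  fix f \<phi> assume f: "f \<in> Arr S" and p: "\<phi> \<in> Preds (first_level S X) (Dom S f)"
  thus "\<exists>\<chi>. is_forall S (first_level S X) f \<phi> \<chi>"
    using X_forall[unfolded has_forall_def, THEN conjunct1, rule_format, OF first_sq[OF f refl refl], of \<phi>]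
    by (simp add: first_level_is)
next
  fix f g f' g' \<phi> \<chi> assume pb: "is_pullback S f g g' f'" and p: "\<phi> \<in> Preds (first_level S X) (Dom S f)"
    "is_forall S (first_level S X) f \<phi> \<chi>"
  note pD = pullbackD[OF pb]
  have sq: "(bang S (Dom S f), bang S (Cod S f), f, Idn S (Cod S (bang S (Dom S f)))) \<in> Arr (arrow_cat S)"
    using first_sq[OF pD(1) refl refl] pD by simp
  have gq: "(bang S (Dom S g), bang S (Cod S f), g, Idn S (one S)) \<in> Arr (arrow_cat S)"
    using first_sq[OF pD(2) refl] pD by simp
  have v: "Cod S (bang S (Dom S f)) = Cod S (bang S (Cod S f))" using pD by simp
  have apb: "is_pullback (arrow_cat S) (bang S (Dom S f), bang S (Cod S f), f, Idn S (one S)) (bang S (Dom S g), bang S (Cod S f), g, Idn S (one S))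
    (bang S (Dom S f'), bang S (Dom S f), g', Idn S (one S)) (bang S (Dom S f'), bang S (Dom S g), f', Idn S (one S))"
    using arrow_pullback[OF pb sq v gq] pD by simp
  have "is_forall (arrow_cat S) X (bang S (Dom S f'), bang S (Dom S g), f', Idn S (one S))
     (Rdx X (bang S (Dom S f'), bang S (Dom S f), g', Idn S (one S)) \<phi>) (Rdx X (bang S (Dom S g), bang S (Cod S f), g, Idn S (one S)) \<chi>)"
    by (rule X_forall[unfolded has_forall_def, THEN conjunct2, rule_format, OF _ apb])
      (use p pD v in \<open>simp_all add: first_level_is\<close>)
  thus "is_forall S (first_level S X) f' (Rdx (first_level S X) g' \<phi>) (Rdx (first_level S X) g \<chi>)"
    using pD by (simp add: first_level_is)
qed

lemma first_level_generic: "\<exists>Prp tr. is_generic S (first_level S X) Prp tr"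
proof -
  obtain Prp tr where P: "Prp \<in> Obj S" "tr \<in> Preds X (bang S Prp)"
    and g: "\<And>m \<phi>. m \<in> Arr S \<Longrightarrow> \<phi> \<in> Preds X m \<Longrightarrow> \<exists>f\<in>hom (arrow_cat S) m (bang S Prp). iso_pred X m \<phi> (Rdx X f tr)"
    using X_generic unfolding is_generic_def by auto
  have "\<exists>f\<in>hom S I Prp. iso_pred X (bang S I) \<phi> (Rdx X (bang S (Dom S f), bang S (Cod S f), f, Idn S (one S)) tr)"
    if I: "I \<in> Obj S" "\<phi> \<in> Preds X (bang S I)" for I \<phi>
  proof -
    obtain f where f: "f \<in> hom (arrow_cat S) (bang S I) (bang S Prp)" "iso_pred X (bang S I) \<phi> (Rdx X f tr)"
      using g[of "bang S I" \<phi>] I by auto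
    obtain u v where fe: "f = (bang S I, bang S Prp, u, v)" using f(1) by (cases f) (simp add: hom_def)
    have "(bang S I, bang S Prp, u, v) \<in> Arr (arrow_cat S)" using f(1) fe by (simp add: hom_def)
    note a = sqD[OF this]
    have "v = Idn S (one S)" by (rule to_one) (use a(1-8) I P in simp_all)
    thus ?thesis using f(2) fe a(1-8) I P by (intro bexI[of _ u]) (simp_all add: hom_def)
  qed
  hence "is_generic S (first_level S X) Prp tr" using P unfolding is_generic_def by (simp add: first_level_is)
  thus ?thesis by blast
qed

lemma Top_rdx:
  assumes f: "f \<in> Arr S" "Cod S f = M" and \<phi>: "\<phi> \<in> Preds X (bang S M)" and h: "h \<in> Arr S" "Cod S h = Dom S f"
  shows "Top (Dom S f) (Rdx X (bang S (Dom S f), bang S M, f, Idn S (one S)) \<phi>) h \<longleftrightarrow> Top M \<phi> (f \<cdot> h)"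
proof -
  note s1 = Top_sq[OF h] and s2 = first_sq[OF f(1) refl f(2)]
  let ?a = "Rdx X (Idn S (Dom S h), bang S (Dom S f), h, bang S (Dom S h)) (Rdx X (bang S (Dom S f), bang S M, f, Idn S (one S)) \<phi>)"
  let ?b = "Rdx X (Idn S (Dom S h), bang S M, f \<cdot> h, bang S (Dom S h)) \<phi>"
  have i: "iso_pred X (Idn S (Dom S h)) ?b ?a" using X.rdx_cmp[OF s1 s2, of \<phi>] \<phi> h by simp
  have P: "?a \<in> Preds X (Idn S (Dom S h))" "?b \<in> Preds X (Idn S (Dom S h))"
    using X.rdx_in[OF s1] X.rdx_in[OF s2] X.rdx_in[OF sq_cmp[OF s1 s2]] \<phi> h by simp_all
  have "is_top X (Idn S (Dom S h)) ?a \<longleftrightarrow> is_top X (Idn S (Dom S h)) ?b"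
    using X.is_top_iso[OF _ i] X.is_top_iso[OF _ X.iso_sym[OF i]] P h by auto
  thus ?thesis using f h by (simp add: Top_def)
qed

lemma first_level_tripos: "tripos_with_gamma S (to_gtripos S X)"
  unfolding tripos_with_gamma_def to_gtripos_def prod.case
proof (intro conjI ballI allI impI)
  show "fib_map S (first_level S X) (sub_fib S) (gamma_of S X)"
    unfolding fib_map_def
  proof (intro conjI ballI impI)
    fix M \<phi> assume h: "M \<in> Obj S" "\<phi> \<in> Preds (first_level S X) M"
    thus "gamma_of S X M \<phi> \<in> Preds (sub_fib S) M" using gamma_char(1,2) by (simp add: sub_fib_def)
  next
    fix M \<phi> \<psi> assume h: "M \<in> Obj S" "\<phi> \<in> Preds (first_level S X) M" "\<psi> \<in> Preds (first_level S X) M" "Le (first_level S X) M \<phi> \<psi>"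
    have \<phi>: "\<phi> \<in> Preds X (bang S M)" "\<psi> \<in> Preds X (bang S M)" "Le X (bang S M) \<phi> \<psi>" using h by simp_all
    let ?g = "gamma_of S X M \<phi>"
    note g = gamma_char[OF \<phi>(1) h(1)] and g' = gamma_char[OF \<phi>(2) h(1)]
    have ga: "?g \<in> Arr S" using g by simp
    note sq = Top_sq[OF ga g(2)]
    have "Top M \<phi> ?g" using g(3)[OF ga g(2)] factors_refl[OF ga] by simp
    hence "Top M \<psi> ?g"
      unfolding Top_def using X.is_top_le X.rdx_mono[OF sq] X.rdx_in[OF sq] \<phi> ga by (metis arrow_cat_simps(1-3) dom_obj idn_arr)
    thus "Le (sub_fib S) M (gamma_of S X M \<phi>) (gamma_of S X M \<psi>)"
      using g'(3)[OF ga g(2)] by (simp add: sub_fib_def)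
  next
    fix f \<phi> assume h: "f \<in> Arr S" "\<phi> \<in> Preds (first_level S X) (Cod S f)"
    let ?r = "Rdx X (bang S (Dom S f), bang S (Cod S f), f, Idn S (one S)) \<phi>"
    have \<phi>: "\<phi> \<in> Preds X (bang S (Cod S f))" "?r \<in> Preds X (bang S (Dom S f))"
      using h X.rdx_in[OF first_sq[OF h(1) refl refl]] by simp_all
    note g = gamma_char[OF \<phi>(1) cod_obj[OF h(1)]] and g' = gamma_char[OF \<phi>(2) dom_obj[OF h(1)]]
    note sr = sub_reindex[OF h(1) g(1,2)]
    have "iso_pred (sub_fib S) (Dom S f) (gamma_of S X (Dom S f) ?r) (Rdx (sub_fib S) f (gamma_of S X (Cod S f) \<phi>))"
    proof (rule sub_isoI)
      fix k assume k: "k \<in> Arr S" "Cod S k = Dom S f"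
      show "factors S k (gamma_of S X (Dom S f) ?r) \<longleftrightarrow> factors S k (Rdx (sub_fib S) f (gamma_of S X (Cod S f) \<phi>))"
        using g'(3)[OF k] Top_rdx[OF h(1) refl \<phi>(1) k] g(3)[of "f \<cdot> k"] sr(3)[OF k] h(1) k by simp
    qed (use g' sr in simp_all)
    thus "iso_pred (sub_fib S) (Dom S f) (gamma_of S X (Dom S f) (Rdx (first_level S X) f \<phi>)) (Rdx (sub_fib S) f (gamma_of S X (Cod S f) \<phi>))"
      by simp
  qed
next
  fix M \<tau> assume M: "M \<in> Obj S" and t: "is_top (first_level S X) M \<tau>"
  have t: "is_top X (bang S M) \<tau>" "\<tau> \<in> Preds X (bang S M)" using t by (simp_all add: first_level_is is_top_def)
  note g = gamma_char[OF t(2) M]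
  have "Top M \<tau> (Idn S M)" using X_top_rdx[OF Top_sq[of "Idn S M" M]] t M by (simp add: Top_def)
  hence "factors S (Idn S M) (gamma_of S X M \<tau>)" using g(3)[of "Idn S M"] M by simp
  thus "is_top (sub_fib S) M (gamma_of S X M \<tau>)"
    using g idn_factors[of "gamma_of S X M \<tau>"] by (simp add: is_top_def sub_fib_def)
next
  fix M \<phi> \<psi> \<mu> assume M: "M \<in> Obj S" and p: "\<phi> \<in> Preds (first_level S X) M" "\<psi> \<in> Preds (first_level S X) M"
    "is_meet (first_level S X) M \<phi> \<psi> \<mu>"
  have p: "\<phi> \<in> Preds X (bang S M)" "\<psi> \<in> Preds X (bang S M)" "\<mu> \<in> Preds X (bang S M)" "is_meet X (bang S M) \<phi> \<psi> \<mu>"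
    using p by (simp_all add: first_level_is is_meet_def)
  have "Top M \<mu> u \<longleftrightarrow> Top M \<phi> u \<and> Top M \<psi> u" if u: "u \<in> Arr S" "Cod S u = M" for u
  proof -
    have "is_meet X (Idn S (Dom S u)) (Rdx X (Idn S (Dom S u), bang S M, u, bang S (Dom S u)) \<phi>)
      (Rdx X (Idn S (Dom S u), bang S M, u, bang S (Dom S u)) \<psi>) (Rdx X (Idn S (Dom S u), bang S M, u, bang S (Dom S u)) \<mu>)"
      using X_meet_rdx[OF Top_sq[OF u]] p by simp
    thus ?thesis using X.rdx_in[OF Top_sq[OF u]] p unfolding Top_def is_top_def is_meet_def by auto
  qed
  thus "is_meet (sub_fib S) M (gamma_of S X M \<phi>) (gamma_of S X M \<psi>) (gamma_of S X M \<mu>)"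
    using gamma_char[OF p(1) M] gamma_char[OF p(2) M] gamma_char[OF p(3) M] by (simp add: is_meet_def sub_fib_def)
next
  fix p assume p: "p \<in> Preds (first_level S X) (one S)" "is_top (sub_fib S) (one S) (gamma_of S X (one S) p)"
  let ?i = "Idn S (one S)"
  have P: "p \<in> Preds X (bang S (one S))" using p by simp
  have "factors S ?i (gamma_of S X (one S) p)" using p(2) by (simp add: is_top_def sub_fib_def)
  hence "Top (one S) p ?i" using gamma_char(3)[OF P one_obj, of ?i] by simp
  \<comment> \<open>\<open>bang S (one S)\<close> is an identity, so over the terminal object
    passing to \<open>bar\<close> is reindexing along an identity square.\<close>
  hence "is_top X ?i (Rdx X (?i, ?i, ?i, ?i) p)" by (simp add: Top_def)
  moreover have "iso_pred X ?i (Rdx X (?i, ?i, ?i, ?i) p) p" using X.rdx_idn[of ?i p] P by simp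
  ultimately have "is_top X ?i p" using X.is_top_iso P by simp
  thus "is_top (first_level S X) (one S) p" by (simp add: first_level_is)
qed (rule first_level_fib first_level_reflects first_level_meets first_level_implication first_level_forall first_level_generic)+

sublocale T: gamma_tripos S "first_level S X" "gamma_of S X"
  using first_level_tripos by unfold_locales (simp add: to_gtripos_def)

lemma gtop_Top: "\<chi> \<in> Preds X (bang S L) \<Longrightarrow> L \<in> Obj S \<Longrightarrow> T.gtop L \<chi> \<longleftrightarrow> Top L \<chi> (Idn S L)"
  using gamma_char(3)[of \<chi> L "Idn S L"] by (simp add: T.gtop_def)

lemma T_ent: "T.ent M = X.ent (bang S M)"
  by (intro ext) (simp add: T.ent_def X.ent_def)

section \<open>Predicates over \<open>m\<close> compared with those over
  \<open>Dom S m \<rightarrow> 1\<close>\<close>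

definition lift :: "'a \<Rightarrow> 'p \<Rightarrow> 'p" where
  "lift m \<phi> = Rdx X (m, bang S (Dom S m), Idn S (Dom S m), bang S (Cod S m)) \<phi>"

lemma lift_sq: "m \<in> Arr S \<Longrightarrow> (m, bang S (Dom S m), Idn S (Dom S m), bang S (Cod S m)) \<in> Arr (arrow_cat S)"
  by (rule sqI) auto

lemma lift_in: "m \<in> Arr S \<Longrightarrow> \<phi> \<in> Preds X (bang S (Dom S m)) \<Longrightarrow> lift m \<phi> \<in> Preds X m"
  unfolding lift_def using X.rdx_in[OF lift_sq, of m \<phi>] by simp

lemma lift_iso: "m \<in> Arr S \<Longrightarrow> \<phi> \<in> Preds X (bang S (Dom S m)) \<Longrightarrow> \<psi> \<in> Preds X (bang S (Dom S m)) \<Longrightarrow>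
    iso_pred X (bang S (Dom S m)) \<phi> \<psi> \<Longrightarrow> iso_pred X m (lift m \<phi>) (lift m \<psi>)"
  unfolding lift_def using X.rdx_iso[OF lift_sq, of m \<phi> \<psi>] by simp

lemma lift_rdx:
  assumes sq: "(m', m, u, v) \<in> Arr (arrow_cat S)" and p: "\<phi> \<in> Preds X (bang S (Dom S m))"
  shows "iso_pred X m' (lift m' (Rdx (first_level S X) u \<phi>)) (Rdx X (m', m, u, v) (lift m \<phi>))"
proof -
  note a = sqD[OF sq]
  note fs = first_sq[OF a(3,5,6)] and ls = lift_sq[OF a(1)] lift_sq[OF a(2)]
  have 1: "iso_pred X m' (Rdx X (m', bang S (Dom S m), u, bang S (Cod S m')) \<phi>) (lift m' (Rdx (first_level S X) u \<phi>))"
    using X.rdx_cmp[OF ls(1) fs, of \<phi>] p a(1-8) by (simp add: lift_def)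
  have 2: "iso_pred X m' (Rdx X (m', bang S (Dom S m), u, bang S (Cod S m')) \<phi>) (Rdx X (m', m, u, v) (lift m \<phi>))"
    using X.rdx_cmp[OF sq ls(2), of \<phi>] p a(1-8) by (simp add: lift_def)
  have 3: "Rdx X (m', bang S (Dom S m), u, bang S (Cod S m')) \<phi> \<in> Preds X m'"
    using X.rdx_in[OF sq_cmp[OF ls(1) fs], of \<phi>] p a(1-8) by simp
  have 4: "lift m' (Rdx (first_level S X) u \<phi>) \<in> Preds X m'"
    using lift_in[OF a(1)] T.rdx_in[OF a(3), of \<phi>] p a(5,6) by simp
  have 5: "Rdx X (m', m, u, v) (lift m \<phi>) \<in> Preds X m'" using X.rdx_in[OF sq] lift_in[OF a(2) p] by simp
  show ?thesis by (rule X.iso_trans[OF X.iso_sym[OF 1] 2 _ 4 3 5]) (use a(1) in simp)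
qed

text \<open>The generic predicate lives over \<open>Prp \<rightarrow> 1\<close>. By terminality the
  base component of a classifying square is forced, so the square factors through
  \<open>Dom S m \<rightarrow> 1\<close>.\<close>

lemma lift_surj:
  assumes m: "m \<in> Arr S" and p: "\<psi> \<in> Preds X m"
  shows "\<exists>\<phi>\<in>Preds X (bang S (Dom S m)). iso_pred X m (lift m \<phi>) \<psi>"
proof -
  obtain Prp tr f where P: "Prp \<in> Obj S" "tr \<in> Preds X (bang S Prp)"
    and f: "f \<in> hom (arrow_cat S) m (bang S Prp)" "iso_pred X m \<psi> (Rdx X f tr)"
    using X_generic m p unfolding is_generic_def by (metis arrow_cat_simps(1))
  obtain u v where fe: "f = (m, bang S Prp, u, v)" using f(1) by (cases f) (simp add: hom_def)
  have sq: "(m, bang S Prp, u, v) \<in> Arr (arrow_cat S)" using f(1) fe by (simp add: hom_def)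
  note a = sqD[OF sq]
  have v: "v = bang S (Cod S m)" by (rule to_one) (use a(1-8) P in simp_all)
  have uP: "Cod S u = Prp" using a P by simp
  note fs = first_sq[OF a(3) a(5) uP]
  let ?\<phi> = "Rdx X (bang S (Dom S m), bang S Prp, u, Idn S (one S)) tr"
  have pP: "?\<phi> \<in> Preds X (bang S (Dom S m))" using X.rdx_in[OF fs] P by simp
  have "iso_pred X m (Rdx X f tr) (lift m ?\<phi>)"
    unfolding lift_def fe v using X.rdx_cmp[OF lift_sq[OF m] fs, of tr] P a(1-8) by simp
  hence "iso_pred X m (lift m ?\<phi>) \<psi>"
    using X.iso_trans[of m "lift m ?\<phi>" "Rdx X f tr" \<psi>] X.iso_sym f(2) X.rdx_in[OF sq] P(2) fe m p lift_in[OF m pP] by simp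
  thus ?thesis using pP by blast
qed

text \<open>Starting from an inequality over \<open>m\<close>, the witness \<open>\<chi>\<close> is
  the quantified implication, formed between objects over \<open>1\<close>. The inequality makes the
  lifted implication true over \<open>m\<close>, and Beck-Chevalley transfers this to the identity
  of \<open>Cod S m\<close>, where \<open>\<gamma>\<close> is read off. Conversely a witness with
  maximal \<open>\<gamma>\<close> becomes top over \<open>m\<close>, so it drops out of the
  entailment.\<close>

lemma lift_le:
  assumes m: "m \<in> Arr S" and p: "\<phi> \<in> Preds X (bang S (Dom S m))" "\<psi> \<in> Preds X (bang S (Dom S m))"
  shows "Le X m (lift m \<phi>) (lift m \<psi>) \<longleftrightarrow> T.tle m \<phi> \<psi>"
proof
  let ?M = "Dom S m" and ?L = "Cod S m"
  have L: "?L \<in> Obj S" and M: "?M \<in> Obj S" using m by simp_all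
  note fs = first_sq[OF m refl refl] and ls = lift_sq[OF m]
  have gs: "(m, Idn S ?L, m, Idn S ?L) \<in> Arr (arrow_cat S)" by (rule sqI) (use m in simp_all)
  {
    assume "T.tle m \<phi> \<psi>"
    then obtain \<chi> where c: "T.gtop ?L \<chi>" "X.ent (bang S ?M) (Rdx (first_level S X) m \<chi>) \<phi> \<psi>"
      unfolding T.tle_def T_ent by blast
    have cP: "\<chi> \<in> Preds X (bang S ?L)" using T.gtop_in[OF c(1)] by simp
    have mc: "Rdx (first_level S X) m \<chi> \<in> Preds X (bang S ?M)" using T.rdx_in[OF m, of \<chi>] cP by simp
    have e: "X.ent m (lift m (Rdx (first_level S X) m \<chi>)) (lift m \<phi>) (lift m \<psi>)"
      using X.ent_rdx[OF X_finite_meets ls, of "Rdx (first_level S X) m \<chi>" \<phi> \<psi>] c(2) mc p by (simp add: lift_def)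
    have "is_top X (Idn S ?L) (Rdx X (Idn S ?L, bang S ?L, Idn S ?L, bang S ?L) \<chi>)"
      using gtop_Top[OF cP L] c(1) L by (simp add: Top_def)
    from top_cmp[OF bar_sq[OF L] gs cP this]
    have t: "is_top X m (Rdx X (m, bang S ?L, m, bang S ?L) \<chi>)" using m by simp
    have i: "iso_pred X m (Rdx X (m, bang S ?L, m, bang S ?L) \<chi>) (lift m (Rdx (first_level S X) m \<chi>))"
      using X.rdx_cmp[OF ls fs, of \<chi>] cP m by (simp add: lift_def)
    have "is_top X m (lift m (Rdx (first_level S X) m \<chi>))"
      using X.is_top_iso[OF t i] lift_in[OF m mc] m by simp
    thus "Le X m (lift m \<phi>) (lift m \<psi>)" using X.ent_top e lift_in[OF m] p m by simp
  next
    assume le: "Le X m (lift m \<phi>) (lift m \<psi>)"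
    obtain \<iota> where io: "is_imp X (bang S ?M) \<phi> \<psi> \<iota>"
      using X_implication[unfolded has_implication_def, THEN conjunct1, rule_format, of "bang S ?M" \<phi> \<psi>] p M by auto
    have iP: "\<iota> \<in> Preds X (bang S ?M)" using io unfolding is_imp_def by blast
    obtain \<chi> where ch: "is_forall (arrow_cat S) X (bang S ?M, bang S ?L, m, Idn S (one S)) \<iota> \<chi>"
      using X_forall[unfolded has_forall_def, THEN conjunct1, rule_format, OF fs, of \<iota>] iP M L by auto
    have cP: "\<chi> \<in> Preds X (bang S ?L)" using ch unfolding is_forall_def by simp
    have mcP: "Rdx (first_level S X) m \<chi> \<in> Preds X (bang S ?M)" using T.rdx_in[OF m, of \<chi>] cP by simp
    have "Le X (bang S ?M) (Rdx (first_level S X) m \<chi>) \<iota>"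
      using ch cP X.le_refl[of "bang S ?L" \<chi>] L unfolding is_forall_def by simp
    hence e: "X.ent (bang S ?M) (Rdx (first_level S X) m \<chi>) \<phi> \<psi>"
      using X.is_imp_ent[OF X_finite_meets, of "bang S ?M" \<phi> \<psi> \<iota>] io p M mcP by simp
    \<comment> \<open>A trivial square in the topos, but the pullback it induces in the arrow
      category replaces the objects over \<open>1\<close> by \<open>m\<close> and the identity of
      \<open>?L\<close>.\<close>
    have pb: "is_pullback S m (Idn S ?L) (Idn S ?M) m"
    proof (rule pullbackI)
      fix x y assume "x \<in> Arr S" "y \<in> Arr S" "Dom S x = Dom S y" "Cod S x = Dom S m" "Cod S y = Dom S (Idn S ?L)" "m \<cdot> x = Idn S ?L \<cdot> y"
      thus "\<exists>h\<in>Arr S. Dom S h = Dom S x \<and> Cod S h = Dom S (Idn S ?M) \<and> Idn S ?M \<cdot> h = x \<and> m \<cdot> h = y"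
        using m by (intro bexI[of _ x]) simp_all
    next
      fix h k assume "h \<in> Arr S" "k \<in> Arr S" "Cod S h = Dom S (Idn S ?M)" "Cod S k = Dom S (Idn S ?M)" "Idn S ?M \<cdot> h = Idn S ?M \<cdot> k"
      thus "h = k" using m by simp
    qed (use m in simp_all)
    have sq: "(bang S ?M, bang S ?L, m, Idn S (Cod S (bang S ?M))) \<in> Arr (arrow_cat S)" using fs M by simp
    have v: "Cod S (bang S ?M) = Cod S (bang S ?L)" using M L by simp
    have apb: "is_pullback (arrow_cat S) (bang S ?M, bang S ?L, m, Idn S (one S)) (Idn S ?L, bang S ?L, Idn S ?L, bang S ?L)
      (m, bang S ?M, Idn S ?M, bang S ?L) (m, Idn S ?L, m, Idn S ?L)"
      using arrow_pullback[OF pb sq v bar_sq[OF L]] m M L by simp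
    have bc: "is_forall (arrow_cat S) X (m, Idn S ?L, m, Idn S ?L) (lift m \<iota>) (Rdx X (Idn S ?L, bang S ?L, Idn S ?L, bang S ?L) \<chi>)"
      unfolding lift_def
      by (rule X_forall[unfolded has_forall_def, THEN conjunct2, rule_format, OF _ apb]) (use iP ch v M in simp_all)
    have li: "is_imp X m (lift m \<phi>) (lift m \<psi>) (lift m \<iota>)"
      unfolding lift_def using X_implication[unfolded has_implication_def, THEN conjunct2, rule_format, OF ls, of \<phi> \<psi> \<iota>] p io by simp
    have "Le X m \<xi> (lift m \<iota>)" if "\<xi> \<in> Preds X m" for \<xi>
      using X.is_imp_ent[OF X_finite_meets, of m "lift m \<phi>" "lift m \<psi>" "lift m \<iota>"] li X.ent_le[OF le, of \<xi>] lift_in[OF m] p m that by simp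
    hence "Le X (Idn S ?L) \<xi> (Rdx X (Idn S ?L, bang S ?L, Idn S ?L, bang S ?L) \<chi>)" if "\<xi> \<in> Preds X (Idn S ?L)" for \<xi>
      using bc that X.rdx_in[OF gs, of \<xi>] unfolding is_forall_def by simp
    hence "Top ?L \<chi> (Idn S ?L)" using X.rdx_in[OF bar_sq[OF L], of \<chi>] cP L by (simp add: Top_def is_top_def)
    hence "T.gtop ?L \<chi>" using gtop_Top[OF cP L] by simp
    thus "T.tle m \<phi> \<psi>" using e unfolding T.tle_def T_ent by blast
  }
qed

end

section \<open>Invariance of the recovered order and comparison of equivalence classes\<close>

lemma tle_transport1:
  assumes P: "gamma_tripos S P \<gamma>" and Q: "gamma_tripos S Q \<delta>" and e: "fib_equivalence S P Q F G"
    and g: "\<And>M \<phi>. M \<in> Obj S \<Longrightarrow> \<phi> \<in> Preds P M \<Longrightarrow> iso_pred (sub_fib S) M (\<delta> M (F M \<phi>)) (\<gamma> M \<phi>)"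
    and m: "m \<in> Arr S" and p: "\<phi> \<in> Preds P (Dom S m)" "\<psi> \<in> Preds P (Dom S m)"
    and t: "gamma_tripos.tle S P \<gamma> m \<phi> \<psi>"
  shows "gamma_tripos.tle S Q \<delta> m (F (Dom S m) \<phi>) (F (Dom S m) \<psi>)"
proof -
  interpret P: gamma_tripos S P \<gamma> by fact
  interpret Q: gamma_tripos S Q \<delta> by fact
  have F: "fib_map S P Q F" and G: "fib_map S Q P G"
    and FG: "\<And>I \<psi>. I \<in> Obj S \<Longrightarrow> \<psi> \<in> Preds Q I \<Longrightarrow> iso_pred Q I (F I (G I \<psi>)) \<psi>"
    using e unfolding fib_equivalence_def by blast+
  let ?M = "Dom S m" and ?L = "Cod S m"
  have M: "?M \<in> Obj S" and L: "?L \<in> Obj S" using m by simp_all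
  note le = fib_equivalence_le[OF P.fib_loc_axioms Q.fib_loc_axioms e M]
  obtain \<chi> where c: "P.gtop ?L \<chi>" "P.ent ?M (Rdx P m \<chi>) \<phi> \<psi>" using t unfolding P.tle_def by blast
  note cP = P.gtop_in[OF c(1)]
  have FP: "F ?L \<chi> \<in> Preds Q ?L" "F ?M \<phi> \<in> Preds Q ?M" "F ?M \<psi> \<in> Preds Q ?M" using fib_map_in[OF F] cP p L M by simp_all
  have mcP: "Rdx P m \<chi> \<in> Preds P ?M" using P.rdx_in[OF m cP] .
  have FmP: "F ?M (Rdx P m \<chi>) \<in> Preds Q ?M" "Rdx Q m (F ?L \<chi>) \<in> Preds Q ?M"
    using fib_map_in[OF F M mcP] Q.rdx_in[OF m FP(1)] by simp_all
  have "factors S (\<gamma> ?L \<chi>) (\<delta> ?L (F ?L \<chi>))" using g[OF L cP] by (simp add: iso_pred_def sub_fib_def)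
  \<comment> \<open>The witness on the side of \<open>Q\<close> is the image of
    \<open>\<chi>\<close> under \<open>F\<close>; its \<open>\<delta>\<close> is maximal because
    \<open>F\<close> carries \<open>\<gamma>\<close> to \<open>\<delta>\<close> up to
    isomorphism.\<close>
  hence 1: "Q.gtop ?L (F ?L \<chi>)"
    using c(1) FP(1) P.factors_trans P.gamma_sub[OF L cP] Q.gamma_sub[OF L FP(1)] P.mono_arr
    unfolding P.gtop_def Q.gtop_def by blast
  have i: "iso_pred Q ?M (F ?M (Rdx P m \<chi>)) (Rdx Q m (F ?L \<chi>))" using F m cP unfolding fib_map_def by blast
  have "Q.ent ?M (Rdx Q m (F ?L \<chi>)) (F ?M \<phi>) (F ?M \<psi>)"
    unfolding Q.ent_def
  proof (intro ballI impI)
    \<comment> \<open>A test predicate of \<open>Q\<close> is only isomorphic to one in the image of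
      \<open>F\<close>, namely to the image of \<open>G ?M \<xi>\<close>; the inequalities are moved
      there and back.\<close>
    fix \<xi> assume x: "\<xi> \<in> Preds Q ?M" "Le Q ?M \<xi> (Rdx Q m (F ?L \<chi>))" "Le Q ?M \<xi> (F ?M \<phi>)"
    have gx: "G ?M \<xi> \<in> Preds P ?M" using fib_map_in[OF G M x(1)] .
    have fgx: "F ?M (G ?M \<xi>) \<in> Preds Q ?M" "iso_pred Q ?M (F ?M (G ?M \<xi>)) \<xi>" using fib_map_in[OF F M gx] FG[OF M x(1)] by simp_all
    have "Le Q ?M (F ?M (G ?M \<xi>)) (F ?M (Rdx P m \<chi>))"
      using Q.le_iso_cong[OF fgx(2) i M fgx(1) x(1) FmP] x(2) by simp
    hence "Le P ?M (G ?M \<xi>) (Rdx P m \<chi>)" using le[OF gx mcP] by simp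
    moreover have "Le Q ?M (F ?M (G ?M \<xi>)) (F ?M \<phi>)"
      using Q.le_iso_cong[OF fgx(2) Q.iso_refl[OF M FP(2)] M fgx(1) x(1) FP(2) FP(2)] x(3) by simp
    hence "Le P ?M (G ?M \<xi>) \<phi>" using le[OF gx p(1)] by simp
    ultimately have "Le P ?M (G ?M \<xi>) \<psi>" using c(2) gx unfolding P.ent_def by blast
    hence "Le Q ?M (F ?M (G ?M \<xi>)) (F ?M \<psi>)" using le[OF gx p(2)] by simp
    thus "Le Q ?M \<xi> (F ?M \<psi>)"
      using Q.le_iso_cong[OF fgx(2) Q.iso_refl[OF M FP(3)] M fgx(1) x(1) FP(3) FP(3)] by simp
  qed
  thus ?thesis using 1 unfolding Q.tle_def by blast
qed

lemma tle_transport: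
  assumes P: "gamma_tripos S P \<gamma>" and Q: "gamma_tripos S Q \<delta>" and e: "fib_equivalence S P Q F G"
    and g: "\<And>M \<phi>. M \<in> Obj S \<Longrightarrow> \<phi> \<in> Preds P M \<Longrightarrow> iso_pred (sub_fib S) M (\<delta> M (F M \<phi>)) (\<gamma> M \<phi>)"
    and m: "m \<in> Arr S" and p: "\<phi> \<in> Preds P (Dom S m)" "\<psi> \<in> Preds P (Dom S m)"
  shows "gamma_tripos.tle S P \<gamma> m \<phi> \<psi> \<longleftrightarrow> gamma_tripos.tle S Q \<delta> m (F (Dom S m) \<phi>) (F (Dom S m) \<psi>)"
proof
  interpret P: gamma_tripos S P \<gamma> by fact
  interpret Q: gamma_tripos S Q \<delta> by fact
  have F: "fib_map S P Q F" and G: "fib_map S Q P G"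
    and FG: "\<And>I \<psi>. I \<in> Obj S \<Longrightarrow> \<psi> \<in> Preds Q I \<Longrightarrow> iso_pred Q I (F I (G I \<psi>)) \<psi>"
    and GF: "\<And>I \<psi>. I \<in> Obj S \<Longrightarrow> \<psi> \<in> Preds P I \<Longrightarrow> iso_pred P I (G I (F I \<psi>)) \<psi>"
    using e unfolding fib_equivalence_def by blast+
  let ?M = "Dom S m"
  have M: "?M \<in> Obj S" using m by simp
  have FP: "F ?M \<phi> \<in> Preds Q ?M" "F ?M \<psi> \<in> Preds Q ?M" using fib_map_in[OF F M] p by simp_all
  {
    assume t: "P.tle m \<phi> \<psi>"
    show "Q.tle m (F ?M \<phi>) (F ?M \<psi>)" by (rule tle_transport1[OF P Q e g m p t])
  next
    assume t: "Q.tle m (F ?M \<phi>) (F ?M \<psi>)"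
    \<comment> \<open>Compatibility of \<open>G\<close> with \<open>\<delta>\<close> and
      \<open>\<gamma>\<close> is inherited from \<open>F\<close>, since applying \<open>F\<close>
      after \<open>G\<close> is isomorphic to the identity. It allows the direction already proved
      to be used for \<open>G\<close>.\<close>
    have g': "iso_pred (sub_fib S) I (\<gamma> I (G I \<chi>)) (\<delta> I \<chi>)" if I: "I \<in> Obj S" "\<chi> \<in> Preds Q I" for I \<chi>
    proof -
      have GP: "G I \<chi> \<in> Preds P I" and FGP: "F I (G I \<chi>) \<in> Preds Q I" using fib_map_in[OF G] fib_map_in[OF F] I by blast+
      have "iso_pred (sub_fib S) I (\<delta> I (F I (G I \<chi>))) (\<delta> I \<chi>)"
        using Q.gamma_map FG[OF I] I FGP unfolding fib_map_def iso_pred_def by blast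
      hence "factors S (\<delta> I (F I (G I \<chi>))) (\<delta> I \<chi>)" "factors S (\<delta> I \<chi>) (\<delta> I (F I (G I \<chi>)))"
        by (simp_all add: iso_pred_def sub_fib_def)
      moreover have "factors S (\<delta> I (F I (G I \<chi>))) (\<gamma> I (G I \<chi>))" "factors S (\<gamma> I (G I \<chi>)) (\<delta> I (F I (G I \<chi>)))"
        using g[OF I(1) GP] by (simp_all add: iso_pred_def sub_fib_def)
      moreover have "\<delta> I (F I (G I \<chi>)) \<in> Arr S" "\<delta> I \<chi> \<in> Arr S" "\<gamma> I (G I \<chi>) \<in> Arr S"
        using Q.gamma_sub[OF I(1) FGP] Q.gamma_sub[OF I] P.gamma_sub[OF I(1) GP] by simp_all
      ultimately have "factors S (\<gamma> I (G I \<chi>)) (\<delta> I \<chi>)" "factors S (\<delta> I \<chi>) (\<gamma> I (G I \<chi>))"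
        by (blast intro: P.factors_trans)+
      thus ?thesis by (simp add: iso_pred_def sub_fib_def)
    qed
    have "P.tle m (G ?M (F ?M \<phi>)) (G ?M (F ?M \<psi>))"
      by (rule tle_transport1[OF Q P fib_equivalence_sym[OF e] g' m FP t])
    thus "P.tle m \<phi> \<psi>"
      using P.tle_cong[OF m GF[OF M p(1)] GF[OF M p(2)]] fib_map_in[OF G M] FP p by blast
  }
qed

text \<open>A code \<open>f\<close> over \<open>m\<close> is sent to the lift of the image of its
  predicate. Its order is followed through \<open>tle\<close> for \<open>P\<close>, then
  \<open>tle\<close> for the first level of \<open>Y\<close>, and finally into \<open>Y\<close> by
  \<open>lift_le\<close>. Here \<open>P\<close> may be the first level of another fibered tripos;
  this freedom gives injectivity of the passage from (b) to (c).\<close>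

lemma rep_equiv:
  assumes rep: "represented_tripos S P \<gamma> A R tr" and Y: "fib_tripos S Y" and e: "fib_equivalence S P (first_level S Y) F G"
    and gam: "\<And>M \<phi>. M \<in> Obj S \<Longrightarrow> \<phi> \<in> Preds P M \<Longrightarrow> iso_pred (sub_fib S) M (gamma_of S Y M (F M \<phi>)) (\<gamma> M \<phi>)"
  shows "fib_equiv (arrow_cat S) (ufam S (A, R)) Y"
proof -
  interpret P: represented_tripos S P \<gamma> A R tr by fact
  interpret Y: fib_tripos S Y by fact
  have F: "fib_map S P (first_level S Y) F" and G: "fib_map S (first_level S Y) P G"
    and FG: "\<And>I \<psi>. I \<in> Obj S \<Longrightarrow> \<psi> \<in> Preds (first_level S Y) I \<Longrightarrow> iso_pred (first_level S Y) I (F I (G I \<psi>)) \<psi>"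
    using e unfolding fib_equivalence_def by blast+
  have FP: "F I \<phi> \<in> Preds Y (bang S I)" if "I \<in> Obj S" "\<phi> \<in> Preds P I" for I \<phi>
    using fib_map_in[OF F that] by simp
  have Fi: "iso_pred Y (bang S I) (F I \<phi>) (F I \<psi>)" if "I \<in> Obj S" "\<phi> \<in> Preds P I" "\<psi> \<in> Preds P I" "iso_pred P I \<phi> \<psi>" for I \<phi> \<psi>
    using F that unfolding fib_map_def iso_pred_def by simp
  let ?K = "\<lambda>m f. Y.lift m (F (Dom S m) (P.d f))"
  have KP: "?K m f \<in> Preds Y m" if "m \<in> Arr S" "f \<in> hom S (Dom S m) A" for m f
    by (rule Y.lift_in) (use that FP P.d_in in simp_all)
  have "\<exists>G. fib_equivalence (arrow_cat S) (ufam S (A, R)) Y ?K G"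
  proof (rule fib_equivI[OF P.X.fib_loc_axioms Y.X.fib_loc_axioms])
    fix m f assume "m \<in> Obj (arrow_cat S)" "f \<in> Preds (ufam S (A, R)) m"
    thus "?K m f \<in> Preds Y m" using KP by simp
  next
    fix m f g assume h: "m \<in> Obj (arrow_cat S)" "f \<in> Preds (ufam S (A, R)) m" "g \<in> Preds (ufam S (A, R)) m"
    have m: "m \<in> Arr S" and f: "f \<in> hom S (Dom S m) A" "g \<in> hom S (Dom S m) A" using h by simp_all
    have "Le (ufam S (A, R)) m f g \<longleftrightarrow> P.tle m (P.d f) (P.d g)" by (rule P.X_Le[OF m f])
    also have "\<dots> \<longleftrightarrow> Y.T.tle m (F (Dom S m) (P.d f)) (F (Dom S m) (P.d g))"
      by (rule tle_transport[OF P.gamma_tripos_axioms Y.T.gamma_tripos_axioms e gam m P.d_in[OF f(1)] P.d_in[OF f(2)]])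
    also have "\<dots> \<longleftrightarrow> Le Y m (?K m f) (?K m g)"
      by (rule Y.lift_le[symmetric]) (use m FP P.d_in f in simp_all)
    finally show "Le (ufam S (A, R)) m f g \<longleftrightarrow> Le Y m (?K m f) (?K m g)" .
  next
    fix s f assume h: "s \<in> Arr (arrow_cat S)" "f \<in> Preds (ufam S (A, R)) (Cod (arrow_cat S) s)"
    obtain m' m u v where s: "s = (m', m, u, v)" by (cases s)
    have sq: "(m', m, u, v) \<in> Arr (arrow_cat S)" using h s by simp
    note a = P.sqD[OF sq]
    have f: "f \<in> hom S (Dom S m) A" using h s by simp
    have fu: "f \<cdot>\<^bsub>S\<^esub> u \<in> hom S (Dom S m') A" using P.d_in_cmp[OF f a(3,6)] a(5) by simp
    have M: "Dom S m \<in> Obj S" "Dom S m' \<in> Obj S" using a by simp_all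
    have rP: "Rdx P u (P.d f) \<in> Preds P (Dom S m')" using P.rdx_in[OF a(3)] P.d_in[OF f] a(5,6) by simp
    have RP: "Rdx (first_level S Y) u (F (Dom S m) (P.d f)) \<in> Preds Y (bang S (Dom S m'))"
      using Y.T.rdx_in[OF a(3), of "F (Dom S m) (P.d f)"] FP[OF M(1) P.d_in[OF f]] a(5,6) by simp
    have "iso_pred Y (bang S (Dom S m')) (F (Dom S m') (P.d (f \<cdot>\<^bsub>S\<^esub> u))) (F (Dom S m') (Rdx P u (P.d f)))"
      by (rule Fi) (use M P.d_in fu rP P.d_cmp[OF f a(3,6)] a(5) in simp_all)
    moreover have "iso_pred Y (bang S (Dom S m')) (F (Dom S m') (Rdx P u (P.d f))) (Rdx (first_level S Y) u (F (Dom S m) (P.d f)))"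
      using F[unfolded fib_map_def, THEN conjunct2, THEN conjunct2, rule_format, OF a(3), of "P.d f"] P.d_in[OF f] a(5,6)
      by (simp add: Y.first_level_is)
    ultimately have "iso_pred Y (bang S (Dom S m')) (F (Dom S m') (P.d (f \<cdot>\<^bsub>S\<^esub> u))) (Rdx (first_level S Y) u (F (Dom S m) (P.d f)))"
      by (rule Y.X.iso_trans) (use M FP P.d_in[OF fu] rP RP in simp_all)
    hence "iso_pred Y m' (?K m' (f \<cdot>\<^bsub>S\<^esub> u)) (Y.lift m' (Rdx (first_level S Y) u (F (Dom S m) (P.d f))))"
      by (intro Y.lift_iso) (use a(1) M FP P.d_in[OF fu] RP in simp_all)
    moreover have "iso_pred Y m' (Y.lift m' (Rdx (first_level S Y) u (F (Dom S m) (P.d f)))) (Rdx Y s (?K m f))"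
      unfolding s by (rule Y.lift_rdx[OF sq]) (use FP M P.d_in[OF f] in simp)
    ultimately have "iso_pred Y m' (?K m' (f \<cdot>\<^bsub>S\<^esub> u)) (Rdx Y s (?K m f))"
      by (rule Y.X.iso_trans) (use a(1) KP fu Y.lift_in[OF a(1) RP] Y.X.rdx_in[OF sq] KP[OF a(2) f] s in simp_all)
    thus "iso_pred Y (Dom (arrow_cat S) s) (?K (Dom (arrow_cat S) s) (Rdx (ufam S (A, R)) s f)) (Rdx Y s (?K (Cod (arrow_cat S) s) f))"
      using s by simp
  next
    fix m \<psi> assume h: "m \<in> Obj (arrow_cat S)" "\<psi> \<in> Preds Y m"
    hence m: "m \<in> Arr S" by simp
    have M: "Dom S m \<in> Obj S" using m by simp
    obtain \<phi> where p: "\<phi> \<in> Preds Y (bang S (Dom S m))" "iso_pred Y m (Y.lift m \<phi>) \<psi>" using Y.lift_surj[OF m h(2)] by blast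
    have GP: "G (Dom S m) \<phi> \<in> Preds P (Dom S m)" using fib_map_in[OF G M] p by simp
    obtain f where f: "f \<in> hom S (Dom S m) A" "iso_pred P (Dom S m) (G (Dom S m) \<phi>) (P.d f)" using P.d_ex[OF M GP] by blast
    have "iso_pred Y (bang S (Dom S m)) (F (Dom S m) (P.d f)) (F (Dom S m) (G (Dom S m) \<phi>))"
      by (rule Fi[OF M P.d_in[OF f(1)] GP P.iso_sym[OF f(2)]])
    moreover have "iso_pred Y (bang S (Dom S m)) (F (Dom S m) (G (Dom S m) \<phi>)) \<phi>"
      using FG[OF M, of \<phi>] p by (simp add: Y.first_level_is)
    ultimately have "iso_pred Y (bang S (Dom S m)) (F (Dom S m) (P.d f)) \<phi>"
      by (rule Y.X.iso_trans) (use M FP P.d_in[OF f(1)] GP p in simp_all)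
    hence "iso_pred Y m (?K m f) (Y.lift m \<phi>)" by (intro Y.lift_iso) (use m M FP P.d_in[OF f(1)] p in simp_all)
    hence "iso_pred Y m (?K m f) \<psi>"
      using p(2) by (rule Y.X.iso_trans) (use m KP f Y.lift_in[OF m p(1)] h in simp_all)
    thus "\<exists>f\<in>Preds (ufam S (A, R)) m. iso_pred Y m (?K m f) \<psi>" using f(1) by auto
  qed
  thus ?thesis unfolding fib_equiv_def by blast
qed

text \<open>The equivalence is decoding. It respects the order by \<open>tle_bang\<close>. For
  \<open>\<gamma>\<close>, a generalized element \<open>h\<close> lies in \<open>gamma_of\<close>
  iff the code \<open>f \<cdot> h\<close> is top over the identity of \<open>Dom S h\<close>, and
  there comparison with top depends on \<open>\<gamma>\<close> alone, by
  \<open>tle_idn\<close>.\<close>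

lemma gtripos_of_rep:
  assumes rep: "represented_tripos S P \<gamma> A R tr"
  shows "gtripos_equiv S (to_gtripos S (ufam S (A, R))) (P, \<gamma>)"
proof -
  interpret P: represented_tripos S P \<gamma> A R tr by fact
  let ?X = "ufam S (A, R)"
  have ft: "fibered_tripos S ?X" using P.logical_fibered_tripos[OF P.logical] .
  interpret Y: fib_tripos S ?X using ft by unfold_locales
  let ?F = "\<lambda>M f. P.d f"
  have "\<exists>G. fib_equivalence S (first_level S ?X) P ?F G"
  proof (rule fib_equivI[OF Y.T.fib_loc_axioms P.fib_loc_axioms])
    fix M f assume "M \<in> Obj S" "f \<in> Preds (first_level S ?X) M"
    thus "P.d f \<in> Preds P M" using P.d_in by simp
  next
    fix M f g assume h: "M \<in> Obj S" "f \<in> Preds (first_level S ?X) M" "g \<in> Preds (first_level S ?X) M"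
    thus "Le (first_level S ?X) M f g \<longleftrightarrow> Le P M (P.d f) (P.d g)"
      using P.X_Le[of "bang S M" f g] P.tle_bang[of M "P.d f" "P.d g"] P.d_in by simp
  next
    fix f \<phi> assume h: "f \<in> Arr S" "\<phi> \<in> Preds (first_level S ?X) (Cod S f)"
    thus "iso_pred P (Dom S f) (P.d (Rdx (first_level S ?X) f \<phi>)) (Rdx P f (P.d \<phi>))"
      using P.d_cmp[of \<phi> "Cod S f" f] by simp
  next
    fix M \<psi> assume h: "M \<in> Obj S" "\<psi> \<in> Preds P M"
    thus "\<exists>\<phi>\<in>Preds (first_level S ?X) M. iso_pred P M (P.d \<phi>) \<psi>" using P.d_ex[OF h] P.iso_sym by auto
  qed
  then obtain G where G: "fib_equivalence S (first_level S ?X) P ?F G" by blast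
  have "iso_pred (sub_fib S) M (\<gamma> M (P.d f)) (gamma_of S ?X M f)" if M: "M \<in> Obj S" and f: "f \<in> hom S M A" for M f
  proof (rule P.sub_isoI)
    have fX: "f \<in> Preds ?X (bang S M)" using f M by simp
    note gc = Y.gamma_char[OF fX M]
    note gs = P.gamma_sub[OF M P.d_in[OF f]]
    show "\<gamma> M (P.d f) \<in> Arr S" "gamma_of S ?X M f \<in> Arr S" "Cod S (\<gamma> M (P.d f)) = M" "Cod S (gamma_of S ?X M f) = M"
      using gs gc by simp_all
    fix h assume h: "h \<in> Arr S" "Cod S h = M"
    let ?K = "Dom S h" and ?i = "Idn S (Dom S h)" and ?f = "f \<cdot>\<^bsub>S\<^esub> h"
    have K: "?K \<in> Obj S" using h by simp
    have fh: "?f \<in> hom S ?K A" using P.d_in_cmp[OF f h] .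
    have iA: "?i \<in> Arr S" "Dom S ?i = ?K" using K by simp_all
    obtain \<tau> where t: "is_top P ?K \<tau>" using P.top_exists[OF K] by blast
    have tP: "\<tau> \<in> Preds P ?K" using t unfolding is_top_def by blast
    obtain w where w: "w \<in> hom S ?K A" "iso_pred P ?K \<tau> (P.d w)" using P.d_ex[OF K tP] by blast
    have wt: "is_top P ?K (P.d w)" using P.is_top_iso[OF t w(2) K P.d_in[OF w(1)]] .
    have "factors S h (gamma_of S ?X M f) \<longleftrightarrow> is_top ?X ?i ?f"
      using gc(3)[OF h] by (simp add: Y.Top_def)
    also have "\<dots> \<longleftrightarrow> (\<forall>x\<in>hom S ?K A. P.tle ?i (P.d x) (P.d ?f))"
      using P.X_Le[OF iA(1)] fh iA(2) by (simp add: is_top_def)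
    also have "\<dots> \<longleftrightarrow> P.tle ?i (P.d w) (P.d ?f)"
    proof
      assume tl: "P.tle ?i (P.d w) (P.d ?f)"
      show "\<forall>x\<in>hom S ?K A. P.tle ?i (P.d x) (P.d ?f)"
      proof
        fix x assume x: "x \<in> hom S ?K A"
        have "P.tle ?i (P.d x) (P.d w)"
          by (rule P.tle_le) (use iA P.d_in x w wt in \<open>simp_all add: is_top_def\<close>)
        thus "P.tle ?i (P.d x) (P.d ?f)" using P.tle_trans[OF iA(1)] tl by blast
      qed
    qed (use w in blast)
    also have "\<dots> \<longleftrightarrow> P.gtop ?K (P.d ?f)" by (rule P.tle_idn[OF K wt P.d_in[OF fh]])
    also have "\<dots> \<longleftrightarrow> P.gtop ?K (Rdx P h (P.d f))"
    proof -
      have "iso_pred P ?K (P.d ?f) (Rdx P h (P.d f))" using P.d_cmp[OF f h] .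
      moreover have "Rdx P h (P.d f) \<in> Preds P ?K" using P.rdx_in[OF h(1)] P.d_in[OF f] h(2) by simp
      ultimately show ?thesis using P.gtop_mono[OF K] P.d_in[OF fh] unfolding iso_pred_def by blast
    qed
    also have "\<dots> \<longleftrightarrow> factors S h (\<gamma> M (P.d f))" using P.factors_gamma[OF h(1), of "P.d f"] h(2) P.d_in[OF f] by simp
    finally show "factors S h (\<gamma> M (P.d f)) \<longleftrightarrow> factors S h (gamma_of S ?X M f)" by simp
  qed
  hence "\<forall>M\<in>Obj S. \<forall>f\<in>Preds (first_level S ?X) M. iso_pred (sub_fib S) M (\<gamma> M (P.d f)) (gamma_of S ?X M f)" by simp
  thus ?thesis using G unfolding gtripos_equiv_def to_gtripos_def prod.case by (intro exI conjI)
qed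

lemma first_level_map:
  assumes Z: "fib_tripos S Z" "fib_tripos S Z'" and H: "fib_map (arrow_cat S) Z Z' H"
  shows "fib_map S (first_level S Z) (first_level S Z') (\<lambda>M \<phi>. H (bang S M) \<phi>)"
proof -
  interpret Z: fib_tripos S Z by fact
  interpret Z': fib_tripos S Z' by fact
  show ?thesis
    unfolding fib_map_def Z.first_level_simps Z'.first_level_simps Z'.first_level_is
  proof (intro conjI ballI impI)
    fix f \<phi> assume h: "f \<in> Arr S" "\<phi> \<in> Preds Z (bang S (Cod S f))"
    show "iso_pred Z' (bang S (Dom S f)) (H (bang S (Dom S f)) (Rdx Z (bang S (Dom S f), bang S (Cod S f), f, Idn S (one S)) \<phi>))
      (Rdx Z' (bang S (Dom S f), bang S (Cod S f), f, Idn S (one S)) (H (bang S (Cod S f)) \<phi>))"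
      using H[unfolded fib_map_def, THEN conjunct2, THEN conjunct2, rule_format, OF Z.first_sq[OF h(1) refl refl], of \<phi>] h by simp
  qed (use H in \<open>simp_all add: fib_map_def\<close>)
qed

text \<open>\<open>gamma_of\<close> is determined by which reindexed predicates are top, and an
  equivalence of fibered preorders preserves and reflects being top.\<close>

lemma gtripos_equiv_of_fib_equiv:
  assumes X: "fib_tripos S X" and Y: "fib_tripos S Y" and e: "fib_equiv (arrow_cat S) X Y"
  shows "gtripos_equiv S (to_gtripos S X) (to_gtripos S Y)"
proof -
  interpret X: fib_tripos S X by fact
  interpret Y: fib_tripos S Y by fact
  obtain F G where FG: "fib_equivalence (arrow_cat S) X Y F G" using e unfolding fib_equiv_def by blast
  have F: "fib_map (arrow_cat S) X Y F" and G: "fib_map (arrow_cat S) Y X G" using FG unfolding fib_equivalence_def by blast+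
  have eq: "fib_equivalence S (first_level S X) (first_level S Y) (\<lambda>M \<phi>. F (bang S M) \<phi>) (\<lambda>M \<phi>. G (bang S M) \<phi>)"
    using first_level_map[OF X Y F] first_level_map[OF Y X G] FG unfolding fib_equivalence_def
    by (simp add: X.first_level_is Y.first_level_is)
  have "iso_pred (sub_fib S) M (gamma_of S Y M (F (bang S M) \<phi>)) (gamma_of S X M \<phi>)"
    if M: "M \<in> Obj S" and p: "\<phi> \<in> Preds X (bang S M)" for M \<phi>
  proof (rule X.sub_isoI)
    have Fp: "F (bang S M) \<phi> \<in> Preds Y (bang S M)" using fib_map_in[OF F, of "bang S M" \<phi>] M p by simp
    note gx = X.gamma_char[OF p M] and gy = Y.gamma_char[OF Fp M]
    show "gamma_of S Y M (F (bang S M) \<phi>) \<in> Arr S" "gamma_of S X M \<phi> \<in> Arr S"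
      "Cod S (gamma_of S Y M (F (bang S M) \<phi>)) = M" "Cod S (gamma_of S X M \<phi>) = M"
      using gx gy by simp_all
    fix h assume h: "h \<in> Arr S" "Cod S h = M"
    let ?i = "Idn S (Dom S h)"
    let ?s = "(?i, bang S M, h, bang S (Dom S h))"
    have i: "?i \<in> Obj (arrow_cat S)" using h by simp
    note sq = X.Top_sq[OF h]
    have rX: "Rdx X ?s \<phi> \<in> Preds X ?i" using X.X.rdx_in[OF sq] p by simp
    have rY: "Rdx Y ?s (F (bang S M) \<phi>) \<in> Preds Y ?i" using Y.X.rdx_in[OF sq] Fp by simp
    have FrX: "F ?i (Rdx X ?s \<phi>) \<in> Preds Y ?i" using fib_map_in[OF F i rX] .
    have iso: "iso_pred Y ?i (F ?i (Rdx X ?s \<phi>)) (Rdx Y ?s (F (bang S M) \<phi>))"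
      using F[unfolded fib_map_def, THEN conjunct2, THEN conjunct2, rule_format, OF sq, of \<phi>] p by simp
    have "factors S h (gamma_of S Y M (F (bang S M) \<phi>)) \<longleftrightarrow> is_top Y ?i (Rdx Y ?s (F (bang S M) \<phi>))"
      using gy(3)[OF h] by (simp add: Y.Top_def)
    also have "\<dots> \<longleftrightarrow> is_top Y ?i (F ?i (Rdx X ?s \<phi>))"
      using Y.X.is_top_iso[OF _ iso i rY] Y.X.is_top_iso[OF _ Y.X.iso_sym[OF iso] i FrX] by blast
    also have "\<dots> \<longleftrightarrow> is_top X ?i (Rdx X ?s \<phi>)"
      by (rule is_top_equiv[OF X.X.fib_loc_axioms Y.X.fib_loc_axioms FG i rX, symmetric])
    also have "\<dots> \<longleftrightarrow> factors S h (gamma_of S X M \<phi>)" using gx(3)[OF h] by (simp add: X.Top_def)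
    finally show "factors S h (gamma_of S Y M (F (bang S M) \<phi>)) \<longleftrightarrow> factors S h (gamma_of S X M \<phi>)" .
  qed
  hence "\<forall>M\<in>Obj S. \<forall>\<phi>\<in>Preds (first_level S X) M. iso_pred (sub_fib S) M (gamma_of S Y M (F (bang S M) \<phi>)) (gamma_of S X M \<phi>)" by simp
  thus ?thesis using eq unfolding gtripos_equiv_def to_gtripos_def prod.case by blast
qed

lemma (in fib_tripos) upo_exists:
  obtains A R tr where "represented_tripos S (first_level S X) (gamma_of S X) A R tr" "fib_equiv (arrow_cat S) (ufam S (A, R)) X"
proof -
  obtain A R tr where r: "represented_tripos S (first_level S X) (gamma_of S X) A R tr" using T.representation by blast
  have "fib_equiv (arrow_cat S) (ufam S (A, R)) X"
  proof (rule rep_equiv[OF r fib_tripos_axioms fib_equivalence_refl[OF T.fib_loc_axioms]])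
    fix M \<phi> assume "M \<in> Obj S" "\<phi> \<in> Preds (first_level S X) M"
    thus "iso_pred (sub_fib S) M (gamma_of S X M \<phi>) (gamma_of S X M \<phi>)"
      using gamma_char[of \<phi> M] by (intro sub_isoI) simp_all
  qed
  thus ?thesis using that r by blast
qed

lemma fib_equiv_of_gtripos_equiv:
  assumes X: "fib_tripos S X" and Y: "fib_tripos S Y" and e: "gtripos_equiv S (to_gtripos S X) (to_gtripos S Y)"
  shows "fib_equiv (arrow_cat S) X Y"
proof -
  interpret X: fib_tripos S X by fact
  interpret Y: fib_tripos S Y by fact
  obtain F G where FG: "fib_equivalence S (first_level S X) (first_level S Y) F G"
    and g: "\<And>M \<phi>. M \<in> Obj S \<Longrightarrow> \<phi> \<in> Preds (first_level S X) M \<Longrightarrow> iso_pred (sub_fib S) M (gamma_of S Y M (F M \<phi>)) (gamma_of S X M \<phi>)"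
    using e unfolding gtripos_equiv_def to_gtripos_def prod.case by blast
  obtain A R tr where r: "represented_tripos S (first_level S X) (gamma_of S X) A R tr" and eX: "fib_equiv (arrow_cat S) (ufam S (A, R)) X"
    using X.upo_exists by blast
  interpret R: represented_tripos S "first_level S X" "gamma_of S X" A R tr by fact
  have eY: "fib_equiv (arrow_cat S) (ufam S (A, R)) Y" by (rule rep_equiv[OF r Y FG g])
  show ?thesis
    using eX eY fib_equivalence_sym fib_equivalence_trans[OF _ _ X.X.fib_loc_axioms R.X.fib_loc_axioms Y.X.fib_loc_axioms]
    unfolding fib_equiv_def by meson
qed

lemma fib_triposI: "topos S \<Longrightarrow> fibered_tripos S X \<Longrightarrow> fib_tripos S X"
  by (simp add: fib_tripos_def topos_loc_def fib_tripos_axioms_def)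

text \<open>The bijections are split into well-definedness, agreement of the equivalence relations,
  and surjectivity up to equivalence. The fibered tripos found for a given \<open>T\<close> is of
  the form \<open>ufam S (A, R)\<close>, so its predicates are arrows; this is where the predicate
  type \<open>'a\<close> comes from.\<close>

theorem theorem4p12p10:
  fixes S :: "('o, 'a) cat"
  assumes "topos S"
  shows
    "(\<forall>U. logical_uniform_preorder S U \<longrightarrow> fibered_tripos S (ufam S U)) \<and>
     (\<forall>U V. logical_uniform_preorder S U \<longrightarrow> logical_uniform_preorder S V \<longrightarrow>
        (upo_equiv S U V \<longleftrightarrow> fib_equiv (arrow_cat S) (ufam S U) (ufam S V))) \<and>
     (\<forall>X :: ('a, 'a sq, 'p) fpre. fibered_tripos S X \<longrightarrow>
        (\<exists>U. logical_uniform_preorder S U \<and> fib_equiv (arrow_cat S) (ufam S U) X)) \<and>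
     (\<forall>X :: ('a, 'a sq, 'p) fpre. fibered_tripos S X \<longrightarrow> tripos_with_gamma S (to_gtripos S X)) \<and>
     (\<forall>(X :: ('a, 'a sq, 'p) fpre) (Y :: ('a, 'a sq, 'q) fpre).
        fibered_tripos S X \<longrightarrow> fibered_tripos S Y \<longrightarrow>
        (fib_equiv (arrow_cat S) X Y \<longleftrightarrow> gtripos_equiv S (to_gtripos S X) (to_gtripos S Y))) \<and>
     (\<forall>T :: ('o, 'a, 'p) gtripos. tripos_with_gamma S T \<longrightarrow>
        (\<exists>X :: ('a, 'a sq, 'a) fpre. fibered_tripos S X \<and> gtripos_equiv S (to_gtripos S X) T))"
proof (intro conjI allI impI)
  interpret topos_loc S using assms by unfold_locales
  note ftI = fib_triposI[OF assms]
  fix U V :: "('o, 'a) upo"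
  show "fibered_tripos S (ufam S U)" if "logical_uniform_preorder S U" using logical_fibered_tripos that .
  show "upo_equiv S U V \<longleftrightarrow> fib_equiv (arrow_cat S) (ufam S U) (ufam S V)"
    if "logical_uniform_preorder S U" "logical_uniform_preorder S V"
    using upo_equiv_iff that unfolding logical_uniform_preorder_def by blast
  fix X :: "('a, 'a sq, 'p) fpre"
  show "\<exists>U. logical_uniform_preorder S U \<and> fib_equiv (arrow_cat S) (ufam S U) X" if "fibered_tripos S X"
  proof -
    interpret X: fib_tripos S X using that by (rule ftI)
    show ?thesis using X.upo_exists represented_tripos.logical by metis
  qed
  show "tripos_with_gamma S (to_gtripos S X)" if "fibered_tripos S X" using fib_tripos.first_level_tripos[OF ftI[OF that]] .
  fix Y :: "('a, 'a sq, 'q) fpre"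
  show "fib_equiv (arrow_cat S) X Y \<longleftrightarrow> gtripos_equiv S (to_gtripos S X) (to_gtripos S Y)"
    if "fibered_tripos S X" "fibered_tripos S Y"
    using gtripos_equiv_of_fib_equiv fib_equiv_of_gtripos_equiv ftI[OF that(1)] ftI[OF that(2)] by blast
  fix T :: "('o, 'a, 'p) gtripos"
  assume T: "tripos_with_gamma S T"
  obtain P \<gamma> where TP: "T = (P, \<gamma>)" by (cases T)
  interpret T: gamma_tripos S P \<gamma> using T TP by unfold_locales simp
  obtain A R tr where r: "represented_tripos S P \<gamma> A R tr" using T.representation by blast
  show "\<exists>X :: ('a, 'a sq, 'a) fpre. fibered_tripos S X \<and> gtripos_equiv S (to_gtripos S X) T"
    using gtripos_of_rep[OF r] logical_fibered_tripos[OF represented_tripos.logical[OF r]] TP by blast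
qed

end
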